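(* Let $\Phi(\underline a)$ be a formula in the language of $\mathsf{E\text{-}PA}^{\omega}_{\mathrm{st}}$ and suppose $\Phi(\underline a)^{S_{\mathrm{st}}}\equiv\forall^{\mathrm{st}}\underline x\,\exists^{\mathrm{st}}\underline y\,\varphi(\underline x,\underline y,\underline a)$. If $\Delta_{\mathrm{int}}$ is a collection of internal formulas and $$\mathsf{E\text{-}PA}^{\omega}_{\mathrm{st}}+\mathsf I+\mathsf{HAC}_{\mathrm{int}}+\mathsf{PF\text{-}TP}_\forall+\Delta_{\mathrm{int}}\vdash\Phi(\underline a),$$ then $$\mathsf{E\text{-}PA}^{\omega}+\Delta_{\mathrm{int}}\vdash\ \exists\underline t\,\forall\underline a\,\forall\underline x\,\exists\underline y\in\underline t[\underline x]\ \varphi(\underline x,\underline y,\underline a).$$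
   Context: $\mathsf{E\text{-}PA}^{\omega}$ is classical extensional Peano arithmetic in all finite types (types generated from $0$ by $\to$, no product types). The language of $\mathsf{E\text{-}PA}^{\omega}_{\mathrm{st}}$ adds unary predicates $\mathrm{st}^\sigma$ and quantifiers $\forall^{\mathrm{st}}x^\sigma,\exists^{\mathrm{st}}x^\sigma$ for every finite type $\sigma$. Formulas without these new symbols are called internal; small Greek letters denote internal formulas, capital Greek letters arbitrary (possibly external) formulas. $\mathsf{E\text{-}PA}^{\omega}_{\mathrm{st}}$ is $\mathsf{E\text{-}PA}^{\omega}$ (with induction for internal formulas) plus: (EQ) $\forall^{\mathrm{st}}x\,\Phi(x)\leftrightarrow\forall x(\mathrm{st}(x)\to\Phi(x))$ and $\exists^{\mathrm{st}}x\,\Phi(x)\leftrightarrow\exists x(\mathrm{st}(x)\wedge\Phi(x))$; ($\mathcal T_{\mathrm{st}}$) $\mathrm{st}(x)\wedge x=y\to\mathrm{st}(y)$; $\mathrm{st}(t)$ for each closed term $t$; $\mathrm{st}(f)\wedge\mathrm{st}(x)\to\mathrm{st}(fx)$; $\mathrm{st}^0(x)\wedge y\le x\to\mathrm{st}^0(y)$; ($\mathsf{IA}^{\mathrm{st}}$) $(\Phi(0)\wedge\forall^{\mathrm{st}}x^0(\Phi(x)\to\Phi(x+1)))\to\forall^{\mathrm{st}}x^0\Phi(x)$ for arbitrary external $\Phi$ (parameters allowed). Finite sequences of objects of type $\sigma$ are coded as single objects of type $\sigma$, such that every object codes a finite sequence; $x\in y$ means $x$ equals one of the components of the sequence coded by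 $y$; $\cup$ is concatenation. For $Y$ of type $\sigma\to\tau$ (viewed as coding a finite sequence of functionals) and $x$ of type $\sigma$, $Y[x]:=\bigcup_{f\in Y}f(x)$. Underlined letters denote tuples, and these notations are applied componentwise. Further axioms ($\varphi$ internal): ($\mathsf I$) $\forall^{\mathrm{st}}y'\,\exists x\,\forall y\in y'\,\varphi(x,y)\to\exists x\,\forall^{\mathrm{st}}y\,\varphi(x,y)$; ($\mathsf{HAC}_{\mathrm{int}}$) $\forall^{\mathrm{st}}x^\sigma\,\exists^{\mathrm{st}}y^\tau\,\varphi(x,y)\to\exists^{\mathrm{st}}Y^{\sigma\to\tau}\,\forall^{\mathrm{st}}x^\sigma\,\exists y^\tau\in Y[x]\ \varphi(x,y)$ (in both of these, further parameters are allowed in $\varphi$); ($\mathsf{PF\text{-}TP}_\forall$) $\forall^{\mathrm{st}}\underline x\,\varphi(\underline x)\to\forall\underline x\,\varphi(\underline x)$, where internal $\varphi(\underline x)$ has no free variables besides $\underline x$. The $S_{\mathrm{st}}$-interpretation assigns to every formula $\Phi(\underline a)$ a formula $\Phi(\underline a)^{S_{\mathrm{st}}}$ of the form $\forall^{\mathrm{st}}\underline x\,\exists^{\mathrm{st}}\underline y\,\varphi(\underline x,\underline y,\underline a)$ with $\varphi$ internal. If $\Phi(\underline a)^{S_{\mathrm{st}}}\equiv\forall^{\mathrm{st}}\underline x\exists^{\mathrm{st}}\underline y\,\varphi(\underline x,\underline y,\underline a)$ and $\Psi(\underline b)^{S_{\mathrm{st}}}\equiv\forall^{\mathrm{st}}\underline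 u\exists^{\mathrm{st}}\underline v\,\psi(\underline u,\underline v,\underline b)$, the clauses are: - $\varphi^{S_{\mathrm{st}}}:\equiv\varphi$ for internal atomic $\varphi$; $\ (\mathrm{st}(z))^{S_{\mathrm{st}}}:\equiv\exists^{\mathrm{st}}x\,(z=x)$; - $(\neg\Phi)^{S_{\mathrm{st}}}:\equiv\forall^{\mathrm{st}}\underline Y\,\exists^{\mathrm{st}}\underline x\,\forall\underline y\in\underline Y[\underline x]\ \neg\varphi(\underline x,\underline y,\underline a)$; - $(\Phi\vee\Psi)^{S_{\mathrm{st}}}:\equiv\forall^{\mathrm{st}}\underline x,\underline u\,\exists^{\mathrm{st}}\underline y,\underline v\,(\varphi\vee\psi)$; $\ (\Phi\wedge\Psi)^{S_{\mathrm{st}}}:\equiv\forall^{\mathrm{st}}\underline x,\underline u\,\exists^{\mathrm{st}}\underline y,\underline v\,(\varphi\wedge\psi)$; - $\Phi\to\Psi$ is defined as $\neg\Phi\vee\Psi$, so $(\Phi\to\Psi)^{S_{\mathrm{st}}}$ is, modulo classical logic in the internal matrix, $\forall^{\mathrm{st}}\underline Y,\underline u\,\exists^{\mathrm{st}}\underline x,\underline v\,(\exists\underline y\in\underline Y[\underline x]\,\varphi(\underline x,\underline y,\underline a)\to\psi(\underline u,\underline v,\underline b))$; - and, when $\Phi(\underline a,z)^{S_{\mathrm{st}}}\equiv\forall^{\mathrm{st}}\underline x\exists^{\mathrm{st}}\underline y\,\varphi(\underline x,\underline y,z,\underline a)$: $(\forall z\,\Phi)^{S_{\mathrm{st}}}:\equiv\forall^{\mathrm{st}}\underline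 x\,\exists^{\mathrm{st}}\underline y'\,\forall z\,\exists\underline y\in\underline y'\,\varphi$; $(\forall^{\mathrm{st}}z\,\Phi)^{S_{\mathrm{st}}}:\equiv\forall^{\mathrm{st}}\underline x,z\,\exists^{\mathrm{st}}\underline y\,\varphi$; $(\exists^{\mathrm{st}}z\,\Phi)^{S_{\mathrm{st}}}:\equiv\forall^{\mathrm{st}}\underline X\,\exists^{\mathrm{st}}\underline Y,z\,\forall\underline x\in\underline X[z,\underline Y]\,\exists\underline y\in\underline Y[\underline x]\,\varphi$; $(\exists z\,\Phi)^{S_{\mathrm{st}}}:\equiv\forall^{\mathrm{st}}\underline X\,\exists^{\mathrm{st}}\underline Y\,\exists z\,\forall\underline x\in\underline X[\underline Y]\,\exists\underline y\in\underline Y[\underline x]\,\varphi$. *)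

theory Defs
  imports Main
begin

section \<open>Finite types, terms, formulas\<close>

datatype ty = TNat | TFun ty ty  (infixr "\<rightarrowtail>" 65)

fun arrs :: "ty list \<Rightarrow> ty \<Rightarrow> ty" where
  "arrs \<sigma>s \<tau> = foldr TFun \<sigma>s \<tau>"

text \<open>A variable carries its type: for each type there are countably many variables.\<close>
type_synonym var = "nat \<times> ty"

text \<open>
  \<open>Kc \<sigma> \<tau> : \<sigma> \<rightarrowtail> \<tau> \<rightarrowtail> \<sigma>\<close>,
  \<open>Sc \<rho> \<sigma> \<tau> : (\<rho> \<rightarrowtail> \<sigma> \<rightarrowtail> \<tau>) \<rightarrowtail> (\<rho> \<rightarrowtail> \<sigma>) \<rightarrowtail> \<rho> \<rightarrowtail> \<tau>\<close> and
  \<open>Rec \<sigma> : \<sigma> \<rightarrowtail> (\<sigma> \<rightarrowtail> TNat \<rightarrowtail> \<sigma>) \<rightarrowtail> TNat \<rightarrowtail> \<sigma>\<close> are the combinators and the recursors.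
\<close>
datatype tm = V var | Zero | Succ | Kc ty ty | Sc ty ty ty | Rec ty
  | App tm tm  (infixl "\<cdot>" 90)

text \<open>\<open>ty_of\<close> is meaningful on well-typed terms (\<open>wt\<close>) only.\<close>
fun ty_of :: "tm \<Rightarrow> ty" where
  "ty_of (V x) = snd x"
| "ty_of Zero = TNat"
| "ty_of Succ = TNat \<rightarrowtail> TNat"
| "ty_of (Kc \<sigma> \<tau>) = \<sigma> \<rightarrowtail> \<tau> \<rightarrowtail> \<sigma>"
| "ty_of (Sc \<rho> \<sigma> \<tau>) = (\<rho> \<rightarrowtail> \<sigma> \<rightarrowtail> \<tau>) \<rightarrowtail> (\<rho> \<rightarrowtail> \<sigma>) \<rightarrowtail> \<rho> \<rightarrowtail> \<tau>"
| "ty_of (Rec \<sigma>) = \<sigma> \<rightarrowtail> (\<sigma> \<rightarrowtail> TNat \<rightarrowtail> \<sigma>) \<rightarrowtail> TNat \<rightarrowtail> \<sigma>"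
| "ty_of (f \<cdot> t) = (case ty_of f of \<sigma> \<rightarrowtail> \<tau> \<Rightarrow> \<tau> | TNat \<Rightarrow> TNat)"

fun wt :: "tm \<Rightarrow> bool" where
  "wt (f \<cdot> t) \<longleftrightarrow> wt f \<and> wt t \<and> (case ty_of f of \<sigma> \<rightarrowtail> \<tau> \<Rightarrow> ty_of t = \<sigma> | TNat \<Rightarrow> False)"
| "wt _ \<longleftrightarrow> True"

text \<open>Equality is primitive at every type. Implication is the usual abbreviation.\<close>
datatype fm = Eq tm tm | St tm | Neg fm | Disj fm fm | Conj fm fm
  | Forall var fm | Exists var fm | ForallSt var fm | ExistsSt var fm

abbreviation Imp :: "fm \<Rightarrow> fm \<Rightarrow> fm" where
  "Imp A B \<equiv> Disj (Neg A) B"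

abbreviation Iff :: "fm \<Rightarrow> fm \<Rightarrow> fm" where
  "Iff A B \<equiv> Conj (Imp A B) (Imp B A)"

abbreviation Foralls :: "var list \<Rightarrow> fm \<Rightarrow> fm" where
  "Foralls xs A \<equiv> foldr Forall xs A"

abbreviation Existss :: "var list \<Rightarrow> fm \<Rightarrow> fm" where
  "Existss xs A \<equiv> foldr Exists xs A"

abbreviation ForallSts :: "var list \<Rightarrow> fm \<Rightarrow> fm" where
  "ForallSts xs A \<equiv> foldr ForallSt xs A"

fun wff :: "fm \<Rightarrow> bool" where
  "wff (Eq s t) \<longleftrightarrow> wt s \<and> wt t \<and> ty_of s = ty_of t"
| "wff (St t) \<longleftrightarrow> wt t"
| "wff (Neg A) \<longleftrightarrow> wff A"
| "wff (Disj A B) \<longleftrightarrow> wff A \<and> wff B"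
| "wff (Conj A B) \<longleftrightarrow> wff A \<and> wff B"
| "wff (Forall x A) \<longleftrightarrow> wff A"
| "wff (Exists x A) \<longleftrightarrow> wff A"
| "wff (ForallSt x A) \<longleftrightarrow> wff A"
| "wff (ExistsSt x A) \<longleftrightarrow> wff A"

fun internal :: "fm \<Rightarrow> bool" where
  "internal (Eq s t) \<longleftrightarrow> True"
| "internal (St t) \<longleftrightarrow> False"
| "internal (Neg A) \<longleftrightarrow> internal A"
| "internal (Disj A B) \<longleftrightarrow> internal A \<and> internal B"
| "internal (Conj A B) \<longleftrightarrow> internal A \<and> internal B"
| "internal (Forall x A) \<longleftrightarrow> internal A"
| "internal (Exists x A) \<longleftrightarrow> internal A"
| "internal (ForallSt x A) \<longleftrightarrow> False"
| "internal (ExistsSt x A) \<longleftrightarrow> False"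

fun fvt :: "tm \<Rightarrow> var set" where
  "fvt (V x) = {x}"
| "fvt (s \<cdot> t) = fvt s \<union> fvt t"
| "fvt _ = {}"

fun fv :: "fm \<Rightarrow> var set" where
  "fv (Eq s t) = fvt s \<union> fvt t"
| "fv (St t) = fvt t"
| "fv (Neg A) = fv A"
| "fv (Disj A B) = fv A \<union> fv B"
| "fv (Conj A B) = fv A \<union> fv B"
| "fv (Forall x A) = fv A - {x}"
| "fv (Exists x A) = fv A - {x}"
| "fv (ForallSt x A) = fv A - {x}"
| "fv (ExistsSt x A) = fv A - {x}"

text \<open>
  \<open>fresh_name X\<close> exceeds all names in the finite set \<open>X\<close>; \<open>freshes X \<sigma>s\<close> is a list of distinct
  variables of types \<open>\<sigma>s\<close> outside \<open>X\<close>.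
\<close>
definition fresh_name :: "var set \<Rightarrow> nat" where
  "fresh_name X = (if X = {} then 0 else Suc (Max (fst ` X)))"

definition fresh :: "var set \<Rightarrow> ty \<Rightarrow> var" where
  "fresh X \<sigma> = (fresh_name X, \<sigma>)"

definition freshes :: "var set \<Rightarrow> ty list \<Rightarrow> var list" where
  "freshes X \<sigma>s = zip [fresh_name X ..< fresh_name X + length \<sigma>s] \<sigma>s"

section \<open>Capture-avoiding simultaneous substitution\<close>

fun substt :: "(var \<Rightarrow> tm) \<Rightarrow> tm \<Rightarrow> tm" where
  "substt s (V x) = s x"
| "substt s (t \<cdot> u) = substt s t \<cdot> substt s u"
| "substt s t = t"

text \<open>The name of the bound variable \<open>x\<close> of \<open>Q x A\<close> in the result of the substitution: it is
  changed only if \<open>x\<close> would capture a free variable of a substituted term.\<close>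
definition rebind :: "(var \<Rightarrow> tm) \<Rightarrow> var \<Rightarrow> fm \<Rightarrow> var" where
  "rebind s x A = (let X = (\<Union>y \<in> fv A - {x}. fvt (s y)) in
     if x \<in> X then fresh X (snd x) else x)"

fun subst :: "(var \<Rightarrow> tm) \<Rightarrow> fm \<Rightarrow> fm" where
  "subst s (Eq t u) = Eq (substt s t) (substt s u)"
| "subst s (St t) = St (substt s t)"
| "subst s (Neg A) = Neg (subst s A)"
| "subst s (Disj A B) = Disj (subst s A) (subst s B)"
| "subst s (Conj A B) = Conj (subst s A) (subst s B)"
| "subst s (Forall x A) = (let x' = rebind s x A in Forall x' (subst (s(x := V x')) A))"
| "subst s (Exists x A) = (let x' = rebind s x A in Exists x' (subst (s(x := V x')) A))"
| "subst s (ForallSt x A) = (let x' = rebind s x A in ForallSt x' (subst (s(x := V x')) A))"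
| "subst s (ExistsSt x A) = (let x' = rebind s x A in ExistsSt x' (subst (s(x := V x')) A))"

abbreviation subst1 :: "fm \<Rightarrow> var \<Rightarrow> tm \<Rightarrow> fm" where
  "subst1 A x t \<equiv> subst (V(x := t)) A"

section \<open>Closed terms for the coding of finite sequences\<close>

text \<open>Bracket abstraction: \<open>lam x t\<close> is the combinatory term for \<open>\<lambda>x. t\<close>.\<close>
fun lam :: "var \<Rightarrow> tm \<Rightarrow> tm" where
  "lam x (V y) = (if y = x
     then Sc (snd x) (snd x \<rightarrowtail> snd x) (snd x) \<cdot> Kc (snd x) (snd x \<rightarrowtail> snd x) \<cdot> Kc (snd x) (snd x)
     else Kc (snd y) (snd x) \<cdot> V y)"
| "lam x (s \<cdot> t) = Sc (snd x) (ty_of t) (ty_of (s \<cdot> t)) \<cdot> lam x s \<cdot> lam x t"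
| "lam x t = Kc (ty_of t) (snd x) \<cdot> t"

abbreviation nv :: "nat \<Rightarrow> var" where
  "nv i \<equiv> (i, TNat)"

definition pred_c :: tm where
  "pred_c = lam (nv 0) (Rec TNat \<cdot> Zero \<cdot> lam (nv 1) (lam (nv 2) (V (nv 2))) \<cdot> V (nv 0))"

definition plus_c :: tm where
  "plus_c = lam (nv 0) (lam (nv 1)
     (Rec TNat \<cdot> V (nv 0) \<cdot> lam (nv 2) (lam (nv 3) (Succ \<cdot> V (nv 2))) \<cdot> V (nv 1)))"

text \<open>Truncated subtraction.\<close>
definition monus_c :: tm where
  "monus_c = lam (nv 0) (lam (nv 1)
     (Rec TNat \<cdot> V (nv 0) \<cdot> lam (nv 2) (lam (nv 3) (pred_c \<cdot> V (nv 2))) \<cdot> V (nv 1)))"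

definition le :: "tm \<Rightarrow> tm \<Rightarrow> fm" where
  "le s t = Eq (monus_c \<cdot> s \<cdot> t) Zero"

text \<open>\<open>cond_c \<sigma> \<cdot> n \<cdot> a \<cdot> b\<close> is \<open>a\<close> if \<open>n\<close> is zero and \<open>b\<close> otherwise.\<close>
definition cond_c :: "ty \<Rightarrow> tm" where
  "cond_c \<sigma> = lam (0, TNat) (lam (1, \<sigma>) (lam (2, \<sigma>)
     (Rec \<sigma> \<cdot> V (1, \<sigma>) \<cdot> lam (3, \<sigma>) (lam (4, TNat) (V (2, \<sigma>))) \<cdot> V (0, TNat))))"

text \<open>
  Cantor pairing \<open>pair x y = tri (x + y) + x\<close> with \<open>tri n = 0 + 1 + \<dots> + n\<close>.
  \<open>diag_c \<cdot> n\<close> is the largest \<open>w\<close> with \<open>tri w \<le> n\<close>.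
\<close>
definition tri_c :: tm where
  "tri_c = lam (nv 0) (Rec TNat \<cdot> Zero \<cdot>
     lam (nv 1) (lam (nv 2) (plus_c \<cdot> V (nv 1) \<cdot> (Succ \<cdot> V (nv 2)))) \<cdot> V (nv 0))"

definition pair_c :: tm where
  "pair_c = lam (nv 0) (lam (nv 1)
     (plus_c \<cdot> (tri_c \<cdot> (plus_c \<cdot> V (nv 0) \<cdot> V (nv 1))) \<cdot> V (nv 0)))"

definition diag_c :: tm where
  "diag_c = lam (nv 0) (Rec TNat \<cdot> Zero \<cdot>
     lam (nv 1) (lam (nv 2)
       (cond_c TNat \<cdot> (monus_c \<cdot> (tri_c \<cdot> (Succ \<cdot> V (nv 1))) \<cdot> (Succ \<cdot> V (nv 2)))
          \<cdot> (Succ \<cdot> V (nv 1)) \<cdot> V (nv 1))) \<cdot> V (nv 0))"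

definition fst_c :: tm where
  "fst_c = lam (nv 0) (monus_c \<cdot> V (nv 0) \<cdot> (tri_c \<cdot> (diag_c \<cdot> V (nv 0))))"

definition snd_c :: tm where
  "snd_c = lam (nv 0) (monus_c \<cdot> (diag_c \<cdot> V (nv 0)) \<cdot> (fst_c \<cdot> V (nv 0)))"

text \<open>
  Type \<open>TNat\<close>: \<open>0\<close> codes the empty sequence and \<open>pair h s + 1\<close> codes \<open>h\<close> followed by the
  sequence coded by \<open>s\<close>. This is a bijection between numbers and finite sequences of numbers.
  \<open>drop0_c \<cdot> s \<cdot> i\<close> removes the first \<open>i\<close> components; the length of \<open>s\<close> is the number of \<open>i < s\<close>
  for which something remains; \<open>mk0_c \<cdot> n \<cdot> f\<close> codes \<open>f 0, \<dots>, f (n - 1)\<close>.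
\<close>
definition drop0_c :: tm where
  "drop0_c = lam (nv 0) (lam (nv 1) (Rec TNat \<cdot> V (nv 0) \<cdot>
     lam (nv 2) (lam (nv 3) (snd_c \<cdot> (pred_c \<cdot> V (nv 2)))) \<cdot> V (nv 1)))"

definition len0_c :: tm where
  "len0_c = lam (nv 0) (Rec TNat \<cdot> Zero \<cdot>
     lam (nv 1) (lam (nv 2) (plus_c \<cdot> V (nv 1) \<cdot>
       (cond_c TNat \<cdot> (drop0_c \<cdot> V (nv 0) \<cdot> V (nv 2)) \<cdot> Zero \<cdot> (Succ \<cdot> Zero)))) \<cdot> V (nv 0))"

definition comp0_c :: tm where
  "comp0_c = lam (nv 0) (lam (nv 1) (fst_c \<cdot> (pred_c \<cdot> (drop0_c \<cdot> V (nv 0) \<cdot> V (nv 1)))))"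

definition mk0_c :: tm where
  "mk0_c = lam (nv 0) (lam (1, TNat \<rightarrowtail> TNat) (Rec TNat \<cdot> Zero \<cdot>
     lam (nv 2) (lam (nv 3)
       (Succ \<cdot> (pair_c \<cdot> (V (1, TNat \<rightarrowtail> TNat) \<cdot> (monus_c \<cdot> (pred_c \<cdot> V (nv 0)) \<cdot> V (nv 3)))
          \<cdot> V (nv 2)))) \<cdot> V (nv 0)))"

fun zero_c :: "ty \<Rightarrow> tm" where
  "zero_c TNat = Zero"
| "zero_c (\<sigma> \<rightarrowtail> \<tau>) = Kc \<tau> \<sigma> \<cdot> zero_c \<tau>"

text \<open>
  Type \<open>\<sigma> \<rightarrowtail> \<tau>\<close>: the sequence \<open>f\<^sub>0, \<dots>, f\<^sub>n\<^sub>-\<^sub>1\<close> is coded by the functional mapping \<open>x\<close> to the code of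
  \<open>f\<^sub>0 x, \<dots>, f\<^sub>n\<^sub>-\<^sub>1 x\<close>. An arbitrary \<open>Y\<close> is read as a sequence whose length is that of \<open>Y\<close> at the
  zero functional. In each type the zero functional codes the empty sequence.
\<close>
fun len_c :: "ty \<Rightarrow> tm" where
  "len_c TNat = len0_c"
| "len_c (\<sigma> \<rightarrowtail> \<tau>) = lam (0, \<sigma> \<rightarrowtail> \<tau>) (len_c \<tau> \<cdot> (V (0, \<sigma> \<rightarrowtail> \<tau>) \<cdot> zero_c \<sigma>))"

fun comp_c :: "ty \<Rightarrow> tm" where
  "comp_c TNat = comp0_c"
| "comp_c (\<sigma> \<rightarrowtail> \<tau>) = lam (0, \<sigma> \<rightarrowtail> \<tau>) (lam (1, TNat) (lam (2, \<sigma>)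
     (comp_c \<tau> \<cdot> (V (0, \<sigma> \<rightarrowtail> \<tau>) \<cdot> V (2, \<sigma>)) \<cdot> V (1, TNat))))"

fun mk_c :: "ty \<Rightarrow> tm" where
  "mk_c TNat = mk0_c"
| "mk_c (\<sigma> \<rightarrowtail> \<tau>) = lam (0, TNat) (lam (1, TNat \<rightarrowtail> \<sigma> \<rightarrowtail> \<tau>) (lam (2, \<sigma>)
     (mk_c \<tau> \<cdot> V (0, TNat) \<cdot>
        lam (3, TNat) (V (1, TNat \<rightarrowtail> \<sigma> \<rightarrowtail> \<tau>) \<cdot> V (3, TNat) \<cdot> V (2, \<sigma>)))))"

text \<open>Concatenation of two sequences of type \<open>\<sigma>\<close>.\<close>
definition cat_c :: "ty \<Rightarrow> tm" where
  "cat_c \<sigma> = lam (0, \<sigma>) (lam (1, \<sigma>)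
     (mk_c \<sigma> \<cdot> (plus_c \<cdot> (len_c \<sigma> \<cdot> V (0, \<sigma>)) \<cdot> (len_c \<sigma> \<cdot> V (1, \<sigma>))) \<cdot>
        lam (2, TNat) (cond_c \<sigma>
          \<cdot> (monus_c \<cdot> (Succ \<cdot> V (2, TNat)) \<cdot> (len_c \<sigma> \<cdot> V (0, \<sigma>)))
          \<cdot> (comp_c \<sigma> \<cdot> V (0, \<sigma>) \<cdot> V (2, TNat))
          \<cdot> (comp_c \<sigma> \<cdot> V (1, \<sigma>) \<cdot> (monus_c \<cdot> V (2, TNat) \<cdot> (len_c \<sigma> \<cdot> V (0, \<sigma>)))))))"

text \<open>\<open>Y[x]\<close>: the concatenation of all \<open>f \<cdot> x\<close>, where \<open>f\<close> runs through the sequence coded by \<open>Y\<close>.\<close>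
definition bracket_c :: "ty \<Rightarrow> ty \<Rightarrow> tm" where
  "bracket_c \<sigma> \<tau> = lam (0, \<sigma> \<rightarrowtail> \<tau>) (lam (1, \<sigma>)
     (Rec \<tau> \<cdot> zero_c \<tau> \<cdot>
        lam (2, \<tau>) (lam (3, TNat) (cat_c \<tau> \<cdot> V (2, \<tau>) \<cdot>
          (comp_c (\<sigma> \<rightarrowtail> \<tau>) \<cdot> V (0, \<sigma> \<rightarrowtail> \<tau>) \<cdot> V (3, TNat) \<cdot> V (1, \<sigma>)))) \<cdot>
        (len_c (\<sigma> \<rightarrowtail> \<tau>) \<cdot> V (0, \<sigma> \<rightarrowtail> \<tau>))))"

text \<open>For tuples of arguments, \<open>Y[x\<^sub>1, \<dots>, x\<^sub>n] = Y[x\<^sub>1]\<dots>[x\<^sub>n]\<close>; in particular \<open>Y[] = Y\<close>.\<close>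
definition bracket :: "tm \<Rightarrow> tm list \<Rightarrow> tm" where
  "bracket Y ts = foldl (\<lambda>Z t. bracket_c (ty_of t) (ty_of (Z \<cdot> t)) \<cdot> Z \<cdot> t) Y ts"

definition brackets :: "var list \<Rightarrow> var list \<Rightarrow> tm list" where
  "brackets Ys xs = map (\<lambda>Y. bracket (V Y) (map V xs)) Ys"

text \<open>\<open>s \<in> t\<close>: \<open>s\<close> equals some component of the sequence coded by \<open>t\<close>.\<close>
definition elem :: "tm \<Rightarrow> tm \<Rightarrow> fm" where
  "elem s t = (let i = fresh (fvt s \<union> fvt t) TNat in
     Exists i (Conj (le (Succ \<cdot> V i) (len_c (ty_of t) \<cdot> t)) (Eq s (comp_c (ty_of t) \<cdot> t \<cdot> V i))))"

definition ball :: "var list \<Rightarrow> tm list \<Rightarrow> fm \<Rightarrow> fm" where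
  "ball ys Ts A = foldr (\<lambda>(y, T) B. Forall y (Imp (elem (V y) T) B)) (zip ys Ts) A"

definition bex :: "var list \<Rightarrow> tm list \<Rightarrow> fm \<Rightarrow> fm" where
  "bex ys Ts A = foldr (\<lambda>(y, T) B. Exists y (Conj (elem (V y) T) B)) (zip ys Ts) A"

section \<open>Derivability\<close>

text \<open>Truth value of a formula as a propositional combination of quantified and atomic formulas.\<close>
fun peval :: "(fm \<Rightarrow> bool) \<Rightarrow> fm \<Rightarrow> bool" where
  "peval v (Neg A) \<longleftrightarrow> \<not> peval v A"
| "peval v (Disj A B) \<longleftrightarrow> peval v A \<or> peval v B"
| "peval v (Conj A B) \<longleftrightarrow> peval v A \<and> peval v B"
| "peval v A \<longleftrightarrow> v A"

definition taut :: "fm \<Rightarrow> bool" where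
  "taut A \<longleftrightarrow> (\<forall>v. peval v A)"

text \<open>
  Hilbert-style classical predicate logic for the language with set of formulas \<open>L\<close> and the
  non-logical axioms \<open>Ax \<inter> L\<close>. Membership in \<open>L\<close> imposes well-typedness, so the axiom schemata
  below need not do so. Non-logical axioms may have free variables, which are read universally.
  The quantifiers \<open>ForallSt\<close> and \<open>ExistsSt\<close> have no logical rules of their own.
\<close>
inductive deriv :: "fm set \<Rightarrow> fm set \<Rightarrow> fm \<Rightarrow> bool" for L Ax where
  ax: "A \<in> Ax \<Longrightarrow> A \<in> L \<Longrightarrow> deriv L Ax A"
| taut: "taut A \<Longrightarrow> A \<in> L \<Longrightarrow> deriv L Ax A"
| forall_elim: "Forall x A \<in> L \<Longrightarrow> wt t \<Longrightarrow> ty_of t = snd x \<Longrightarrow>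
    deriv L Ax (Imp (Forall x A) (subst1 A x t))"
| exists_intro: "Exists x A \<in> L \<Longrightarrow> wt t \<Longrightarrow> ty_of t = snd x \<Longrightarrow>
    deriv L Ax (Imp (subst1 A x t) (Exists x A))"
| mp: "deriv L Ax A \<Longrightarrow> deriv L Ax (Imp A B) \<Longrightarrow> deriv L Ax B"
| forall_intro: "deriv L Ax (Imp A B) \<Longrightarrow> x \<notin> fv A \<Longrightarrow> deriv L Ax (Imp A (Forall x B))"
| exists_elim: "deriv L Ax (Imp A B) \<Longrightarrow> x \<notin> fv B \<Longrightarrow> deriv L Ax (Imp (Exists x A) B)"

inductive_set EPA_axioms :: "fm set" where
  refl: "Eq t t \<in> EPA_axioms"
| sym: "Imp (Eq s t) (Eq t s) \<in> EPA_axioms"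
| trans: "Imp (Conj (Eq s t) (Eq t u)) (Eq s u) \<in> EPA_axioms"
| cong: "Imp (Conj (Eq f g) (Eq s t)) (Eq (f \<cdot> s) (g \<cdot> t)) \<in> EPA_axioms"
| ext: "x \<notin> fvt f \<union> fvt g \<Longrightarrow>
    Imp (Forall x (Eq (f \<cdot> V x) (g \<cdot> V x))) (Eq f g) \<in> EPA_axioms"
| succ_zero: "Neg (Eq (Succ \<cdot> s) Zero) \<in> EPA_axioms"
| succ_inj: "Imp (Eq (Succ \<cdot> s) (Succ \<cdot> t)) (Eq s t) \<in> EPA_axioms"
| ind: "internal A \<Longrightarrow> snd x = TNat \<Longrightarrow>
    Imp (Conj (subst1 A x Zero) (Forall x (Imp A (subst1 A x (Succ \<cdot> V x))))) (Forall x A)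
      \<in> EPA_axioms"
| K: "Eq (Kc \<sigma> \<tau> \<cdot> s \<cdot> t) s \<in> EPA_axioms"
| S: "Eq (Sc \<rho> \<sigma> \<tau> \<cdot> s \<cdot> t \<cdot> u) (s \<cdot> u \<cdot> (t \<cdot> u)) \<in> EPA_axioms"
| R0: "Eq (Rec \<sigma> \<cdot> s \<cdot> t \<cdot> Zero) s \<in> EPA_axioms"
| RS: "Eq (Rec \<sigma> \<cdot> s \<cdot> t \<cdot> (Succ \<cdot> u)) (t \<cdot> (Rec \<sigma> \<cdot> s \<cdot> t \<cdot> u) \<cdot> u) \<in> EPA_axioms"

inductive_set st_axioms :: "fm set" where
  EQ_all: "Iff (ForallSt x A) (Forall x (Imp (St (V x)) A)) \<in> st_axioms"
| EQ_ex: "Iff (ExistsSt x A) (Exists x (Conj (St (V x)) A)) \<in> st_axioms"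
| T_eq: "Imp (Conj (St s) (Eq s t)) (St t) \<in> st_axioms"
| T_closed: "fvt t = {} \<Longrightarrow> St t \<in> st_axioms"
| T_app: "Imp (Conj (St s) (St t)) (St (s \<cdot> t)) \<in> st_axioms"
| T_le: "ty_of s = TNat \<Longrightarrow> Imp (Conj (St s) (le t s)) (St t) \<in> st_axioms"
| IA_st: "snd x = TNat \<Longrightarrow>
    Imp (Conj (subst1 A x Zero) (ForallSt x (Imp A (subst1 A x (Succ \<cdot> V x))))) (ForallSt x A)
      \<in> st_axioms"

inductive_set I_axioms :: "fm set" where
  "internal A \<Longrightarrow> x \<noteq> y \<Longrightarrow> y' \<notin> insert x (insert y (fv A)) \<Longrightarrow> snd y' = snd y \<Longrightarrow>
    Imp (ForallSt y' (Exists x (ball [y] [V y'] A))) (Exists x (ForallSt y A)) \<in> I_axioms"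

inductive_set HAC_int_axioms :: "fm set" where
  "internal A \<Longrightarrow> x \<noteq> y \<Longrightarrow> Y \<notin> insert x (insert y (fv A)) \<Longrightarrow> snd Y = snd x \<rightarrowtail> snd y \<Longrightarrow>
    Imp (ForallSt x (ExistsSt y A))
        (ExistsSt Y (ForallSt x (bex [y] [bracket (V Y) [V x]] A))) \<in> HAC_int_axioms"

inductive_set PF_TP_axioms :: "fm set" where
  "internal A \<Longrightarrow> distinct xs \<Longrightarrow> fv A \<subseteq> set xs \<Longrightarrow>
    Imp (ForallSts xs A) (Foralls xs A) \<in> PF_TP_axioms"

definition EPA_proves :: "fm set \<Rightarrow> fm \<Rightarrow> bool" where
  "EPA_proves \<Delta> A \<longleftrightarrow> deriv {B. wff B \<and> internal B} (EPA_axioms \<union> \<Delta>) A"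

definition EPAst_I_HAC_PFTP_proves :: "fm set \<Rightarrow> fm \<Rightarrow> bool" where
  "EPAst_I_HAC_PFTP_proves \<Delta> A \<longleftrightarrow>
     deriv {B. wff B}
       (EPA_axioms \<union> st_axioms \<union> I_axioms \<union> HAC_int_axioms \<union> PF_TP_axioms \<union> \<Delta>) A"

section \<open>The interpretation\<close>

text \<open>
  \<open>Sst X \<Phi> = (xs, ys, \<phi>)\<close> stands for the formula with prefix \<open>ForallSt\<close> over \<open>xs\<close> and \<open>ExistsSt\<close>
  over \<open>ys\<close> and internal matrix \<open>\<phi>\<close>. The finite set \<open>X\<close> must contain the free variables of \<open>\<Phi>\<close>;
  \<open>xs @ ys\<close> are distinct variables outside \<open>X\<close>. In the two clauses for external quantifiers, \<open>z\<close> is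
  renamed to a fresh \<open>w\<close> since it becomes one of \<open>xs\<close> or \<open>ys\<close>.
\<close>
abbreviation tys :: "var list \<Rightarrow> ty list" where
  "tys xs \<equiv> map snd xs"

fun Sst :: "var set \<Rightarrow> fm \<Rightarrow> var list \<times> var list \<times> fm" where
  "Sst X (Eq s t) = ([], [], Eq s t)"
| "Sst X (St t) = (let x = fresh X (ty_of t) in ([], [x], Eq t (V x)))"
| "Sst X (Neg A) =
    (let (xs, ys, \<phi>) = Sst X A;
         Ys = freshes (X \<union> set xs \<union> set ys) (map (arrs (tys xs)) (tys ys))
     in (Ys, xs, ball ys (brackets Ys xs) (Neg \<phi>)))"
| "Sst X (Disj A B) =
    (let (xs, ys, \<phi>) = Sst X A;
         (us, vs, \<psi>) = Sst (X \<union> set xs \<union> set ys) B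
     in (xs @ us, ys @ vs, Disj \<phi> \<psi>))"
| "Sst X (Conj A B) =
    (let (xs, ys, \<phi>) = Sst X A;
         (us, vs, \<psi>) = Sst (X \<union> set xs \<union> set ys) B
     in (xs @ us, ys @ vs, Conj \<phi> \<psi>))"
| "Sst X (Forall z A) =
    (let (xs, ys, \<phi>) = Sst (insert z X) A;
         ys' = freshes (insert z X \<union> set xs \<union> set ys) (tys ys)
     in (xs, ys', Forall z (bex ys (map V ys') \<phi>)))"
| "Sst X (ForallSt z A) =
    (let (xs, ys, \<phi>) = Sst (insert z X) A;
         w = fresh (insert z X \<union> set xs \<union> set ys) (snd z)
     in (xs @ [w], ys, subst1 \<phi> z (V w)))"
| "Sst X (ExistsSt z A) =
    (let (xs, ys, \<phi>) = Sst (insert z X) A;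
         w = fresh (insert z X \<union> set xs \<union> set ys) (snd z);
         Ys = freshes (insert w (insert z X) \<union> set xs \<union> set ys) (map (arrs (tys xs)) (tys ys));
         Xs = freshes (insert w (insert z X) \<union> set xs \<union> set ys \<union> set Ys)
                (map (arrs (tys (w # Ys))) (tys xs))
     in (Xs, Ys @ [w],
         ball xs (brackets Xs (w # Ys)) (bex ys (brackets Ys xs) (subst1 \<phi> z (V w)))))"
| "Sst X (Exists z A) =
    (let (xs, ys, \<phi>) = Sst (insert z X) A;
         Ys = freshes (insert z X \<union> set xs \<union> set ys) (map (arrs (tys xs)) (tys ys));
         Xs = freshes (insert z X \<union> set xs \<union> set ys \<union> set Ys) (map (arrs (tys Ys)) (tys xs))
     in (Xs, Ys, Exists z (ball xs (brackets Xs Ys) (bex ys (brackets Ys xs) \<phi>))))"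

end

theory Submission
  imports Defs "HOL-Library.Countable"
begin

text \<open>
  \<open>E-PA\<^sup>\<omega>\<close> is a countable many-sorted first-order theory, so by Henkin's completeness theorem it
  suffices to establish the conclusion in every (nonstandard, extensional) model \<open>M\<close> of
  \<open>E-PA\<^sup>\<omega> + \<Delta>\<^sub>i\<^sub>n\<^sub>t\<close>. In \<open>M\<close> call \<open>\<Phi>\<close> valid if some \<open>t\<close> in \<open>M\<close> satisfies
  \<open>\<forall>a \<forall>x \<exists>y \<in> t[x]. \<phi>(x, y, a)\<close>. All quantifiers here range over \<open>M\<close> and truth in \<open>M\<close> is
  two-valued, so one can argue by cases on the truth of matrices, and only the existence of
  finite sets of candidates that depend on \<open>x\<close> through a functional of \<open>M\<close> has to be proved.
  Valid formulas are closed under Shoenfield's rules, hence contain the tautologies by Kalmar's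
  argument; each axiom of the external system is valid. For external induction the realizers are
  defined by primitive recursion on tuples (coded into a single type) and verified by internal
  induction in \<open>M\<close>; for \<open>PF-TP\<close> one takes a counterexample in \<open>M\<close>, if there is one.
\<close>

section \<open>Semantics\<close>

text \<open>Because the conclusion itself asserts that \<open>t\<close> exists, \<open>t\<close> may
  be found separately in each model, even by an undecidable case distinction; completeness supplies
  the formal proof. No closed term is extracted. The proof is shaped by one order of quantifiers:
  \<open>t\<close> comes before the values of the free variables. The truth of an open formula may
  therefore be used to verify candidates but not to choose them. This is why candidate sets are
  fixed in advance, why the rules unite the candidates of all cases, and why zero tuples are added
  where a set might be empty. Such sets are controlled by the predicate \<open>hb\<close>, which
  asks only for inclusion in the elements of codes computed by functionals of the model; inclusion
  suffices because a larger candidate set remains good. "Finite" is meant in the sense of the model: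
  a code may have nonstandard length. The treatment of realizers thus reduces to closure properties
  of \<open>hb\<close> (composition, union, union over a bounded family, currying), while the matrix
  is handled by the HOL predicate \<open>SR\<close>, which meets the syntax of \<open>Sst\<close>
  only in \<open>Sst_sat\<close>.\<close>

lemma finite_fvt [simp]: "finite (fvt t)"
  by (induction t) auto

lemma finite_fv [simp]: "finite (fv A)"
  by (induction A) auto

lemma fresh_notin: "finite X \<Longrightarrow> fresh X \<sigma> \<notin> X"
proof
  assume "finite X" and "fresh X \<sigma> \<in> X"
  then have "fresh_name X \<le> Max (fst ` X)" "X \<noteq> {}"
    by (auto simp: fresh_def image_iff intro!: Max_ge bexI[of _ "(fresh_name X, \<sigma>)"])
  then show False
    by (simp add: fresh_name_def)
qed

lemma snd_fresh [simp]: "snd (fresh X \<sigma>) = \<sigma>"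
  by (simp add: fresh_def)

lemma snd_rebind [simp]: "snd (rebind s x A) = snd x"
  by (simp add: rebind_def Let_def)

lemma rebind_notin: "y \<in> fv A - {x} \<Longrightarrow> rebind s x A \<notin> fvt (s y)"
proof -
  assume y: "y \<in> fv A - {x}"
  let ?X = "\<Union>y \<in> fv A - {x}. fvt (s y)"
  have "finite ?X" by simp
  then have "rebind s x A \<notin> ?X"
    using fresh_notin[of ?X] by (auto simp: rebind_def Let_def)
  with y show ?thesis by blast
qed

definition wsubst :: "(var \<Rightarrow> tm) \<Rightarrow> bool" where
  "wsubst s \<longleftrightarrow> (\<forall>x. wt (s x) \<and> ty_of (s x) = snd x)"

lemma wsubst_V [simp]: "wsubst V"
  by (simp add: wsubst_def)

lemma wsubst_upd [simp]: "wsubst s \<Longrightarrow> wt t \<Longrightarrow> ty_of t = snd x \<Longrightarrow> wsubst (s(x := t))"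
  by (auto simp: wsubst_def)

lemma ty_of_substt [simp]: "wsubst s \<Longrightarrow> ty_of (substt s t) = ty_of t"
  by (induction t) (auto simp: wsubst_def)

lemma wt_substt [simp]: "wsubst s \<Longrightarrow> wt t \<Longrightarrow> wt (substt s t)"
  by (induction t) (auto simp: wsubst_def split: ty.splits)

lemma wff_subst [simp]: "wsubst s \<Longrightarrow> wff A \<Longrightarrow> wff (subst s A)"
  by (induction A arbitrary: s) (auto simp: Let_def)

lemma internal_subst [simp]: "internal (subst s A) = internal A"
  by (induction A arbitrary: s) (auto simp: Let_def)

text \<open>Allows the truth lemma of the term model to descend from a quantified formula to its
  instances, which are not subformulas.\<close>

lemma size_subst [simp]: "size (subst s A) = size A"
  by (induction A arbitrary: s) (auto simp: Let_def)

lemma substt_V [simp]: "substt V t = t"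
  by (induction t) auto

lemma subst_V [simp]: "subst V A = A"
proof -
  have V: "fvt (V y) = {y}" for y by simp
  have "rebind V x A = x" for x A
    by (simp add: rebind_def Let_def)
  moreover have "V(x := V x) = V" for x by auto
  ultimately show ?thesis
    by (induction A) (auto simp: Let_def)
qed

text \<open>HOL has no families of types, so the domains of all finite types are subsets
  \<open>D \<sigma>\<close> of one carrier. Only the typing of the constants is demanded here; their
  equations come with \<open>epa_model\<close>.\<close>

locale tstruct =
  fixes D :: "ty \<Rightarrow> 'a set" and app :: "'a \<Rightarrow> 'a \<Rightarrow> 'a" and cst :: "tm \<Rightarrow> 'a"
  assumes app_D [simp]: "f \<in> D (\<sigma> \<rightarrowtail> \<tau>) \<Longrightarrow> a \<in> D \<sigma> \<Longrightarrow> app f a \<in> D \<tau>"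
    and cst_Zero [simp]: "cst Zero \<in> D TNat"
    and cst_Succ [simp]: "cst Succ \<in> D (TNat \<rightarrowtail> TNat)"
    and cst_K [simp]: "cst (Kc \<sigma> \<tau>) \<in> D (\<sigma> \<rightarrowtail> \<tau> \<rightarrowtail> \<sigma>)"
    and cst_S [simp]: "cst (Sc \<rho> \<sigma> \<tau>) \<in> D ((\<rho> \<rightarrowtail> \<sigma> \<rightarrowtail> \<tau>) \<rightarrowtail> (\<rho> \<rightarrowtail> \<sigma>) \<rightarrowtail> \<rho> \<rightarrowtail> \<tau>)"
    and cst_R [simp]: "cst (Rec \<sigma>) \<in> D (\<sigma> \<rightarrowtail> (\<sigma> \<rightarrowtail> TNat \<rightarrowtail> \<sigma>) \<rightarrowtail> TNat \<rightarrowtail> \<sigma>)"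
begin

fun val :: "(var \<Rightarrow> 'a) \<Rightarrow> tm \<Rightarrow> 'a" where
  "val e (V x) = e x"
| "val e (s \<cdot> t) = app (val e s) (val e t)"
| "val e c = cst c"

text \<open>Only meaningful for internal formulas.\<close>
fun sat :: "(var \<Rightarrow> 'a) \<Rightarrow> fm \<Rightarrow> bool" where
  "sat e (Eq s t) \<longleftrightarrow> val e s = val e t"
| "sat e (Neg A) \<longleftrightarrow> \<not> sat e A"
| "sat e (Disj A B) \<longleftrightarrow> sat e A \<or> sat e B"
| "sat e (Conj A B) \<longleftrightarrow> sat e A \<and> sat e B"
| "sat e (Forall x A) \<longleftrightarrow> (\<forall>d \<in> D (snd x). sat (e(x := d)) A)"
| "sat e (Exists x A) \<longleftrightarrow> (\<exists>d \<in> D (snd x). sat (e(x := d)) A)"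
| "sat e _ \<longleftrightarrow> False"

definition env :: "(var \<Rightarrow> 'a) \<Rightarrow> bool" where
  "env e \<longleftrightarrow> (\<forall>x. e x \<in> D (snd x))"

lemma env_upd [simp]: "env e \<Longrightarrow> d \<in> D (snd x) \<Longrightarrow> env (e(x := d))"
  by (auto simp: env_def)

lemma val_D [simp]: "env e \<Longrightarrow> wt t \<Longrightarrow> val e t \<in> D (ty_of t)"
  by (induction t) (auto simp: env_def split: ty.splits)

lemma val_cong: "(\<And>x. x \<in> fvt t \<Longrightarrow> e x = e' x) \<Longrightarrow> val e t = val e' t"
  by (induction t) auto

lemma sat_cong: "(\<And>x. x \<in> fv A \<Longrightarrow> e x = e' x) \<Longrightarrow> sat e A = sat e' A"
proof (induction A arbitrary: e e')
  case (Eq s t)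
  then have "val e s = val e' s" "val e t = val e' t" by (auto intro!: val_cong)
  then show ?case by simp
next
  case (Forall x A)
  have "sat (e(x := d)) A = sat (e'(x := d)) A" for d
    using Forall.prems by (intro Forall.IH) auto
  then show ?case by simp
next
  case (Exists x A)
  have "sat (e(x := d)) A = sat (e'(x := d)) A" for d
    using Exists.prems by (intro Exists.IH) auto
  then show ?case by simp
next
  case (Neg A)
  have "sat e A = sat e' A" using Neg.prems by (intro Neg.IH) auto
  then show ?case by simp
next
  case (Disj A B)
  have "sat e A = sat e' A" "sat e B = sat e' B"
    using Disj.prems by (auto intro!: Disj.IH)
  then show ?case by simp
next
  case (Conj A B)
  have "sat e A = sat e' A" "sat e B = sat e' B"
    using Conj.prems by (auto intro!: Conj.IH)
  then show ?case by simp
qed auto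

lemma val_substt: "val e (substt s t) = val (\<lambda>x. val e (s x)) t"
  by (induction t) auto

text \<open>\<open>rebind\<close> protects only variables free in \<open>A\<close>, so the two
  environments agree there and possibly nowhere else. The pointwise form serves
  \<open>sat_subst\<close> and, later, \<open>SR_subst\<close>.\<close>

lemma val_rebind:
  assumes "y \<in> fv A"
  shows "val (e(rebind s x A := d)) ((s(x := V (rebind s x A))) y)
    = ((\<lambda>y. val e (s y))(x := d)) y"
proof (cases "y = x")
  case False
  then have "rebind s x A \<notin> fvt (s y)"
    using assms by (intro rebind_notin) auto
  then show ?thesis
    using False by (auto intro!: val_cong)
qed simp

lemma sat_subst: "sat e (subst s A) = sat (\<lambda>x. val e (s x)) A"
proof (induction A arbitrary: e s)
  case (Forall x A)
  have "sat (\<lambda>y. val (e(rebind s x A := d)) ((s(x := V (rebind s x A))) y)) A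
      = sat ((\<lambda>y. val e (s y))(x := d)) A" for d
    by (rule sat_cong) (rule val_rebind)
  then show ?case by (simp only: subst.simps Let_def sat.simps Forall.IH snd_rebind)
next
  case (Exists x A)
  have "sat (\<lambda>y. val (e(rebind s x A := d)) ((s(x := V (rebind s x A))) y)) A
      = sat ((\<lambda>y. val e (s y))(x := d)) A" for d
    by (rule sat_cong) (rule val_rebind)
  then show ?case by (simp only: subst.simps Let_def sat.simps Exists.IH snd_rebind)
qed (auto simp: val_substt Let_def)

lemma sat_subst1: "sat e (subst1 A x t) = sat (e(x := val e t)) A"
proof -
  have "(\<lambda>y. val e ((V(x := t)) y)) = e(x := val e t)" by auto
  then show ?thesis by (simp add: sat_subst)
qed

text \<open>The truth lemma of the term model concerns one environment. The universal closure
  carries truth from it to every environment \<open>e'\<close>, by instantiating the quantifiers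
  with the values of \<open>e'\<close>.\<close>

lemma sat_Foralls:
  assumes "sat e (Foralls xs A)" "env e" "env e'" "\<And>x. x \<in> fv A \<Longrightarrow> x \<in> set xs \<or> e x = e' x"
  shows "sat e' A"
  using assms
proof (induction xs arbitrary: e)
  case Nil
  then show ?case using sat_cong[of A e e'] by auto
next
  case (Cons x xs)
  show ?case
  proof (rule Cons.IH)
    show "sat (e(x := e' x)) (Foralls xs A)"
      using Cons.prems(1,3) by (cases x) (auto simp: env_def)
    show "env (e(x := e' x))"
      using Cons.prems by (metis env_def env_upd)
  qed (use Cons.prems in auto)
qed

end

section \<open>Henkin extensions\<close>

instance ty :: countable by countable_datatype
instance tm :: countable by countable_datatype
instance fm :: countable by countable_datatype

abbreviation Lint :: "fm set" where
  "Lint \<equiv> {B. wff B \<and> internal B}"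

section \<open>Substitution calculus for Henkin witnesses\<close>

lemma subst_idle: "(\<And>x. x \<in> fv A \<Longrightarrow> s x = V x) \<Longrightarrow> subst s A = A"
proof (induction A arbitrary: s)
  have t: "(\<And>x. x \<in> fvt t \<Longrightarrow> s x = V x) \<Longrightarrow> substt s t = t" for t s
    by (induction t) auto
  have r: "rebind s x A = x" if "\<And>y. y \<in> fv A - {x} \<Longrightarrow> s y = V y" for s x A
    using that by (auto simp: rebind_def Let_def)
  {
    case Eq then show ?case by (auto simp: t)
  next
    case St then show ?case by (auto simp: t)
  next
    case Neg then show ?case by auto
  next
    case Disj then show ?case by auto
  next
    case Conj then show ?case by auto
  next
    case (Forall x A)
    have "subst (s(x := V x)) A = A" using Forall.prems by (intro Forall.IH) auto
    moreover have "rebind s x A = x" using Forall.prems by (intro r) auto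
    ultimately show ?case by simp
  next
    case (Exists x A)
    have "subst (s(x := V x)) A = A" using Exists.prems by (intro Exists.IH) auto
    moreover have "rebind s x A = x" using Exists.prems by (intro r) auto
    ultimately show ?case by simp
  next
    case (ForallSt x A)
    have "subst (s(x := V x)) A = A" using ForallSt.prems by (intro ForallSt.IH) auto
    moreover have "rebind s x A = x" using ForallSt.prems by (intro r) auto
    ultimately show ?case by simp
  next
    case (ExistsSt x A)
    have "subst (s(x := V x)) A = A" using ExistsSt.prems by (intro ExistsSt.IH) auto
    moreover have "rebind s x A = x" using ExistsSt.prems by (intro r) auto
    ultimately show ?case by simp
  }
qed

lemma fvt_substt: "fvt (substt s t) = (\<Union>x \<in> fvt t. fvt (s x))"
  by (induction t) auto

lemma fv_subst: "fv (subst s A) \<subseteq> (\<Union>x \<in> fv A. fvt (s x))"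
proof (induction A arbitrary: s)
  case (Forall x A)
  show ?case using Forall[of "s(x := V (rebind s x A))"]
    by (fastforce simp: Let_def split: if_splits)
next
  case (Exists x A)
  show ?case using Exists[of "s(x := V (rebind s x A))"]
    by (fastforce simp: Let_def split: if_splits)
next
  case (ForallSt x A)
  show ?case using ForallSt[of "s(x := V (rebind s x A))"]
    by (fastforce simp: Let_def split: if_splits)
next
  case (ExistsSt x A)
  show ?case using ExistsSt[of "s(x := V (rebind s x A))"]
    by (fastforce simp: Let_def split: if_splits)
qed (fastforce simp: fvt_substt)+

text \<open>Bound variables count too: substituting a variable outside this set never forces a
  binder to be renamed, which makes the substitution invertible.\<close>

fun vars :: "fm \<Rightarrow> var set" where
  "vars (Neg A) = vars A"
| "vars (Disj A B) = vars A \<union> vars B"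
| "vars (Conj A B) = vars A \<union> vars B"
| "vars (Forall x A) = insert x (vars A)"
| "vars (Exists x A) = insert x (vars A)"
| "vars (ForallSt x A) = insert x (vars A)"
| "vars (ExistsSt x A) = insert x (vars A)"
| "vars A = fv A"

lemma finite_vars [simp]: "finite (vars A)"
  by (induction A) auto

lemma fv_vars: "fv A \<subseteq> vars A"
  by (induction A) auto

text \<open>Since \<open>y\<close> occurs nowhere in \<open>A\<close>, neither substitution has to
  rename a binder. Below a binder \<open>x\<close> the inner one stops, and the outer one then meets
  no \<open>y\<close>.\<close>

lemma subst_swap: "y \<notin> vars A \<Longrightarrow> subst (V(y := V x)) (subst (V(x := V y)) A) = A"
proof (induction A)
  have t: "y \<notin> fvt t \<Longrightarrow> substt (V(y := V x)) (substt (V(x := V y)) t) = t" for t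
    by (induction t) auto
  \<comment> \<open>\<open>B z A\<close> is the body of a quantifier over \<open>z\<close> after the
    first substitution; the binder \<open>x\<close> shields its body.\<close>
  define B where "B z A = (if z = x then A else subst (V(x := V y)) A)" for z A
  have r1: "rebind (V(x := V y)) z A = z" if "z \<noteq> y" for z A
    using that by (auto simp: rebind_def Let_def split: if_splits)
  have u1: "subst ((V(x := V y))(z := V z)) A = B z A" for z A
    by (cases "z = x") (auto simp: fun_upd_twist B_def intro!: arg_cong[of _ _ "\<lambda>s. subst s A"])
  have r2: "rebind (V(y := V x)) z (B z A) = z" if "y \<notin> vars A" for z A
    using that fv_vars[of A] by (auto simp: rebind_def Let_def B_def split: if_splits)
  have u2: "subst ((V(y := V x))(z := V z)) (B z A) = A"
    if "y \<notin> vars A" "z \<noteq> y" "subst (V(y := V x)) (subst (V(x := V y)) A) = A" for z A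
  proof (cases "z = x")
    case True
    then show ?thesis
      using that fv_vars[of A] by (auto simp: B_def intro!: subst_idle)
  next
    case False
    then have "(V(y := V x))(z := V z) = V(y := V x)" using that(2) by auto
    then show ?thesis using that False by (simp add: B_def)
  qed
  {
    case (Eq u v)
    then have "y \<notin> fvt u" "y \<notin> fvt v" by auto
    then show ?case unfolding subst.simps by (intro arg_cong2[of _ _ _ _ Eq] t)
  next
    case (St u)
    then have "y \<notin> fvt u" by auto
    then show ?case unfolding subst.simps by (intro arg_cong[of _ _ St] t)
  next
    case (Forall z A)
    then have "z \<noteq> y" "y \<notin> vars A" by auto
    then show ?case using Forall.IH by (simp add: r1 u1 r2 u2 del: fun_upd_apply)
  next
    case (Exists z A)
    then have "z \<noteq> y" "y \<notin> vars A" by auto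
    then show ?case using Exists.IH by (simp add: r1 u1 r2 u2 del: fun_upd_apply)
  next
    case (ForallSt z A)
    then have "z \<noteq> y" "y \<notin> vars A" by auto
    then show ?case using ForallSt.IH by (simp add: r1 u1 r2 u2 del: fun_upd_apply)
  next
    case (ExistsSt z A)
    then have "z \<noteq> y" "y \<notin> vars A" by auto
    then show ?case using ExistsSt.IH by (simp add: r1 u1 r2 u2 del: fun_upd_apply)
  }
qed auto

lemma peval_imps: "peval v (foldr Imp As B) \<longleftrightarrow> (\<forall>A \<in> set As. peval v A) \<longrightarrow> peval v B"
  by (induction As) auto

lemma imps_Lint: "foldr Imp As B \<in> Lint \<longleftrightarrow> set As \<subseteq> Lint \<and> B \<in> Lint"
  by (induction As) auto

lemma fv_imps: "fv (foldr Imp As B) = \<Union>(fv ` set As) \<union> fv B"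
  by (induction As) auto

section \<open>Derivations from hypotheses in the internal calculus\<close>

locale internal_logic =
  fixes Ax :: "fm set"
begin

abbreviation thr where "thr \<equiv> deriv Lint Ax"

lemma thr_Lint: "thr A \<Longrightarrow> A \<in> Lint"
  by (induction rule: deriv.induct) auto

lemma thr_taut: "A \<in> Lint \<Longrightarrow> (\<And>v. peval v A) \<Longrightarrow> thr A"
  by (auto intro: deriv.taut simp: taut_def)

lemma thr_conseq:
  assumes "thr A" "B \<in> Lint" "\<And>v. peval v A \<Longrightarrow> peval v B"
  shows "thr B"
  by (rule deriv.mp[OF assms(1) thr_taut]) (use thr_Lint[OF assms(1)] assms(2,3) in auto)

lemma thr_conseq2:
  assumes "thr A" "thr B" "C \<in> Lint" "\<And>v. peval v A \<Longrightarrow> peval v B \<Longrightarrow> peval v C"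
  shows "thr C"
proof (rule deriv.mp[OF assms(2)])
  show "thr (Imp B C)"
    by (rule thr_conseq[OF assms(1)]) (use thr_Lint[OF assms(2)] assms(3,4) in auto)
qed

lemma thr_gen: "thr A \<Longrightarrow> thr (Forall x A)"
proof -
  \<comment> \<open>The generalization rule acts on implications only, so a closed tautology is put
    in front as a dummy premise.\<close>
  let ?T = "Imp (Eq Zero Zero) (Eq Zero Zero)"
  assume A: "thr A"
  then have "thr (Imp ?T A)" using thr_Lint[OF A] by (intro thr_conseq[OF A]) auto
  then have "thr (Imp ?T (Forall x A))" by (rule deriv.forall_intro) simp
  then show ?thesis by (rule thr_conseq) (use thr_Lint[OF A] in auto)
qed

lemma thr_gens: "thr A \<Longrightarrow> thr (Foralls xs A)"
  by (induction xs) (auto intro: thr_gen)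

lemma thr_not_forall: "Forall x A \<in> Lint \<Longrightarrow> thr (Imp (Neg (Forall x A)) (Exists x (Neg A)))"
proof -
  assume A: "Forall x A \<in> Lint"
  then have "thr (Imp (subst1 (Neg A) x (V x)) (Exists x (Neg A)))"
    by (intro deriv.exists_intro) auto
  then have "thr (Imp (Neg A) (Exists x (Neg A)))" by simp
  then have "thr (Imp (Neg (Exists x (Neg A))) A)"
    by (rule thr_conseq) (use A in auto)
  then have "thr (Imp (Neg (Exists x (Neg A))) (Forall x A))"
    by (rule deriv.forall_intro) auto
  then show ?thesis by (rule thr_conseq) (use A in auto)
qed

text \<open>The rule \<open>exists_elim\<close> binds the eigenvariable itself. It therefore yields
  \<open>Exists y\<close> of the renamed formula, and \<open>A\<close> implies the latter by
  \<open>subst_swap\<close>; then \<open>x\<close> can be eliminated, being no longer free on the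
  right.\<close>

lemma thr_witness:
  assumes "thr (Imp (subst1 A x (V y)) C)" and y: "y \<notin> vars A" "y \<notin> fv C" "snd y = snd x"
    and A: "A \<in> Lint"
  shows "thr (Imp (Exists x A) C)"
proof -
  let ?A = "subst1 A x (V y)"
  have 1: "thr (Imp (Exists y ?A) C)"
    using assms by (intro deriv.exists_elim)
  have "thr (Imp (subst1 ?A y (V x)) (Exists y ?A))"
    using A y by (intro deriv.exists_intro) auto
  then have "thr (Imp A (Exists y ?A))" using subst_swap y by simp
  moreover have "x \<notin> fv (Exists y ?A)"
    using fv_subst[of "V(x := V y)" A] by (auto split: if_splits)
  ultimately have 2: "thr (Imp (Exists x A) (Exists y ?A))"
    by (intro deriv.exists_elim)
  show ?thesis
    by (rule thr_conseq2[OF 1 2]) (use thr_Lint[OF 1] A in auto)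
qed

text \<open>Hypotheses are moved into a theorem as a finite chain of implications. The deduction
  theorem becomes propositional, and the quantifier rules never operate under open
  hypotheses.\<close>

definition prv :: "fm set \<Rightarrow> fm \<Rightarrow> bool" where
  "prv \<Gamma> B \<longleftrightarrow> (\<exists>As. set As \<subseteq> \<Gamma> \<and> thr (foldr Imp As B))"

abbreviation Bot where "Bot \<equiv> Neg (Imp (Eq Zero Zero) (Eq Zero Zero))"

abbreviation "consistent \<Gamma> \<equiv> \<not> prv \<Gamma> Bot"

lemma prv_mono: "prv \<Gamma> A \<Longrightarrow> \<Gamma> \<subseteq> \<Gamma>' \<Longrightarrow> prv \<Gamma>' A"
  by (auto simp: prv_def)

lemma prv_thr: "thr A \<Longrightarrow> prv \<Gamma> A"
  by (auto simp: prv_def intro!: exI[of _ "[]"])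

lemma prv_asm: "A \<in> \<Gamma> \<Longrightarrow> A \<in> Lint \<Longrightarrow> prv \<Gamma> A"
  by (auto simp: prv_def intro!: exI[of _ "[A]"] thr_taut)

lemma prv_conseq2:
  assumes "prv \<Gamma> A" "prv \<Gamma> B" "C \<in> Lint" "\<And>v. peval v A \<Longrightarrow> peval v B \<Longrightarrow> peval v C"
  shows "prv \<Gamma> C"
proof -
  from assms obtain As Bs where AB: "set As \<subseteq> \<Gamma>" "thr (foldr Imp As A)"
    "set Bs \<subseteq> \<Gamma>" "thr (foldr Imp Bs B)" by (auto simp: prv_def)
  have "foldr Imp (As @ Bs) C \<in> Lint"
    using thr_Lint[OF AB(2)] thr_Lint[OF AB(4)] assms(3) by (simp only: imps_Lint) auto
  then have "thr (foldr Imp (As @ Bs) C)"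
    using thr_conseq2[OF AB(2,4)] assms(4)
    by (auto simp: peval_imps simp del: foldr_append)
  with AB show ?thesis unfolding prv_def by (intro exI[of _ "As @ Bs"]) auto
qed

lemma prv_conseq:
  "prv \<Gamma> A \<Longrightarrow> C \<in> Lint \<Longrightarrow> (\<And>v. peval v A \<Longrightarrow> peval v C) \<Longrightarrow> prv \<Gamma> C"
  using prv_conseq2[of \<Gamma> A A C] by auto

lemma prv_deduct: "prv (insert A \<Gamma>) B \<Longrightarrow> A \<in> Lint \<Longrightarrow> prv \<Gamma> (Imp A B)"
proof -
  assume "prv (insert A \<Gamma>) B" and A: "A \<in> Lint"
  then obtain As where As: "set As \<subseteq> insert A \<Gamma>" "thr (foldr Imp As B)"
    by (auto simp: prv_def)
  let ?As = "filter (\<lambda>B. B \<noteq> A) As"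
  have "foldr Imp ?As (Imp A B) \<in> Lint"
    using thr_Lint[OF As(2)] A by (simp only: imps_Lint) auto
  then have "thr (foldr Imp ?As (Imp A B))"
    by (intro thr_conseq[OF As(2)]) (auto simp: peval_imps)
  then show ?thesis unfolding prv_def using As by (intro exI[of _ ?As]) auto
qed

text \<open>If adding the instance gave a contradiction, finitely many hypotheses and
  \<open>Bot\<close> would form a formula \<open>?C\<close> implied by it. As \<open>y\<close> is
  new for \<open>?C\<close>, \<open>thr_witness\<close> replaces the instance by
  \<open>Exists x A\<close>, which is already assumed.\<close>

lemma consistent_witness:
  assumes "consistent \<Gamma>" "\<Gamma> \<subseteq> Lint" "Exists x A \<in> \<Gamma>" "y \<notin> \<Union>(vars ` \<Gamma>)" "snd y = snd x"
  shows "consistent (insert (subst1 A x (V y)) \<Gamma>)"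
proof
  let ?A = "subst1 A x (V y)"
  assume bot: "prv (insert ?A \<Gamma>) Bot"
  have A: "A \<in> Lint" using assms by auto
  then have A': "?A \<in> Lint" using assms by auto
  have "prv \<Gamma> (Imp ?A Bot)" using bot A' by (rule prv_deduct)
  then obtain As where As: "set As \<subseteq> \<Gamma>" "thr (foldr Imp As (Imp ?A Bot))"
    by (auto simp: prv_def)
  let ?C = "foldr Imp As Bot"
  have C: "?C \<in> Lint" using As(1) assms(2) by (simp only: imps_Lint) auto
  have "thr (Imp ?A ?C)"
    by (rule thr_conseq[OF As(2)]) (use A' C in \<open>auto simp: peval_imps\<close>)
  moreover have "y \<notin> fv ?C" using As(1) assms(4) fv_vars by (fastforce simp: fv_imps)
  ultimately have "thr (Imp (Exists x A) ?C)"
    using assms A by (intro thr_witness[where A = A and x = x and y = y]) auto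
  then have "prv \<Gamma> (foldr Imp (Exists x A # As) Bot)" by (simp add: prv_thr)
  then have "prv \<Gamma> Bot" using As(1) assms(3) \<open>thr (Imp (Exists x A) ?C)\<close>
    unfolding prv_def by (intro exI[of _ "Exists x A # As"]) auto
  with assms(1) show False by simp
qed

definition witness :: "fm \<Rightarrow> fm set \<Rightarrow> fm set" where
  "witness A \<Gamma> = (case A of
     Exists x B \<Rightarrow> {subst1 B x (V (fresh (\<Union>(vars ` insert A \<Gamma>)) (snd x)))} | _ \<Rightarrow> {})"

primrec henkin :: "fm \<Rightarrow> nat \<Rightarrow> fm set" where
  "henkin \<psi> 0 = {\<psi>}"
| "henkin \<psi> (Suc n) = (let A = from_nat n; \<Gamma> = henkin \<psi> n in
     if A \<in> Lint \<and> consistent (insert A \<Gamma>) then insert A \<Gamma> \<union> witness A \<Gamma> else \<Gamma>)"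

lemma henkin_step:
  assumes "\<psi> \<in> Lint" "consistent {\<psi>}"
  shows "finite (henkin \<psi> n) \<and> henkin \<psi> n \<subseteq> Lint \<and> consistent (henkin \<psi> n)"
proof (induction n)
  case (Suc n)
  define A :: fm and \<Gamma> where "A = from_nat n" and "\<Gamma> = henkin \<psi> n"
  show ?case
  proof (cases "A \<in> Lint \<and> consistent (insert A \<Gamma>)")
    case True
    have H: "henkin \<psi> (Suc n) = insert A \<Gamma> \<union> witness A \<Gamma>"
      using True by (simp add: A_def \<Gamma>_def Let_def)
    show ?thesis
    proof (cases "\<exists>x B. A = Exists x B")
      case ex: True
      then obtain x B where AB: "A = Exists x B" by blast
      let ?y = "fresh (\<Union>(vars ` insert A \<Gamma>)) (snd x)"
      have "?y \<notin> \<Union>(vars ` insert A \<Gamma>)"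
        using Suc by (intro fresh_notin) (auto simp: \<Gamma>_def)
      then have "consistent (insert (subst1 B x (V ?y)) (insert A \<Gamma>))"
        using Suc True AB by (intro consistent_witness) (auto simp: \<Gamma>_def)
      then show ?thesis
        unfolding H using Suc True AB by (auto simp: \<Gamma>_def witness_def)
    next
      case False
      then have "witness A \<Gamma> = {}" by (auto simp: witness_def split: fm.splits)
      then show ?thesis unfolding H using Suc True by (auto simp: \<Gamma>_def)
    qed
  next
    case False
    then have "henkin \<psi> (Suc n) = \<Gamma>" by (auto simp: A_def \<Gamma>_def Let_def)
    then show ?thesis using Suc by (simp add: \<Gamma>_def)
  qed
qed (use assms in auto)

lemma henkin_mono: "m \<le> n \<Longrightarrow> henkin \<psi> m \<subseteq> henkin \<psi> n"
  by (rule lift_Suc_mono_le[of "henkin \<psi>"]) (auto simp: Let_def)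

lemma henkin_extension:
  assumes "\<psi> \<in> Lint" "consistent {\<psi>}"
  obtains W where "\<psi> \<in> W" "W \<subseteq> Lint" "consistent W"
    "\<And>A. A \<in> Lint \<Longrightarrow> consistent (insert A W) \<Longrightarrow> A \<in> W"
    "\<And>x A. Exists x A \<in> W \<Longrightarrow> \<exists>y. snd y = snd x \<and> subst1 A x (V y) \<in> W"
proof
  let ?W = "\<Union>n. henkin \<psi> n"
  note st = henkin_step[OF assms]
  show "\<psi> \<in> ?W" by (auto intro: exI[of _ 0])
  show "?W \<subseteq> Lint" using st by blast
  have fin: "\<exists>n. X \<subseteq> henkin \<psi> n" if "finite X" "X \<subseteq> ?W" for X
    using that
  proof induction
    case (insert A X)
    then obtain m n where "X \<subseteq> henkin \<psi> n" "A \<in> henkin \<psi> m" by auto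
    then show ?case
      using henkin_mono[of m "max m n" \<psi>] henkin_mono[of n "max m n" \<psi>] by fastforce
  qed simp
  show con: "consistent ?W"
  proof
    assume "prv ?W Bot"
    then obtain As where As: "set As \<subseteq> ?W" "thr (foldr Imp As Bot)" by (auto simp: prv_def)
    then obtain n where "set As \<subseteq> henkin \<psi> n" using fin[of "set As"] by auto
    then have "prv (henkin \<psi> n) Bot" using As(2) unfolding prv_def by blast
    with st show False by blast
  qed
  \<comment> \<open>The formula \<open>A\<close> is examined at stage \<open>to_nat A\<close>.
    Consistency with the limit implies consistency with that stage, so \<open>A\<close> was accepted
    there together with its witness.\<close>
  have step: "insert A (henkin \<psi> (to_nat A)) \<union> witness A (henkin \<psi> (to_nat A)) \<subseteq> ?W"
    if A: "A \<in> Lint" "consistent (insert A ?W)" for A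
  proof -
    have "consistent (insert A (henkin \<psi> (to_nat A)))"
      using A(2) prv_mono[of "insert A (henkin \<psi> (to_nat A))" Bot "insert A ?W"] by blast
    then have "henkin \<psi> (Suc (to_nat A))
        = insert A (henkin \<psi> (to_nat A)) \<union> witness A (henkin \<psi> (to_nat A))"
      using A(1) by (simp add: Let_def)
    then show ?thesis by blast
  qed
  then show "A \<in> ?W" if "A \<in> Lint" "consistent (insert A ?W)" for A
    using that by blast
  show "\<exists>y. snd y = snd x \<and> subst1 A x (V y) \<in> ?W" if "Exists x A \<in> ?W" for x A
  proof -
    have "Exists x A \<in> Lint" using that \<open>?W \<subseteq> Lint\<close> by blast
    moreover have "consistent (insert (Exists x A) ?W)" using con that by (simp add: insert_absorb)
    ultimately have "witness (Exists x A) (henkin \<psi> (to_nat (Exists x A))) \<subseteq> ?W"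
      using step by blast
    then have "\<exists>y. snd y = snd x \<and> {subst1 A x (V y)} \<subseteq> ?W"
      unfolding witness_def fm.case by (intro exI conjI) (rule snd_fresh)
    then show ?thesis by blast
  qed
qed

end

section \<open>The term model\<close>

locale henkin_model = internal_logic Ax for Ax +
  fixes W :: "fm set"
  assumes Ax: "EPA_axioms \<subseteq> Ax"
    and W_Lint: "W \<subseteq> Lint" and W_con: "consistent W"
    and W_max: "A \<in> Lint \<Longrightarrow> consistent (insert A W) \<Longrightarrow> A \<in> W"
    and W_wit: "Exists x A \<in> W \<Longrightarrow> \<exists>y. snd y = snd x \<and> subst1 A x (V y) \<in> W"
begin

lemma W_closed: assumes "prv W A" "A \<in> Lint" shows "A \<in> W"
proof (rule W_max[OF assms(2)], rule)
  assume "prv (insert A W) Bot"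
  then have "prv W (Imp A Bot)" using assms by (intro prv_deduct)
  then have "prv W Bot" by (rule prv_conseq2[OF assms(1)]) auto
  with W_con show False by simp
qed

lemma W_thr: "thr A \<Longrightarrow> A \<in> W"
  using W_closed prv_thr thr_Lint by blast

lemma W_conseq2:
  assumes "A \<in> W" "B \<in> W" "C \<in> Lint" "\<And>v. peval v A \<Longrightarrow> peval v B \<Longrightarrow> peval v C"
  shows "C \<in> W"
proof (rule W_closed[OF prv_conseq2])
  show "prv W A" "prv W B" using assms W_Lint by (auto intro: prv_asm)
qed (use assms in auto)

lemma W_mp: "A \<in> W \<Longrightarrow> Imp A B \<in> W \<Longrightarrow> B \<in> W"
  by (rule W_conseq2[of A "Imp A B"]) (use W_Lint in auto)

lemma W_Neg: "A \<in> Lint \<Longrightarrow> Neg A \<in> W \<longleftrightarrow> A \<notin> W"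
proof
  assume "A \<in> Lint" "Neg A \<in> W"
  then show "A \<notin> W"
    using W_conseq2[of A "Neg A" Bot] W_con prv_asm[of Bot W] W_Lint by auto
next
  assume A: "A \<in> Lint" "A \<notin> W"
  then have "prv (insert A W) Bot" using W_max by blast
  then have "prv W (Imp A Bot)" using A by (intro prv_deduct)
  then have "prv W (Neg A)" by (rule prv_conseq) (use A in auto)
  then show "Neg A \<in> W" by (rule W_closed) (use A in auto)
qed

lemma W_Disj: "A \<in> Lint \<Longrightarrow> B \<in> Lint \<Longrightarrow> Disj A B \<in> W \<longleftrightarrow> A \<in> W \<or> B \<in> W"
  using W_conseq2[of "Disj A B" "Neg A" B] W_conseq2[of A A "Disj A B"]
    W_conseq2[of B B "Disj A B"] by (auto simp: W_Neg)

lemma W_Conj: "A \<in> Lint \<Longrightarrow> B \<in> Lint \<Longrightarrow> Conj A B \<in> W \<longleftrightarrow> A \<in> W \<and> B \<in> W"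
  using W_conseq2[of "Conj A B" "Conj A B" A] W_conseq2[of "Conj A B" "Conj A B" B]
    W_conseq2[of A B "Conj A B"] by auto

lemma W_Exists:
  assumes "Exists x A \<in> Lint"
  shows "Exists x A \<in> W \<longleftrightarrow> (\<exists>t. wt t \<and> ty_of t = snd x \<and> subst1 A x t \<in> W)"
proof
  assume "Exists x A \<in> W"
  then show "\<exists>t. wt t \<and> ty_of t = snd x \<and> subst1 A x t \<in> W"
    using W_wit by (metis ty_of.simps(1) wt.simps(2))
next
  assume "\<exists>t. wt t \<and> ty_of t = snd x \<and> subst1 A x t \<in> W"
  then show "Exists x A \<in> W"
    using W_mp W_thr deriv.exists_intro[OF assms] by blast
qed

lemma W_Forall:
  assumes "Forall x A \<in> Lint"
  shows "Forall x A \<in> W \<longleftrightarrow> (\<forall>t. wt t \<longrightarrow> ty_of t = snd x \<longrightarrow> subst1 A x t \<in> W)"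
proof
  assume "Forall x A \<in> W"
  then show "\<forall>t. wt t \<longrightarrow> ty_of t = snd x \<longrightarrow> subst1 A x t \<in> W"
    using W_mp W_thr deriv.forall_elim[OF assms] by blast
next
  assume all: "\<forall>t. wt t \<longrightarrow> ty_of t = snd x \<longrightarrow> subst1 A x t \<in> W"
  show "Forall x A \<in> W"
  proof (rule ccontr)
    assume "Forall x A \<notin> W"
    then have "Neg (Forall x A) \<in> W" using assms by (simp add: W_Neg)
    then have "Exists x (Neg A) \<in> W" using W_mp W_thr thr_not_forall[OF assms] by blast
    then obtain t where "wt t" "ty_of t = snd x" "subst1 (Neg A) x t \<in> W"
      using assms by (auto simp: W_Exists)
    then show False using all assms by (auto simp: W_Neg)
  qed
qed

lemma W_ax: "A \<in> EPA_axioms \<Longrightarrow> A \<in> Lint \<Longrightarrow> A \<in> W"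
  using Ax by (intro W_thr deriv.ax) auto

lemma W_refl: "wt t \<Longrightarrow> Eq t t \<in> W"
  by (rule W_ax[OF EPA_axioms.refl]) auto

lemma W_sym: "Eq s t \<in> W \<Longrightarrow> Eq t s \<in> W"
  by (rule W_mp, assumption, rule W_ax[OF EPA_axioms.sym]) (use W_Lint in auto)

lemma W_trans: assumes "Eq s t \<in> W" "Eq t u \<in> W" shows "Eq s u \<in> W"
proof (rule W_mp)
  show "Conj (Eq s t) (Eq t u) \<in> W" using assms W_Lint by (subst W_Conj) auto
  have "wff (Eq s t)" "wff (Eq t u)" using assms W_Lint by auto
  then show "Imp (Conj (Eq s t) (Eq t u)) (Eq s u) \<in> W"
    by (intro W_ax[OF EPA_axioms.trans]) auto
qed

lemma W_cong:
  assumes "Eq f g \<in> W" "Eq s t \<in> W" "wt (f \<cdot> s)"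
  shows "Eq (f \<cdot> s) (g \<cdot> t) \<in> W"
proof (rule W_mp)
  have "wff (Eq f g)" "wff (Eq s t)" using assms W_Lint by auto
  then show "Conj (Eq f g) (Eq s t) \<in> W" using assms by (subst W_Conj) auto
  show "Imp (Conj (Eq f g) (Eq s t)) (Eq (f \<cdot> s) (g \<cdot> t)) \<in> W"
    using assms(3) \<open>wff (Eq f g)\<close> \<open>wff (Eq s t)\<close>
    by (intro W_ax[OF EPA_axioms.cong]) (auto split: ty.splits)
qed

text \<open>Classes of equality as decided by \<open>W\<close>. The type is part of the condition,
  which keeps classes of different types apart.\<close>

definition cls :: "tm \<Rightarrow> tm set" where
  "cls t = {u. wt u \<and> ty_of u = ty_of t \<and> Eq t u \<in> W}"

definition dom :: "ty \<Rightarrow> tm set set" where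
  "dom \<sigma> = cls ` {t. wt t \<and> ty_of t = \<sigma>}"

definition rep :: "tm set \<Rightarrow> tm" where
  "rep c = (SOME t. wt t \<and> cls t = c)"

lemma cls_eq: "wt t \<Longrightarrow> wt u \<Longrightarrow> cls t = cls u \<longleftrightarrow> ty_of t = ty_of u \<and> Eq t u \<in> W"
proof (intro iffI conjI)
  assume tu: "wt t" "wt u"
  {
    assume "cls t = cls u"
    then have "u \<in> cls t" using tu W_refl by (auto simp: cls_def)
    then show "ty_of t = ty_of u" "Eq t u \<in> W" by (auto simp: cls_def)
  next
    assume "ty_of t = ty_of u \<and> Eq t u \<in> W"
    then show "cls t = cls u" using W_trans[of t u] W_trans[of u t] W_sym[of t u]
      by (auto simp: cls_def)
  }
qed

lemma rep_cls: "wt t \<Longrightarrow> wt (rep (cls t)) \<and> cls (rep (cls t)) = cls t"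
  unfolding rep_def by (rule someI[of _ t]) simp

text \<open>Application of classes goes through chosen representatives; the congruence axiom makes
  the choice irrelevant, as \<open>apc_cls\<close> shows.\<close>

definition apc :: "tm set \<Rightarrow> tm set \<Rightarrow> tm set" where
  "apc c d = cls (rep c \<cdot> rep d)"

lemma apc_cls: "wt (f \<cdot> t) \<Longrightarrow> apc (cls f) (cls t) = cls (f \<cdot> t)"
proof -
  assume ft: "wt (f \<cdot> t)"
  have f: "wt (rep (cls f))" "ty_of (rep (cls f)) = ty_of f" "Eq (rep (cls f)) f \<in> W"
    using rep_cls[of f] cls_eq[of "rep (cls f)" f] ft by auto
  have t: "wt (rep (cls t))" "ty_of (rep (cls t)) = ty_of t" "Eq (rep (cls t)) t \<in> W"
    using rep_cls[of t] cls_eq[of "rep (cls t)" t] ft by auto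
  have "wt (rep (cls f) \<cdot> rep (cls t))" using f t ft by (auto split: ty.splits)
  then show ?thesis
    unfolding apc_def using f t ft W_cong by (subst cls_eq) auto
qed

lemma domE: "c \<in> dom \<sigma> \<Longrightarrow> (\<And>t. wt t \<Longrightarrow> ty_of t = \<sigma> \<Longrightarrow> c = cls t \<Longrightarrow> P) \<Longrightarrow> P"
  by (auto simp: dom_def)

sublocale tstruct dom apc cls
proof
  show "apc f a \<in> dom \<tau>" if "f \<in> dom (\<sigma> \<rightarrowtail> \<tau>)" "a \<in> dom \<sigma>" for f a \<sigma> \<tau>
    using that by (elim domE) (auto simp: apc_cls dom_def)
qed (auto simp: dom_def)

definition e0 :: "var \<Rightarrow> tm set" where "e0 x = cls (V x)"

lemma env_e0 [simp]: "env e0"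
  by (auto simp: env_def e0_def dom_def)

lemma val_e0: "wt t \<Longrightarrow> val e0 t = cls t"
  by (induction t) (auto simp: e0_def apc_cls)

text \<open>Every element of a domain is the class of a term, so a quantifier over
  \<open>dom\<close> is one over instances. These have the size of the body, hence induction on
  \<open>size\<close>; \<open>W_Exists\<close> and \<open>W_Forall\<close> handle the
  quantifiers.\<close>

lemma truth: "A \<in> Lint \<Longrightarrow> sat e0 A \<longleftrightarrow> A \<in> W"
proof (induction "size A" arbitrary: A rule: less_induct)
  case less
  note IH = less.hyps
  show ?case
  proof (cases A)
    case (Eq s t)
    then show ?thesis using less.prems by (auto simp: val_e0 cls_eq)
  next
    case (Neg B)
    then show ?thesis using less.prems IH[of B] by (auto simp: W_Neg)
  next
    case (Disj B C)
    then show ?thesis using less.prems IH[of B] IH[of C] by (auto simp: W_Disj)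
  next
    case (Conj B C)
    then show ?thesis using less.prems IH[of B] IH[of C] by (auto simp: W_Conj)
  next
    case (Forall x B)
    have "sat (e0(x := cls t)) B \<longleftrightarrow> subst1 B x t \<in> W" if "wt t" "ty_of t = snd x" for t
      using IH[of "subst1 B x t"] less.prems that Forall by (simp add: sat_subst1 val_e0)
    then show ?thesis using Forall less.prems W_Forall[of x B] by (auto simp: dom_def)
  next
    case (Exists x B)
    have "sat (e0(x := cls t)) B \<longleftrightarrow> subst1 B x t \<in> W" if "wt t" "ty_of t = snd x" for t
      using IH[of "subst1 B x t"] less.prems that Exists by (simp add: sat_subst1 val_e0)
    then show ?thesis using Exists less.prems W_Exists[of x B] by (auto simp: dom_def)
  qed (use less.prems in auto)
qed

lemma truth_thr: "thr A \<Longrightarrow> env e \<Longrightarrow> sat e A"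
proof -
  assume A: "thr A" and e: "env e"
  obtain xs where xs: "set xs = fv A" using finite_list[OF finite_fv] by blast
  have "thr (Foralls xs A)" using A by (rule thr_gens)
  then have "sat e0 (Foralls xs A)" using truth thr_Lint W_thr by blast
  then show ?thesis by (rule sat_Foralls) (use e xs in auto)
qed

end

text \<open>The negation of an unprovable formula is consistent, and the term model of a Henkin
  extension refutes the formula at the environment that sends every variable to its own class.
  Axioms hold in all environments because their universal closures are theorems.\<close>

lemma (in internal_logic) completeness:
  assumes "EPA_axioms \<subseteq> Ax" "\<psi> \<in> Lint" "\<not> thr \<psi>"
  obtains D :: "ty \<Rightarrow> tm set set" and app cst where "tstruct D app cst"
    "\<And>A e. A \<in> Ax \<Longrightarrow> A \<in> Lint \<Longrightarrow> tstruct.env D e \<Longrightarrow> tstruct.sat D app cst e A"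
    "\<exists>e. tstruct.env D e \<and> \<not> tstruct.sat D app cst e \<psi>"
proof -
  have "consistent {Neg \<psi>}"
  proof
    assume "prv {Neg \<psi>} Bot"
    then have "prv {} (Imp (Neg \<psi>) Bot)" using assms(2) by (intro prv_deduct) auto
    then have "prv {} \<psi>" by (rule prv_conseq) (use assms(2) in auto)
    then show False using assms(3) by (auto simp: prv_def)
  qed
  then obtain W where W: "Neg \<psi> \<in> W" "W \<subseteq> Lint" "consistent W"
    "\<And>A. A \<in> Lint \<Longrightarrow> consistent (insert A W) \<Longrightarrow> A \<in> W"
    "\<And>x A. Exists x A \<in> W \<Longrightarrow> \<exists>y. snd y = snd x \<and> subst1 A x (V y) \<in> W"
    using henkin_extension[of "Neg \<psi>"] assms(2) by auto
  interpret M: henkin_model Ax W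
    by standard (use W assms in auto)
  show ?thesis
  proof
    show "tstruct M.dom M.apc M.cls" by (rule M.tstruct_axioms)
    show "M.sat e A" if "A \<in> Ax" "A \<in> Lint" "M.env e" for A e
      by (rule M.truth_thr[OF deriv.ax]) (use that in auto)
    show "\<exists>e. M.env e \<and> \<not> M.sat e \<psi>"
      using M.truth[of "Neg \<psi>"] W(1) assms(2) by (auto intro!: exI[of _ M.e0])
  qed
qed

section \<open>Definable functions and predicates in a model\<close>

declare arrs.simps [simp del]

lemma arrs_Nil [simp]: "arrs [] \<tau> = \<tau>"
  and arrs_Cons [simp]: "arrs (\<sigma> # \<sigma>s) \<tau> = \<sigma> \<rightarrowtail> arrs \<sigma>s \<tau>"
  and arrs_append [simp]: "arrs (\<sigma>s @ \<sigma>s') \<tau> = arrs \<sigma>s (arrs \<sigma>s' \<tau>)"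
  by (simp_all add: arrs.simps)

lemma ty_of_lam [simp]: "wt t \<Longrightarrow> ty_of (lam x t) = snd x \<rightarrowtail> ty_of t"
  and wt_lam [simp]: "wt t \<Longrightarrow> wt (lam x t)"
proof -
  have "wt t \<Longrightarrow> wt (lam x t) \<and> ty_of (lam x t) = snd x \<rightarrowtail> ty_of t"
    by (induction t) (auto split: ty.splits)
  then show "wt t \<Longrightarrow> ty_of (lam x t) = snd x \<rightarrowtail> ty_of t" "wt t \<Longrightarrow> wt (lam x t)"
    by auto
qed

lemma fvt_lam [simp]: "fvt (lam x t) = fvt t - {x}"
  by (induction t) auto

lemma zero_c_props [simp]: "wt (zero_c \<sigma>)" "ty_of (zero_c \<sigma>) = \<sigma>" "fvt (zero_c \<sigma>) = {}"
proof -
  have "wt (zero_c \<sigma>) \<and> ty_of (zero_c \<sigma>) = \<sigma> \<and> fvt (zero_c \<sigma>) = {}"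
    by (induction \<sigma>) auto
  then show "wt (zero_c \<sigma>)" "ty_of (zero_c \<sigma>) = \<sigma>" "fvt (zero_c \<sigma>) = {}" by auto
qed

section \<open>Tuples of arguments and iterated abstraction\<close>

fun upds :: "(var \<Rightarrow> 'a) \<Rightarrow> var list \<Rightarrow> 'a list \<Rightarrow> var \<Rightarrow> 'a" where
  "upds e (v # vs) (x # xs) = upds (e(v := x)) vs xs"
| "upds e _ _ = e"

lemma upds_other [simp]: "v \<notin> set vs \<Longrightarrow> upds e vs xs v = e v"
  by (induction e vs xs rule: upds.induct) auto

lemma upds_nth:
  "distinct vs \<Longrightarrow> length xs = length vs \<Longrightarrow> i < length vs \<Longrightarrow> upds e vs xs (vs ! i) = xs ! i"
  by (induction e vs xs arbitrary: i rule: upds.induct) (auto simp: nth_Cons split: nat.split)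

lemma map_upds: "distinct vs \<Longrightarrow> length xs = length vs \<Longrightarrow> map (upds e vs xs) vs = xs"
  by (intro nth_equalityI) (auto simp: upds_nth)

lemma upds_append:
  "length xs = length vs \<Longrightarrow> upds e (vs @ ws) (xs @ ys) = upds (upds e vs xs) ws ys"
  by (induction e vs xs rule: upds.induct) auto

text \<open>The number of a variable gives its position in the list, which stays unambiguous when
  types repeat.\<close>

definition ctx :: "nat \<Rightarrow> ty list \<Rightarrow> var list" where
  "ctx n X = zip [n ..< n + length X] X"

lemma length_ctx [simp]: "length (ctx n X) = length X"
  and tys_ctx [simp]: "tys (ctx n X) = X"
  and distinct_ctx [simp]: "distinct (ctx n X)"
  and nth_ctx [simp]: "i < length X \<Longrightarrow> ctx n X ! i = (n + i, X ! i)"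
  by (auto simp: ctx_def distinct_zipI1)

lemma in_ctx: "v \<in> set (ctx n X) \<longleftrightarrow> n \<le> fst v \<and> fst v < n + length X \<and> X ! (fst v - n) = snd v"
proof
  assume "v \<in> set (ctx n X)"
  then obtain i where "i < length X" "v = ctx n X ! i" by (auto simp: in_set_conv_nth)
  then show "n \<le> fst v \<and> fst v < n + length X \<and> X ! (fst v - n) = snd v" by simp
next
  assume v: "n \<le> fst v \<and> fst v < n + length X \<and> X ! (fst v - n) = snd v"
  then have "v = ctx n X ! (fst v - n)" "fst v - n < length X" by (auto simp: prod_eq_iff)
  then show "v \<in> set (ctx n X)" by (metis length_ctx nth_mem)
qed

lemma ctx_append: "ctx n (X @ Y) = ctx n X @ ctx (n + length X) Y"
  by (auto intro!: nth_equalityI simp: nth_append)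

definition appst :: "tm \<Rightarrow> tm list \<Rightarrow> tm" where
  "appst = foldl App"

lemma appst_simps [simp]: "appst t [] = t" "appst t (u # us) = appst (t \<cdot> u) us"
  by (auto simp: appst_def)

lemma wt_appst: "wt t \<Longrightarrow> ty_of t = arrs (map ty_of us) \<tau> \<Longrightarrow> \<forall>u \<in> set us. wt u \<Longrightarrow>
    wt (appst t us) \<and> ty_of (appst t us) = \<tau>"
  by (induction us arbitrary: t) auto

text \<open>Standardness has no counterpart in the model: external formulas are never evaluated,
  only their realizers are studied.\<close>

locale epa_model = tstruct D app cst
  for D :: "ty \<Rightarrow> 'a set" and app (infixl "\<bullet>" 90) and cst +
  assumes epa: "A \<in> EPA_axioms \<Longrightarrow> A \<in> Lint \<Longrightarrow> env e \<Longrightarrow> sat e A"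
begin

definition cv :: "tm \<Rightarrow> 'a" where
  "cv t = val (\<lambda>_. undefined) t"

lemma val_closed: "fvt t = {} \<Longrightarrow> val e t = cv t"
  unfolding cv_def by (rule val_cong) simp

lemma cv_D [simp]: "fvt t = {} \<Longrightarrow> wt t \<Longrightarrow> \<sigma> = ty_of t \<Longrightarrow> cv t \<in> D \<sigma>"
proof -
  have "fvt t = {} \<Longrightarrow> wt t \<Longrightarrow> cv t \<in> D (ty_of t)"
    by (induction t) (auto simp: cv_def split: ty.splits)
  then show "fvt t = {} \<Longrightarrow> wt t \<Longrightarrow> \<sigma> = ty_of t \<Longrightarrow> cv t \<in> D \<sigma>" by simp
qed

text \<open>The zero functionals show that no domain is empty, so some environment exists.\<close>

definition env0 :: "var \<Rightarrow> 'a" where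
  "env0 x = cv (zero_c (snd x))"

lemma env_env0 [simp]: "env env0"
  by (auto simp: env_def env0_def)

text \<open>The axiom is instantiated with variables only; the environment then puts arbitrary
  elements in their place, so the equation holds for all elements and not just for values of closed
  terms.\<close>

lemma K_eq [simp]: "a \<in> D \<sigma> \<Longrightarrow> b \<in> D \<tau> \<Longrightarrow> cst (Kc \<sigma> \<tau>) \<bullet> a \<bullet> b = a"
  using epa[OF EPA_axioms.K[of \<sigma> \<tau> "V (0, \<sigma>)" "V (1, \<tau>)"],
    of "env0((0, \<sigma>) := a, (1, \<tau>) := b)"] by simp

lemma S_eq [simp]:
  assumes "a \<in> D (\<rho> \<rightarrowtail> \<sigma> \<rightarrowtail> \<tau>)" "b \<in> D (\<rho> \<rightarrowtail> \<sigma>)" "c \<in> D \<rho>"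
  shows "cst (Sc \<rho> \<sigma> \<tau>) \<bullet> a \<bullet> b \<bullet> c = a \<bullet> c \<bullet> (b \<bullet> c)"
  using epa[OF EPA_axioms.S[of \<rho> \<sigma> \<tau> "V (0, \<rho> \<rightarrowtail> \<sigma> \<rightarrowtail> \<tau>)" "V (1, \<rho> \<rightarrowtail> \<sigma>)" "V (2, \<rho>)"],
    of "env0((0, \<rho> \<rightarrowtail> \<sigma> \<rightarrowtail> \<tau>) := a, (1, \<rho> \<rightarrowtail> \<sigma>) := b, (2, \<rho>) := c)"] assms by simp

abbreviation zr :: 'a where "zr \<equiv> cst Zero"
abbreviation sc :: "'a \<Rightarrow> 'a" where "sc n \<equiv> cst Succ \<bullet> n"

lemma R0_eq [simp]:
  assumes "a \<in> D \<sigma>" "b \<in> D (\<sigma> \<rightarrowtail> TNat \<rightarrowtail> \<sigma>)"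
  shows "cst (Rec \<sigma>) \<bullet> a \<bullet> b \<bullet> zr = a"
  using epa[OF EPA_axioms.R0[of \<sigma> "V (0, \<sigma>)" "V (1, \<sigma> \<rightarrowtail> TNat \<rightarrowtail> \<sigma>)"],
    of "env0((0, \<sigma>) := a, (1, \<sigma> \<rightarrowtail> TNat \<rightarrowtail> \<sigma>) := b)"] assms by simp

lemma RS_eq [simp]:
  assumes "a \<in> D \<sigma>" "b \<in> D (\<sigma> \<rightarrowtail> TNat \<rightarrowtail> \<sigma>)" "n \<in> D TNat"
  shows "cst (Rec \<sigma>) \<bullet> a \<bullet> b \<bullet> (sc n) = b \<bullet> (cst (Rec \<sigma>) \<bullet> a \<bullet> b \<bullet> n) \<bullet> n"
  using epa[OF EPA_axioms.RS[of \<sigma> "V (0, \<sigma>)" "V (1, \<sigma> \<rightarrowtail> TNat \<rightarrowtail> \<sigma>)" "V (2, TNat)"],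
    of "env0((0, \<sigma>) := a, (1, \<sigma> \<rightarrowtail> TNat \<rightarrowtail> \<sigma>) := b, (2, TNat) := n)"] assms by simp

lemma app_ext:
  assumes "f \<in> D (\<sigma> \<rightarrowtail> \<tau>)" "g \<in> D (\<sigma> \<rightarrowtail> \<tau>)" "\<And>a. a \<in> D \<sigma> \<Longrightarrow> f \<bullet> a = g \<bullet> a"
  shows "f = g"
  using epa[OF EPA_axioms.ext[of "(2, \<sigma>)" "V (0, \<sigma> \<rightarrowtail> \<tau>)" "V (1, \<sigma> \<rightarrowtail> \<tau>)"],
    of "env0((0, \<sigma> \<rightarrowtail> \<tau>) := f, (1, \<sigma> \<rightarrowtail> \<tau>) := g)"] assms by simp

lemma sc_D [simp]: "n \<in> D TNat \<Longrightarrow> sc n \<in> D TNat"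
  by (rule app_D[OF cst_Succ])

lemma sc_ne [simp]: "n \<in> D TNat \<Longrightarrow> sc n \<noteq> zr" "n \<in> D TNat \<Longrightarrow> zr \<noteq> sc n"
  using epa[OF EPA_axioms.succ_zero[of "V (0, TNat)"], of "env0((0, TNat) := n)"] by force+

lemma sc_inj [simp]: "m \<in> D TNat \<Longrightarrow> n \<in> D TNat \<Longrightarrow> sc m = sc n \<longleftrightarrow> m = n"
  using epa[OF EPA_axioms.succ_inj[of "V (0, TNat)" "V (1, TNat)"],
    of "env0((0, TNat) := m, (1, TNat) := n)"] by auto

text \<open>Combinatory completeness as seen in the model. It frees all later constructions from the
  expansion into combinators.\<close>

lemma val_lam [simp]:
  "env e \<Longrightarrow> wt t \<Longrightarrow> d \<in> D (snd x) \<Longrightarrow> val e (lam x t) \<bullet> d = val (e(x := d)) t"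
proof (induction t)
  case (App s t)
  then obtain \<sigma> \<tau> where "ty_of s = \<sigma> \<rightarrowtail> \<tau>" "ty_of t = \<sigma>" by (auto split: ty.splits)
  then show ?case
    using App val_D[of e "lam x s"] val_D[of e "lam x t"] by simp
next
  case (V y)
  then have "e y \<in> D (snd y)" unfolding env_def by blast
  with V show ?case using app_D[OF cst_K V(3)] by auto
qed simp_all

definition apps :: "'a \<Rightarrow> 'a list \<Rightarrow> 'a" where
  "apps = foldl app"

lemma apps_simps [simp]: "apps f [] = f" "apps f (x # xs) = apps (f \<bullet> x) xs"
  "apps f (xs @ ys) = apps (apps f xs) ys"
  by (auto simp: apps_def)

definition Ds :: "ty list \<Rightarrow> 'a list set" where
  "Ds X = {x. list_all2 (\<lambda>a \<sigma>. a \<in> D \<sigma>) x X}"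

lemma Ds_Nil [simp]: "x \<in> Ds [] \<longleftrightarrow> x = []"
  and Ds_Cons: "x \<in> Ds (\<sigma> # X) \<longleftrightarrow> (\<exists>a y. x = a # y \<and> a \<in> D \<sigma> \<and> y \<in> Ds X)"
  and Ds_Cons_Cons [simp]: "a # y \<in> Ds (\<sigma> # X) \<longleftrightarrow> a \<in> D \<sigma> \<and> y \<in> Ds X"
  and Nil_Ds [simp]: "[] \<in> Ds X \<longleftrightarrow> X = []"
  by (auto simp: Ds_def list_all2_Cons2)

lemma Ds_length: "x \<in> Ds X \<Longrightarrow> length x = length X"
  by (auto simp: Ds_def list_all2_lengthD)

lemma Ds_nth: "x \<in> Ds X \<Longrightarrow> i < length X \<Longrightarrow> x ! i \<in> D (X ! i)"
  by (auto simp: Ds_def list_all2_conv_all_nth)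

lemma DsI: "length x = length X \<Longrightarrow> (\<And>i. i < length X \<Longrightarrow> x ! i \<in> D (X ! i)) \<Longrightarrow> x \<in> Ds X"
  by (auto simp: Ds_def list_all2_conv_all_nth)

lemma Ds_append [simp]: "x \<in> Ds X \<Longrightarrow> y \<in> Ds Y \<Longrightarrow> x @ y \<in> Ds (X @ Y)"
  by (auto simp: Ds_def list_all2_appendI)

lemma Ds_appendE: "z \<in> Ds (X @ Y) \<Longrightarrow> (\<And>x y. z = x @ y \<Longrightarrow> x \<in> Ds X \<Longrightarrow> y \<in> Ds Y \<Longrightarrow> P) \<Longrightarrow> P"
  by (auto simp: Ds_def list_all2_append2)

lemma Ds_take [simp]: "z \<in> Ds (X @ Y) \<Longrightarrow> take (length X) z \<in> Ds X"
  and Ds_drop [simp]: "z \<in> Ds (X @ Y) \<Longrightarrow> drop (length X) z \<in> Ds Y"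
  by (auto elim!: Ds_appendE simp: Ds_length)

definition zeros :: "ty list \<Rightarrow> 'a list" where
  "zeros X = map (\<lambda>\<sigma>. cv (zero_c \<sigma>)) X"

lemma zeros_Ds [simp]: "zeros X \<in> Ds X"
  by (auto simp: zeros_def intro!: DsI)

lemma apps_D [simp]: "f \<in> D (arrs X \<tau>) \<Longrightarrow> x \<in> Ds X \<Longrightarrow> apps f x \<in> D \<tau>"
  by (induction X arbitrary: f x) (auto simp: Ds_Cons)

lemma env_upds [simp]: "env e \<Longrightarrow> x \<in> Ds (tys vs) \<Longrightarrow> env (upds e vs x)"
  by (induction vs arbitrary: e x) (auto simp: Ds_Cons)

lemma val_lams: "env e \<Longrightarrow> wt t \<Longrightarrow> x \<in> Ds (tys vs) \<Longrightarrow>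
    apps (val e (foldr lam vs t)) x = val (upds e vs x) t"
proof (induction vs arbitrary: e x)
  case (Cons v vs)
  have "wt (foldr lam vs t)" using \<open>wt t\<close> by (induction vs) auto
  moreover obtain a y where x: "x = a # y" "a \<in> D (snd v)" "y \<in> Ds (tys vs)"
    using Cons.prems(3) by (auto simp: Ds_Cons)
  moreover have "apps (val (e(v := a)) (foldr lam vs t)) y = val (upds (e(v := a)) vs y) t"
    by (rule Cons.IH[OF env_upd[OF Cons.prems(1) x(2)] Cons.prems(2) x(3)])
  ultimately show ?case using Cons.prems by simp
qed simp

lemma lams_props: "wt t \<Longrightarrow> wt (foldr lam vs t) \<and> ty_of (foldr lam vs t) = arrs (tys vs) (ty_of t)"
  by (induction vs) auto

lemma val_appst [simp]: "val e (appst t us) = apps (val e t) (map (val e) us)"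
  by (induction us arbitrary: t) auto

text \<open>A semantic lambda calculus: \<open>f\<close> is an arbitrary HOL function that some
  element of the model represents on \<open>Ds X\<close>. Closure lemmas for \<open>mfun\<close>
  replace the writing of terms with parameters.\<close>

definition mfun :: "ty list \<Rightarrow> ty \<Rightarrow> ('a list \<Rightarrow> 'a) \<Rightarrow> bool" where
  "mfun X \<tau> f \<longleftrightarrow> (\<exists>g \<in> D (arrs X \<tau>). \<forall>x \<in> Ds X. f x = apps g x)"

text \<open>The base of the closure properties: a term with parameters from \<open>e\<close>,
  abstracted over \<open>vs\<close>, evaluates to the representing element.\<close>

lemma mfun_term:
  assumes "env e" "wt t" "ty_of t = \<tau>" "tys vs = X" "\<And>x. x \<in> Ds X \<Longrightarrow> f x = val (upds e vs x) t"
  shows "mfun X \<tau> f"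
  unfolding mfun_def
  using assms val_lams[of e t _ vs] lams_props[of t vs] val_D[of e "foldr lam vs t"]
  by (intro bexI[of _ "val e (foldr lam vs t)"]) auto

lemma mfun_D: "mfun X \<tau> f \<Longrightarrow> x \<in> Ds X \<Longrightarrow> f x \<in> D \<tau>"
  by (auto simp: mfun_def)

lemma mfun_cong: "mfun X \<tau> f \<Longrightarrow> (\<And>x. x \<in> Ds X \<Longrightarrow> g x = f x) \<Longrightarrow> mfun X \<tau> g"
  by (auto simp: mfun_def)

lemma mfun_const: "c \<in> D \<tau> \<Longrightarrow> mfun X \<tau> (\<lambda>x. c)"
proof (rule mfun_term)
  let ?v = "(length X, \<tau>)"
  show "env (env0(?v := c))" if "c \<in> D \<tau>" using that by simp
  show "c = val (upds (env0(?v := c)) (ctx 0 X) x) (V ?v)" if "x \<in> Ds X" for x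
    by (simp add: in_ctx)
qed auto

lemma mfun_nth: "i < length X \<Longrightarrow> \<tau> = X ! i \<Longrightarrow> mfun X \<tau> (\<lambda>x. x ! i)"
proof (rule mfun_term)
  assume i: "i < length X"
  show "x ! i = val (upds env0 (ctx 0 X) x) (V (ctx 0 X ! i))" if "x \<in> Ds X" for x
    unfolding val.simps using i Ds_length[OF that] by (subst upds_nth) auto
qed auto

lemma mfun_app:
  assumes "mfun X (\<sigma> \<rightarrowtail> \<tau>) f" "mfun X \<sigma> g"
  shows "mfun X \<tau> (\<lambda>x. f x \<bullet> g x)"
proof -
  obtain F G where F: "F \<in> D (arrs X (\<sigma> \<rightarrowtail> \<tau>))" "\<And>x. x \<in> Ds X \<Longrightarrow> f x = apps F x"
    and G: "G \<in> D (arrs X \<sigma>)" "\<And>x. x \<in> Ds X \<Longrightarrow> g x = apps G x"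
    using assms by (auto simp: mfun_def)
  let ?u = "(0, arrs X (\<sigma> \<rightarrowtail> \<tau>))" and ?v = "(1, arrs X \<sigma>)" and ?vs = "ctx 2 X"
  let ?e = "env0(?u := F, ?v := G)"
  have 1: "wt (appst (V ?u) (map V ?vs)) \<and> ty_of (appst (V ?u) (map V ?vs)) = \<sigma> \<rightarrowtail> \<tau>"
    "wt (appst (V ?v) (map V ?vs)) \<and> ty_of (appst (V ?v) (map V ?vs)) = \<sigma>"
    by (rule wt_appst; auto simp: o_def)+
  show ?thesis
  proof (rule mfun_term)
    show "f x \<bullet> g x = val (upds ?e ?vs x) (appst (V ?u) (map V ?vs) \<cdot> appst (V ?v) (map V ?vs))"
      if "x \<in> Ds X" for x
      using F(2) G(2) that Ds_length[OF that] by (simp add: o_def in_ctx map_upds)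
  qed (use 1 F(1) G(1) in auto)
qed

text \<open>The types \<open>arrs (X @ [\<sigma>]) \<tau>\<close> and
  \<open>arrs X (\<sigma> \<rightarrowtail> \<tau>)\<close> coincide, so the same representing
  element does for both.\<close>

lemma mfun_lam:
  assumes "mfun (X @ [\<sigma>]) \<tau> f"
  obtains F where "mfun X (\<sigma> \<rightarrowtail> \<tau>) F" "\<And>x d. x \<in> Ds X \<Longrightarrow> d \<in> D \<sigma> \<Longrightarrow> F x \<bullet> d = f (x @ [d])"
proof -
  obtain g where "g \<in> D (arrs X (\<sigma> \<rightarrowtail> \<tau>))" "\<And>x. x \<in> Ds (X @ [\<sigma>]) \<Longrightarrow> f x = apps g x"
    using assms by (auto simp: mfun_def)
  then show ?thesis using that[of "apps g"] by (auto simp: mfun_def)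
qed

lemma mfun_apps:
  assumes "mfun X (arrs Y \<tau>) f" "length gs = length Y"
    "\<And>i. i < length Y \<Longrightarrow> mfun X (Y ! i) (gs ! i)"
  shows "mfun X \<tau> (\<lambda>x. apps (f x) (map (\<lambda>g. g x) gs))"
  using assms
proof (induction Y arbitrary: f gs)
  case (Cons \<sigma> Y)
  then obtain g hs where gs: "gs = g # hs" by (cases gs) auto
  have "mfun X (arrs Y \<tau>) (\<lambda>x. f x \<bullet> g x)"
    using Cons.prems(1) Cons.prems(3)[of 0] gs by (intro mfun_app) auto
  moreover have "mfun X (Y ! i) (hs ! i)" if "i < length Y" for i
    using Cons.prems(3)[of "Suc i"] gs that by simp
  ultimately show ?case using Cons.IH[of "\<lambda>x. f x \<bullet> g x" hs] Cons.prems(2) gs by simp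
qed simp

text \<open>Context variables are overwritten by position and everything else keeps its parameter
  value, also variables with the same number but another type. This explicit form makes the shift of
  parameters in \<open>dfn_conj\<close> a pointwise computation.\<close>

definition cenv :: "ty list \<Rightarrow> (var \<Rightarrow> 'a) \<Rightarrow> 'a list \<Rightarrow> var \<Rightarrow> 'a" where
  "cenv X e x v = (if v \<in> set (ctx 0 X) then x ! fst v else e v)"

lemma cenv_upds: "x \<in> Ds X \<Longrightarrow> cenv X e x = upds e (ctx 0 X) x"
proof
  fix v assume x: "x \<in> Ds X"
  show "cenv X e x v = upds e (ctx 0 X) x v"
  proof (cases "v \<in> set (ctx 0 X)")
    case True
    then have "v = ctx 0 X ! fst v" "fst v < length X" by (auto simp: in_ctx prod_eq_iff)
    then have "upds e (ctx 0 X) x v = x ! fst v"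
      using upds_nth[of "ctx 0 X" x "fst v" e] Ds_length[OF x] by simp
    then show ?thesis using True by (simp add: cenv_def)
  qed (simp add: cenv_def)
qed

text \<open>Definability with parameters; the parameters are the values of \<open>e\<close>.\<close>
definition dfn :: "ty list \<Rightarrow> ('a list \<Rightarrow> bool) \<Rightarrow> bool" where
  "dfn X P \<longleftrightarrow> (\<exists>A e. A \<in> Lint \<and> env e \<and> (\<forall>x \<in> Ds X. P x \<longleftrightarrow> sat (cenv X e x) A))"

lemma dfn_cong: "dfn X P \<Longrightarrow> (\<And>x. x \<in> Ds X \<Longrightarrow> Q x = P x) \<Longrightarrow> dfn X Q"
  by (auto simp: dfn_def)

lemma dfn_eq:
  assumes "mfun X \<tau> f" "mfun X \<tau> g"
  shows "dfn X (\<lambda>x. f x = g x)"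
proof -
  obtain F G where F: "F \<in> D (arrs X \<tau>)" "\<And>x. x \<in> Ds X \<Longrightarrow> f x = apps F x"
    and G: "G \<in> D (arrs X \<tau>)" "\<And>x. x \<in> Ds X \<Longrightarrow> g x = apps G x"
    using assms by (auto simp: mfun_def)
  let ?n = "length X"
  \<comment> \<open>The representing elements become parameters; numbers from
    \<open>length X\<close> on cannot clash with the context.\<close>
  let ?u = "(?n, arrs X \<tau>)" and ?v = "(Suc ?n, arrs X \<tau>)" and ?vs = "ctx 0 X"
  let ?e = "env0(?u := F, ?v := G)"
  have 1: "wt (appst (V ?u) (map V ?vs)) \<and> ty_of (appst (V ?u) (map V ?vs)) = \<tau>"
    "wt (appst (V ?v) (map V ?vs)) \<and> ty_of (appst (V ?v) (map V ?vs)) = \<tau>"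
    by (rule wt_appst; auto simp: o_def)+
  let ?A = "Eq (appst (V ?u) (map V ?vs)) (appst (V ?v) (map V ?vs))"
  have "f x = g x \<longleftrightarrow> sat (cenv X ?e x) ?A" if "x \<in> Ds X" for x
    unfolding F(2)[OF that] G(2)[OF that] cenv_upds[OF that]
    using Ds_length[OF that] by (simp add: o_def in_ctx map_upds)
  moreover have "?A \<in> Lint" using 1 by simp
  moreover have "env ?e" using F(1) G(1) by simp
  ultimately show ?thesis unfolding dfn_def by blast
qed

lemma dfn_not: "dfn X P \<Longrightarrow> dfn X (\<lambda>x. \<not> P x)"
proof -
  assume "dfn X P"
  then obtain A e where "A \<in> Lint" "env e" "\<forall>x \<in> Ds X. P x \<longleftrightarrow> sat (cenv X e x) A"
    by (auto simp: dfn_def)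
  then show ?thesis unfolding dfn_def by (intro exI[of _ "Neg A"] exI[of _ e]) simp
qed

text \<open>The parameters of the two formulas are moved to variables with numbers of different parity.\<close>
lemma dfn_conj:
  assumes "dfn X P" "dfn X Q"
  shows "dfn X (\<lambda>x. P x \<and> Q x)"
proof -
  obtain A d B e where A: "A \<in> Lint" "env d" "\<And>x. x \<in> Ds X \<Longrightarrow> P x \<longleftrightarrow> sat (cenv X d x) A"
    and B: "B \<in> Lint" "env e" "\<And>x. x \<in> Ds X \<Longrightarrow> Q x \<longleftrightarrow> sat (cenv X e x) B"
    using assms unfolding dfn_def by blast
  let ?n = "length X"
  define s where "s k v = V (if v \<in> set (ctx 0 X) then v else (?n + 2 * fst v + k, snd v))"
    for k and v :: var
  define c where "c v = (let m = fst v - ?n in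
    if even m then d (m div 2, snd v) else e (m div 2, snd v))" for v :: var
  have c: "env c" using A(2) B(2) by (auto simp: env_def c_def Let_def)
  have 1: "(\<lambda>v. val (cenv X c x) (s 0 v)) = cenv X d x" for x
    by (auto simp: fun_eq_iff s_def cenv_def c_def in_ctx)
  have 2: "(\<lambda>v. val (cenv X c x) (s 1 v)) = cenv X e x" for x
    by (auto simp: fun_eq_iff s_def cenv_def c_def in_ctx)
  have s: "wsubst (s k)" for k by (auto simp: wsubst_def s_def)
  let ?A = "Conj (subst (s 0) A) (subst (s 1) B)"
  have "P x \<and> Q x \<longleftrightarrow> sat (cenv X c x) ?A" if "x \<in> Ds X" for x
    using A(3) B(3) that by (simp add: sat_subst 1 2 del: One_nat_def)
  then show ?thesis
    unfolding dfn_def using A(1) B(1) c s by (intro exI[of _ ?A] exI[of _ c]) auto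
qed

lemma dfn_disj: "dfn X P \<Longrightarrow> dfn X Q \<Longrightarrow> dfn X (\<lambda>x. P x \<or> Q x)"
  using dfn_not[OF dfn_conj[OF dfn_not dfn_not, of X P Q]] by simp

lemma dfn_imp: "dfn X P \<Longrightarrow> dfn X Q \<Longrightarrow> dfn X (\<lambda>x. P x \<longrightarrow> Q x)"
  using dfn_disj[OF dfn_not, of X P Q] by simp

text \<open>The variable numbered \<open>length X\<close> is the last context slot, so quantifying
  over it shortens the context by one.\<close>

lemma dfn_all: "dfn (X @ [\<sigma>]) P \<Longrightarrow> dfn X (\<lambda>x. \<forall>d \<in> D \<sigma>. P (x @ [d]))"
proof -
  assume "dfn (X @ [\<sigma>]) P"
  then obtain A e where A: "A \<in> Lint" "env e"
    "\<forall>x \<in> Ds (X @ [\<sigma>]). P x \<longleftrightarrow> sat (cenv (X @ [\<sigma>]) e x) A"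
    by (auto simp: dfn_def)
  have "cenv (X @ [\<sigma>]) e (x @ [d]) = (cenv X e x)((length X, \<sigma>) := d)"
    if "x \<in> Ds X" "d \<in> D \<sigma>" for x d
    using that Ds_length[OF that(1)] by (simp add: cenv_upds ctx_append upds_append) (simp add: ctx_def)
  then show ?thesis using A unfolding dfn_def
    by (intro exI[of _ "Forall (length X, \<sigma>) A"] exI[of _ e]) auto
qed

lemma dfn_ex: "dfn (X @ [\<sigma>]) P \<Longrightarrow> dfn X (\<lambda>x. \<exists>d \<in> D \<sigma>. P (x @ [d]))"
  using dfn_not[OF dfn_all[OF dfn_not, of X \<sigma> P]] by simp

text \<open>\<open>D TNat\<close> may contain nonstandard numbers, so induction is available for
  definable predicates. Hence the \<open>dfn\<close> obligation in each induction below, with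
  elements of the model as parameters.\<close>

lemma nat_induct:
  assumes "dfn [TNat] (\<lambda>x. P (x ! 0))" "P zr" "\<And>n. n \<in> D TNat \<Longrightarrow> P n \<Longrightarrow> P (sc n)" "n \<in> D TNat"
  shows "P n"
proof -
  obtain A e where A: "A \<in> Lint" "env e"
    "\<And>x. x \<in> Ds [TNat] \<Longrightarrow> P (x ! 0) \<longleftrightarrow> sat (cenv [TNat] e x) A"
    using assms(1) unfolding dfn_def by blast
  have P: "P n \<longleftrightarrow> sat (e((0, TNat) := n)) A" if "n \<in> D TNat" for n
    using A(3)[of "[n]"] that by (simp add: cenv_upds) (simp add: ctx_def)
  have "sat e (Imp (Conj (subst1 A (0, TNat) Zero)
      (Forall (0, TNat) (Imp A (subst1 A (0, TNat) (Succ \<cdot> V (0, TNat)))))) (Forall (0, TNat) A))"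
    by (rule epa[OF EPA_axioms.ind]) (use A in auto)
  then have "\<forall>n \<in> D TNat. sat (e((0, TNat) := n)) A"
    using assms(2,3) by (auto simp: sat_subst1 P[symmetric])
  then show ?thesis using P assms(4) by simp
qed

end

section \<open>Arithmetic in a model\<close>

declare lam.simps [simp del]

lemma pred_c_props [simp]: "wt pred_c" "ty_of pred_c = TNat \<rightarrowtail> TNat" "fvt pred_c = {}"
  by (simp_all add: pred_c_def)

lemma plus_c_props [simp]:
  "wt plus_c" "ty_of plus_c = TNat \<rightarrowtail> TNat \<rightarrowtail> TNat" "fvt plus_c = {}"
  by (auto simp: plus_c_def)

lemma monus_c_props [simp]:
  "wt monus_c" "ty_of monus_c = TNat \<rightarrowtail> TNat \<rightarrowtail> TNat" "fvt monus_c = {}"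
  by (auto simp: monus_c_def)

lemma cond_c_props [simp]:
  "wt (cond_c \<sigma>)" "ty_of (cond_c \<sigma>) = TNat \<rightarrowtail> \<sigma> \<rightarrowtail> \<sigma> \<rightarrowtail> \<sigma>" "fvt (cond_c \<sigma>) = {}"
  by (auto simp: cond_c_def)

lemma tri_c_props [simp]: "wt tri_c" "ty_of tri_c = TNat \<rightarrowtail> TNat" "fvt tri_c = {}"
  by (auto simp: tri_c_def)

lemma pair_c_props [simp]:
  "wt pair_c" "ty_of pair_c = TNat \<rightarrowtail> TNat \<rightarrowtail> TNat" "fvt pair_c = {}"
  by (auto simp: pair_c_def)

lemma diag_c_props [simp]: "wt diag_c" "ty_of diag_c = TNat \<rightarrowtail> TNat" "fvt diag_c = {}"
  by (auto simp: diag_c_def)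

lemma fst_c_props [simp]: "wt fst_c" "ty_of fst_c = TNat \<rightarrowtail> TNat" "fvt fst_c = {}"
  by (auto simp: fst_c_def)

lemma snd_c_props [simp]: "wt snd_c" "ty_of snd_c = TNat \<rightarrowtail> TNat" "fvt snd_c = {}"
  by (auto simp: snd_c_def)

lemma drop0_c_props [simp]:
  "wt drop0_c" "ty_of drop0_c = TNat \<rightarrowtail> TNat \<rightarrowtail> TNat" "fvt drop0_c = {}"
  by (auto simp: drop0_c_def)

lemma len0_c_props [simp]: "wt len0_c" "ty_of len0_c = TNat \<rightarrowtail> TNat" "fvt len0_c = {}"
  by (auto simp: len0_c_def)

lemma comp0_c_props [simp]:
  "wt comp0_c" "ty_of comp0_c = TNat \<rightarrowtail> TNat \<rightarrowtail> TNat" "fvt comp0_c = {}"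
  by (auto simp: comp0_c_def)

lemma mk0_c_props [simp]:
  "wt mk0_c" "ty_of mk0_c = TNat \<rightarrowtail> (TNat \<rightarrowtail> TNat) \<rightarrowtail> TNat" "fvt mk0_c = {}"
  by (auto simp: mk0_c_def)

lemma len_c_props [simp]: "wt (len_c \<sigma>)" "ty_of (len_c \<sigma>) = \<sigma> \<rightarrowtail> TNat" "fvt (len_c \<sigma>) = {}"
proof -
  have "wt (len_c \<sigma>) \<and> ty_of (len_c \<sigma>) = \<sigma> \<rightarrowtail> TNat \<and> fvt (len_c \<sigma>) = {}"
    by (induction \<sigma>) auto
  then show "wt (len_c \<sigma>)" "ty_of (len_c \<sigma>) = \<sigma> \<rightarrowtail> TNat" "fvt (len_c \<sigma>) = {}" by auto
qed

lemma comp_c_props [simp]: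
  "wt (comp_c \<sigma>)" "ty_of (comp_c \<sigma>) = \<sigma> \<rightarrowtail> TNat \<rightarrowtail> \<sigma>" "fvt (comp_c \<sigma>) = {}"
proof -
  have "wt (comp_c \<sigma>) \<and> ty_of (comp_c \<sigma>) = \<sigma> \<rightarrowtail> TNat \<rightarrowtail> \<sigma> \<and> fvt (comp_c \<sigma>) = {}"
    by (induction \<sigma>) auto
  then show "wt (comp_c \<sigma>)" "ty_of (comp_c \<sigma>) = \<sigma> \<rightarrowtail> TNat \<rightarrowtail> \<sigma>" "fvt (comp_c \<sigma>) = {}"
    by auto
qed

lemma mk_c_props [simp]:
  "wt (mk_c \<sigma>)" "ty_of (mk_c \<sigma>) = TNat \<rightarrowtail> (TNat \<rightarrowtail> \<sigma>) \<rightarrowtail> \<sigma>" "fvt (mk_c \<sigma>) = {}"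
proof -
  have "wt (mk_c \<sigma>) \<and> ty_of (mk_c \<sigma>) = TNat \<rightarrowtail> (TNat \<rightarrowtail> \<sigma>) \<rightarrowtail> \<sigma> \<and> fvt (mk_c \<sigma>) = {}"
    by (induction \<sigma>) auto
  then show "wt (mk_c \<sigma>)" "ty_of (mk_c \<sigma>) = TNat \<rightarrowtail> (TNat \<rightarrowtail> \<sigma>) \<rightarrowtail> \<sigma>"
    "fvt (mk_c \<sigma>) = {}" by auto
qed

declare zero_c.simps [simp del] len_c.simps [simp del] comp_c.simps [simp del] mk_c.simps [simp del]

lemma cat_c_props [simp]:
  "wt (cat_c \<sigma>)" "ty_of (cat_c \<sigma>) = \<sigma> \<rightarrowtail> \<sigma> \<rightarrowtail> \<sigma>" "fvt (cat_c \<sigma>) = {}"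
  by (auto simp: cat_c_def)

lemma bracket_c_props [simp]: "wt (bracket_c \<sigma> \<tau>)"
  "ty_of (bracket_c \<sigma> \<tau>) = (\<sigma> \<rightarrowtail> \<tau>) \<rightarrowtail> \<sigma> \<rightarrowtail> \<tau>" "fvt (bracket_c \<sigma> \<tau>) = {}"
  by (auto simp: bracket_c_def)

context epa_model
begin

abbreviation N :: "'a set" where "N \<equiv> D TNat"

lemma val_consts [simp]:
  "val e (zero_c \<sigma>) = cv (zero_c \<sigma>)" "val e pred_c = cv pred_c" "val e plus_c = cv plus_c"
  "val e monus_c = cv monus_c" "val e (cond_c \<sigma>) = cv (cond_c \<sigma>)" "val e tri_c = cv tri_c"
  "val e pair_c = cv pair_c" "val e diag_c = cv diag_c" "val e fst_c = cv fst_c"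
  "val e snd_c = cv snd_c" "val e drop0_c = cv drop0_c" "val e len0_c = cv len0_c"
  "val e comp0_c = cv comp0_c" "val e mk0_c = cv mk0_c" "val e (len_c \<sigma>) = cv (len_c \<sigma>)"
  "val e (comp_c \<sigma>) = cv (comp_c \<sigma>)" "val e (mk_c \<sigma>) = cv (mk_c \<sigma>)"
  "val e (cat_c \<sigma>) = cv (cat_c \<sigma>)" "val e (bracket_c \<sigma> \<tau>) = cv (bracket_c \<sigma> \<tau>)"
  by (simp_all add: val_closed)

lemma val_D' [simp]: "env e \<Longrightarrow> wt t \<Longrightarrow> ty_of t = \<tau> \<Longrightarrow> val e t \<in> D \<tau>"
  using val_D by blast

lemma Rec_D [simp]: "a \<in> D \<sigma> \<Longrightarrow> b \<in> D (\<sigma> \<rightarrowtail> TNat \<rightarrowtail> \<sigma>) \<Longrightarrow> n \<in> N \<Longrightarrow> cst (Rec \<sigma>) \<bullet> a \<bullet> b \<bullet> n \<in> D \<sigma>"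
  by (intro app_D[OF app_D[OF app_D[OF cst_R]]])

text \<open>Opens one closed constant and leaves the constants inside it folded, so that the
  resulting equations mention those by name.\<close>

lemma cv_unfold: "fvt t = {} \<Longrightarrow> t = u \<Longrightarrow> cv t = val env0 u"
  by (simp add: val_closed)

lemma val_upd_idle: "x \<notin> fvt t \<Longrightarrow> val (e(x := d)) t = val e t"
  by (rule val_cong) auto

abbreviation "pd n \<equiv> cv pred_c \<bullet> n"
abbreviation "pl m n \<equiv> cv plus_c \<bullet> m \<bullet> n"
abbreviation "mn m n \<equiv> cv monus_c \<bullet> m \<bullet> n"
abbreviation "cnd \<sigma> n a b \<equiv> cv (cond_c \<sigma>) \<bullet> n \<bullet> a \<bullet> b"
abbreviation "tri n \<equiv> cv tri_c \<bullet> n"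
abbreviation "pr m n \<equiv> cv pair_c \<bullet> m \<bullet> n"
abbreviation "dg n \<equiv> cv diag_c \<bullet> n"
abbreviation "p1 n \<equiv> cv fst_c \<bullet> n"
abbreviation "p2 n \<equiv> cv snd_c \<bullet> n"
abbreviation "drp s i \<equiv> cv drop0_c \<bullet> s \<bullet> i"

lemma unary_D: "c \<in> D (TNat \<rightarrowtail> TNat) \<Longrightarrow> a \<in> N \<Longrightarrow> c \<bullet> a \<in> N"
  by (rule app_D)

lemma binary_D: "c \<in> D (TNat \<rightarrowtail> TNat \<rightarrowtail> TNat) \<Longrightarrow> a \<in> N \<Longrightarrow> b \<in> N \<Longrightarrow> c \<bullet> a \<bullet> b \<in> N"
  by (rule app_D[OF app_D])

lemma arith_D [simp]:
  "m \<in> N \<Longrightarrow> pd m \<in> N" "m \<in> N \<Longrightarrow> n \<in> N \<Longrightarrow> pl m n \<in> N" "m \<in> N \<Longrightarrow> n \<in> N \<Longrightarrow> mn m n \<in> N"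
  "m \<in> N \<Longrightarrow> tri m \<in> N" "m \<in> N \<Longrightarrow> n \<in> N \<Longrightarrow> pr m n \<in> N" "m \<in> N \<Longrightarrow> dg m \<in> N"
  "m \<in> N \<Longrightarrow> p1 m \<in> N" "m \<in> N \<Longrightarrow> p2 m \<in> N" "m \<in> N \<Longrightarrow> n \<in> N \<Longrightarrow> drp m n \<in> N"
  by (rule unary_D binary_D; simp)+

lemma arith1_D [simp]: assumes "m \<in> N"
  shows "cv plus_c \<bullet> m \<in> D (TNat \<rightarrowtail> TNat)" "cv monus_c \<bullet> m \<in> D (TNat \<rightarrowtail> TNat)"
    "cv pair_c \<bullet> m \<in> D (TNat \<rightarrowtail> TNat)" "cv drop0_c \<bullet> m \<in> D (TNat \<rightarrowtail> TNat)"
  using assms by (auto intro!: app_D[where \<sigma> = TNat])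

lemma mfun_unary: "mfun X TNat f \<Longrightarrow> c \<in> D (TNat \<rightarrowtail> TNat) \<Longrightarrow> mfun X TNat (\<lambda>x. c \<bullet> f x)"
  by (intro mfun_app[of X TNat] mfun_const)

lemma mfun_binary: "mfun X TNat f \<Longrightarrow> mfun X TNat g \<Longrightarrow> c \<in> D (TNat \<rightarrowtail> TNat \<rightarrowtail> TNat) \<Longrightarrow>
    mfun X TNat (\<lambda>x. c \<bullet> f x \<bullet> g x)"
  by (intro mfun_app[of X TNat] mfun_const)

lemma mfun_nth0: "mfun [\<sigma>] \<sigma> (\<lambda>x. x ! 0)"
  by (rule mfun_nth) auto

lemmas dfn_intros = dfn_eq[where \<tau> = TNat] dfn_conj dfn_disj dfn_imp dfn_not
  mfun_nth0 mfun_const mfun_binary mfun_unary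

section \<open>Recursion equations of the arithmetic constants\<close>

lemma pd_simps [simp]: "pd zr = zr" "n \<in> N \<Longrightarrow> pd (sc n) = n"
  by (simp_all add: cv_unfold[OF pred_c_props(3) pred_c_def] val_upd_idle)

lemma pl_0 [simp]: "m \<in> N \<Longrightarrow> pl m zr = m"
  and pl_sc [simp]: "m \<in> N \<Longrightarrow> n \<in> N \<Longrightarrow> pl m (sc n) = sc (pl m n)"
  by (simp_all add: cv_unfold[OF plus_c_props(3) plus_c_def] val_upd_idle)

lemma mn_0 [simp]: "m \<in> N \<Longrightarrow> mn m zr = m"
  and mn_sc: "m \<in> N \<Longrightarrow> n \<in> N \<Longrightarrow> mn m (sc n) = pd (mn m n)"
  by (simp_all add: cv_unfold[OF monus_c_props(3) monus_c_def] val_upd_idle)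

lemma cnd_simps [simp]:
  "a \<in> D \<sigma> \<Longrightarrow> b \<in> D \<sigma> \<Longrightarrow> cnd \<sigma> zr a b = a"
  "a \<in> D \<sigma> \<Longrightarrow> b \<in> D \<sigma> \<Longrightarrow> n \<in> N \<Longrightarrow> cnd \<sigma> (sc n) a b = b"
  by (simp_all add: cv_unfold[OF cond_c_props(3) cond_c_def] val_upd_idle)

lemma tri_0 [simp]: "tri zr = zr"
  and tri_sc [simp]: "n \<in> N \<Longrightarrow> tri (sc n) = pl (tri n) (sc n)"
  by (simp_all add: cv_unfold[OF tri_c_props(3) tri_c_def] val_upd_idle del: pl_sc)

lemma pr_eq: "m \<in> N \<Longrightarrow> n \<in> N \<Longrightarrow> pr m n = pl (tri (pl m n)) m"
  by (simp add: cv_unfold[OF pair_c_props(3) pair_c_def] val_upd_idle)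

lemma dg_0 [simp]: "dg zr = zr"
  and dg_sc: "n \<in> N \<Longrightarrow> dg (sc n)
    = cnd TNat (mn (tri (sc (dg n))) (sc n)) (sc (dg n)) (dg n)"
  by (simp_all add: cv_unfold[OF diag_c_props(3) diag_c_def] val_upd_idle del: tri_sc)

lemma p1_eq: "n \<in> N \<Longrightarrow> p1 n = mn n (tri (dg n))"
  by (simp add: cv_unfold[OF fst_c_props(3) fst_c_def] val_upd_idle)

lemma p2_eq: "n \<in> N \<Longrightarrow> p2 n = mn (dg n) (p1 n)"
  by (simp add: cv_unfold[OF snd_c_props(3) snd_c_def] val_upd_idle)

lemma drp_0 [simp]: "s \<in> N \<Longrightarrow> drp s zr = s"
  and drp_sc: "s \<in> N \<Longrightarrow> i \<in> N \<Longrightarrow> drp s (sc i) = p2 (pd (drp s i))"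
  by (simp_all add: cv_unfold[OF drop0_c_props(3) drop0_c_def] val_upd_idle)

text \<open>The predecessor term in place of an existential quantifier turns the induction predicate
  into equations.\<close>

lemma nat_cases:
  assumes "n \<in> N"
  obtains "n = zr" | m where "m \<in> N" "n = sc m"
proof -
  have "n = zr \<or> n = sc (pd n)"
    by (rule nat_induct[where n = n]) (use assms in \<open>auto intro!: dfn_intros\<close>)
  then show ?thesis using that(1) that(2)[of "pd n"] assms by auto
qed

lemma pl_0_left [simp]: "n \<in> N \<Longrightarrow> pl zr n = n"
  by (rule nat_induct[where n = n]) (auto intro!: dfn_intros)

lemma pl_sc_left [simp]: "m \<in> N \<Longrightarrow> n \<in> N \<Longrightarrow> pl (sc m) n = sc (pl m n)"
  by (rule nat_induct[where n = n]) (auto intro!: dfn_intros)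

lemma pl_commute: "m \<in> N \<Longrightarrow> n \<in> N \<Longrightarrow> pl m n = pl n m"
  by (rule nat_induct[where n = n]) (auto intro!: dfn_intros)

lemma pl_assoc: "k \<in> N \<Longrightarrow> m \<in> N \<Longrightarrow> n \<in> N \<Longrightarrow> pl (pl k m) n = pl k (pl m n)"
  by (rule nat_induct[where n = n]) (auto intro!: dfn_intros)

lemma pl_left_commute: "k \<in> N \<Longrightarrow> m \<in> N \<Longrightarrow> n \<in> N \<Longrightarrow> pl m (pl k n) = pl k (pl m n)"
  by (metis pl_assoc pl_commute)

lemmas pl_ac = pl_assoc pl_commute pl_left_commute

lemma mn_sc_sc [simp]: "m \<in> N \<Longrightarrow> n \<in> N \<Longrightarrow> mn (sc m) (sc n) = mn m n"
  by (rule nat_induct[where n = n]) (auto intro!: dfn_intros simp: mn_sc)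

lemma mn_0_left [simp]: "n \<in> N \<Longrightarrow> mn zr n = zr"
  by (rule nat_induct[where n = n]) (auto intro!: dfn_intros simp: mn_sc)

lemma mn_pl [simp]: "m \<in> N \<Longrightarrow> n \<in> N \<Longrightarrow> mn (pl m n) m = n"
  by (rule nat_induct[where n = m]) (auto intro!: dfn_intros)

lemma mn_pl' [simp]: "m \<in> N \<Longrightarrow> n \<in> N \<Longrightarrow> mn (pl m n) n = m"
  by (simp add: pl_commute[of m n])

lemma mn_pl_0 [simp]: "m \<in> N \<Longrightarrow> n \<in> N \<Longrightarrow> mn m (pl m n) = zr"
  by (rule nat_induct[where n = m]) (auto intro!: dfn_intros)

lemma mn_pl_pl [simp]: "k \<in> N \<Longrightarrow> m \<in> N \<Longrightarrow> n \<in> N \<Longrightarrow> mn (pl k m) (pl k n) = mn m n"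
  by (rule nat_induct[where n = k]) (auto intro!: dfn_intros)

lemma mn_self [simp]: "m \<in> N \<Longrightarrow> mn m m = zr"
  using mn_pl_0[of m zr] by simp

lemma pl_cancel [simp]: "k \<in> N \<Longrightarrow> m \<in> N \<Longrightarrow> n \<in> N \<Longrightarrow> pl k m = pl k n \<longleftrightarrow> m = n"
  by (metis mn_pl)

text \<open>The difference is named by \<open>mn\<close> in both alternatives, so the dichotomy is
  definable by equations. When \<open>n\<close> grows by one, the first alternative persists and the
  second persists or, at difference zero, turns into the first.\<close>

lemma nat_compare:
  assumes "m \<in> N" "n \<in> N"
  obtains c where "c \<in> N" "n = pl m c" | c where "c \<in> N" "m = sc (pl n c)"
proof -
  have "pl m (mn n m) = n \<or> pl (sc n) (mn m (sc n)) = m"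
  proof (rule nat_induct[where n = n])
    show "pl m (mn zr m) = zr \<or> pl (sc zr) (mn m (sc zr)) = m"
      using assms(1) by (cases m rule: nat_cases) auto
  next
    fix n assume n: "n \<in> N" and "pl m (mn n m) = n \<or> pl (sc n) (mn m (sc n)) = m"
    then consider c where "c \<in> N" "n = pl m c" | c where "c \<in> N" "m = pl (sc n) c"
      using assms(1) by (metis arith_D(3) sc_D)
    then show "pl m (mn (sc n) m) = sc n \<or> pl (sc (sc n)) (mn m (sc (sc n))) = m"
    proof cases
      case 1
      then have "sc n = pl m (sc c)" using assms(1) by simp
      then show ?thesis using 1 assms(1) by (metis mn_pl sc_D)
    next
      case 2
      then show ?thesis
      proof (cases c rule: nat_cases)
        case (2 d)
        then have "m = pl (sc (sc n)) d" using \<open>m = pl (sc n) c\<close> n by simp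
        then show ?thesis using 2 n by (metis mn_pl sc_D)
      qed (use n in auto)
    qed
  qed (use assms in \<open>auto intro!: dfn_intros\<close>)
  then show ?thesis
    using that(1)[of "mn n m"] that(2)[of "mn m (sc n)"] assms by auto
qed

lemma mn_eq_0: "m \<in> N \<Longrightarrow> n \<in> N \<Longrightarrow> mn m n = zr \<longleftrightarrow> (\<exists>c \<in> N. n = pl m c)"
proof
  assume N: "m \<in> N" "n \<in> N" and "mn m n = zr"
  from N show "\<exists>c \<in> N. n = pl m c"
  proof (cases rule: nat_compare)
    case (2 c)
    then have "m = pl n (sc c)" using N by simp
    then have "mn m n = sc c" using 2 N by (metis mn_pl sc_D)
    then show ?thesis using 2 \<open>mn m n = zr\<close> by simp
  qed auto
qed auto

definition lt :: "'a \<Rightarrow> 'a \<Rightarrow> bool" where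
  "lt m n \<longleftrightarrow> mn (sc m) n = zr"

lemma lt_iff: "m \<in> N \<Longrightarrow> n \<in> N \<Longrightarrow> lt m n \<longleftrightarrow> (\<exists>c \<in> N. n = sc (pl m c))"
  by (auto simp: lt_def mn_eq_0)

lemma lt_0 [simp]: "m \<in> N \<Longrightarrow> \<not> lt m zr"
  by (simp add: lt_def)

lemma lt_sc: "m \<in> N \<Longrightarrow> n \<in> N \<Longrightarrow> lt m (sc n) \<longleftrightarrow> lt m n \<or> m = n"
proof
  assume N: "m \<in> N" "n \<in> N" and "lt m (sc n)"
  then obtain c where c: "c \<in> N" "n = pl m c" by (auto simp: lt_iff)
  show "lt m n \<or> m = n"
    using c(1) by (cases c rule: nat_cases) (use c N in \<open>auto simp: lt_iff\<close>)
next
  assume N: "m \<in> N" "n \<in> N" and "lt m n \<or> m = n"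
  then consider c where "c \<in> N" "n = pl m (sc c)" | "n = pl m zr" by (auto simp: lt_iff)
  then have "\<exists>c \<in> N. n = pl m c" by cases (use cst_Zero sc_D in blast)+
  then show "lt m (sc n)" using N by (auto simp: lt_iff)
qed

lemma dfn_lt: "mfun X TNat f \<Longrightarrow> mfun X TNat g \<Longrightarrow> dfn X (\<lambda>x. lt (f x) (g x))"
  unfolding lt_def by (intro dfn_intros) auto

section \<open>Cantor pairing\<close>

lemma tri_mono: "m \<in> N \<Longrightarrow> n \<in> N \<Longrightarrow> mn (tri m) (tri (pl m n)) = zr"
proof (rule nat_induct[where n = n])
  fix n assume N: "m \<in> N" "n \<in> N" and "mn (tri m) (tri (pl m n)) = zr"
  then obtain c where "c \<in> N" "tri (pl m n) = pl (tri m) c" by (auto simp: mn_eq_0)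
  then have "tri (pl m (sc n)) = pl (tri m) (pl c (sc (pl m n)))" using N by (simp add: pl_assoc)
  then show "mn (tri m) (tri (pl m (sc n))) = zr" using N \<open>c \<in> N\<close> by (simp del: pl_sc)
qed (auto intro!: dfn_intros)

lemma le_tri: "n \<in> N \<Longrightarrow> mn n (tri n) = zr"
  by (cases n rule: nat_cases) (auto simp: pl_commute[of "tri _"] simp del: pl_sc)

text \<open>The diagonal \<open>w = dg n\<close> is characterized by \<open>tri w \<le> n\<close>
  and \<open>n - tri w \<le> w\<close>, which together say
  \<open>tri w \<le> n < tri (w + 1)\<close>.\<close>

lemma dg_spec: "n \<in> N \<Longrightarrow> pl (tri (dg n)) (mn n (tri (dg n))) = n \<and> mn (mn n (tri (dg n))) (dg n) = zr"
proof (rule nat_induct[where n = n])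
  fix n assume n: "n \<in> N"
    and IH: "pl (tri (dg n)) (mn n (tri (dg n))) = n \<and> mn (mn n (tri (dg n))) (dg n) = zr"
  define w r where "w = dg n" and "r = mn n (tri w)"
  have N: "w \<in> N" "r \<in> N" using n by (auto simp: w_def r_def)
  have nr: "n = pl (tri w) r" and "mn r w = zr" using IH by (auto simp: w_def r_def)
  then obtain c where c: "c \<in> N" "w = pl r c" using N by (auto simp: mn_eq_0)
  \<comment> \<open>With \<open>n = tri w + r\<close> the test of \<open>diag_c\<close>, namely
    \<open>tri (w + 1) - (n + 1)\<close>, reduces to \<open>w - r\<close>; it vanishes exactly at
    the end of a diagonal.\<close>
  have d: "dg (sc n) = cnd TNat (mn w r) (sc w) w"
    using n N by (simp add: dg_sc w_def[symmetric]) (simp add: nr)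
  from c(1) show "pl (tri (dg (sc n))) (mn (sc n) (tri (dg (sc n)))) = sc n \<and>
      mn (mn (sc n) (tri (dg (sc n)))) (dg (sc n)) = zr"
  proof (cases c rule: nat_cases)
    case 1
    then have "w = r" using c N by simp
    then have "dg (sc n) = sc w" "sc n = tri (sc w)" using N d nr by auto
    then show ?thesis using N n by (metis arith_D(4) mn_0_left mn_self pl_0 sc_D)
  next
    case (2 q)
    then have "mn w r = sc q" using c N by (metis mn_pl sc_D)
    then have "dg (sc n) = w" using 2 N d by simp
    moreover have "mn (sc n) (tri w) = sc r" using N nr by (metis arith_D(4) mn_pl pl_sc sc_D)
    moreover have "mn (sc r) w = zr" using c(2) 2 N by simp
    ultimately show ?thesis using N nr by simp
  qed
qed (auto intro!: dfn_intros)

text \<open>Diagonals do not overlap: a later triangular number exceeds \<open>tri w\<close> by at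
  least \<open>w + 1\<close>, more than any remainder allowed on diagonal \<open>w\<close>.\<close>

lemma tri_less: "w \<in> N \<Longrightarrow> c \<in> N \<Longrightarrow> \<exists>k \<in> N. tri (sc (pl w c)) = pl (tri w) (pl (sc w) k)"
proof -
  assume N: "w \<in> N" "c \<in> N"
  then have "mn (tri (sc w)) (tri (pl (sc w) c)) = zr" by (intro tri_mono) simp_all
  then obtain k where "k \<in> N" "tri (pl (sc w) c) = pl (tri (sc w)) k"
    using N mn_eq_0[of "tri (sc w)" "tri (pl (sc w) c)"] by (auto simp del: tri_sc pl_sc_left)
  then show ?thesis using N by (intro bexI[of _ k]) (auto simp: pl_assoc)
qed

text \<open>Decompositions of one number on two different diagonals contradict
  \<open>tri_less\<close>: the remainder on the smaller diagonal would exceed that diagonal.\<close>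

lemma dg_unique:
  assumes N: "w \<in> N" "r \<in> N" "c \<in> N" and w: "w = pl r c"
  shows "dg (pl (tri w) r) = w"
proof -
  let ?n = "pl (tri w) r"
  define v q where "v = dg ?n" and "q = mn ?n (tri v)"
  have N': "v \<in> N" "q \<in> N" "?n \<in> N" using N by (auto simp: v_def q_def)
  have nq: "?n = pl (tri v) q" and "mn q v = zr" using dg_spec[of ?n] N by (auto simp: v_def q_def)
  then obtain d where d: "d \<in> N" "v = pl q d" using N' by (auto simp: mn_eq_0)
  from N(1) N'(1) have "v = w"
  proof (cases rule: nat_compare)
    case (1 k)
    from 1(1) show ?thesis
    proof (cases k rule: nat_cases)
      case (2 j)
      then obtain i where "i \<in> N" "tri v = pl (tri w) (pl (sc w) i)"
        using tri_less[of w j] 1 N by auto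
      then have "pl (tri w) r = pl (tri w) (pl (pl (sc w) i) q)"
        using nq N N' by (simp add: pl_assoc)
      then have "r = pl (pl (sc (pl r c)) i) q"
        using N N' \<open>i \<in> N\<close> w by (subst (asm) pl_cancel) auto
      then have "pl r zr = pl r (sc (pl (pl c i) q))"
        using N N' \<open>i \<in> N\<close> by (simp add: pl_assoc)
      then show ?thesis using N N' \<open>i \<in> N\<close> by (subst (asm) pl_cancel) auto
    qed (use 1 N in auto)
  next
    case (2 j)
    then obtain i where "i \<in> N" "tri w = pl (tri v) (pl (sc v) i)"
      using tri_less[of v j] N' by auto
    then have "pl (tri v) q = pl (tri v) (pl (pl (sc v) i) r)"
      using nq N N' by (simp add: pl_assoc)
    then have "q = pl (pl (sc (pl q d)) i) r"
      using N N' \<open>i \<in> N\<close> d by (subst (asm) pl_cancel) auto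
    then have "pl q zr = pl q (sc (pl (pl d i) r))"
      using N N' \<open>i \<in> N\<close> d(1) by (simp add: pl_assoc)
    then show ?thesis using N N' \<open>i \<in> N\<close> d by (subst (asm) pl_cancel) auto
  qed
  then show ?thesis by (simp add: v_def)
qed

text \<open>\<open>tri (m + n) + m\<close> lies on the diagonal \<open>m + n\<close> with remainder
  \<open>m\<close>, so \<open>dg_unique\<close> recovers both numbers.\<close>

lemma pr_props [simp]:
  assumes "m \<in> N" "n \<in> N"
  shows "p1 (pr m n) = m" "p2 (pr m n) = n"
proof -
  have dg: "dg (pr m n) = pl m n"
    using dg_unique[of "pl m n" m n] assms by (simp add: pr_eq)
  then show p1: "p1 (pr m n) = m" using assms by (simp add: p1_eq) (simp add: pr_eq)
  show "p2 (pr m n) = n" using assms by (simp add: p2_eq dg p1)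
qed

lemma p2_0 [simp]: "p2 zr = zr"
  by (simp add: p2_eq p1_eq)

text \<open>Needed for lengths: \<open>len0_c\<close> inspects only positions below the code, so a
  code has to be at least its number of components.\<close>

lemma le_pr: "m \<in> N \<Longrightarrow> n \<in> N \<Longrightarrow> mn n (pr m n) = zr"
proof -
  assume N: "m \<in> N" "n \<in> N"
  then obtain c where c: "c \<in> N" "tri (pl m n) = pl (pl m n) c"
    using le_tri[of "pl m n"] by (auto simp: mn_eq_0)
  then have "pr m n = pl n (pl m (pl c m))" using N by (simp add: pr_eq pl_ac)
  then show ?thesis using N c by simp
qed

end

section \<open>Finite sequences in a model\<close>

context epa_model
begin

abbreviation "len \<sigma> s \<equiv> cv (len_c \<sigma>) \<bullet> s"
abbreviation "cmp \<sigma> s i \<equiv> cv (comp_c \<sigma>) \<bullet> s \<bullet> i"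
abbreviation "mk \<sigma> n f \<equiv> cv (mk_c \<sigma>) \<bullet> n \<bullet> f"
abbreviation "cat \<sigma> s t \<equiv> cv (cat_c \<sigma>) \<bullet> s \<bullet> t"
abbreviation "brk \<sigma> \<tau> Y x \<equiv> cv (bracket_c \<sigma> \<tau>) \<bullet> Y \<bullet> x"

lemma len_D [simp]: "s \<in> D \<sigma> \<Longrightarrow> len \<sigma> s \<in> N"
  by (rule app_D[of _ \<sigma>]) auto

lemma cmp_D [simp]: "s \<in> D \<sigma> \<Longrightarrow> i \<in> N \<Longrightarrow> cmp \<sigma> s i \<in> D \<sigma>"
  by (rule app_D[OF app_D[of _ \<sigma>]]) auto

lemma mk_D [simp]: "n \<in> N \<Longrightarrow> f \<in> D (TNat \<rightarrowtail> \<sigma>) \<Longrightarrow> mk \<sigma> n f \<in> D \<sigma>"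
  by (rule app_D[OF app_D]) auto

lemma brk_D [simp]: "Y \<in> D (\<sigma> \<rightarrowtail> \<tau>) \<Longrightarrow> x \<in> D \<sigma> \<Longrightarrow> brk \<sigma> \<tau> Y x \<in> D \<tau>"
  by (rule app_D[OF app_D]) auto

section \<open>Equations of the sequence constants\<close>

lemma len_simps:
  "s \<in> N \<Longrightarrow> len TNat s = cv len0_c \<bullet> s"
  "s \<in> D (\<sigma> \<rightarrowtail> \<tau>) \<Longrightarrow> len (\<sigma> \<rightarrowtail> \<tau>) s = len \<tau> (s \<bullet> cv (zero_c \<sigma>))"
  by (simp add: len_c.simps(1)) (simp add: cv_unfold[OF len_c_props(3) len_c.simps(2)])

lemma cmp_simps:
  "cmp TNat s i = cv comp0_c \<bullet> s \<bullet> i"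
  "s \<in> D (\<sigma> \<rightarrowtail> \<tau>) \<Longrightarrow> i \<in> N \<Longrightarrow> x \<in> D \<sigma> \<Longrightarrow> cmp (\<sigma> \<rightarrowtail> \<tau>) s i \<bullet> x = cmp \<tau> (s \<bullet> x) i"
  by (simp add: comp_c.simps(1)) (simp add: cv_unfold[OF comp_c_props(3) comp_c.simps(2)])

lemma zero_app [simp]: "x \<in> D \<sigma> \<Longrightarrow> cv (zero_c (\<sigma> \<rightarrowtail> \<tau>)) \<bullet> x = cv (zero_c \<tau>)"
  by (simp add: cv_unfold[OF zero_c_props(3) zero_c.simps(2)])

text \<open>The code is assembled from the back: \<open>\<rho> k\<close> codes the last
  \<open>k\<close> of the \<open>n\<close> components. Separating the recursion variable
  \<open>k\<close> from the fixed \<open>n\<close> makes induction possible.\<close>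

lemma mk0_rec:
  assumes n: "n \<in> N" and f: "f \<in> D (TNat \<rightarrowtail> TNat)"
  obtains \<rho> where "\<And>k. k \<in> N \<Longrightarrow> \<rho> k \<in> N" "mfun [TNat] TNat (\<lambda>x. \<rho> (x ! 0))"
    "mk TNat n f = \<rho> n" "\<rho> zr = zr"
    "\<And>k. k \<in> N \<Longrightarrow> \<rho> (sc k) = sc (pr (f \<bullet> mn (pd n) k) (\<rho> k))"
proof -
  let ?e = "env0((0, TNat) := n, (1, TNat \<rightarrowtail> TNat) := f)"
  let ?t = "lam (nv 2) (lam (nv 3) (Succ \<cdot> (pair_c \<cdot>
    (V (1, TNat \<rightarrowtail> TNat) \<cdot> (monus_c \<cdot> (pred_c \<cdot> V (nv 0)) \<cdot> V (nv 3))) \<cdot> V (nv 2))))"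
  define R where "R = cst (Rec TNat) \<bullet> zr \<bullet> val ?e ?t"
  have e: "env ?e" using n f by simp
  have R: "R \<in> D (TNat \<rightarrowtail> TNat)"
    unfolding R_def using e by (intro app_D[OF app_D[OF cst_R]]) auto
  show ?thesis
  proof (rule that[of "\<lambda>k. R \<bullet> k"])
    show "mfun [TNat] TNat (\<lambda>x. R \<bullet> (x ! 0))"
      using R by (intro dfn_intros)
    show "mk TNat n f = R \<bullet> n"
      using n f by (simp add: mk_c.simps cv_unfold[OF mk0_c_props(3) mk0_c_def] R_def)
    show "R \<bullet> sc k = sc (pr (f \<bullet> mn (pd n) k) (R \<bullet> k))" if "k \<in> N" for k
    proof -
      have "R \<bullet> k \<in> N" using R that by (rule app_D)
      then show ?thesis unfolding R_def using e n f that by simp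
    qed
  qed (use R e in \<open>auto simp: R_def intro: app_D\<close>)
qed

text \<open>\<open>\<rho> k\<close> counts the positions below \<open>k\<close> at which something
  remains. The search bound is the code \<open>s\<close> itself, so here too the recursion variable
  is separated from it.\<close>

lemma len0_rec:
  assumes s: "s \<in> N"
  obtains \<rho> where "\<And>k. k \<in> N \<Longrightarrow> \<rho> k \<in> N" "mfun [TNat] TNat (\<lambda>x. \<rho> (x ! 0))"
    "len TNat s = \<rho> s" "\<rho> zr = zr"
    "\<And>k. k \<in> N \<Longrightarrow> \<rho> (sc k) = pl (\<rho> k) (cnd TNat (drp s k) zr (sc zr))"
proof -
  let ?e = "env0((0, TNat) := s)"
  let ?t = "lam (nv 1) (lam (nv 2) (plus_c \<cdot> V (nv 1) \<cdot>
       (cond_c TNat \<cdot> (drop0_c \<cdot> V (nv 0) \<cdot> V (nv 2)) \<cdot> Zero \<cdot> (Succ \<cdot> Zero))))"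
  define R where "R = cst (Rec TNat) \<bullet> zr \<bullet> val ?e ?t"
  have e: "env ?e" using s by simp
  have R: "R \<in> D (TNat \<rightarrowtail> TNat)"
    unfolding R_def using e by (intro app_D[OF app_D[OF cst_R]]) auto
  show ?thesis
  proof (rule that[of "\<lambda>k. R \<bullet> k"])
    show "mfun [TNat] TNat (\<lambda>x. R \<bullet> (x ! 0))"
      using R by (intro dfn_intros)
    show "len TNat s = R \<bullet> s"
      using s by (simp add: len_c.simps cv_unfold[OF len0_c_props(3) len0_c_def] R_def)
    show "R \<bullet> sc k = pl (R \<bullet> k) (cnd TNat (drp s k) zr (sc zr))" if "k \<in> N" for k
    proof -
      have "R \<bullet> k \<in> N" using R that by (rule app_D)
      then show ?thesis unfolding R_def using e s that by simp
    qed
  qed (use R e in \<open>auto simp: R_def intro: app_D\<close>)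
qed

lemma len0_zero [simp]: "len TNat zr = zr"
  by (rule len0_rec[of zr]) auto

lemma cmp0_eq: "s \<in> N \<Longrightarrow> i \<in> N \<Longrightarrow> cmp TNat s i = p1 (pd (drp s i))"
  by (simp add: cmp_simps cv_unfold[OF comp0_c_props(3) comp0_c_def])

lemma mk0_props:
  assumes n: "n \<in> N" and f: "f \<in> D (TNat \<rightarrowtail> TNat)"
  shows "len TNat (mk TNat n f) = n" "i \<in> N \<Longrightarrow> lt i n \<Longrightarrow> cmp TNat (mk TNat n f) i = f \<bullet> i"
proof -
  obtain \<rho> where \<rho>: "\<And>k. k \<in> N \<Longrightarrow> \<rho> k \<in> N" "mfun [TNat] TNat (\<lambda>x. \<rho> (x ! 0))"
    "mk TNat n f = \<rho> n" "\<rho> zr = zr"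
    "\<And>k. k \<in> N \<Longrightarrow> \<rho> (sc k) = sc (pr (f \<bullet> mn (pd n) k) (\<rho> k))"
    using mk0_rec[OF n f] by blast
  have f_D: "f \<bullet> k \<in> N" if "k \<in> N" for k using f that by (rule app_D)
  \<comment> \<open>At \<open>k = 0\<close> both sides are zero, because predecessor and projection
    send zero to zero.\<close>
  have tl: "p2 (pd (\<rho> k)) = \<rho> (pd k)" if "k \<in> N" for k
    using that by (cases k rule: nat_cases) (auto simp: \<rho> n f_D)
  have drp: "drp (\<rho> n) i = \<rho> (mn n i)" if "i \<in> N" for i
  proof (rule nat_induct[where n = i])
    have "mfun [TNat] TNat (\<lambda>x. \<rho> (([\<lambda>x. mn n (x ! 0)] ! 0) x))"
    proof -
      obtain R where R: "R \<in> D (TNat \<rightarrowtail> TNat)" "\<And>k. k \<in> N \<Longrightarrow> \<rho> k = R \<bullet> k"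
        using \<rho>(2) unfolding mfun_def by (auto simp: Ds_Cons) (metis Ds_Cons_Cons Nil_Ds nth_Cons_0 apps_simps(1,2))
      have "mfun [TNat] TNat (\<lambda>x. R \<bullet> mn n (x ! 0))"
        using R n by (intro dfn_intros) auto
      then show ?thesis by (rule mfun_cong) (auto simp: R n Ds_Cons)
    qed
    then show "dfn [TNat] (\<lambda>x. drp (\<rho> n) (x ! 0) = \<rho> (mn n (x ! 0)))"
      using n \<rho>(1) by (intro dfn_intros) auto
  qed (use that n in \<open>auto simp: \<rho>(1) drp_sc mn_sc tl\<close>)
  obtain \<mu> where \<mu>: "\<And>k. k \<in> N \<Longrightarrow> \<mu> k \<in> N" "mfun [TNat] TNat (\<lambda>x. \<mu> (x ! 0))"
    "len TNat (\<rho> n) = \<mu> (\<rho> n)" "\<mu> zr = zr"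
    "\<And>k. k \<in> N \<Longrightarrow> \<mu> (sc k) = pl (\<mu> k) (cnd TNat (drp (\<rho> n) k) zr (sc zr))"
    using len0_rec[OF \<rho>(1)[OF n]] by blast
  \<comment> \<open>\<open>mn n (mn n j)\<close> is the minimum of \<open>n\<close> and
    \<open>j\<close>: the count grows until the \<open>n\<close> components are exhausted and then
    stays.\<close>
  have \<mu>_eq: "\<mu> j = mn n (mn n j)" if "j \<in> N" for j
  proof (rule nat_induct[where n = j])
    show "dfn [TNat] (\<lambda>x. \<mu> (x ! 0) = mn n (mn n (x ! 0)))"
      using n \<mu>(2) by (intro dfn_intros) auto
  next
    fix j assume j: "j \<in> N" and IH: "\<mu> j = mn n (mn n j)"
    have "mn n j \<in> N" using n j by simp
    then show "\<mu> (sc j) = mn n (mn n (sc j))"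
    proof (cases "mn n j" rule: nat_cases)
      case 1
      then show ?thesis using n j IH by (simp add: \<mu> drp \<rho> mn_sc)
    next
      case (2 q)
      from j n obtain c where c: "c \<in> N" "n = pl j c"
      proof (cases rule: nat_compare)
        case (2 c)
        then have "mn n j = zr" using n mn_pl_0[of n "sc c"] by simp
        then show ?thesis using \<open>q \<in> N\<close> \<open>mn n j = sc q\<close> by simp
      qed
      then have "n = pl (sc j) q" using 2 j by simp
      then have "mn n (sc q) = j" "mn n q = sc j" using 2 j by (metis pl_sc pl_sc_left mn_pl' sc_D)+
      then show ?thesis using n j 2 IH by (simp add: \<mu> drp \<rho> mn_sc f_D)
    qed
  qed (use that n in \<open>auto simp: \<mu>\<close>)
  \<comment> \<open>The search runs up to the code, which is at least \<open>n\<close>, so it counts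
    all components.\<close>
  have "mn k (\<rho> k) = zr" if "k \<in> N" for k
  proof (rule nat_induct[where n = k])
    fix k assume k: "k \<in> N" and "mn k (\<rho> k) = zr"
    then obtain c where c: "c \<in> N" "\<rho> k = pl k c" by (auto simp: mn_eq_0 \<rho>)
    obtain d where d: "d \<in> N" "pr (f \<bullet> mn (pd n) k) (\<rho> k) = pl (\<rho> k) d"
      using le_pr[of "f \<bullet> mn (pd n) k" "\<rho> k"] k n by (auto simp: mn_eq_0 \<rho> f_D)
    then show "mn (sc k) (\<rho> (sc k)) = zr" using k c n by (simp add: \<rho>(5)) (simp add: pl_assoc)
  qed (use that \<rho> in \<open>auto intro!: dfn_intros\<close>)
  then show "len TNat (mk TNat n f) = n" using n by (simp add: \<rho> \<mu> \<mu>_eq)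
  assume i: "i \<in> N" "lt i n"
  then obtain c where c: "c \<in> N" "n = sc (pl i c)" using n by (auto simp: lt_iff)
  then have "mn n i = sc c" using i by (metis mn_pl pl_sc sc_D)
  then have "drp (\<rho> n) i = \<rho> (sc c)" using drp i by simp
  then have "cmp TNat (\<rho> n) i = f \<bullet> mn (pd n) c"
    using c i n by (simp add: cmp0_eq \<rho> f_D)
  then show "cmp TNat (mk TNat n f) i = f \<bullet> i" unfolding \<rho>(3) using c i by simp
qed

lemma mk_app:
  assumes "n \<in> N" "f \<in> D (TNat \<rightarrowtail> \<sigma> \<rightarrowtail> \<tau>)" "x \<in> D \<sigma>"
  obtains g where "g \<in> D (TNat \<rightarrowtail> \<tau>)" "\<And>i. i \<in> N \<Longrightarrow> g \<bullet> i = f \<bullet> i \<bullet> x"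
    "mk (\<sigma> \<rightarrowtail> \<tau>) n f \<bullet> x = mk \<tau> n g"
proof (rule that)
  let ?e = "env0((0, TNat) := n, (1, TNat \<rightarrowtail> \<sigma> \<rightarrowtail> \<tau>) := f, (2, \<sigma>) := x)"
  let ?t = "lam (3, TNat) (V (1, TNat \<rightarrowtail> \<sigma> \<rightarrowtail> \<tau>) \<cdot> V (3, TNat) \<cdot> V (2, \<sigma>))"
  have e: "env ?e" using assms by simp
  show "val ?e ?t \<in> D (TNat \<rightarrowtail> \<tau>)" using e by simp
  show "val ?e ?t \<bullet> i = f \<bullet> i \<bullet> x" if "i \<in> N" for i using e that by simp
  show "mk (\<sigma> \<rightarrowtail> \<tau>) n f \<bullet> x = mk \<tau> n (val ?e ?t)"
    using assms e by (simp add: cv_unfold[OF mk_c_props(3) mk_c.simps(2)])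
qed

text \<open>At a function type everything is pointwise: the length is read at the zero functional,
  and components agree by extensionality because they agree at each argument.\<close>

lemma mk_props:
  assumes "n \<in> N" "f \<in> D (TNat \<rightarrowtail> \<sigma>)"
  shows "len \<sigma> (mk \<sigma> n f) = n" "i \<in> N \<Longrightarrow> lt i n \<Longrightarrow> cmp \<sigma> (mk \<sigma> n f) i = f \<bullet> i"
proof -
  have "len \<sigma> (mk \<sigma> n f) = n \<and> (\<forall>i \<in> N. lt i n \<longrightarrow> cmp \<sigma> (mk \<sigma> n f) i = f \<bullet> i)"
    using assms(2)
  proof (induction \<sigma> arbitrary: f)
    case TNat
    then show ?case using mk0_props assms(1) by blast
  next
    case (TFun \<sigma> \<tau>)
    note n = assms(1)
    obtain g where "g \<in> D (TNat \<rightarrowtail> \<tau>)" "mk (\<sigma> \<rightarrowtail> \<tau>) n f \<bullet> cv (zero_c \<sigma>) = mk \<tau> n g"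
      using mk_app[OF n TFun.prems cv_D] by (metis zero_c_props)
    then have "len (\<sigma> \<rightarrowtail> \<tau>) (mk (\<sigma> \<rightarrowtail> \<tau>) n f) = n"
      using TFun.IH(2) TFun.prems n by (simp add: len_simps)
    moreover have "cmp (\<sigma> \<rightarrowtail> \<tau>) (mk (\<sigma> \<rightarrowtail> \<tau>) n f) i = f \<bullet> i" if i: "i \<in> N" "lt i n" for i
    proof (rule app_ext)
      show "cmp (\<sigma> \<rightarrowtail> \<tau>) (mk (\<sigma> \<rightarrowtail> \<tau>) n f) i \<in> D (\<sigma> \<rightarrowtail> \<tau>)" using TFun.prems n i by simp
      show "f \<bullet> i \<in> D (\<sigma> \<rightarrowtail> \<tau>)" using TFun.prems i by (intro app_D)
      fix x assume x: "x \<in> D \<sigma>"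
      obtain g where "g \<in> D (TNat \<rightarrowtail> \<tau>)" "\<And>i. i \<in> N \<Longrightarrow> g \<bullet> i = f \<bullet> i \<bullet> x"
        "mk (\<sigma> \<rightarrowtail> \<tau>) n f \<bullet> x = mk \<tau> n g"
        using mk_app[OF n TFun.prems x] by blast
      then show "cmp (\<sigma> \<rightarrowtail> \<tau>) (mk (\<sigma> \<rightarrowtail> \<tau>) n f) i \<bullet> x = f \<bullet> i \<bullet> x"
        using TFun.IH(2) TFun.prems n i x by (simp add: cmp_simps)
    qed
    ultimately show ?case by blast
  qed
  then show "len \<sigma> (mk \<sigma> n f) = n" "i \<in> N \<Longrightarrow> lt i n \<Longrightarrow> cmp \<sigma> (mk \<sigma> n f) i = f \<bullet> i"
    by auto
qed

lemma len_zero [simp]: "len \<sigma> (cv (zero_c \<sigma>)) = zr"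
proof (induction \<sigma>)
  case TNat
  have "cv Zero = zr" by (simp add: cv_def)
  then show ?case by (simp add: zero_c.simps(1))
qed (simp add: len_simps)

text \<open>A HOL set; for a code of nonstandard length it may be infinite. Different codes may have
  the same elements, and the later arguments see codes through their elements.\<close>

definition elems :: "ty \<Rightarrow> 'a \<Rightarrow> 'a set" where
  "elems \<sigma> s = {cmp \<sigma> s i | i. i \<in> N \<and> lt i (len \<sigma> s)}"

lemma elems_D: "s \<in> D \<sigma> \<Longrightarrow> elems \<sigma> s \<subseteq> D \<sigma>"
  by (auto simp: elems_def)

lemma elems_zero [simp]: "elems \<sigma> (cv (zero_c \<sigma>)) = {}"
  by (auto simp: elems_def)

lemma elems_mk:
  assumes "n \<in> N" "f \<in> D (TNat \<rightarrowtail> \<sigma>)"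
  shows "elems \<sigma> (mk \<sigma> n f) = {f \<bullet> i | i. i \<in> N \<and> lt i n}"
  unfolding elems_def mk_props(1)[OF assms]
  by (intro Collect_cong ex_cong1) (auto simp: mk_props(2)[OF assms])

lemma elems_cat: assumes s: "s \<in> D \<sigma>" and t: "t \<in> D \<sigma>"
  shows "elems \<sigma> (cat \<sigma> s t) = elems \<sigma> s \<union> elems \<sigma> t"
proof -
  let ?e = "env0((0, \<sigma>) := s, (1, \<sigma>) := t)"
  let ?t = "lam (2, TNat) (cond_c \<sigma>
          \<cdot> (monus_c \<cdot> (Succ \<cdot> V (2, TNat)) \<cdot> (len_c \<sigma> \<cdot> V (0, \<sigma>)))
          \<cdot> (comp_c \<sigma> \<cdot> V (0, \<sigma>) \<cdot> V (2, TNat))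
          \<cdot> (comp_c \<sigma> \<cdot> V (1, \<sigma>) \<cdot> (monus_c \<cdot> V (2, TNat) \<cdot> (len_c \<sigma> \<cdot> V (0, \<sigma>)))))"
  let ?a = "len \<sigma> s" and ?b = "len \<sigma> t"
  define g where "g = val ?e ?t"
  have e: "env ?e" using s t by simp
  have N: "?a \<in> N" "?b \<in> N" using s t by auto
  have g: "g \<in> D (TNat \<rightarrowtail> \<sigma>)" unfolding g_def using e by simp
  have gi: "g \<bullet> i = cnd \<sigma> (mn (sc i) ?a) (cmp \<sigma> s i) (cmp \<sigma> t (mn i ?a))" if "i \<in> N" for i
    unfolding g_def using e that by simp
  have 1: "g \<bullet> i = cmp \<sigma> s i" if "i \<in> N" "lt i ?a" for i
    using that s t by (simp add: gi lt_def)
  have 2: "g \<bullet> pl ?a j = cmp \<sigma> t j" if "j \<in> N" for j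
    using that s t N mn_pl[of ?a "sc j"] by (simp add: gi)
  have "cat \<sigma> s t = mk \<sigma> (pl ?a ?b) g"
    using s t e by (simp add: cv_unfold[OF cat_c_props(3) cat_c_def] g_def)
  then have el: "elems \<sigma> (cat \<sigma> s t) = {g \<bullet> i | i. i \<in> N \<and> lt i (pl ?a ?b)}"
    using N g by (simp add: elems_mk)
  show ?thesis
  proof (intro equalityI subsetI)
    fix c assume "c \<in> elems \<sigma> (cat \<sigma> s t)"
    then obtain i where i: "i \<in> N" "lt i (pl ?a ?b)" "c = g \<bullet> i" using el by auto
    show "c \<in> elems \<sigma> s \<union> elems \<sigma> t"
    proof (cases "lt i ?a")
      case False
      from N(1) i(1) obtain j where j: "j \<in> N" "i = pl ?a j"
      proof (cases rule: nat_compare)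
        case (2 c)
        then show ?thesis using False N i by (auto simp: lt_iff)
      qed
      then have "lt j ?b" using i N by (simp add: lt_def pl_sc[symmetric] del: pl_sc)
      then show ?thesis using j 2 i by (auto simp: elems_def)
    qed (use i 1 in \<open>auto simp: elems_def\<close>)
  next
    fix c assume "c \<in> elems \<sigma> s \<union> elems \<sigma> t"
    then consider i where "i \<in> N" "lt i ?a" "c = cmp \<sigma> s i" | j where "j \<in> N" "lt j ?b" "c = cmp \<sigma> t j"
      by (auto simp: elems_def)
    then show "c \<in> elems \<sigma> (cat \<sigma> s t)"
    proof cases
      case 1
      then have "lt i (pl ?a ?b)" using N by (auto simp: lt_iff pl_assoc)
      then show ?thesis using 1 \<open>\<And>i. i \<in> N \<Longrightarrow> lt i ?a \<Longrightarrow> _\<close> el by force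
    next
      case 2
      then have "lt (pl ?a j) (pl ?a ?b)" using N by (simp add: lt_def pl_sc[symmetric] del: pl_sc)
      then show ?thesis using 2 \<open>\<And>j. j \<in> N \<Longrightarrow> g \<bullet> pl ?a j = _\<close> el N by force
    qed
  qed
qed

section \<open>Tuples of represented functions\<close>

definition mfuns :: "ty list \<Rightarrow> ty list \<Rightarrow> ('a list \<Rightarrow> 'a list) \<Rightarrow> bool" where
  "mfuns X Y F \<longleftrightarrow> (\<forall>x \<in> Ds X. length (F x) = length Y) \<and> (\<forall>i < length Y. mfun X (Y ! i) (\<lambda>x. F x ! i))"

lemma mfuns_D: "mfuns X Y F \<Longrightarrow> x \<in> Ds X \<Longrightarrow> F x \<in> Ds Y"
  unfolding mfuns_def using mfun_D[of X _ "\<lambda>x. F x ! _" x] by (intro DsI) blast+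

lemma mfun_comp:
  assumes "mfun Y \<tau> f" "mfuns X Y F"
  shows "mfun X \<tau> (\<lambda>x. f (F x))"
proof -
  obtain g where g: "g \<in> D (arrs Y \<tau>)" "\<And>y. y \<in> Ds Y \<Longrightarrow> f y = apps g y"
    using assms(1) by (auto simp: mfun_def)
  let ?gs = "map (\<lambda>i x. F x ! i) [0..<length Y]"
  have "mfun X \<tau> (\<lambda>x. apps g (map (\<lambda>g. g x) ?gs))"
    using g(1) assms(2) by (intro mfun_apps[of X Y] mfun_const) (auto simp: mfuns_def)
  then show ?thesis
  proof (rule mfun_cong)
    fix x assume x: "x \<in> Ds X"
    have "map (\<lambda>g. g x) ?gs = F x"
      using assms(2) x by (intro nth_equalityI) (auto simp: mfuns_def)
    then show "f (F x) = apps g (map (\<lambda>g. g x) ?gs)"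
      using g(2) mfuns_D[OF assms(2) x] by simp
  qed
qed

lemma mfuns_butlast: "mfuns (X @ [\<sigma>]) X butlast"
  unfolding mfuns_def
proof (intro conjI allI impI ballI)
  show "length (butlast x) = length X" if "x \<in> Ds (X @ [\<sigma>])" for x
    using Ds_length[OF that] by simp
  show "mfun (X @ [\<sigma>]) (X ! i) (\<lambda>x. butlast x ! i)" if i: "i < length X" for i
  proof (rule mfun_cong)
    show "mfun (X @ [\<sigma>]) (X ! i) (\<lambda>x. x ! i)" using i by (intro mfun_nth) (auto simp: nth_append)
    show "butlast x ! i = x ! i" if "x \<in> Ds (X @ [\<sigma>])" for x
      using Ds_length[OF that] i by (intro nth_butlast) simp
  qed
qed

lemma mfun_weaken: "mfun X \<tau> f \<Longrightarrow> mfun (X @ [\<sigma>]) \<tau> (\<lambda>x. f (butlast x))"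
  by (rule mfun_comp[OF _ mfuns_butlast])

lemma mfun_last: "mfun (X @ [\<sigma>]) \<sigma> last"
proof (rule mfun_cong)
  show "mfun (X @ [\<sigma>]) \<sigma> (\<lambda>x. x ! length X)" by (intro mfun_nth) auto
  show "last x = x ! length X" if "x \<in> Ds (X @ [\<sigma>])" for x
    using Ds_length[OF that] by (cases "x = []") (auto simp: last_conv_nth)
qed

text \<open>Splitting the context with \<open>butlast\<close> and \<open>last\<close> lets the rule
  match a predicate given as \<open>Q x d\<close>.\<close>

lemma dfn_ex': "dfn (X @ [\<sigma>]) (\<lambda>z. Q (butlast z) (last z)) \<Longrightarrow> dfn X (\<lambda>x. \<exists>d \<in> D \<sigma>. Q x d)"
  using dfn_ex[of X \<sigma> "\<lambda>z. Q (butlast z) (last z)"] by simp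

lemma dfn_all': "dfn (X @ [\<sigma>]) (\<lambda>z. Q (butlast z) (last z)) \<Longrightarrow> dfn X (\<lambda>x. \<forall>d \<in> D \<sigma>. Q x d)"
  using dfn_all[of X \<sigma> "\<lambda>z. Q (butlast z) (last z)"] by simp

lemma mfun_len: "mfun X \<sigma> f \<Longrightarrow> mfun X TNat (\<lambda>x. len \<sigma> (f x))"
  by (rule mfun_app[of X \<sigma>, OF mfun_const]) auto

lemma mfun_cmp: "mfun X \<sigma> f \<Longrightarrow> mfun X TNat g \<Longrightarrow> mfun X \<sigma> (\<lambda>x. cmp \<sigma> (f x) (g x))"
  by (rule mfun_app[of X TNat, OF mfun_app[of X \<sigma>, OF mfun_const]]) auto

lemma mfun_mk: "mfun X TNat f \<Longrightarrow> mfun X (TNat \<rightarrowtail> \<sigma>) g \<Longrightarrow> mfun X \<sigma> (\<lambda>x. mk \<sigma> (f x) (g x))"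
  by (rule mfun_app[of X "TNat \<rightarrowtail> \<sigma>", OF mfun_app[of X TNat, OF mfun_const]]) auto

lemma mfun_cat: "mfun X \<sigma> f \<Longrightarrow> mfun X \<sigma> g \<Longrightarrow> mfun X \<sigma> (\<lambda>x. cat \<sigma> (f x) (g x))"
  by (rule mfun_app[of X \<sigma>, OF mfun_app[of X \<sigma>, OF mfun_const]]) auto

lemma mfun_brk: "mfun X (\<sigma> \<rightarrowtail> \<tau>) f \<Longrightarrow> mfun X \<sigma> g \<Longrightarrow> mfun X \<tau> (\<lambda>x. brk \<sigma> \<tau> (f x) (g x))"
  by (rule mfun_app[of X \<sigma>, OF mfun_app[of X "\<sigma> \<rightarrowtail> \<tau>", OF mfun_const]]) auto

lemma elems_iff: "c \<in> elems \<sigma> s \<longleftrightarrow> (\<exists>i \<in> N. lt i (len \<sigma> s) \<and> c = cmp \<sigma> s i)"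
  by (auto simp: elems_def)

lemma dfn_elems: "mfun X \<sigma> f \<Longrightarrow> mfun X \<sigma> g \<Longrightarrow> dfn X (\<lambda>x. f x \<in> elems \<sigma> (g x))"
  unfolding elems_iff
  by (intro dfn_ex' dfn_conj dfn_lt dfn_eq[where \<tau> = \<sigma>] mfun_last mfun_len mfun_cmp)
    (auto intro: mfun_weaken)

text \<open>The recursor in \<open>bracket_c\<close> concatenates one value per step, so by
  induction \<open>n\<close> steps collect the elements of the first \<open>n\<close>
  values.\<close>

lemma elems_brk:
  assumes Y: "Y \<in> D (\<sigma> \<rightarrowtail> \<tau>)" and x: "x \<in> D \<sigma>"
  shows "elems \<tau> (brk \<sigma> \<tau> Y x) = (\<Union>f \<in> elems (\<sigma> \<rightarrowtail> \<tau>) Y. elems \<tau> (f \<bullet> x))"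
proof -
  let ?e = "env0((0, \<sigma> \<rightarrowtail> \<tau>) := Y, (1, \<sigma>) := x)"
  let ?t = "lam (2, \<tau>) (lam (3, TNat) (cat_c \<tau> \<cdot> V (2, \<tau>) \<cdot>
          (comp_c (\<sigma> \<rightarrowtail> \<tau>) \<cdot> V (0, \<sigma> \<rightarrowtail> \<tau>) \<cdot> V (3, TNat) \<cdot> V (1, \<sigma>))))"
  define R where "R = cst (Rec \<tau>) \<bullet> cv (zero_c \<tau>) \<bullet> val ?e ?t"
  define h where "h i = cmp (\<sigma> \<rightarrowtail> \<tau>) Y i \<bullet> x" for i
  have h: "h i \<in> D \<tau>" if "i \<in> N" for i
    unfolding h_def using Y x that by (intro app_D[of "cmp (\<sigma> \<rightarrowtail> \<tau>) Y i" \<sigma>]) auto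
  have e: "env ?e" using Y x by simp
  have R: "R \<in> D (TNat \<rightarrowtail> \<tau>)"
    unfolding R_def using e by (intro app_D[OF app_D[OF cst_R]]) auto
  then have R_D: "R \<bullet> k \<in> D \<tau>" if "k \<in> N" for k using that by (rule app_D)
  have R_0: "R \<bullet> zr = cv (zero_c \<tau>)" unfolding R_def using e by simp
  have R_sc: "R \<bullet> sc k = cat \<tau> (R \<bullet> k) (h k)" if "k \<in> N" for k
    using R_D[OF that] unfolding R_def h_def using e that by simp
  have "elems \<tau> (R \<bullet> n) = (\<Union>i \<in> {i \<in> N. lt i n}. elems \<tau> (h i))" if n: "n \<in> N" for n
  proof -
    \<comment> \<open>The induction is run for one fixed \<open>c\<close>, which becomes a
      parameter, since membership of \<open>c\<close> is a definable predicate of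
      \<open>n\<close>.\<close>
    have "c \<in> elems \<tau> (R \<bullet> n) \<longleftrightarrow> (\<exists>i \<in> N. lt i n \<and> c \<in> elems \<tau> (h i))" if c: "c \<in> D \<tau>" for c
    proof (rule nat_induct[where n = n])
      show "dfn [TNat] (\<lambda>z. (c \<in> elems \<tau> (R \<bullet> (z ! 0))) \<longleftrightarrow> (\<exists>i \<in> N. lt i (z ! 0) \<and> c \<in> elems \<tau> (h i)))"
      proof -
        have 1: "dfn [TNat] (\<lambda>z. c \<in> elems \<tau> (R \<bullet> (z ! 0)))"
          using R c by (intro dfn_elems mfun_const mfun_app[of _ TNat] mfun_nth0)
        have "mfun ([TNat] @ [TNat]) \<tau> (\<lambda>z. h (last z))"
          unfolding h_def using Y x
          by (intro mfun_app[of _ \<sigma>] mfun_cmp mfun_const mfun_last)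
        then have 2: "dfn [TNat] (\<lambda>z. \<exists>i \<in> N. lt i (z ! 0) \<and> c \<in> elems \<tau> (h i))"
          using c by (intro dfn_ex' dfn_conj dfn_elems dfn_lt mfun_const mfun_last
            mfun_weaken[of "[TNat]" TNat "\<lambda>z. z ! 0"] mfun_nth0)
        show ?thesis
          using dfn_conj[OF dfn_imp[OF 1 2] dfn_imp[OF 2 1]] by (simp add: iff_conv_conj_imp)
      qed
      show "c \<in> elems \<tau> (R \<bullet> sc k) \<longleftrightarrow> (\<exists>i \<in> N. lt i (sc k) \<and> c \<in> elems \<tau> (h i))"
        if "k \<in> N" "c \<in> elems \<tau> (R \<bullet> k) \<longleftrightarrow> (\<exists>i \<in> N. lt i k \<and> c \<in> elems \<tau> (h i))" for k
        using that R_D h by (auto simp: R_sc elems_cat lt_sc)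
    qed (use n in \<open>auto simp: R_0\<close>)
    then show ?thesis using elems_D[OF R_D[OF n]] elems_D[OF h] by blast
  qed
  moreover have "brk \<sigma> \<tau> Y x = R \<bullet> len (\<sigma> \<rightarrowtail> \<tau>) Y"
    using Y x e by (simp add: cv_unfold[OF bracket_c_props(3) bracket_c_def] R_def)
  ultimately show ?thesis using Y by (auto simp: elems_def[of "\<sigma> \<rightarrowtail> \<tau>"] h_def)
qed

end

section \<open>Functions with finitely many values\<close>

context epa_model
begin

text \<open>A constant function is read as a sequence of length one.\<close>

lemma mfun_sing:
  assumes "mfun X \<sigma> f"
  obtains g where "mfun X \<sigma> g" "\<And>x. x \<in> Ds X \<Longrightarrow> elems \<sigma> (g x) = {f x}"
proof
  let ?g = "\<lambda>x. mk \<sigma> (sc zr) (cst (Kc \<sigma> TNat) \<bullet> f x)"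
  show "mfun X \<sigma> ?g"
    using assms by (intro mfun_mk mfun_app[of X \<sigma> _ "\<lambda>_. cst (Kc \<sigma> TNat)"] mfun_const) auto
  show "elems \<sigma> (?g x) = {f x}" if x: "x \<in> Ds X" for x
  proof -
    have "cst (Kc \<sigma> TNat) \<bullet> f x \<in> D (TNat \<rightarrowtail> \<sigma>)" using mfun_D[OF assms x] by (intro app_D[OF cst_K])
    then show ?thesis using mfun_D[OF assms x] by (auto simp: elems_mk lt_sc intro!: exI[of _ zr])
  qed
qed

text \<open>The union is \<open>Y[0]\<close>, where \<open>Y\<close> codes the sequence of the functions constantly \<open>g x c\<close>,
  \<open>c \<in> s x\<close>.\<close>
lemma mfun_UN:
  assumes s: "mfun X \<sigma> s" and g: "mfun (X @ [\<sigma>]) \<tau> g"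
  obtains h where "mfun X \<tau> h"
    "\<And>x. x \<in> Ds X \<Longrightarrow> elems \<tau> (h x) = (\<Union>c \<in> elems \<sigma> (s x). elems \<tau> (g (x @ [c])))"
proof -
  obtain G where G: "mfun X (\<sigma> \<rightarrowtail> \<tau>) G" "\<And>x d. x \<in> Ds X \<Longrightarrow> d \<in> D \<sigma> \<Longrightarrow> G x \<bullet> d = g (x @ [d])"
    using mfun_lam[OF g] by blast
  have "mfun (X @ [TNat]) (TNat \<rightarrowtail> \<tau>)
      (\<lambda>z. cst (Kc \<tau> TNat) \<bullet> (G (butlast z) \<bullet> cmp \<sigma> (s (butlast z)) (last z)))"
    by (intro mfun_app[of _ \<tau> _ "\<lambda>_. cst (Kc \<tau> TNat)"] mfun_app[of _ \<sigma>] mfun_const mfun_cmp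
        mfun_last mfun_weaken G s) auto
  then obtain K where K: "mfun X (TNat \<rightarrowtail> TNat \<rightarrowtail> \<tau>) K"
    "\<And>x i. x \<in> Ds X \<Longrightarrow> i \<in> N \<Longrightarrow> K x \<bullet> i = cst (Kc \<tau> TNat) \<bullet> (G x \<bullet> cmp \<sigma> (s x) i)"
    by (rule mfun_lam) simp
  let ?h = "\<lambda>x. brk TNat \<tau> (mk (TNat \<rightarrowtail> \<tau>) (len \<sigma> (s x)) (K x)) zr"
  show ?thesis
  proof
    show "mfun X \<tau> ?h"
      using K(1) s by (intro mfun_brk mfun_mk mfun_len mfun_const) auto
    fix x assume x: "x \<in> Ds X"
    have sx: "s x \<in> D \<sigma>" and Kx: "K x \<in> D (TNat \<rightarrowtail> TNat \<rightarrowtail> \<tau>)"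
      using mfun_D[OF s x] mfun_D[OF K(1) x] .
    have "K x \<bullet> i \<bullet> zr = g (x @ [cmp \<sigma> (s x) i])" if "i \<in> N" for i
    proof -
      have "g (x @ [cmp \<sigma> (s x) i]) \<in> D \<tau>" using that x sx by (intro mfun_D[OF g]) auto
      then show ?thesis using that x sx by (simp add: K G)
    qed
    then show "elems \<tau> (?h x) = (\<Union>c \<in> elems \<sigma> (s x). elems \<tau> (g (x @ [c])))"
      using sx Kx by (auto simp: elems_brk elems_mk elems_def[of \<sigma>])
  qed
qed

lemma mfun_union:
  assumes "mfun X \<sigma> f" "mfun X \<sigma> g"
  obtains h where "mfun X \<sigma> h" "\<And>x. x \<in> Ds X \<Longrightarrow> elems \<sigma> (h x) = elems \<sigma> (f x) \<union> elems \<sigma> (g x)"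
proof
  show "mfun X \<sigma> (\<lambda>x. cat \<sigma> (f x) (g x))" using assms by (rule mfun_cat)
qed (use mfun_D assms in \<open>auto simp: elems_cat\<close>)

fun brks :: "ty list \<Rightarrow> ty \<Rightarrow> 'a \<Rightarrow> 'a list \<Rightarrow> 'a" where
  "brks (\<sigma> # Z) \<tau> Y (x # xs) = brks Z \<tau> (brk \<sigma> (arrs Z \<tau>) Y x) xs"
| "brks _ _ Y _ = Y"

lemma brks_D: "Y \<in> D (arrs Z \<tau>) \<Longrightarrow> x \<in> Ds Z \<Longrightarrow> brks Z \<tau> Y x \<in> D \<tau>"
  by (induction Z arbitrary: Y x) (auto simp: Ds_Cons)

text \<open>By \<open>elems_brk\<close> each bracket is a union over the elements of
  \<open>Y\<close>, so codes with equal elements stay interchangeable through the whole argument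
  tuple.\<close>

lemma brks_cong: "Y \<in> D (arrs Z \<tau>) \<Longrightarrow> Y' \<in> D (arrs Z \<tau>) \<Longrightarrow> x \<in> Ds Z \<Longrightarrow>
    elems (arrs Z \<tau>) Y = elems (arrs Z \<tau>) Y' \<Longrightarrow> elems \<tau> (brks Z \<tau> Y x) = elems \<tau> (brks Z \<tau> Y' x)"
proof (induction Z arbitrary: Y Y' x)
  case (Cons \<sigma> Z)
  then obtain a y where x: "x = a # y" "a \<in> D \<sigma>" "y \<in> Ds Z" by (auto simp: Ds_Cons)
  have "elems \<tau> (brks Z \<tau> (brk \<sigma> (arrs Z \<tau>) Y a) y) = elems \<tau> (brks Z \<tau> (brk \<sigma> (arrs Z \<tau>) Y' a) y)"
    using Cons.prems x by (intro Cons.IH) (auto simp: elems_brk)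
  then show ?case using x by simp
qed simp

text \<open>Each argument is abstracted and the result is wrapped as a one-element sequence, because
  a bracket unwraps one sequence per argument. The outcome agrees with \<open>f\<close> on elements,
  not as a code.\<close>

lemma mfun_curry:
  assumes "mfun (X @ Z) \<tau> f"
  obtains F where "mfun X (arrs Z \<tau>) F"
    "\<And>x z. x \<in> Ds X \<Longrightarrow> z \<in> Ds Z \<Longrightarrow> elems \<tau> (brks Z \<tau> (F x) z) = elems \<tau> (f (x @ z))"
  using assms
proof (induction Z arbitrary: X thesis)
  case Nil
  then show ?case by (intro Nil.prems(1)[of f]) auto
next
  case (Cons \<sigma> Z)
  have "mfun ((X @ [\<sigma>]) @ Z) \<tau> f" using Cons.prems(2) by simp
  then obtain F where F: "mfun (X @ [\<sigma>]) (arrs Z \<tau>) F"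
    "\<And>x z. x \<in> Ds (X @ [\<sigma>]) \<Longrightarrow> z \<in> Ds Z \<Longrightarrow> elems \<tau> (brks Z \<tau> (F x) z) = elems \<tau> (f (x @ z))"
    using Cons.IH by blast
  obtain G where G: "mfun X (\<sigma> \<rightarrowtail> arrs Z \<tau>) G"
    "\<And>x d. x \<in> Ds X \<Longrightarrow> d \<in> D \<sigma> \<Longrightarrow> G x \<bullet> d = F (x @ [d])"
    using mfun_lam[OF F(1)] by blast
  obtain H where H: "mfun X (\<sigma> \<rightarrowtail> arrs Z \<tau>) H"
    "\<And>x. x \<in> Ds X \<Longrightarrow> elems (\<sigma> \<rightarrowtail> arrs Z \<tau>) (H x) = {G x}"
    using mfun_sing[OF G(1)] by blast
  show ?case
  proof (rule Cons.prems(1)[of H])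
    show "mfun X (arrs (\<sigma> # Z) \<tau>) H" using H by simp
    fix x z assume x: "x \<in> Ds X" and "z \<in> Ds (\<sigma> # Z)"
    then obtain a y where z: "z = a # y" "a \<in> D \<sigma>" "y \<in> Ds Z" by (auto simp: Ds_Cons)
    have FD: "F (x @ [a]) \<in> D (arrs Z \<tau>)" using F(1) x z by (intro mfun_D) auto
    have HD: "H x \<in> D (\<sigma> \<rightarrowtail> arrs Z \<tau>)" using H(1) x by (rule mfun_D)
    have "elems \<tau> (brks Z \<tau> (brk \<sigma> (arrs Z \<tau>) (H x) a) y) = elems \<tau> (brks Z \<tau> (F (x @ [a])) y)"
      using HD FD z x by (intro brks_cong) (auto simp: elems_brk H G)
    then show "elems \<tau> (brks (\<sigma> # Z) \<tau> (H x) z) = elems \<tau> (f (x @ z))"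
      using F(2)[of "x @ [a]" y] x z by simp
  qed
qed

lemma mfunsI: "(\<And>x. x \<in> Ds X \<Longrightarrow> length (F x) = length Y) \<Longrightarrow>
    (\<And>i. i < length Y \<Longrightarrow> mfun X (Y ! i) (\<lambda>x. F x ! i)) \<Longrightarrow> mfuns X Y F"
  by (simp add: mfuns_def)

lemma mfuns_nth: "mfuns X Y F \<Longrightarrow> i < length Y \<Longrightarrow> mfun X (Y ! i) (\<lambda>x. F x ! i)"
  by (simp add: mfuns_def)

lemma mfuns_choice:
  assumes "\<And>i. i < length Y \<Longrightarrow> \<exists>f. mfun X (Y ! i) f \<and> (\<forall>x \<in> Ds X. P i x (f x))"
  shows "\<exists>F. mfuns X Y F \<and> (\<forall>x \<in> Ds X. \<forall>i < length Y. P i x (F x ! i))"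
proof -
  obtain f where f: "\<And>i. i < length Y \<Longrightarrow> mfun X (Y ! i) (f i) \<and> (\<forall>x \<in> Ds X. P i x (f i x))"
    using assms by metis
  then have "mfuns X Y (\<lambda>x. map (\<lambda>i. f i x) [0..<length Y])"
    by (intro mfunsI) auto
  then show ?thesis
    using f by (intro exI[of _ "\<lambda>x. map (\<lambda>i. f i x) [0..<length Y]"]) auto
qed

lemma mfuns_comp: "mfuns Y Z G \<Longrightarrow> mfuns X Y F \<Longrightarrow> mfuns X Z (\<lambda>x. G (F x))"
  using mfun_comp[of Y _ "\<lambda>y. G y ! _" X F] mfuns_D[of X Y F] by (auto simp: mfuns_def)

lemma mfuns_cong: "mfuns X Y F \<Longrightarrow> (\<And>x. x \<in> Ds X \<Longrightarrow> G x = F x) \<Longrightarrow> mfuns X Y G"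
  unfolding mfuns_def using mfun_cong[of X _ "\<lambda>x. F x ! _" "\<lambda>x. G x ! _"] by auto

lemma mfuns_slice:
  "X = X1 @ Y @ X2 \<Longrightarrow> mfuns X Y (\<lambda>x. take (length Y) (drop (length X1) x))"
proof (rule mfunsI)
  assume X: "X = X1 @ Y @ X2"
  show l: "length (take (length Y) (drop (length X1) x)) = length Y" if "x \<in> Ds X" for x
    using Ds_length[OF that] X by simp
  show "mfun X (Y ! i) (\<lambda>x. take (length Y) (drop (length X1) x) ! i)" if i: "i < length Y" for i
  proof (rule mfun_cong)
    show "mfun X (Y ! i) (\<lambda>x. x ! (length X1 + i))"
      using i X by (intro mfun_nth) (auto simp: nth_append)
    show "take (length Y) (drop (length X1) x) ! i = x ! (length X1 + i)" if "x \<in> Ds X" for x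
      using i X Ds_length[OF that] by simp
  qed
qed

lemma mfuns_take: "mfuns (X @ Y) X (take (length X))"
  using mfuns_slice[of "X @ Y" "[]" X Y] by simp

lemma mfuns_const: "y \<in> Ds Y \<Longrightarrow> mfuns X Y (\<lambda>x. y)"
  by (intro mfunsI mfun_const) (auto simp: Ds_length Ds_nth)

lemma mfuns_append: "mfuns X Y F \<Longrightarrow> mfuns X Z G \<Longrightarrow> mfuns X (Y @ Z) (\<lambda>x. F x @ G x)"
proof (rule mfunsI)
  assume F: "mfuns X Y F" and G: "mfuns X Z G"
  then show "length (F x @ G x) = length (Y @ Z)" if "x \<in> Ds X" for x
    using that by (simp add: mfuns_def)
  show "mfun X ((Y @ Z) ! i) (\<lambda>x. (F x @ G x) ! i)" if i: "i < length (Y @ Z)" for i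
  proof (cases "i < length Y")
    case True
    have "mfun X (Y ! i) (\<lambda>x. (F x @ G x) ! i)"
      using F True by (intro mfun_cong[OF mfuns_nth[OF F True]]) (auto simp: nth_append mfuns_def)
    then show ?thesis using True by (simp add: nth_append)
  next
    case False
    then have "mfun X (Z ! (i - length Y)) (\<lambda>x. G x ! (i - length Y))"
      using i by (intro mfuns_nth[OF G]) auto
    then show ?thesis using False F i
      by (auto simp: nth_append mfuns_def intro: mfun_cong)
  qed
qed

lemma mfuns_1: "mfun X \<sigma> f \<Longrightarrow> mfuns X [\<sigma>] (\<lambda>x. [f x])"
  by (auto intro!: mfunsI)

lemma mfuns_Nil [simp]: "mfuns X [] F \<longleftrightarrow> (\<forall>x \<in> Ds X. F x = [])"
  by (auto simp: mfuns_def)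

lemma mfun_brks:
  "mfun X (arrs Z \<tau>) f \<Longrightarrow> mfuns X Z G \<Longrightarrow> mfun X \<tau> (\<lambda>x. brks Z \<tau> (f x) (G x))"
proof (induction Z arbitrary: f G)
  case (Cons \<sigma> Z)
  have "mfun X \<sigma> (\<lambda>x. G x ! 0)" using mfuns_nth[OF Cons.prems(2), of 0] by simp
  then have 1: "mfun X (arrs Z \<tau>) (\<lambda>x. brk \<sigma> (arrs Z \<tau>) (f x) (G x ! 0))"
    using Cons.prems(1) by (intro mfun_brk) auto
  have 2: "mfuns X Z (\<lambda>x. tl (G x))"
  proof (rule mfunsI)
    show "length (tl (G x)) = length Z" if "x \<in> Ds X" for x
      using that Cons.prems(2) by (simp add: mfuns_def)
    show "mfun X (Z ! i) (\<lambda>x. tl (G x) ! i)" if "i < length Z" for i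
      using that Cons.prems(2) mfuns_nth[OF Cons.prems(2), of "Suc i"]
      by (auto simp: mfuns_def nth_tl intro: mfun_cong)
  qed
  show ?case
  proof (rule mfun_cong[OF Cons.IH[OF 1 2]])
    show "brks (\<sigma> # Z) \<tau> (f x) (G x) = brks Z \<tau> (brk \<sigma> (arrs Z \<tau>) (f x) (G x ! 0)) (tl (G x))"
      if "x \<in> Ds X" for x
      using mfuns_D[OF Cons.prems(2) that] by (auto simp: Ds_Cons)
  qed
qed (auto intro: mfun_cong)

text \<open>A box: the tuple is coded component by component, so all combinations of components
  belong to it. The extra combinations do no harm where candidates are only bounded from
  above.\<close>

definition elemss :: "ty list \<Rightarrow> 'a list \<Rightarrow> 'a list set" where
  "elemss Y s = {y. length y = length Y \<and> (\<forall>i < length Y. y ! i \<in> elems (Y ! i) (s ! i))}"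

lemma elemss_D: "s \<in> Ds Y \<Longrightarrow> y \<in> elemss Y s \<Longrightarrow> y \<in> Ds Y"
  by (rule DsI, simp add: elemss_def, rule subsetD[OF elems_D[OF Ds_nth]]) (auto simp: elemss_def)

definition brs :: "ty list \<Rightarrow> ty list \<Rightarrow> 'a list \<Rightarrow> 'a list \<Rightarrow> 'a list set" where
  "brs Z Y F z = {y. length y = length Y \<and>
     (\<forall>i < length Y. y ! i \<in> elems (Y ! i) (brks Z (Y ! i) (F ! i) z))}"

lemma brs_D: "F \<in> Ds (map (arrs Z) Y) \<Longrightarrow> z \<in> Ds Z \<Longrightarrow> y \<in> brs Z Y F z \<Longrightarrow> y \<in> Ds Y"
proof (rule DsI)
  assume F: "F \<in> Ds (map (arrs Z) Y)" and z: "z \<in> Ds Z" and y: "y \<in> brs Z Y F z"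
  show "length y = length Y" using y by (simp add: brs_def)
  show "y ! i \<in> D (Y ! i)" if i: "i < length Y" for i
    using elems_D[OF brks_D[of "F ! i" Z "Y ! i" z]] Ds_nth[OF F, of i] z y i
    by (auto simp: brs_def)
qed

text \<open>Contexts are lists of tuples, so that a variable \<open>g ! i\<close> stands for a whole tuple.\<close>
definition DDs :: "ty list list \<Rightarrow> 'a list list set" where
  "DDs \<Gamma> = {g. list_all2 (\<lambda>x X. x \<in> Ds X) g \<Gamma>}"

lemma DDs_Nil [simp]: "g \<in> DDs [] \<longleftrightarrow> g = []"
  and DDs_Cons: "g \<in> DDs (X # \<Gamma>) \<longleftrightarrow> (\<exists>x h. g = x # h \<and> x \<in> Ds X \<and> h \<in> DDs \<Gamma>)"
  and DDs_Cons_Cons [simp]: "x # h \<in> DDs (X # \<Gamma>) \<longleftrightarrow> x \<in> Ds X \<and> h \<in> DDs \<Gamma>"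
  and Nil_DDs [simp]: "[] \<in> DDs \<Gamma> \<longleftrightarrow> \<Gamma> = []"
  by (auto simp: DDs_def list_all2_Cons2)

lemma DDs_length: "g \<in> DDs \<Gamma> \<Longrightarrow> length g = length \<Gamma>"
  by (auto simp: DDs_def list_all2_lengthD)

lemma DDs_nth: "g \<in> DDs \<Gamma> \<Longrightarrow> i < length \<Gamma> \<Longrightarrow> g ! i \<in> Ds (\<Gamma> ! i)"
  by (auto simp: DDs_def list_all2_conv_all_nth)

lemma DDs_append [simp]: "g \<in> DDs \<Gamma> \<Longrightarrow> h \<in> DDs \<Delta> \<Longrightarrow> g @ h \<in> DDs (\<Gamma> @ \<Delta>)"
  by (auto simp: DDs_def list_all2_appendI)

lemma DDs_concat [simp]: "g \<in> DDs \<Gamma> \<Longrightarrow> concat g \<in> Ds (concat \<Gamma>)"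
  by (induction \<Gamma> arbitrary: g) (auto simp: DDs_Cons)

text \<open>Functionals of the model see one flat argument list, the concatenation of the tuples;
  the tuple structure lives in HOL alone, where it lets the rules address a whole tuple by
  \<open>g ! i\<close>.\<close>

definition mf :: "ty list list \<Rightarrow> ty list \<Rightarrow> ('a list list \<Rightarrow> 'a list) \<Rightarrow> bool" where
  "mf \<Gamma> Y F \<longleftrightarrow> (\<exists>F'. mfuns (concat \<Gamma>) Y F' \<and> (\<forall>g \<in> DDs \<Gamma>. F g = F' (concat g)))"

text \<open>\<open>S\<close> may be any family inside a box computed by functionals of the model and
  need not be definable itself. This is the sense in which candidates depend on challenges through
  functionals.\<close>

definition hb :: "ty list list \<Rightarrow> ty list \<Rightarrow> ('a list list \<Rightarrow> 'a list set) \<Rightarrow> bool" where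
  "hb \<Gamma> Y S \<longleftrightarrow> (\<exists>F. mfuns (concat \<Gamma>) Y F \<and> (\<forall>g \<in> DDs \<Gamma>. S g \<subseteq> elemss Y (F (concat g))))"

lemma mf_D: "mf \<Gamma> Y F \<Longrightarrow> g \<in> DDs \<Gamma> \<Longrightarrow> F g \<in> Ds Y"
  using mfuns_D by (auto simp: mf_def)

lemma hb_D: "hb \<Gamma> Y S \<Longrightarrow> g \<in> DDs \<Gamma> \<Longrightarrow> y \<in> S g \<Longrightarrow> y \<in> Ds Y"
  unfolding hb_def using mfuns_D elemss_D DDs_concat by blast

lemma mf_nth: "i < length \<Gamma> \<Longrightarrow> Y = \<Gamma> ! i \<Longrightarrow> mf \<Gamma> Y (\<lambda>g. g ! i)"
proof -
  assume i: "i < length \<Gamma>" and Y: "Y = \<Gamma> ! i"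
  let ?k = "length (concat (take i \<Gamma>))"
  have \<Gamma>: "\<Gamma> = take i \<Gamma> @ \<Gamma> ! i # drop (Suc i) \<Gamma>" using i by (rule id_take_nth_drop)
  have "concat \<Gamma> = concat (take i \<Gamma>) @ Y @ concat (drop (Suc i) \<Gamma>)"
    by (subst \<Gamma>) (simp add: Y)
  then have 1: "mfuns (concat \<Gamma>) Y (\<lambda>x. take (length Y) (drop ?k x))"
    by (rule mfuns_slice)
  have "g ! i = take (length Y) (drop ?k (concat g))" if g: "g \<in> DDs \<Gamma>" for g
  proof -
    have l: "length g = length \<Gamma>" using g by (rule DDs_length)
    have "g = take i g @ g ! i # drop (Suc i) g" using i l by (intro id_take_nth_drop) simp
    then have c: "concat g = concat (take i g) @ g ! i @ concat (drop (Suc i) g)"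
      by (metis concat.simps(2) concat_append)
    have "take i g \<in> DDs (take i \<Gamma>)" using g by (simp add: DDs_def)
    then have "length (concat (take i g)) = ?k" using DDs_concat Ds_length by blast
    moreover have "length (g ! i) = length Y" using DDs_nth[OF g i] Y Ds_length by blast
    ultimately show ?thesis by (simp add: c)
  qed
  with 1 show ?thesis unfolding mf_def by blast
qed

lemma mf_const: "y \<in> Ds Y \<Longrightarrow> mf \<Gamma> Y (\<lambda>g. y)"
  unfolding mf_def using mfuns_const by blast

lemma mf_append: "mf \<Gamma> Y F \<Longrightarrow> mf \<Gamma> Z G \<Longrightarrow> mf \<Gamma> (Y @ Z) (\<lambda>g. F g @ G g)"
  unfolding mf_def using mfuns_append by (metis (no_types, lifting))

lemma mf_Nil [simp]: "mf \<Gamma> [] (\<lambda>g. [])"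
  using mf_const[of "[]" "[]"] by simp

definition mfs :: "ty list list \<Rightarrow> ty list list \<Rightarrow> ('a list list \<Rightarrow> 'a list list) \<Rightarrow> bool" where
  "mfs \<Gamma> \<Delta> F \<longleftrightarrow> (\<exists>F'. mfuns (concat \<Gamma>) (concat \<Delta>) F' \<and>
     (\<forall>g \<in> DDs \<Gamma>. F g \<in> DDs \<Delta> \<and> concat (F g) = F' (concat g)))"

lemma mfs_Nil: "mfs \<Gamma> [] (\<lambda>g. [])"
  by (auto simp: mfs_def)

lemma mfs_Cons: "mf \<Gamma> X f \<Longrightarrow> mfs \<Gamma> \<Delta> F \<Longrightarrow> mfs \<Gamma> (X # \<Delta>) (\<lambda>g. f g # F g)"
proof -
  assume f: "mf \<Gamma> X f" and "mfs \<Gamma> \<Delta> F"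
  then obtain f' F' where "mfuns (concat \<Gamma>) X f'" "\<forall>g \<in> DDs \<Gamma>. f g = f' (concat g)"
    "mfuns (concat \<Gamma>) (concat \<Delta>) F'" "\<forall>g \<in> DDs \<Gamma>. F g \<in> DDs \<Delta> \<and> concat (F g) = F' (concat g)"
    by (auto simp: mf_def mfs_def)
  then show ?thesis
    unfolding mfs_def using mfuns_append mf_D[OF f]
    by (intro exI[of _ "\<lambda>x. f' x @ F' x"]) auto
qed

lemmas mfs_intros = mfs_Cons mfs_Nil

lemma hb_comp: "hb \<Delta> Y S \<Longrightarrow> mfs \<Gamma> \<Delta> F \<Longrightarrow> hb \<Gamma> Y (\<lambda>g. S (F g))"
proof -
  assume "hb \<Delta> Y S" "mfs \<Gamma> \<Delta> F"
  then obtain G F' where "mfuns (concat \<Delta>) Y G" "\<forall>g \<in> DDs \<Delta>. S g \<subseteq> elemss Y (G (concat g))"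
    "mfuns (concat \<Gamma>) (concat \<Delta>) F'" "\<forall>g \<in> DDs \<Gamma>. F g \<in> DDs \<Delta> \<and> concat (F g) = F' (concat g)"
    by (auto simp: hb_def mfs_def)
  then show ?thesis
    unfolding hb_def using mfuns_comp[of "concat \<Delta>" Y G "concat \<Gamma>" F']
    by (intro exI[of _ "\<lambda>x. G (F' x)"]) (metis (no_types, lifting))
qed

lemma mf_comp: "mf \<Delta> Y S \<Longrightarrow> mfs \<Gamma> \<Delta> F \<Longrightarrow> mf \<Gamma> Y (\<lambda>g. S (F g))"
proof -
  assume "mf \<Delta> Y S" "mfs \<Gamma> \<Delta> F"
  then obtain G F' where "mfuns (concat \<Delta>) Y G" "\<forall>g \<in> DDs \<Delta>. S g = G (concat g)"
    "mfuns (concat \<Gamma>) (concat \<Delta>) F'" "\<forall>g \<in> DDs \<Gamma>. F g \<in> DDs \<Delta> \<and> concat (F g) = F' (concat g)"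
    by (auto simp: mf_def mfs_def)
  then show ?thesis
    unfolding mf_def using mfuns_comp[of "concat \<Delta>" Y G "concat \<Gamma>" F']
    by (intro exI[of _ "\<lambda>x. G (F' x)"]) (metis (no_types, lifting))
qed

lemma hb_mono: "hb \<Gamma> Y S \<Longrightarrow> (\<And>g. g \<in> DDs \<Gamma> \<Longrightarrow> T g \<subseteq> S g) \<Longrightarrow> hb \<Gamma> Y T"
  unfolding hb_def by (meson subset_trans)

lemma hb_sing: "mf \<Gamma> Y F \<Longrightarrow> hb \<Gamma> Y (\<lambda>g. {F g})"
proof -
  assume "mf \<Gamma> Y F"
  then obtain F' where F': "mfuns (concat \<Gamma>) Y F'" "\<And>g. g \<in> DDs \<Gamma> \<Longrightarrow> F g = F' (concat g)"
    by (auto simp: mf_def)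
  have "\<exists>f. mfun (concat \<Gamma>) (Y ! i) f \<and> (\<forall>x \<in> Ds (concat \<Gamma>). F' x ! i \<in> elems (Y ! i) (f x))"
    if "i < length Y" for i
    by (rule mfun_sing[OF mfuns_nth[OF F'(1) that]]) auto
  from mfuns_choice[OF this] obtain G where "mfuns (concat \<Gamma>) Y G"
    "\<And>x i. x \<in> Ds (concat \<Gamma>) \<Longrightarrow> i < length Y \<Longrightarrow> F' x ! i \<in> elems (Y ! i) (G x ! i)"
    by blast
  moreover have "length (F' (concat g)) = length Y" if "g \<in> DDs \<Gamma>" for g
    using F'(1) that by (simp add: mfuns_def)
  ultimately show ?thesis using F'(2) unfolding hb_def elemss_def by (intro exI[of _ G]) auto
qed

lemma hb_elemss: "mf \<Gamma> Y F \<Longrightarrow> hb \<Gamma> Y (\<lambda>g. elemss Y (F g))"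
  by (auto simp: mf_def hb_def)

lemma hb_elemssD: "hb \<Gamma> Y S \<Longrightarrow> \<exists>F. mf \<Gamma> Y F \<and> (\<forall>g \<in> DDs \<Gamma>. S g \<subseteq> elemss Y (F g))"
  by (auto simp: mf_def hb_def)

lemma hb_union: "hb \<Gamma> Y S \<Longrightarrow> hb \<Gamma> Y T \<Longrightarrow> hb \<Gamma> Y (\<lambda>g. S g \<union> T g)"
proof -
  assume "hb \<Gamma> Y S" "hb \<Gamma> Y T"
  then obtain F G where F: "mfuns (concat \<Gamma>) Y F" "\<And>g. g \<in> DDs \<Gamma> \<Longrightarrow> S g \<subseteq> elemss Y (F (concat g))"
    and G: "mfuns (concat \<Gamma>) Y G" "\<And>g. g \<in> DDs \<Gamma> \<Longrightarrow> T g \<subseteq> elemss Y (G (concat g))"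
    by (auto simp: hb_def)
  have "\<exists>f. mfun (concat \<Gamma>) (Y ! i) f \<and> (\<forall>x \<in> Ds (concat \<Gamma>).
      elems (Y ! i) (f x) = elems (Y ! i) (F x ! i) \<union> elems (Y ! i) (G x ! i))"
    if "i < length Y" for i
    by (rule mfun_union[OF mfuns_nth[OF F(1) that] mfuns_nth[OF G(1) that]]) auto
  from mfuns_choice[OF this] obtain H where "mfuns (concat \<Gamma>) Y H"
    "\<And>x i. x \<in> Ds (concat \<Gamma>) \<Longrightarrow> i < length Y \<Longrightarrow>
      elems (Y ! i) (H x ! i) = elems (Y ! i) (F x ! i) \<union> elems (Y ! i) (G x ! i)"
    by blast
  then show ?thesis using F G unfolding hb_def elemss_def by (intro exI[of _ H]) fastforce
qed

text \<open>Induction from the right end of the tuple: \<open>mfun_UN\<close> unites over the last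
  component with the earlier ones as parameters, then the induction hypothesis treats those.\<close>

lemma mfun_UNs:
  assumes "mfuns X Y F" "mfun (X @ Y) \<tau> g"
  shows "\<exists>h. mfun X \<tau> h \<and> (\<forall>x \<in> Ds X. \<forall>y \<in> elemss Y (F x). elems \<tau> (g (x @ y)) \<subseteq> elems \<tau> (h x))"
  using assms
proof (induction Y arbitrary: F g rule: rev_induct)
  case Nil
  then show ?case by (intro exI[of _ g]) (auto simp: elemss_def)
next
  case (snoc \<sigma> Y)
  have last: "mfun X \<sigma> (\<lambda>x. F x ! length Y)" using mfuns_nth[OF snoc.prems(1), of "length Y"] by simp
  then have "mfun (X @ Y) \<sigma> (\<lambda>z. F (take (length X) z) ! length Y)"
    by (rule mfun_comp) (rule mfuns_take)
  moreover have "mfun ((X @ Y) @ [\<sigma>]) \<tau> g" using snoc.prems(2) by simp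
  ultimately obtain h where h: "mfun (X @ Y) \<tau> h" "\<And>z. z \<in> Ds (X @ Y) \<Longrightarrow> elems \<tau> (h z) =
      (\<Union>c \<in> elems \<sigma> (F (take (length X) z) ! length Y). elems \<tau> (g (z @ [c])))"
    by (rule mfun_UN) blast
  have F': "mfuns X Y (\<lambda>x. take (length Y) (F x))"
    using mfuns_comp[OF mfuns_take snoc.prems(1)] .
  obtain k where k: "mfun X \<tau> k"
    "\<And>x y. x \<in> Ds X \<Longrightarrow> y \<in> elemss Y (take (length Y) (F x)) \<Longrightarrow> elems \<tau> (h (x @ y)) \<subseteq> elems \<tau> (k x)"
    using snoc.IH[OF F' h(1)] by blast
  have "elems \<tau> (g (x @ y)) \<subseteq> elems \<tau> (k x)" if x: "x \<in> Ds X" and y: "y \<in> elemss (Y @ [\<sigma>]) (F x)" for x y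
  proof -
    let ?y = "take (length Y) y" and ?c = "y ! length Y"
    have len: "length y = Suc (length Y)" using y by (simp add: elemss_def)
    then have y': "y = ?y @ [?c]" by (metis lessI order_refl take_Suc_conv_app_nth take_all)
    have yi: "y ! i \<in> elems ((Y @ [\<sigma>]) ! i) (F x ! i)" if "i < Suc (length Y)" for i
      using y that by (auto simp: elemss_def)
    have c: "?c \<in> elems \<sigma> (F x ! length Y)" using yi[of "length Y"] by simp
    have "?y \<in> elemss Y (take (length Y) (F x))"
      unfolding elemss_def
    proof (intro CollectI conjI allI impI)
      fix i assume i: "i < length Y"
      then show "take (length Y) y ! i \<in> elems (Y ! i) (take (length Y) (F x) ! i)"
        using yi[of i] by (simp add: nth_append)
    qed (use len in simp)
    moreover from this have "?y \<in> Ds Y" using elemss_D mfuns_D[OF F' x] by blast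
    then have "elems \<tau> (g (x @ ?y @ [?c])) \<subseteq> elems \<tau> (h (x @ ?y))"
      using x c Ds_length[OF x] by (subst h) auto
    ultimately show ?thesis using k(2)[OF x] y' by force
  qed
  with k(1) show ?case by blast
qed

text \<open>The central closure property: it collects the answers to all challenges from a bounded
  set, when the answers to each challenge are bounded uniformly.\<close>

lemma hb_UN:
  assumes S: "hb \<Gamma> Y S" and T: "hb (\<Gamma> @ [Y]) Z T"
  shows "hb \<Gamma> Z (\<lambda>g. \<Union>y \<in> S g. T (g @ [y]))"
proof -
  let ?X = "concat \<Gamma>"
  obtain F where F: "mfuns ?X Y F" "\<And>g. g \<in> DDs \<Gamma> \<Longrightarrow> S g \<subseteq> elemss Y (F (concat g))"
    using S by (auto simp: hb_def)
  obtain G where G: "mfuns (?X @ Y) Z G"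
    "\<And>g. g \<in> DDs (\<Gamma> @ [Y]) \<Longrightarrow> T g \<subseteq> elemss Z (G (concat g))"
    using T by (auto simp: hb_def)
  have "\<exists>h. mfun ?X (Z ! i) h \<and> (\<forall>x \<in> Ds ?X. \<forall>y \<in> elemss Y (F x).
      elems (Z ! i) (G (x @ y) ! i) \<subseteq> elems (Z ! i) (h x))" if "i < length Z" for i
    by (rule mfun_UNs[OF F(1) mfuns_nth[OF G(1) that]])
  from mfuns_choice[OF this] obtain H where H: "mfuns ?X Z H" "\<And>x i. x \<in> Ds ?X \<Longrightarrow> i < length Z \<Longrightarrow>
      \<forall>y \<in> elemss Y (F x). elems (Z ! i) (G (x @ y) ! i) \<subseteq> elems (Z ! i) (H x ! i)"
    by blast
  have "(\<Union>y \<in> S g. T (g @ [y])) \<subseteq> elemss Z (H (concat g))" if g: "g \<in> DDs \<Gamma>" for g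
  proof (rule UN_least)
    fix y assume y: "y \<in> S g"
    then have "y \<in> elemss Y (F (concat g))" using F(2) g by blast
    moreover have "y \<in> Ds Y" using hb_D[OF S g y] .
    then have "T (g @ [y]) \<subseteq> elemss Z (G (concat g @ y))" using G(2)[of "g @ [y]"] g by simp
    moreover have "elems (Z ! i) (G (concat g @ y) ! i) \<subseteq> elems (Z ! i) (H (concat g) ! i)"
      if "i < length Z" for i using H(2) DDs_concat[OF g] that calculation(1) by blast
    ultimately show "T (g @ [y]) \<subseteq> elemss Z (H (concat g))"
      unfolding elemss_def by blast
  qed
  with H(1) show ?thesis unfolding hb_def by blast
qed

lemma hb_append:
  assumes "hb \<Gamma> Y S" "hb \<Gamma> Z T"
  shows "hb \<Gamma> (Y @ Z) (\<lambda>g. {y @ z | y z. y \<in> S g \<and> z \<in> T g})"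
proof -
  obtain F where F: "mf \<Gamma> Y F" "\<And>g. g \<in> DDs \<Gamma> \<Longrightarrow> S g \<subseteq> elemss Y (F g)"
    using hb_elemssD[OF assms(1)] by blast
  obtain G where G: "mf \<Gamma> Z G" "\<And>g. g \<in> DDs \<Gamma> \<Longrightarrow> T g \<subseteq> elemss Z (G g)"
    using hb_elemssD[OF assms(2)] by blast
  have "y @ z \<in> elemss (Y @ Z) (F g @ G g)"
    if "g \<in> DDs \<Gamma>" "y \<in> elemss Y (F g)" "z \<in> elemss Z (G g)" for g y z
    using that Ds_length[OF mf_D[OF F(1)]] by (auto simp: elemss_def nth_append)
  then show ?thesis
    using F(2) G(2) by (intro hb_mono[OF hb_elemss[OF mf_append[OF F(1) G(1)]]]) blast
qed

text \<open>The passage from answers depending on \<open>z\<close> to a strategy: tuples like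
  \<open>F\<close> are what the clauses for negation and for the existential quantifiers range over.
  The functionals come from \<open>mfun_curry\<close>.\<close>

lemma hb_curry:
  assumes "hb (\<Gamma> @ [Z]) Y S"
  obtains F where "mf \<Gamma> (map (arrs Z) Y) F"
    "\<And>g z. g \<in> DDs \<Gamma> \<Longrightarrow> z \<in> Ds Z \<Longrightarrow> S (g @ [z]) \<subseteq> brs Z Y (F g) z"
proof -
  let ?X = "concat \<Gamma>"
  obtain G where G: "mfuns (?X @ Z) Y G"
    "\<And>g. g \<in> DDs (\<Gamma> @ [Z]) \<Longrightarrow> S g \<subseteq> elemss Y (G (concat g))"
    using assms by (auto simp: hb_def)
  have "\<exists>f. mfun ?X (map (arrs Z) Y ! i) f \<and> (\<forall>x \<in> Ds ?X. \<forall>z \<in> Ds Z.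
      elems (Y ! i) (brks Z (Y ! i) (f x) z) = elems (Y ! i) (G (x @ z) ! i))"
    if i: "i < length (map (arrs Z) Y)" for i
  proof -
    obtain f where "mfun ?X (arrs Z (Y ! i)) f" "\<And>x z. x \<in> Ds ?X \<Longrightarrow> z \<in> Ds Z \<Longrightarrow>
        elems (Y ! i) (brks Z (Y ! i) (f x) z) = elems (Y ! i) (G (x @ z) ! i)"
      using i mfun_curry[OF mfuns_nth[OF G(1), of i]] by (metis length_map)
    then show ?thesis using i by (intro exI[of _ f]) simp
  qed
  from mfuns_choice[OF this] obtain F where F: "mfuns ?X (map (arrs Z) Y) F"
    "\<And>x i. x \<in> Ds ?X \<Longrightarrow> i < length (map (arrs Z) Y) \<Longrightarrow> \<forall>z \<in> Ds Z.
      elems (Y ! i) (brks Z (Y ! i) (F x ! i) z) = elems (Y ! i) (G (x @ z) ! i)"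
    by blast
  show ?thesis
  proof (rule that[of "\<lambda>g. F (concat g)"])
    show "mf \<Gamma> (map (arrs Z) Y) (\<lambda>g. F (concat g))" using F(1) by (auto simp: mf_def)
    show "S (g @ [z]) \<subseteq> brs Z Y (F (concat g)) z" if "g \<in> DDs \<Gamma>" "z \<in> Ds Z" for g z
      using G(2)[of "g @ [z]"] F(2)[of "concat g"] that by (auto simp: elemss_def brs_def)
  qed
qed

text \<open>Brackets are computed by closed terms, so playing a strategy against a challenge stays
  within \<open>hb\<close>.\<close>

lemma hb_brs:
  assumes "mf \<Gamma> (map (arrs Z) Y) F" "mf \<Gamma> Z G"
  shows "hb \<Gamma> Y (\<lambda>g. brs Z Y (F g) (G g))"
proof -
  let ?X = "concat \<Gamma>"
  obtain F' where F': "mfuns ?X (map (arrs Z) Y) F'" "\<And>g. g \<in> DDs \<Gamma> \<Longrightarrow> F g = F' (concat g)"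
    using assms(1) by (auto simp: mf_def)
  obtain G' where G': "mfuns ?X Z G'" "\<And>g. g \<in> DDs \<Gamma> \<Longrightarrow> G g = G' (concat g)"
    using assms(2) by (auto simp: mf_def)
  let ?H = "\<lambda>x. map (\<lambda>i. brks Z (Y ! i) (F' x ! i) (G' x)) [0..<length Y]"
  have "mfuns ?X Y ?H"
    using G'(1) mfuns_nth[OF F'(1)] by (intro mfunsI) (auto intro!: mfun_brks)
  moreover have "brs Z Y (F g) (G g) \<subseteq> elemss Y (?H (concat g))" if "g \<in> DDs \<Gamma>" for g
    using F'(2) G'(2) that by (auto simp: brs_def elemss_def)
  ultimately show ?thesis unfolding hb_def by blast
qed

end

section \<open>Realizability\<close>

text \<open>The types of the two tuples depend on the formula alone, not on the variables chosen by
  \<open>Sst\<close>, so realizability can be developed without bookkeeping of names.\<close>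

fun SX :: "fm \<Rightarrow> ty list" and SY :: "fm \<Rightarrow> ty list" where
  "SX (Eq s t) = []"
| "SX (St t) = []"
| "SX (Neg A) = map (arrs (SX A)) (SY A)"
| "SX (Disj A B) = SX A @ SX B"
| "SX (Conj A B) = SX A @ SX B"
| "SX (Forall z A) = SX A"
| "SX (Exists z A) = map (arrs (map (arrs (SX A)) (SY A))) (SX A)"
| "SX (ForallSt z A) = SX A @ [snd z]"
| "SX (ExistsSt z A) = map (arrs (snd z # map (arrs (SX A)) (SY A))) (SX A)"
| "SY (Eq s t) = []"
| "SY (St t) = [ty_of t]"
| "SY (Neg A) = SX A"
| "SY (Disj A B) = SY A @ SY B"
| "SY (Conj A B) = SY A @ SY B"
| "SY (Forall z A) = SY A"
| "SY (Exists z A) = map (arrs (SX A)) (SY A)"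
| "SY (ForallSt z A) = SY A"
| "SY (ExistsSt z A) = map (arrs (SX A)) (SY A) @ [snd z]"

lemma SX_SY_subst [simp]:
  "wsubst s \<Longrightarrow> SX (subst s A) = SX A" "wsubst s \<Longrightarrow> SY (subst s A) = SY A"
  by (induction A arbitrary: s) (simp_all add: Let_def)

lemma SX_SY_internal [simp]: "internal A \<Longrightarrow> SX A = []" "internal A \<Longrightarrow> SY A = []"
  by (induction A) auto

context epa_model
begin

text \<open>The truth of the matrix of the interpretation of a formula for given values of the tuples.\<close>
fun SR :: "fm \<Rightarrow> (var \<Rightarrow> 'a) \<Rightarrow> 'a list \<Rightarrow> 'a list \<Rightarrow> bool" where
  "SR (Eq s t) e x y \<longleftrightarrow> val e s = val e t"
| "SR (St t) e x y \<longleftrightarrow> val e t = y ! 0"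
| "SR (Neg A) e Y x \<longleftrightarrow> (\<forall>y \<in> brs (SX A) (SY A) Y x. \<not> SR A e x y)"
| "SR (Disj A B) e x y \<longleftrightarrow> SR A e (take (length (SX A)) x) (take (length (SY A)) y) \<or>
     SR B e (drop (length (SX A)) x) (drop (length (SY A)) y)"
| "SR (Conj A B) e x y \<longleftrightarrow> SR A e (take (length (SX A)) x) (take (length (SY A)) y) \<and>
     SR B e (drop (length (SX A)) x) (drop (length (SY A)) y)"
| "SR (Forall z A) e x y' \<longleftrightarrow> (\<forall>d \<in> D (snd z). \<exists>y \<in> elemss (SY A) y'. SR A (e(z := d)) x y)"
| "SR (Exists z A) e X Y \<longleftrightarrow> (\<exists>d \<in> D (snd z). \<forall>x \<in> brs (map (arrs (SX A)) (SY A)) (SX A) X Y.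
     \<exists>y \<in> brs (SX A) (SY A) Y x. SR A (e(z := d)) x y)"
| "SR (ForallSt z A) e x y \<longleftrightarrow>
     SR A (e(z := x ! length (SX A))) (take (length (SX A)) x) y"
| "SR (ExistsSt z A) e X Y \<longleftrightarrow> (let w = Y ! length (SY A); Y' = take (length (SY A)) Y in
     \<forall>x \<in> brs (snd z # map (arrs (SX A)) (SY A)) (SX A) X (w # Y').
     \<exists>y \<in> brs (SX A) (SY A) Y' x. SR A (e(z := w)) x y)"

lemma SR_cong: "(\<And>v. v \<in> fv A \<Longrightarrow> e v = e' v) \<Longrightarrow> SR A e x y = SR A e' x y"
proof (induction A arbitrary: e e' x y)
  case (Eq s t)
  then have "val e s = val e' s" "val e t = val e' t" by (auto intro!: val_cong)
  then show ?case by simp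
next
  case (St t)
  then have "val e t = val e' t" by (auto intro!: val_cong)
  then show ?case by simp
next
  case (Neg A)
  have "SR A e x y = SR A e' x y" for x y using Neg.prems by (intro Neg.IH) auto
  then show ?case by simp
next
  case (Disj A B)
  have "SR A e x y = SR A e' x y" "SR B e x y = SR B e' x y" for x y
    using Disj.prems by (auto intro!: Disj.IH)
  then show ?case by simp
next
  case (Conj A B)
  have "SR A e x y = SR A e' x y" "SR B e x y = SR B e' x y" for x y
    using Conj.prems by (auto intro!: Conj.IH)
  then show ?case by simp
next
  case (Forall z A)
  have "SR A (e(z := d)) x y = SR A (e'(z := d)) x y" for d x y
    using Forall.prems by (intro Forall.IH) auto
  then show ?case by simp
next
  case (Exists z A)
  have "SR A (e(z := d)) x y = SR A (e'(z := d)) x y" for d x y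
    using Exists.prems by (intro Exists.IH) auto
  then show ?case by simp
next
  case (ForallSt z A)
  have "SR A (e(z := d)) x y = SR A (e'(z := d)) x y" for d x y
    using ForallSt.prems by (intro ForallSt.IH) auto
  then show ?case by simp
next
  case (ExistsSt z A)
  have "SR A (e(z := d)) x y = SR A (e'(z := d)) x y" for d x y
    using ExistsSt.prems by (intro ExistsSt.IH) auto
  then show ?case by simp
qed

lemma SR_upd [simp]: "z \<notin> fv A \<Longrightarrow> SR A (e(z := d)) x y = SR A e x y"
  by (rule SR_cong) auto

lemma SR_subst: "wsubst s \<Longrightarrow> SR (subst s A) e x y = SR A (\<lambda>v. val e (s v)) x y"
proof (induction A arbitrary: s e x y)
  have bind: "SR (subst (s(z := V (rebind s z A))) A) (e(rebind s z A := d)) x y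
      = SR A ((\<lambda>v. val e (s v))(z := d)) x y"
    if IH: "\<And>s e x y. wsubst s \<Longrightarrow> SR (subst s A) e x y = SR A (\<lambda>v. val e (s v)) x y"
      and s: "wsubst s" for A z s e d x y
  proof -
    have "SR A (\<lambda>v. val (e(rebind s z A := d)) ((s(z := V (rebind s z A))) v)) x y
        = SR A ((\<lambda>v. val e (s v))(z := d)) x y"
      by (rule SR_cong) (rule val_rebind)
    then show ?thesis using s by (subst IH) auto
  qed
  {
    case (Forall z A)
    show ?case using bind[OF Forall.IH Forall.prems] Forall.prems by (simp add: Let_def)
  next
    case (Exists z A)
    show ?case using bind[OF Exists.IH Exists.prems] Exists.prems by (simp add: Let_def)
  next
    case (ForallSt z A)
    show ?case using bind[OF ForallSt.IH ForallSt.prems] ForallSt.prems by (simp add: Let_def)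
  next
    case (ExistsSt z A)
    show ?case using bind[OF ExistsSt.IH ExistsSt.prems] ExistsSt.prems by (simp add: Let_def)
  }
qed (simp_all add: val_substt)

lemma SR_subst1: "wt t \<Longrightarrow> ty_of t = snd z \<Longrightarrow> SR (subst1 A z t) e x y = SR A (e(z := val e t)) x y"
proof -
  assume "wt t" "ty_of t = snd z"
  moreover have "(\<lambda>v. val e ((V(z := t)) v)) = e(z := val e t)" by auto
  ultimately show ?thesis by (simp add: SR_subst)
qed

lemma brs_Nil [simp]: "brs Z [] F z = {[]}"
  by (auto simp: brs_def)

lemma brs_Nil1 [simp]: "brs [] Y F [] = elemss Y F"
  by (auto simp: brs_def elemss_def)

lemma elemss_Nil [simp]: "elemss [] y = {[]}"
  by (auto simp: elemss_def)

lemma elemss_1 [simp]: "elemss [\<sigma>] y = {[c] | c. c \<in> elems \<sigma> (y ! 0)}"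
  by (auto simp: elemss_def length_Suc_conv)

lemma SR_internal: "internal A \<Longrightarrow> SR A e [] [] \<longleftrightarrow> sat e A"
  by (induction A arbitrary: e) auto

text \<open>The candidates are fixed before the environment \<open>e\<close>. This mirrors the order
  of \<open>t\<close> and the free variables in the conclusion, and it is what the rule introducing
  \<open>Forall\<close> exploits.\<close>

definition realizes :: "fm \<Rightarrow> ('a list list \<Rightarrow> 'a list set) \<Rightarrow> bool" where
  "realizes A S \<longleftrightarrow> (\<forall>e. env e \<longrightarrow> (\<forall>x \<in> Ds (SX A). \<exists>y \<in> S [x]. SR A e x y))"

definition valid :: "fm \<Rightarrow> bool" where
  "valid A \<longleftrightarrow> (\<exists>S. hb [SX A] (SY A) S \<and> realizes A S)"

section \<open>Contexts extended by one tuple, and parts of tuples\<close>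

lemma mf_last: "mf (\<Gamma> @ [Y]) Y last"
proof -
  have 1: "mf (\<Gamma> @ [Y]) Y (\<lambda>g. g ! length \<Gamma>)" by (intro mf_nth) auto
  have "last g = g ! length \<Gamma>" if "g \<in> DDs (\<Gamma> @ [Y])" for g
    using DDs_length[OF that] by (cases "g = []") (auto simp: last_conv_nth)
  with 1 show ?thesis by (simp add: mf_def)
qed

lemma mf_weaken: "mf \<Gamma> Y F \<Longrightarrow> mf (\<Gamma> @ [X]) Y (\<lambda>h. F (butlast h))"
proof -
  assume "mf \<Gamma> Y F"
  then obtain F' where F': "mfuns (concat \<Gamma>) Y F'" "\<And>g. g \<in> DDs \<Gamma> \<Longrightarrow> F g = F' (concat g)"
    by (auto simp: mf_def)
  have "mfuns (concat (\<Gamma> @ [X])) Y (\<lambda>x. F' (take (length (concat \<Gamma>)) x))"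
    using mfuns_comp[OF F'(1) mfuns_take] by simp
  moreover have "F (butlast h) = F' (take (length (concat \<Gamma>)) (concat h))" if hX: "h \<in> DDs (\<Gamma> @ [X])" for h
  proof -
    obtain g x where h: "h = g @ [x]" "g \<in> DDs \<Gamma>"
      using hX by (auto simp: DDs_def list_all2_append2 list_all2_Cons2)
    then show ?thesis using F'(2) Ds_length[OF DDs_concat[OF h(2)]] by simp
  qed
  ultimately show ?thesis unfolding mf_def by blast
qed

lemma hb_UN':
  assumes "hb \<Gamma> Y S" "hb (\<Gamma> @ [Y]) Z (\<lambda>h. T (butlast h) (last h))"
  shows "hb \<Gamma> Z (\<lambda>g. \<Union>y \<in> S g. T g y)"
  using hb_UN[OF assms] by simp

lemma mf_take: "mf \<Gamma> (Y @ Z) F \<Longrightarrow> mf \<Gamma> Y (\<lambda>g. take (length Y) (F g))"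
  and mf_drop: "mf \<Gamma> (Y @ Z) F \<Longrightarrow> mf \<Gamma> Z (\<lambda>g. drop (length Y) (F g))"
proof -
  assume "mf \<Gamma> (Y @ Z) F"
  then obtain F' where F': "mfuns (concat \<Gamma>) (Y @ Z) F'" "\<And>g. g \<in> DDs \<Gamma> \<Longrightarrow> F g = F' (concat g)"
    by (auto simp: mf_def)
  show "mf \<Gamma> Y (\<lambda>g. take (length Y) (F g))"
    using mfuns_comp[OF mfuns_take F'(1)] F'(2) unfolding mf_def by auto
  have "mfuns (Y @ Z) Z (drop (length Y))"
    using mfuns_slice[of "Y @ Z" Y Z "[]"] by (rule mfuns_cong) (auto dest: Ds_length)
  then show "mf \<Gamma> Z (\<lambda>g. drop (length Y) (F g))"
    unfolding mf_def using mfuns_comp[OF _ F'(1)] F'(2)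
    by (intro exI[of _ "\<lambda>x. drop (length Y) (F' x)"]) auto
qed

lemma hb_image: "hb \<Gamma> Y S \<Longrightarrow> mf [Y] Z F \<Longrightarrow> hb \<Gamma> Z (\<lambda>g. (\<lambda>y. F [y]) ` S g)"
  using hb_UN'[of \<Gamma> Y S Z "\<lambda>g y. {F [y]}"] hb_sing[OF mf_comp[of "[Y]" Z F, OF _ mfs_Cons[OF mf_last mfs_Nil]]]
  by (simp add: UNION_singleton_eq_range)

lemma hb_take: "hb \<Gamma> (Y @ Z) S \<Longrightarrow> hb \<Gamma> Y (\<lambda>g. take (length Y) ` S g)"
  using hb_image[of \<Gamma> "Y @ Z" S Y "\<lambda>g. take (length Y) (g ! 0)"] mf_take[OF mf_nth[of 0 "[Y @ Z]"]]
  by simp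

lemma hb_drop: "hb \<Gamma> (Y @ Z) S \<Longrightarrow> hb \<Gamma> Z (\<lambda>g. drop (length Y) ` S g)"
  using hb_image[of \<Gamma> "Y @ Z" S Z "\<lambda>g. drop (length Y) (g ! 0)"] mf_drop[OF mf_nth[of 0 "[Y @ Z]"]]
  by simp

text \<open>The sequent form of a disjunction: the candidates of the two sides are kept apart,
  though each may depend on both challenges. In the rules below the left disjunct mostly serves as a
  side formula.\<close>

definition rdisj :: "fm \<Rightarrow> fm \<Rightarrow> ('a list list \<Rightarrow> 'a list set) \<Rightarrow> ('a list list \<Rightarrow> 'a list set) \<Rightarrow> bool" where
  "rdisj A B S T \<longleftrightarrow> hb [SX A, SX B] (SY A) S \<and> hb [SX A, SX B] (SY B) T \<and>
    (\<forall>e. env e \<longrightarrow> (\<forall>a \<in> Ds (SX A). \<forall>b \<in> Ds (SX B).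
      \<exists>y \<in> S [a, b]. \<exists>v \<in> T [a, b]. SR A e a y \<or> SR B e b v))"

text \<open>From right to left all pairs of candidates are concatenated, by
  \<open>hb_append\<close>; from left to right candidates are cut at the length of
  \<open>SY A\<close>. The cut loses nothing, since both halves of a successful tuple remain
  available.\<close>

lemma valid_Disj: "valid (Disj A B) \<longleftrightarrow> (\<exists>S T. rdisj A B S T)"
proof
  let ?n = "length (SX A)" and ?m = "length (SY A)"
  {
    assume "valid (Disj A B)"
    then obtain S where S: "hb [SX A @ SX B] (SY A @ SY B) S" "realizes (Disj A B) S"
      by (auto simp: valid_def)
    have "mfs [SX A, SX B] [SX A @ SX B] (\<lambda>g. [g ! 0 @ g ! 1])"
      by (intro mfs_intros mf_append mf_nth) auto
    then have S': "hb [SX A, SX B] (SY A @ SY B) (\<lambda>g. S [g ! 0 @ g ! 1])"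
      by (rule hb_comp[OF S(1)])
    have "\<exists>y \<in> S [a @ b]. SR A e a (take ?m y) \<or> SR B e b (drop ?m y)"
      if "env e" "a \<in> Ds (SX A)" "b \<in> Ds (SX B)" for e a b
    proof -
      have "\<exists>y \<in> S [a @ b]. SR (Disj A B) e (a @ b) y"
        using S(2) that unfolding realizes_def by (simp del: SR.simps)
      then show ?thesis using Ds_length[OF that(2)] by simp
    qed
    then have "rdisj A B (\<lambda>g. take ?m ` S [g ! 0 @ g ! 1]) (\<lambda>g. drop ?m ` S [g ! 0 @ g ! 1])"
      using hb_take[OF S'] hb_drop[OF S'] unfolding rdisj_def by fastforce
    then show "\<exists>S T. rdisj A B S T" by blast
  next
    assume "\<exists>S T. rdisj A B S T"
    then obtain S T where ST: "rdisj A B S T" by blast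
    let ?S = "\<lambda>g. S [take ?n (g ! 0), drop ?n (g ! 0)]"
    let ?T = "\<lambda>g. T [take ?n (g ! 0), drop ?n (g ! 0)]"
    let ?U = "\<lambda>g. {y @ v | y v. y \<in> ?S g \<and> v \<in> ?T g}"
    have "mfs [SX A @ SX B] [SX A, SX B] (\<lambda>g. [take ?n (g ! 0), drop ?n (g ! 0)])"
      by (intro mfs_intros mf_take mf_drop mf_nth) auto
    then have "hb [SX A @ SX B] (SY A) ?S" "hb [SX A @ SX B] (SY B) ?T"
      using ST hb_comp unfolding rdisj_def by blast+
    then have "hb [SX A @ SX B] (SY A @ SY B) ?U" by (rule hb_append)
    moreover have "realizes (Disj A B) ?U"
      unfolding realizes_def
    proof (intro allI impI ballI)
      fix e x assume e: "env e" and "x \<in> Ds (SX (Disj A B))"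
      then obtain a b where x: "x = a @ b" "a \<in> Ds (SX A)" "b \<in> Ds (SX B)"
        by (auto elim: Ds_appendE)
      then obtain y v where y: "y \<in> S [a, b]" "v \<in> T [a, b]" "SR A e a y \<or> SR B e b v"
        using ST e unfolding rdisj_def by blast
      have "y \<in> Ds (SY A)" using ST x y(1) hb_D[of "[SX A, SX B]" "SY A" S "[a, b]" y]
        unfolding rdisj_def by simp
      then have "SR (Disj A B) e x (y @ v)"
        using y(3) x Ds_length[OF x(2)] Ds_length[of y "SY A"] by simp
      moreover have "y @ v \<in> ?U [x]" using y x Ds_length[OF x(2)] by auto
      ultimately show "\<exists>y \<in> ?U [x]. SR (Disj A B) e x y" by blast
    qed
    ultimately show "valid (Disj A B)" by (auto simp: valid_def)
  }
qed

lemma valid_DisjI: "rdisj A B S T \<Longrightarrow> valid (Disj A B)"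
  using valid_Disj by blast

lemma valid_DisjD: "valid (Disj A B) \<Longrightarrow> \<exists>S T. hb [SX A, SX B] (SY A) S \<and>
    hb [SX A, SX B] (SY B) T \<and>
    (\<forall>e a b. env e \<longrightarrow> a \<in> Ds (SX A) \<longrightarrow> b \<in> Ds (SX B) \<longrightarrow>
      (\<exists>y \<in> S [a, b]. \<exists>v \<in> T [a, b]. SR A e a y \<or> SR B e b v))"
  unfolding valid_Disj rdisj_def by blast

lemma valid_assoc: "valid (Disj (Disj A B) C) \<longleftrightarrow> valid (Disj A (Disj B C))"
proof -
  have "SR (Disj (Disj A B) C) e x y = SR (Disj A (Disj B C)) e x y" for e x y
    by (simp add: drop_take add.commute)
  then show ?thesis by (simp add: valid_def realizes_def del: SR.simps)
qed

lemma valid_comm: "valid (Disj A B) \<Longrightarrow> valid (Disj B A)"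
proof -
  assume AB: "valid (Disj A B)"
  obtain S T where *: "hb [SX A, SX B] (SY A) S" "hb [SX A, SX B] (SY B) T"
    "\<And>e a b. env e \<Longrightarrow> a \<in> Ds (SX A) \<Longrightarrow> b \<in> Ds (SX B) \<Longrightarrow>
      \<exists>y \<in> S [a, b]. \<exists>v \<in> T [a, b]. SR A e a y \<or> SR B e b v"
    using valid_DisjD[OF AB] by blast
  have sw: "mfs [SX B, SX A] [SX A, SX B] (\<lambda>g. [g ! 1, g ! 0])"
    by (intro mfs_intros mf_nth) auto
  have "rdisj B A (\<lambda>g. T [g ! 1, g ! 0]) (\<lambda>g. S [g ! 1, g ! 0])"
    unfolding rdisj_def using hb_comp[OF *(1) sw] hb_comp[OF *(2) sw] *(3) by fastforce
  then show "valid (Disj B A)" by (rule valid_DisjI)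
qed

text \<open>The zero tuple is a dummy answer: the left disjunct already succeeds, but a candidate on
  the right has to exist.\<close>

lemma valid_weaken: "valid A \<Longrightarrow> valid (Disj A B)"
proof -
  assume "valid A"
  then obtain S where S: "hb [SX A] (SY A) S" "realizes A S" by (auto simp: valid_def)
  have "mfs [SX A, SX B] [SX A] (\<lambda>g. [g ! 0])" by (intro mfs_intros mf_nth) auto
  moreover have "hb [SX A, SX B] (SY B) (\<lambda>g. {zeros (SY B)})"
    by (intro hb_sing mf_const) simp
  ultimately have "rdisj A B (\<lambda>g. S [g ! 0]) (\<lambda>g. {zeros (SY B)})"
    using hb_comp[OF S(1)] S(2) unfolding rdisj_def realizes_def by fastforce
  then show ?thesis by (rule valid_DisjI)
qed

text \<open>The same challenge is put to both copies and the candidates are united. Which copy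
  succeeds may depend on the environment, so no single candidate could be selected here.\<close>

lemma valid_contract: "valid (Disj A A) \<Longrightarrow> valid A"
proof -
  assume AA: "valid (Disj A A)"
  obtain S T where *: "hb [SX A, SX A] (SY A) S" "hb [SX A, SX A] (SY A) T"
    "\<And>e a b. env e \<Longrightarrow> a \<in> Ds (SX A) \<Longrightarrow> b \<in> Ds (SX A) \<Longrightarrow>
      \<exists>y \<in> S [a, b]. \<exists>v \<in> T [a, b]. SR A e a y \<or> SR A e b v"
    using valid_DisjD[OF AA] by blast
  have "mfs [SX A] [SX A, SX A] (\<lambda>g. [g ! 0, g ! 0])"
    by (intro mfs_intros mf_nth) auto
  then have "hb [SX A] (SY A) (\<lambda>g. S [g ! 0, g ! 0] \<union> T [g ! 0, g ! 0])"
    using *(1,2) by (intro hb_union) (auto intro: hb_comp)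
  moreover have "realizes A (\<lambda>g. S [g ! 0, g ! 0] \<union> T [g ! 0, g ! 0])"
    unfolding realizes_def using *(3) by fastforce
  ultimately show "valid A" by (auto simp: valid_def)
qed

text \<open>The strategy \<open>Y\<close> that challenges \<open>Neg A\<close> is played against the
  challenge \<open>x\<close> to \<open>A\<close>: either some element of \<open>Y[x]\<close> answers
  \<open>x\<close>, or \<open>x\<close> itself defeats \<open>Y\<close>. The zero tuple covers an
  empty \<open>Y[x]\<close>.\<close>

lemma valid_em: "valid (Disj (Neg A) A)"
proof -
  have "hb [SX (Neg A), SX A] (SY (Neg A)) (\<lambda>g. {g ! 1})"
    by (intro hb_sing mf_nth) auto
  moreover have "hb [SX (Neg A), SX A] (SY A) (\<lambda>g. {zeros (SY A)} \<union> brs (SX A) (SY A) (g ! 0) (g ! 1))"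
    by (intro hb_union hb_sing mf_const hb_brs mf_nth) auto
  ultimately have "rdisj (Neg A) A (\<lambda>g. {g ! 1})
      (\<lambda>g. {zeros (SY A)} \<union> brs (SX A) (SY A) (g ! 0) (g ! 1))"
    unfolding rdisj_def by auto
  then show ?thesis by (rule valid_DisjI)
qed

text \<open>A realizer of \<open>A\<close>, abstracted over the challenges of \<open>A\<close>, is a challenge for \<open>Neg A\<close>.\<close>
lemma valid_cut:
  assumes "valid (Disj C A)" "valid (Disj B (Neg A))"
  shows "valid (Disj C B)"
proof -
  obtain S T where ST: "hb [SX C, SX A] (SY C) S" "hb [SX C, SX A] (SY A) T"
    "\<And>e a b. env e \<Longrightarrow> a \<in> Ds (SX C) \<Longrightarrow> b \<in> Ds (SX A) \<Longrightarrow>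
      \<exists>y \<in> S [a, b]. \<exists>v \<in> T [a, b]. SR C e a y \<or> SR A e b v"
    using valid_DisjD[OF assms(1)] by blast
  obtain S' T' where ST': "hb [SX B, SX (Neg A)] (SY B) S'" "hb [SX B, SX (Neg A)] (SX A) T'"
    "\<And>e a b. env e \<Longrightarrow> a \<in> Ds (SX B) \<Longrightarrow> b \<in> Ds (SX (Neg A)) \<Longrightarrow>
      \<exists>y \<in> S' [a, b]. \<exists>v \<in> T' [a, b]. SR B e a y \<or> SR (Neg A) e b v"
    using valid_DisjD[OF assms(2)] by (simp del: SR.simps) blast
  obtain F where F: "mf [SX C] (SX (Neg A)) F"
    "\<And>g z. g \<in> DDs [SX C] \<Longrightarrow> z \<in> Ds (SX A) \<Longrightarrow> T (g @ [z]) \<subseteq> brs (SX A) (SY A) (F g) z"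
    using hb_curry[of "[SX C]" "SX A" "SY A" T] ST(2) by auto
  have mfF: "mf (SX C # \<Gamma>) (SX (Neg A)) (\<lambda>g. F [g ! 0])" for \<Gamma>
    by (rule mf_comp[OF F(1)]) (intro mfs_intros mf_nth; simp)
  have arg: "mfs [SX C, SX B] [SX B, SX (Neg A)] (\<lambda>g. [g ! 1, F [g ! 0]])"
    by (intro mfs_intros mfF mf_nth) auto
  have U: "hb [SX C, SX B] (SY B) (\<lambda>g. S' [g ! 1, F [g ! 0]])"
    by (rule hb_comp[OF ST'(1) arg])
  have "hb [SX C, SX B] (SX A) (\<lambda>g. T' [g ! 1, F [g ! 0]])"
    by (rule hb_comp[OF ST'(2) arg])
  then have W: "hb [SX C, SX B] (SY C) (\<lambda>g. \<Union>x \<in> T' [g ! 1, F [g ! 0]]. S [g ! 0, x])"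
    by (rule hb_UN') (rule hb_comp[OF ST(1)], intro mfs_intros mf_last mf_weaken mf_nth; simp)
  have "\<exists>y \<in> (\<Union>x \<in> T' [b, F [a]]. S [a, x]). \<exists>v \<in> S' [b, F [a]]. SR C e a y \<or> SR B e b v"
    if e: "env e" and a: "a \<in> Ds (SX C)" and b: "b \<in> Ds (SX B)" for e a b
  proof -
    have Fa: "F [a] \<in> Ds (SX (Neg A))" using mf_D[OF F(1), of "[a]"] a by simp
    obtain d x where d: "d \<in> S' [b, F [a]]" "x \<in> T' [b, F [a]]" "SR B e b d \<or> SR (Neg A) e (F [a]) x"
      using ST'(3)[OF e b Fa] by blast
    have x: "x \<in> Ds (SX A)" using hb_D[OF ST'(2) _ d(2)] b Fa by simp
    obtain y v where "y \<in> S [a, x]" "v \<in> T [a, x]" "SR C e a y \<or> SR A e x v"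
      using ST(3)[OF e a x] by blast
    then show ?thesis using d F(2)[of "[a]" x] a x by auto
  qed
  then have "rdisj C B (\<lambda>g. \<Union>x \<in> T' [g ! 1, F [g ! 0]]. S [g ! 0, x]) (\<lambda>g. S' [g ! 1, F [g ! 0]])"
    unfolding rdisj_def using U W by simp
  then show ?thesis by (rule valid_DisjI)
qed

text \<open>The missing half of the challenge is filled up with zeros, and the answer is
  cut.\<close>

lemma valid_Conj_elim: "valid (Disj C (Conj A B)) \<Longrightarrow> valid (Disj C A)"
  "valid (Disj C (Conj A B)) \<Longrightarrow> valid (Disj C B)"
proof -
  let ?m = "length (SY A)"
  assume C: "valid (Disj C (Conj A B))"
  obtain S T where ST: "hb [SX C, SX A @ SX B] (SY C) S"
    "hb [SX C, SX A @ SX B] (SY A @ SY B) T"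
    "\<And>e c x. env e \<Longrightarrow> c \<in> Ds (SX C) \<Longrightarrow> x \<in> Ds (SX A @ SX B) \<Longrightarrow>
      \<exists>y \<in> S [c, x]. \<exists>v \<in> T [c, x]. SR C e c y \<or> SR (Conj A B) e x v"
    using valid_DisjD[OF C] by (simp del: SR.simps) blast
  have 1: "mfs [SX C, SX A] [SX C, SX A @ SX B] (\<lambda>g. [g ! 0, g ! 1 @ zeros (SX B)])"
    by (intro mfs_intros mf_nth mf_append mf_const) auto
  have "rdisj C A (\<lambda>g. S [g ! 0, g ! 1 @ zeros (SX B)]) (\<lambda>g. take ?m ` T [g ! 0, g ! 1 @ zeros (SX B)])"
    unfolding rdisj_def
  proof (intro conjI allI impI ballI)
    fix e c a assume "env e" "c \<in> Ds (SX C)" "a \<in> Ds (SX A)"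
    then show "\<exists>y \<in> S [[c, a] ! 0, [c, a] ! 1 @ zeros (SX B)].
      \<exists>v \<in> take ?m ` T [[c, a] ! 0, [c, a] ! 1 @ zeros (SX B)]. SR C e c y \<or> SR A e a v"
      using ST(3)[of e c "a @ zeros (SX B)"] Ds_length[of a "SX A"] by auto
  qed (rule hb_comp[OF ST(1) 1] hb_take hb_comp[OF ST(2) 1])+
  then show "valid (Disj C A)" by (rule valid_DisjI)
  have 2: "mfs [SX C, SX B] [SX C, SX A @ SX B] (\<lambda>g. [g ! 0, zeros (SX A) @ g ! 1])"
    by (intro mfs_intros mf_nth mf_append mf_const) auto
  have "rdisj C B (\<lambda>g. S [g ! 0, zeros (SX A) @ g ! 1]) (\<lambda>g. drop ?m ` T [g ! 0, zeros (SX A) @ g ! 1])"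
    unfolding rdisj_def
  proof (intro conjI allI impI ballI)
    fix e c b assume "env e" "c \<in> Ds (SX C)" "b \<in> Ds (SX B)"
    then show "\<exists>y \<in> S [[c, b] ! 0, zeros (SX A) @ [c, b] ! 1].
      \<exists>v \<in> drop ?m ` T [[c, b] ! 0, zeros (SX A) @ [c, b] ! 1]. SR C e c y \<or> SR B e b v"
      using ST(3)[of e c "zeros (SX A) @ b"] Ds_length[OF zeros_Ds, of "SX A"] by auto
  qed (rule hb_comp[OF ST(1) 2] hb_drop hb_comp[OF ST(2) 2])+
  then show "valid (Disj C B)" by (rule valid_DisjI)
qed

text \<open>The two premises may need different answers for \<open>C\<close>, hence the union on
  that side.\<close>

lemma valid_Conj_intro:
  assumes "valid (Disj C A)" "valid (Disj C B)"
  shows "valid (Disj C (Conj A B))"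
proof -
  let ?n = "length (SX A)"
  obtain S T where ST: "hb [SX C, SX A] (SY C) S" "hb [SX C, SX A] (SY A) T"
    "\<And>e a b. env e \<Longrightarrow> a \<in> Ds (SX C) \<Longrightarrow> b \<in> Ds (SX A) \<Longrightarrow>
      \<exists>y \<in> S [a, b]. \<exists>v \<in> T [a, b]. SR C e a y \<or> SR A e b v"
    using valid_DisjD[OF assms(1)] by blast
  obtain S' T' where ST': "hb [SX C, SX B] (SY C) S'" "hb [SX C, SX B] (SY B) T'"
    "\<And>e a b. env e \<Longrightarrow> a \<in> Ds (SX C) \<Longrightarrow> b \<in> Ds (SX B) \<Longrightarrow>
      \<exists>y \<in> S' [a, b]. \<exists>v \<in> T' [a, b]. SR C e a y \<or> SR B e b v"
    using valid_DisjD[OF assms(2)] by blast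
  have 1: "mfs [SX C, SX A @ SX B] [SX C, SX A] (\<lambda>g. [g ! 0, take ?n (g ! 1)])"
    and 2: "mfs [SX C, SX A @ SX B] [SX C, SX B] (\<lambda>g. [g ! 0, drop ?n (g ! 1)])"
    by (intro mfs_intros mf_nth mf_take mf_drop; simp)+
  let ?S = "\<lambda>g. S [g ! 0, take ?n (g ! 1)] \<union> S' [g ! 0, drop ?n (g ! 1)]"
  let ?T = "\<lambda>g. {y @ v | y v. y \<in> T [g ! 0, take ?n (g ! 1)] \<and> v \<in> T' [g ! 0, drop ?n (g ! 1)]}"
  have "rdisj C (Conj A B) ?S ?T"
    unfolding rdisj_def
  proof (intro conjI allI impI ballI)
    show "hb [SX C, SX (Conj A B)] (SY C) ?S"
      using hb_comp[OF ST(1) 1] hb_comp[OF ST'(1) 2] by (auto intro: hb_union)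
    show "hb [SX C, SX (Conj A B)] (SY (Conj A B)) ?T"
      using hb_comp[OF ST(2) 1] hb_comp[OF ST'(2) 2] by (auto intro: hb_append)
    fix e c x assume e: "env e" and c: "c \<in> Ds (SX C)" and "x \<in> Ds (SX (Conj A B))"
    then obtain a b where x: "x = a @ b" "a \<in> Ds (SX A)" "b \<in> Ds (SX B)"
      by (auto elim: Ds_appendE)
    obtain y v where y: "y \<in> S [c, a]" "v \<in> T [c, a]" "SR C e c y \<or> SR A e a v"
      using ST(3)[OF e c x(2)] by blast
    obtain y' v' where y': "y' \<in> S' [c, b]" "v' \<in> T' [c, b]" "SR C e c y' \<or> SR B e b v'"
      using ST'(3)[OF e c x(3)] by blast
    have "v \<in> Ds (SY A)" using hb_D[OF ST(2) _ y(2)] c x by simp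
    then have "SR C e c y \<or> SR C e c y' \<or> SR (Conj A B) e x (v @ v')"
      using y(3) y'(3) x Ds_length[OF x(2)] Ds_length[of v "SY A"] by auto
    then show "\<exists>y \<in> ?S [c, x]. \<exists>v \<in> ?T [c, x]. SR C e c y \<or> SR (Conj A B) e x v"
      using y y' x Ds_length[OF x(2)] by (auto 4 4)
  qed
  then show ?thesis by (rule valid_DisjI)
qed

lemma valid_internal: "internal A \<Longrightarrow> valid A \<longleftrightarrow> (\<forall>e. env e \<longrightarrow> sat e A)"
proof
  assume A: "internal A" and "valid A"
  then obtain S where S: "hb [[]] [] S" "realizes A S" by (auto simp: valid_def)
  show "\<forall>e. env e \<longrightarrow> sat e A"
  proof (intro allI impI)
    fix e assume "env e"
    then obtain y where "y \<in> S [[]]" "SR A e [] y"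
      using S(2) A unfolding realizes_def by fastforce
    moreover from this have "y = []" using hb_D[OF S(1), of "[[]]" y] by simp
    ultimately show "sat e A" using A by (simp add: SR_internal)
  qed
next
  assume A: "internal A" and "\<forall>e. env e \<longrightarrow> sat e A"
  then have "realizes A (\<lambda>_. {[]})" by (auto simp: realizes_def SR_internal)
  moreover have "hb [[]] [] (\<lambda>_. {[]})" by (intro hb_sing) simp
  ultimately show "valid A" using A by (auto simp: valid_def)
qed

end

section \<open>Propositional and quantifier rules\<close>

fun primes :: "fm \<Rightarrow> fm set" where
  "primes (Neg A) = primes A"
| "primes (Disj A B) = primes A \<union> primes B"
| "primes (Conj A B) = primes A \<union> primes B"
| "primes A = {A}"

lemma finite_primes [simp]: "finite (primes A)"
  by (induction A) auto

text \<open>The disjunction says that \<open>v\<close> errs at some member of \<open>ps\<close>. It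
  ends in a false formula, as the language has no falsum.\<close>

definition lits :: "(fm \<Rightarrow> bool) \<Rightarrow> fm list \<Rightarrow> fm" where
  "lits v ps = foldr (\<lambda>p. Disj (if v p then Neg p else p)) ps (Neg (Eq Zero Zero))"

context epa_model
begin

section \<open>Derived propositional rules and tautologies\<close>

lemma valid_weaken2: "valid B \<Longrightarrow> valid (Disj A B)"
  by (rule valid_comm[OF valid_weaken])

lemma valid_disj_left: "valid (Disj C A) \<Longrightarrow> valid (Disj C (Disj A B))"
  by (drule valid_weaken[of _ B]) (simp only: valid_assoc)

lemma valid_disj_right: "valid (Disj C B) \<Longrightarrow> valid (Disj C (Disj A B))"
proof -
  assume "valid (Disj C B)"
  then have "valid (Disj A (Disj B C))" by (rule valid_weaken2[OF valid_comm])
  then have "valid (Disj (Disj A B) C)" by (simp only: valid_assoc)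
  then show ?thesis by (rule valid_comm)
qed

lemma valid_em': "valid (Disj A (Neg A))"
  by (rule valid_comm[OF valid_em])

lemma valid_cut': "valid (Disj C A) \<Longrightarrow> valid (Disj C (Neg A)) \<Longrightarrow> valid C"
  by (rule valid_contract[OF valid_cut])

lemma valid_neg_neg: "valid (Disj C A) \<Longrightarrow> valid (Disj C (Neg (Neg A)))"
  by (rule valid_cut[OF _ valid_em])

lemma valid_neg_disj:
  assumes "valid (Disj L (Neg A))" "valid (Disj L (Neg B))"
  shows "valid (Disj L (Neg (Disj A B)))"
proof -
  let ?D = "Neg (Disj A B)"
  have "valid (Disj (Disj ?D A) B)" by (simp only: valid_assoc valid_em)
  then have "valid (Disj (Disj ?D A) L)" using assms(2) by (rule valid_cut)
  then have "valid (Disj L (Disj ?D A))" by (rule valid_comm)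
  then have "valid (Disj (Disj L ?D) A)" by (simp only: valid_assoc)
  then have "valid (Disj (Disj L ?D) L)" using assms(1) by (rule valid_cut)
  then have "valid (Disj L (Disj L ?D))" by (rule valid_comm)
  then have "valid (Disj (Disj L ?D) (Disj L ?D))" by (rule valid_disj_left[OF valid_comm])
  then show ?thesis by (rule valid_contract)
qed

lemma valid_lits: "p \<in> set ps \<Longrightarrow> valid (Disj C (if v p then Neg p else p)) \<Longrightarrow> valid (Disj C (lits v ps))"
  by (induction ps) (auto simp: lits_def intro: valid_disj_left valid_disj_right)

text \<open>In one-sided form: either \<open>v\<close> errs at some prime constituent, or
  \<open>A\<close> has the truth value computed from \<open>v\<close>. The disjunction rules and
  cuts carry this through the connectives.\<close>

lemma kalmar:
  assumes "primes A \<subseteq> set ps"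
  shows "valid (Disj (lits v ps) (if peval v A then A else Neg A))"
proof -
  let ?L = "lits v ps"
  have prime: "valid (Disj ?L (if v p then p else Neg p))" if "p \<in> set ps" for p
  proof (rule valid_comm)
    show "valid (Disj (if v p then p else Neg p) (lits v ps))"
      using valid_lits[OF that, of "if v p then p else Neg p" v] valid_em[of p] valid_em'[of p]
      by (simp split: if_splits)
  qed
  show ?thesis using assms
  proof (induction A)
    case (Neg A)
    then show ?case by (auto intro: valid_neg_neg split: if_splits)
  next
    case (Disj A B)
    then show ?case
      by (auto intro: valid_disj_left valid_disj_right valid_neg_disj split: if_splits)
  next
    case (Conj A B)
    have "valid (Disj (Neg (Conj A B)) A)" "valid (Disj (Neg (Conj A B)) B)"
      using valid_em[of "Conj A B"] by (auto intro: valid_Conj_elim)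
    \<comment> \<open>One refuted conjunct suffices: it is cut against the corresponding
      projection.\<close>
    then have "valid (Disj ?L (Neg (Conj A B)))"
      if "valid (Disj ?L (Neg A)) \<or> valid (Disj ?L (Neg B))"
      using that valid_comm[OF valid_cut[of "Neg (Conj A B)" A ?L]]
        valid_comm[OF valid_cut[of "Neg (Conj A B)" B ?L]] by auto
    then show ?case using Conj by (auto intro: valid_Conj_intro split: if_splits)
  qed (use prime in auto)
qed

text \<open>Two valuations that differ only at \<open>p\<close> leave \<open>p\<close> and
  \<open>Neg p\<close> as alternatives, and a cut removes the literal. Distinctness keeps the
  remaining literals unaffected by the change of \<open>v\<close>.\<close>

lemma valid_lits_elim: "distinct ps \<Longrightarrow> (\<And>v. valid (Disj (lits v ps) A)) \<Longrightarrow> valid A"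
proof (induction ps arbitrary: A)
  case Nil
  have "valid (Eq Zero Zero)" by (simp add: valid_internal)
  then have "valid (Disj A (Eq Zero Zero))" by (rule valid_weaken2)
  moreover have "valid (Disj A (Neg (Eq Zero Zero)))"
    using valid_comm[OF Nil.prems(2)] by (simp add: lits_def)
  ultimately show ?case by (rule valid_cut')
next
  case (Cons p ps)
  show ?case
  proof (rule Cons.IH)
    fix v
    have lits: "lits (v(p := b)) (p # ps) = Disj (if b then Neg p else p) (lits v ps)" for b
      using Cons.prems(1) by (auto simp: lits_def intro!: arg_cong2[of _ _ _ _ Disj] foldr_cong)
    have "valid (Disj (Disj (Neg p) (lits v ps)) A)" "valid (Disj (Disj p (lits v ps)) A)"
      using Cons.prems(2)[of "v(p := True)"] Cons.prems(2)[of "v(p := False)"]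
      unfolding lits by simp_all
    then have "valid (Disj (Neg p) (Disj (lits v ps) A))" "valid (Disj p (Disj (lits v ps) A))"
      unfolding valid_assoc .
    then show "valid (Disj (lits v ps) A)" using valid_cut' valid_comm by metis
  qed (use Cons.prems in auto)
qed

lemma valid_taut: "(\<And>v. peval v A) \<Longrightarrow> valid A"
proof -
  assume A: "\<And>v. peval v A"
  obtain ps where "distinct ps" "set ps = primes A"
    using finite_distinct_list[OF finite_primes] by blast
  moreover from this have "valid (Disj (lits v ps) A)" for v using kalmar[of A ps v] A by simp
  ultimately show ?thesis using valid_lits_elim by metis
qed

lemma valid_mp: "valid A \<Longrightarrow> valid (Imp A B) \<Longrightarrow> valid B"
  by (rule valid_cut'[OF valid_weaken2 valid_comm])

lemma valid_conseq: "valid A \<Longrightarrow> (\<And>v. peval v A \<Longrightarrow> peval v B) \<Longrightarrow> valid B"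
  by (erule valid_mp, rule valid_taut) auto

lemma valid_conseq2:
  "valid A \<Longrightarrow> valid B \<Longrightarrow> (\<And>v. peval v A \<Longrightarrow> peval v B \<Longrightarrow> peval v C) \<Longrightarrow> valid C"
  by (erule valid_mp[of B], erule valid_conseq) auto

text \<open>The candidates do not depend on the environment, so one code \<open>F\<close> bounds the
  answers for every value \<open>d\<close> of \<open>z\<close>; the element that works may vary with
  \<open>d\<close>.\<close>

lemma valid_Forall_intro:
  assumes "valid (Disj C A)" "z \<notin> fv C"
  shows "valid (Disj C (Forall z A))"
proof -
  obtain S T where ST: "hb [SX C, SX A] (SY C) S" "hb [SX C, SX A] (SY A) T"
    "\<And>e a b. env e \<Longrightarrow> a \<in> Ds (SX C) \<Longrightarrow> b \<in> Ds (SX A) \<Longrightarrow>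
      \<exists>y \<in> S [a, b]. \<exists>v \<in> T [a, b]. SR C e a y \<or> SR A e b v"
    using valid_DisjD[OF assms(1)] by blast
  obtain F where F: "mf [SX C, SX A] (SY A) F"
    "\<And>g. g \<in> DDs [SX C, SX A] \<Longrightarrow> T g \<subseteq> elemss (SY A) (F g)"
    using hb_elemssD[OF ST(2)] by blast
  have "rdisj C (Forall z A) S (\<lambda>g. {F g})"
    unfolding rdisj_def
  proof (intro conjI allI impI ballI)
    show "hb [SX C, SX (Forall z A)] (SY C) S" using ST(1) by simp
    show "hb [SX C, SX (Forall z A)] (SY (Forall z A)) (\<lambda>g. {F g})"
      using hb_sing[OF F(1)] by simp
    fix e c x assume e: "env e" and c: "c \<in> Ds (SX C)" and "x \<in> Ds (SX (Forall z A))"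
    then have x: "x \<in> Ds (SX A)" by simp
    show "\<exists>y \<in> S [c, x]. \<exists>v \<in> {F [c, x]}. SR C e c y \<or> SR (Forall z A) e x v"
    \<comment> \<open>The premise may pick different candidates for different \<open>d\<close>.
      Since \<open>z\<close> is not free in \<open>C\<close>, a candidate for \<open>C\<close> works
      for all \<open>d\<close> or for none.\<close>
    proof (cases "\<exists>y \<in> S [c, x]. SR C e c y")
      case False
      have "\<exists>v \<in> elemss (SY A) (F [c, x]). SR A (e(z := d)) x v" if "d \<in> D (snd z)" for d
        using ST(3)[of "e(z := d)" c x] e c x that False F(2)[of "[c, x]"] assms(2)
        by auto
      then have "SR (Forall z A) e x (F [c, x])" by simp
      then show ?thesis using ST(3)[OF e c x] by blast
    qed blast
  qed
  then show ?thesis by (rule valid_DisjI)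
qed

text \<open>Answers to the quantified formula are codes, and the answers to an instance are found
  among their elements. Zeros guard against empty codes.\<close>

lemma valid_Forall_elim:
  assumes "valid (Disj C (Forall z A))" "wt t" "ty_of t = snd z"
  shows "valid (Disj C (subst1 A z t))"
proof -
  obtain S T where ST: "hb [SX C, SX A] (SY C) S" "hb [SX C, SX A] (SY A) T"
    "\<And>e a b. env e \<Longrightarrow> a \<in> Ds (SX C) \<Longrightarrow> b \<in> Ds (SX A) \<Longrightarrow>
      \<exists>y \<in> S [a, b]. \<exists>v \<in> T [a, b]. SR C e a y \<or> SR (Forall z A) e b v"
    using valid_DisjD[OF assms(1)] by (simp del: SR.simps) blast
  let ?T = "\<lambda>g. {zeros (SY A)} \<union> (\<Union>y' \<in> T g. elemss (SY A) y')"
  have "rdisj C (subst1 A z t) S ?T"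
    unfolding rdisj_def
  proof (intro conjI allI impI ballI)
    show "hb [SX C, SX (subst1 A z t)] (SY C) S" using ST(1) assms by simp
    have "hb [SX C, SX A] (SY A) ?T"
      by (intro hb_union hb_sing mf_const hb_UN'[OF ST(2)] hb_elemss mf_last zeros_Ds)
    then show "hb [SX C, SX (subst1 A z t)] (SY (subst1 A z t)) ?T" using assms by simp
    fix e c x assume e: "env e" and c: "c \<in> Ds (SX C)" and "x \<in> Ds (SX (subst1 A z t))"
    then have x: "x \<in> Ds (SX A)" using assms by simp
    obtain y v where y: "y \<in> S [c, x]" "v \<in> T [c, x]" "SR C e c y \<or> SR (Forall z A) e x v"
      using ST(3)[OF e c x] by blast
    moreover have "val e t \<in> D (snd z)" using e assms by simp
    ultimately show "\<exists>y \<in> S [c, x]. \<exists>v \<in> ?T [c, x]. SR C e c y \<or> SR (subst1 A z t) e x v"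
      using assms by (fastforce simp: SR_subst1)
  qed
  then show ?thesis by (rule valid_DisjI)
qed

text \<open>The curried answers \<open>F\<close> to the instance serve as witness, with
  \<open>z\<close> set to the value of \<open>t\<close>. A challenge \<open>X\<close> then asks
  about the tuples in \<open>X[F]\<close>, and candidates for \<open>C\<close> are collected over
  all of them; zeros cover an empty \<open>X[F]\<close>.\<close>

lemma valid_Exists_intro:
  assumes "valid (Disj C (subst1 A z t))" "wt t" "ty_of t = snd z"
  shows "valid (Disj C (Exists z A))"
proof -
  let ?Y = "map (arrs (SX A)) (SY A)"
  obtain S T where ST: "hb [SX C, SX A] (SY C) S" "hb [SX C, SX A] (SY A) T"
    "\<And>e a b. env e \<Longrightarrow> a \<in> Ds (SX C) \<Longrightarrow> b \<in> Ds (SX A) \<Longrightarrow>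
      \<exists>y \<in> S [a, b]. \<exists>v \<in> T [a, b]. SR C e a y \<or> SR A (e(z := val e t)) b v"
    using valid_DisjD[OF assms(1)] assms(2,3) by (simp add: SR_subst1) blast
  obtain F where F: "mf [SX C] ?Y F"
    "\<And>g x. g \<in> DDs [SX C] \<Longrightarrow> x \<in> Ds (SX A) \<Longrightarrow> T (g @ [x]) \<subseteq> brs (SX A) (SY A) (F g) x"
    using hb_curry[of "[SX C]" "SX A" "SY A" T] ST(2) by auto
  have mfF: "mf [SX C, Z] ?Y (\<lambda>g. F [g ! 0])" for Z
    by (rule mf_comp[OF F(1)]) (intro mfs_intros mf_nth; simp)
  let ?Z = "SX (Exists z A)"
  let ?S = "\<lambda>g. S [g ! 0, zeros (SX A)] \<union> (\<Union>x \<in> brs ?Y (SX A) (g ! 1) (F [g ! 0]). S [g ! 0, x])"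
  have "rdisj C (Exists z A) ?S (\<lambda>g. {F [g ! 0]})"
    unfolding rdisj_def
  proof (intro conjI allI impI ballI)
    have 1: "hb [SX C, ?Z] (SX A) (\<lambda>g. brs ?Y (SX A) (g ! 1) (F [g ! 0]))"
      by (intro hb_brs mfF mf_nth) auto
    have 2: "hb ([SX C, ?Z] @ [SX A]) (SY C) (\<lambda>h. S [butlast h ! 0, last h])"
      by (rule hb_comp[OF ST(1)]) (intro mfs_intros mf_last mf_weaken mf_nth; simp)
    have 3: "hb [SX C, ?Z] (SY C) (\<lambda>g. S [g ! 0, zeros (SX A)])"
      by (rule hb_comp[OF ST(1)]) (intro mfs_intros mf_nth mf_const; simp)
    show "hb [SX C, ?Z] (SY C) ?S" by (rule hb_union[OF 3 hb_UN'[OF 1 2]])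
    show "hb [SX C, ?Z] (SY (Exists z A)) (\<lambda>g. {F [g ! 0]})"
      using hb_sing[OF mfF] by simp
    fix e c X assume e: "env e" and c: "c \<in> Ds (SX C)" and "X \<in> Ds ?Z"
    then have X: "X \<in> Ds (map (arrs ?Y) (SX A))" by simp
    have Fc: "F [c] \<in> Ds ?Y" using mf_D[OF F(1), of "[c]"] c by simp
    let ?B = "brs ?Y (SX A) X (F [c])"
    have B: "x \<in> Ds (SX A)" if "x \<in> ?B" for x using brs_D[OF X Fc that] .
    show "\<exists>y \<in> ?S [c, X]. \<exists>v \<in> {F [[c, X] ! 0]}. SR C e c y \<or> SR (Exists z A) e X v"
    proof (cases "\<exists>x \<in> ?B. \<exists>y \<in> S [c, x]. SR C e c y")
      case False
      have "\<exists>y \<in> brs (SX A) (SY A) (F [c]) x. SR A (e(z := val e t)) x y" if "x \<in> ?B" for x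
        using ST(3)[OF e c B[OF that]] False that F(2)[of "[c]" x] B[OF that] c by fastforce
      moreover have "val e t \<in> D (snd z)" using e assms by simp
      ultimately have "SR (Exists z A) e X (F [c])" by auto
      then show ?thesis using ST(3)[OF e c zeros_Ds] by auto
    qed auto
  qed
  then show ?thesis by (rule valid_DisjI)
qed

text \<open>The answers of the second premise for \<open>Neg A\<close>, curried, become the
  challenge \<open>F\<close> to \<open>Exists z A\<close>. The witness \<open>d\<close> obtained
  there is taken as value of \<open>z\<close> in the second premise; \<open>B\<close> does not
  notice, because \<open>z\<close> is not free in it.\<close>

lemma valid_Exists_elim:
  assumes "valid (Disj C (Exists z A))" "valid (Disj B (Neg A))" "z \<notin> fv B"
  shows "valid (Disj C B)"
proof -
  let ?Y = "map (arrs (SX A)) (SY A)" and ?X = "SX (Exists z A)"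
  obtain S T where ST: "hb [SX C, ?X] (SY C) S" "hb [SX C, ?X] ?Y T"
    "\<And>e a b. env e \<Longrightarrow> a \<in> Ds (SX C) \<Longrightarrow> b \<in> Ds ?X \<Longrightarrow>
      \<exists>y \<in> S [a, b]. \<exists>v \<in> T [a, b]. SR C e a y \<or> SR (Exists z A) e b v"
    using valid_DisjD[OF assms(1)] unfolding SY.simps by blast
  obtain S' T' where ST': "hb [SX B, ?Y] (SY B) S'" "hb [SX B, ?Y] (SX A) T'"
    "\<And>e a b. env e \<Longrightarrow> a \<in> Ds (SX B) \<Longrightarrow> b \<in> Ds ?Y \<Longrightarrow>
      \<exists>y \<in> S' [a, b]. \<exists>v \<in> T' [a, b]. SR B e a y \<or> SR (Neg A) e b v"
    using valid_DisjD[OF assms(2)] by (simp del: SR.simps) blast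
  obtain F where F: "mf [SX B] ?X F"
    "\<And>g x. g \<in> DDs [SX B] \<Longrightarrow> x \<in> Ds ?Y \<Longrightarrow> T' (g @ [x]) \<subseteq> brs ?Y (SX A) (F g) x"
    using hb_curry[of "[SX B]" ?Y "SX A" T'] ST'(2) by auto
  have arg: "mfs [SX C, SX B] [SX C, ?X] (\<lambda>g. [g ! 0, F [g ! 1]])"
    by (intro mfs_intros mf_comp[OF F(1)] mf_nth) auto
  let ?T = "\<lambda>g. \<Union>Y \<in> T [g ! 0, F [g ! 1]]. S' [g ! 1, Y]"
  have "rdisj C B (\<lambda>g. S [g ! 0, F [g ! 1]]) ?T"
    unfolding rdisj_def
  proof (intro conjI allI impI ballI)
    show "hb [SX C, SX B] (SY C) (\<lambda>g. S [g ! 0, F [g ! 1]])" by (rule hb_comp[OF ST(1) arg])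
    have 1: "hb ([SX C, SX B] @ [?Y]) (SY B) (\<lambda>h. S' [butlast h ! 1, last h])"
      by (rule hb_comp[OF ST'(1)]) (intro mfs_intros mf_last mf_weaken mf_nth; simp)
    show "hb [SX C, SX B] (SY B) ?T" by (rule hb_UN'[OF hb_comp[OF ST(2) arg] 1])
    fix e c b assume e: "env e" and c: "c \<in> Ds (SX C)" and b: "b \<in> Ds (SX B)"
    have Fb: "F [b] \<in> Ds ?X" using mf_D[OF F(1), of "[b]"] b by simp
    obtain y Y where y: "y \<in> S [c, F [b]]" "Y \<in> T [c, F [b]]" "SR C e c y \<or> SR (Exists z A) e (F [b]) Y"
      using ST(3)[OF e c Fb] by blast
    have Y: "Y \<in> Ds ?Y" using hb_D[OF ST(2) _ y(2)] c Fb by simp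
    show "\<exists>y \<in> S [[c, b] ! 0, F [[c, b] ! 1]]. \<exists>v \<in> ?T [c, b]. SR C e c y \<or> SR B e b v"
    \<comment> \<open>Even when \<open>C\<close> succeeds a candidate for \<open>B\<close> is
      exhibited, since \<open>rdisj\<close> demands one on each side.\<close>
    proof (cases "SR C e c y")
      case True
      then show ?thesis using y ST'(3)[OF e b Y] by auto
    next
      case False
      then obtain d where d: "d \<in> D (snd z)" "\<And>x. x \<in> brs ?Y (SX A) (F [b]) Y \<Longrightarrow>
          \<exists>y \<in> brs (SX A) (SY A) Y x. SR A (e(z := d)) x y"
        using y(3) by auto
      obtain v x where v: "v \<in> S' [b, Y]" "x \<in> T' [b, Y]"
        "SR B (e(z := d)) b v \<or> SR (Neg A) (e(z := d)) Y x"
        using ST'(3)[of "e(z := d)" b Y] e d(1) b Y by auto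
      moreover have "x \<in> brs ?Y (SX A) (F [b]) Y" using F(2)[of "[b]" Y] v(2) b Y by auto
      ultimately have "SR B e b v" using d(2)[of x] assms(3) by auto
      then show ?thesis using y(1,2) v(1) by auto
    qed
  qed
  then show ?thesis by (rule valid_DisjI)
qed

section \<open>Standardness as a hypothesis\<close>

lemma Ds_1: "x \<in> Ds [\<sigma>] \<longleftrightarrow> (\<exists>c \<in> D \<sigma>. x = [c])"
  by (auto simp: Ds_Cons)

text \<open>A challenge to \<open>Neg (St s)\<close> is a code \<open>u\<close>, and the formula
  fails exactly if the value of \<open>s\<close> is among its elements. A standardness hypothesis
  thus means that \<open>s\<close> lies in a given finite set.\<close>

lemma valid_St_elim:
  assumes "valid (Disj C (Disj (Neg (St s)) A))"
  shows "\<exists>S T. hb [SX C, [ty_of s], SX A] (SY C) S \<and> hb [SX C, [ty_of s], SX A] (SY A) T \<and>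
    (\<forall>e c u a. env e \<longrightarrow> c \<in> Ds (SX C) \<longrightarrow> u \<in> D (ty_of s) \<longrightarrow> a \<in> Ds (SX A) \<longrightarrow>
      val e s \<in> elems (ty_of s) u \<longrightarrow>
      (\<exists>y \<in> S [c, [u], a]. \<exists>v \<in> T [c, [u], a]. SR C e c y \<or> SR A e a v))"
proof -
  let ?\<sigma> = "ty_of s"
  obtain S T where ST: "hb [SX C, [?\<sigma>] @ SX A] (SY C) S" "hb [SX C, [?\<sigma>] @ SX A] (SY A) T"
    "\<And>e a b. env e \<Longrightarrow> a \<in> Ds (SX C) \<Longrightarrow> b \<in> Ds ([?\<sigma>] @ SX A) \<Longrightarrow>
      \<exists>y \<in> S [a, b]. \<exists>v \<in> T [a, b]. SR C e a y \<or> SR (Disj (Neg (St s)) A) e b v"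
    using valid_DisjD[OF assms] by (simp del: SR.simps) blast
  have arg: "mfs [SX C, [?\<sigma>], SX A] [SX C, [?\<sigma>] @ SX A] (\<lambda>g. [g ! 0, g ! 1 @ g ! 2])"
    by (intro mfs_intros mf_append mf_nth) auto
  have "\<exists>y \<in> S [c, u # a]. \<exists>v \<in> T [c, u # a]. SR C e c y \<or> SR A e a v"
    if "env e" "c \<in> Ds (SX C)" "u \<in> D ?\<sigma>" "a \<in> Ds (SX A)" "val e s \<in> elems ?\<sigma> u" for e c u a
    using ST(3)[of e c "u # a"] that by auto
  then show ?thesis
    using hb_comp[OF ST(1) arg] hb_comp[OF ST(2) arg]
    by (intro exI[of _ "\<lambda>g. S [g ! 0, g ! 1 @ g ! 2]"] exI[of _ "\<lambda>g. T [g ! 0, g ! 1 @ g ! 2]"]) simp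
qed

text \<open>If \<open>s\<close> lies outside \<open>u\<close> the formula holds by its middle part,
  but candidates for the other parts must still exist; the added zeros supply them.\<close>

lemma valid_St_intro:
  assumes "hb [SX C, [ty_of s], SX A] (SY C) S" "hb [SX C, [ty_of s], SX A] (SY A) T"
    "\<And>e c u a. env e \<Longrightarrow> c \<in> Ds (SX C) \<Longrightarrow> u \<in> D (ty_of s) \<Longrightarrow> a \<in> Ds (SX A) \<Longrightarrow>
      val e s \<in> elems (ty_of s) u \<Longrightarrow>
      \<exists>y \<in> S [c, [u], a]. \<exists>v \<in> T [c, [u], a]. SR C e c y \<or> SR A e a v"
  shows "valid (Disj C (Disj (Neg (St s)) A))"
proof -
  let ?\<sigma> = "ty_of s"
  let ?S = "\<lambda>g. S [g ! 0, take 1 (g ! 1), drop 1 (g ! 1)] \<union> {zeros (SY C)}"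
  let ?T = "\<lambda>g. T [g ! 0, take 1 (g ! 1), drop 1 (g ! 1)] \<union> {zeros (SY A)}"
  have arg: "mfs [SX C, [?\<sigma>] @ SX A] [SX C, [?\<sigma>], SX A] (\<lambda>g. [g ! 0, take 1 (g ! 1), drop 1 (g ! 1)])"
    using mf_take[OF mf_nth[of 1 "[SX C, [?\<sigma>] @ SX A]" "[?\<sigma>] @ SX A"]]
      mf_drop[OF mf_nth[of 1 "[SX C, [?\<sigma>] @ SX A]" "[?\<sigma>] @ SX A"]]
    by (intro mfs_intros mf_nth) auto
  have "rdisj C (Disj (Neg (St s)) A) ?S ?T"
    unfolding rdisj_def
  proof (intro conjI allI impI ballI)
    have "hb [SX C, [?\<sigma>] @ SX A] (SY C) ?S" "hb [SX C, [?\<sigma>] @ SX A] (SY A) ?T"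
      by (intro hb_union hb_comp[OF assms(1) arg] hb_comp[OF assms(2) arg] hb_sing mf_const zeros_Ds)+
    then show "hb [SX C, SX (Disj (Neg (St s)) A)] (SY C) ?S"
      "hb [SX C, SX (Disj (Neg (St s)) A)] (SY (Disj (Neg (St s)) A)) ?T" by simp_all
    fix e c b assume e: "env e" and c: "c \<in> Ds (SX C)" and "b \<in> Ds (SX (Disj (Neg (St s)) A))"
    then obtain u a where b: "b = u # a" "u \<in> D ?\<sigma>" "a \<in> Ds (SX A)" by (auto simp: Ds_Cons)
    show "\<exists>y \<in> ?S [c, b]. \<exists>v \<in> ?T [c, b]. SR C e c y \<or> SR (Disj (Neg (St s)) A) e b v"
    proof (cases "val e s \<in> elems ?\<sigma> u")
      case True
      then obtain y v where "y \<in> S [c, [u], a]" "v \<in> T [c, [u], a]" "SR C e c y \<or> SR A e a v"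
        using assms(3)[OF e c b(2,3)] by blast
      then show ?thesis using b by (intro bexI[of _ y] bexI[of _ v]) auto
    next
      case False
      then have "SR (Disj (Neg (St s)) A) e b (zeros (SY A))" using b by auto
      then show ?thesis by auto
    qed
  qed
  then show ?thesis by (rule valid_DisjI)
qed

end

section \<open>The axioms for standardness\<close>

lemma EPA_axioms_internal: "A \<in> EPA_axioms \<Longrightarrow> internal A"
  by (induction rule: EPA_axioms.induct) auto

lemma elem_props:
  assumes "wt s" "wt t" "ty_of s = ty_of t"
  shows "wff (elem s t)" "internal (elem s t)"
  using assms by (auto simp: elem_def le_def Let_def)

context epa_model
begin

lemma env_snd_D: "env e \<Longrightarrow> e z \<in> D (snd z)"
  unfolding env_def by blast

lemma mf_mfun: "mfun X \<tau> f \<Longrightarrow> mf \<Gamma> X F \<Longrightarrow> mf \<Gamma> [\<tau>] (\<lambda>g. [f (F g)])"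
proof -
  assume f: "mfun X \<tau> f" and F: "mf \<Gamma> X F"
  have "mf [X] [\<tau>] (\<lambda>g. [f (g ! 0)])"
    unfolding mf_def using mfuns_1[OF f] by (intro exI[of _ "\<lambda>x. [f x]"]) (auto simp: DDs_Cons)
  from mf_comp[OF this mfs_Cons[OF F mfs_Nil]] show ?thesis by simp
qed

text \<open>For the places where a single value has to be turned into a challenge to
  \<open>Neg (St (V z))\<close>, by a functional of the model.\<close>

lemma sing_code: "\<exists>P. mf [[\<sigma>]] [\<sigma>] P \<and> (\<forall>w \<in> D \<sigma>. \<exists>p \<in> D \<sigma>. P [[w]] = [p] \<and> w \<in> elems \<sigma> p)"
proof -
  have "hb [[\<sigma>]] [\<sigma>] (\<lambda>g. {g ! 0})" by (intro hb_sing mf_nth) auto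
  from hb_elemssD[OF this] obtain P where P: "mf [[\<sigma>]] [\<sigma>] P" "\<And>g. g \<in> DDs [[\<sigma>]] \<Longrightarrow> {g ! 0} \<subseteq> elemss [\<sigma>] (P g)"
    by blast
  have "\<exists>p \<in> D \<sigma>. P [[w]] = [p] \<and> w \<in> elems \<sigma> p" if "w \<in> D \<sigma>" for w
  proof -
    have "[[w]] \<in> DDs [[\<sigma>]]" using that by simp
    then show ?thesis using P(2)[of "[[w]]"] mf_D[OF P(1), of "[[w]]"] by (auto simp: Ds_1)
  qed
  with P(1) show ?thesis by blast
qed

text \<open>The hypothesis \<open>St (V z)\<close> provides only a finite set containing the value
  of \<open>z\<close>, so the answers are united over all its elements.\<close>

lemma valid_ForallSt_elim:
  assumes "valid (Disj C (ForallSt z A))"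
  shows "valid (Disj C (Disj (Neg (St (V z))) A))"
proof -
  let ?\<sigma> = "snd z"
  obtain S T where ST: "hb [SX C, SX A @ [?\<sigma>]] (SY C) S" "hb [SX C, SX A @ [?\<sigma>]] (SY A) T"
    "\<And>e a b. env e \<Longrightarrow> a \<in> Ds (SX C) \<Longrightarrow> b \<in> Ds (SX A @ [?\<sigma>]) \<Longrightarrow>
      \<exists>y \<in> S [a, b]. \<exists>v \<in> T [a, b]. SR C e a y \<or> SR (ForallSt z A) e b v"
    using valid_DisjD[OF assms] by (simp del: SR.simps) blast
  let ?\<Gamma> = "[SX C, [ty_of (V z)], SX A]"
  let ?U = "\<lambda>R g. \<Union>w \<in> elemss [?\<sigma>] (g ! 1). R [g ! 0, g ! 2 @ w]"
  have el: "hb ?\<Gamma> [?\<sigma>] (\<lambda>g. elemss [?\<sigma>] (g ! 1))" by (intro hb_elemss mf_nth) auto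
  have arg: "mfs (?\<Gamma> @ [[?\<sigma>]]) [SX C, SX A @ [?\<sigma>]] (\<lambda>h. [butlast h ! 0, butlast h ! 2 @ last h])"
    by (intro mfs_intros mf_append mf_last mf_weaken mf_nth) auto
  show ?thesis
  proof (rule valid_St_intro)
    show "hb ?\<Gamma> (SY C) (?U S)" by (rule hb_UN'[OF el hb_comp[OF ST(1) arg]])
    show "hb ?\<Gamma> (SY A) (?U T)" by (rule hb_UN'[OF el hb_comp[OF ST(2) arg]])
    fix e c u a assume e: "env e" and c: "c \<in> Ds (SX C)" and a: "a \<in> Ds (SX A)"
      and el: "val e (V z) \<in> elems (ty_of (V z)) u"
    have "e z \<in> D ?\<sigma>" using e by (rule env_snd_D)
    then obtain y v where "y \<in> S [c, a @ [e z]]" "v \<in> T [c, a @ [e z]]" "SR C e c y \<or> SR A e a v"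
      using ST(3)[OF e c, of "a @ [e z]"] a Ds_length[OF a] by (auto simp: nth_append)
    moreover from this have "y \<in> ?U S [c, [u], a]" "v \<in> ?U T [c, [u], a]" using el by auto
    ultimately show "\<exists>y \<in> ?U S [c, [u], a]. \<exists>v \<in> ?U T [c, [u], a]. SR C e c y \<or> SR A e a v" by blast
  qed
qed

text \<open>A challenge to \<open>ForallSt z A\<close> contains the value \<open>w\<close> of
  \<open>z\<close> itself; a code containing \<open>w\<close> discharges the hypothesis
  \<open>St (V z)\<close>.\<close>

lemma valid_ForallSt_intro:
  assumes "valid (Disj C (Disj (Neg (St (V z))) A))" "z \<notin> fv C"
  shows "valid (Disj C (ForallSt z A))"
proof -
  let ?\<sigma> = "snd z" and ?n = "length (SX A)"
  obtain S T where ST: "hb [SX C, [?\<sigma>], SX A] (SY C) S" "hb [SX C, [?\<sigma>], SX A] (SY A) T"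
    "\<And>e c u a. env e \<Longrightarrow> c \<in> Ds (SX C) \<Longrightarrow> u \<in> D ?\<sigma> \<Longrightarrow> a \<in> Ds (SX A) \<Longrightarrow> e z \<in> elems ?\<sigma> u \<Longrightarrow>
      \<exists>y \<in> S [c, [u], a]. \<exists>v \<in> T [c, [u], a]. SR C e c y \<or> SR A e a v"
    using valid_St_elim[OF assms(1)] by auto
  obtain P where P: "mf [[?\<sigma>]] [?\<sigma>] P"
    "\<And>w. w \<in> D ?\<sigma> \<Longrightarrow> \<exists>p \<in> D ?\<sigma>. P [[w]] = [p] \<and> w \<in> elems ?\<sigma> p"
    using sing_code[of "snd z"] by blast
  let ?R = "\<lambda>R g. R [g ! 0, P [drop ?n (g ! 1)], take ?n (g ! 1)]"
  have arg: "mfs [SX C, SX A @ [?\<sigma>]] [SX C, [?\<sigma>], SX A] (\<lambda>g. [g ! 0, P [drop ?n (g ! 1)], take ?n (g ! 1)])"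
    by (intro mfs_intros mf_comp[OF P(1)] mf_take mf_drop mf_nth) auto
  have "rdisj C (ForallSt z A) (?R S) (?R T)"
    unfolding rdisj_def
  proof (intro conjI allI impI ballI)
    show "hb [SX C, SX (ForallSt z A)] (SY C) (?R S)"
      "hb [SX C, SX (ForallSt z A)] (SY (ForallSt z A)) (?R T)"
      using hb_comp[OF ST(1) arg] hb_comp[OF ST(2) arg] by auto
    fix e c x assume e: "env e" and c: "c \<in> Ds (SX C)" and "x \<in> Ds (SX (ForallSt z A))"
    then obtain a w where x: "x = a @ [w]" "a \<in> Ds (SX A)" "w \<in> D ?\<sigma>"
      by (auto elim!: Ds_appendE simp: Ds_1)
    obtain p where p: "p \<in> D ?\<sigma>" "P [[w]] = [p]" "w \<in> elems ?\<sigma> p" using P(2) x by blast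
    show "\<exists>y \<in> ?R S [c, x]. \<exists>v \<in> ?R T [c, x]. SR C e c y \<or> SR (ForallSt z A) e x v"
      using ST(3)[of "e(z := w)" c p a] e c x p assms(2) Ds_length[OF x(2)]
      by (auto simp: nth_append)
  qed
  then show ?thesis by (rule valid_DisjI)
qed

text \<open>The realizer of \<open>St (V z)\<close> proposes finitely many values, any of which may
  be the actual one. Candidates for \<open>C\<close> are therefore collected over all proposals and
  over all tuples that the challenge asks about for each.\<close>

lemma valid_ExistsSt_intro:
  assumes "valid (Disj C (St (V z)))" "valid (Disj C A)"
  shows "valid (Disj C (ExistsSt z A))"
proof -
  let ?\<sigma> = "snd z" and ?Y = "map (arrs (SX A)) (SY A)"
  let ?X = "map (arrs (?\<sigma> # ?Y)) (SX A)"
  obtain S1 T1 where ST1: "hb [SX C, []] (SY C) S1" "hb [SX C, []] [?\<sigma>] T1"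
    "\<And>e c b. env e \<Longrightarrow> c \<in> Ds (SX C) \<Longrightarrow> b \<in> Ds [] \<Longrightarrow>
      \<exists>y \<in> S1 [c, b]. \<exists>v \<in> T1 [c, b]. SR C e c y \<or> SR (St (V z)) e b v"
    using valid_DisjD[OF assms(1)] by (simp del: SR.simps) blast
  obtain S2 T2 where ST2: "hb [SX C, SX A] (SY C) S2" "hb [SX C, SX A] (SY A) T2"
    "\<And>e a b. env e \<Longrightarrow> a \<in> Ds (SX C) \<Longrightarrow> b \<in> Ds (SX A) \<Longrightarrow>
      \<exists>y \<in> S2 [a, b]. \<exists>v \<in> T2 [a, b]. SR C e a y \<or> SR A e b v"
    using valid_DisjD[OF assms(2)] by blast
  obtain F where F: "mf [SX C] ?Y F"
    "\<And>g x. g \<in> DDs [SX C] \<Longrightarrow> x \<in> Ds (SX A) \<Longrightarrow> T2 (g @ [x]) \<subseteq> brs (SX A) (SY A) (F g) x"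
    using hb_curry[of "[SX C]" "SX A" "SY A" T2] ST2(2) by auto
  have mfF: "mf [SX C, Z] ?Y (\<lambda>g. F [g ! 0])" for Z
    by (rule mf_comp[OF F(1)]) (intro mfs_intros mf_nth; simp)
  let ?T = "\<lambda>g. {y @ w | y w. y \<in> {F [g ! 0]} \<and> w \<in> T1 [g ! 0, []]}"
  let ?S = "\<lambda>g. S1 [g ! 0, []] \<union>
    (\<Union>w \<in> T1 [g ! 0, []]. \<Union>x \<in> brs (?\<sigma> # ?Y) (SX A) (g ! 1) (w @ F [g ! 0]). S2 [g ! 0, x])"
  have arg: "mfs [SX C, ?X] [SX C, []] (\<lambda>g. [g ! 0, []])"
    by (intro mfs_intros mf_nth mf_Nil) auto
  have T: "hb [SX C, ?X] (?Y @ [?\<sigma>]) ?T"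
    by (rule hb_append[OF hb_sing[OF mfF] hb_comp[OF ST1(2) arg]])
  have 1: "hb ([SX C, ?X] @ [[?\<sigma>]]) (SX A)
      (\<lambda>h. brs (?\<sigma> # ?Y) (SX A) (butlast h ! 1) (last h @ F [butlast h ! 0]))"
  proof (rule hb_brs)
    show "mf ([SX C, ?X] @ [[?\<sigma>]]) ?X (\<lambda>h. butlast h ! 1)"
      by (intro mf_weaken mf_nth) auto
    have "mf ([SX C, ?X] @ [[?\<sigma>]]) ([?\<sigma>] @ ?Y) (\<lambda>h. last h @ F [butlast h ! 0])"
      by (rule mf_append[OF mf_last mf_weaken[OF mfF]])
    then show "mf ([SX C, ?X] @ [[?\<sigma>]]) (?\<sigma> # ?Y) (\<lambda>h. last h @ F [butlast h ! 0])" by simp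
  qed
  have 2: "hb (([SX C, ?X] @ [[?\<sigma>]]) @ [SX A]) (SY C) (\<lambda>h. S2 [butlast (butlast h) ! 0, last h])"
    by (rule hb_comp[OF ST2(1)]) (intro mfs_intros mf_last mf_weaken[OF mf_weaken] mf_nth; simp)
  have S: "hb [SX C, ?X] (SY C) ?S"
    by (intro hb_union hb_comp[OF ST1(1) arg] hb_UN'[OF hb_comp[OF ST1(2) arg]] hb_UN'[OF 1 2])
  have "rdisj C (ExistsSt z A) ?S ?T"
    unfolding rdisj_def
  proof (intro conjI allI impI ballI)
    show "hb [SX C, SX (ExistsSt z A)] (SY C) ?S"
      "hb [SX C, SX (ExistsSt z A)] (SY (ExistsSt z A)) ?T" using S T by simp_all
    fix e c X assume e: "env e" and c: "c \<in> Ds (SX C)" and "X \<in> Ds (SX (ExistsSt z A))"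
    then have X: "X \<in> Ds ?X" by simp
    have Fc: "F [c] \<in> Ds ?Y" using mf_D[OF F(1), of "[c]"] c by simp
    obtain y w where y: "y \<in> S1 [c, []]" "w \<in> T1 [c, []]" "SR C e c y \<or> SR (St (V z)) e [] w"
      using ST1(3)[OF e c] by auto
    have "w \<in> Ds [?\<sigma>]" using hb_D[OF ST1(2) _ y(2)] c by simp
    then obtain w0 where w: "w = [w0]" "w0 \<in> D ?\<sigma>" by (auto simp: Ds_1)
    have v: "F [c] @ [w0] \<in> ?T [c, X]" using y w by auto
    let ?B = "brs (?\<sigma> # ?Y) (SX A) X (w0 # F [c])"
    have B: "x \<in> Ds (SX A)" if "x \<in> ?B" for x
      using brs_D[OF X _ that] Fc w by simp
    show "\<exists>y \<in> ?S [c, X]. \<exists>v \<in> ?T [c, X]. SR C e c y \<or> SR (ExistsSt z A) e X v"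
    proof (cases "SR C e c y \<or> (\<exists>x \<in> ?B. \<exists>y \<in> S2 [c, x]. SR C e c y)")
      case True
      then obtain y' where "y' \<in> ?S [c, X]" "SR C e c y'"
        using y(1,2) w by fastforce
      then show ?thesis using v by blast
    next
      case False
      \<comment> \<open>As \<open>C\<close> fails at \<open>y\<close>, the proposal
        \<open>w0\<close> must be the actual value of \<open>z\<close>.\<close>
      then have ez: "e(z := w0) = e" using y(3) w by auto
      have "\<exists>y \<in> brs (SX A) (SY A) (F [c]) x. SR A e x y" if "x \<in> ?B" for x
        using ST2(3)[OF e c B[OF that]] False that F(2)[of "[c]" x] B[OF that] c by fastforce
      then have "SR (ExistsSt z A) e X (F [c] @ [w0])"
        using ez Ds_length[OF Fc] by (simp add: nth_append)
      moreover have "y \<in> ?S [c, X]" using y(1) by simp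
      ultimately show ?thesis using v by blast
    qed
  qed
  then show ?thesis by (rule valid_DisjI)
qed

text \<open>As for \<open>Exists\<close>, but the challenge now sees the witness \<open>w\<close>,
  so the answers of the second premise are curried over \<open>w\<close> as well; \<open>P\<close>
  turns \<open>w\<close> into the code demanded by the hypothesis \<open>St (V z)\<close>.\<close>

lemma valid_ExistsSt_elim:
  assumes "valid (Disj C (ExistsSt z A))" "valid (Disj B (Disj (Neg (St (V z))) (Neg A)))" "z \<notin> fv B"
  shows "valid (Disj C B)"
proof -
  let ?\<sigma> = "snd z" and ?Y = "map (arrs (SX A)) (SY A)" and ?m = "length (SY A)"
  let ?X = "map (arrs (?\<sigma> # ?Y)) (SX A)"
  obtain S T where ST: "hb [SX C, ?X] (SY C) S" "hb [SX C, ?X] (?Y @ [?\<sigma>]) T"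
    "\<And>e a b. env e \<Longrightarrow> a \<in> Ds (SX C) \<Longrightarrow> b \<in> Ds ?X \<Longrightarrow>
      \<exists>y \<in> S [a, b]. \<exists>v \<in> T [a, b]. SR C e a y \<or> SR (ExistsSt z A) e b v"
    using valid_DisjD[OF assms(1)] unfolding SY.simps SX.simps by blast
  obtain S' T' where ST': "hb [SX B, [?\<sigma>], ?Y] (SY B) S'" "hb [SX B, [?\<sigma>], ?Y] (SX A) T'"
    "\<And>e b u a. env e \<Longrightarrow> b \<in> Ds (SX B) \<Longrightarrow> u \<in> D ?\<sigma> \<Longrightarrow> a \<in> Ds ?Y \<Longrightarrow> e z \<in> elems ?\<sigma> u \<Longrightarrow>
      \<exists>y \<in> S' [b, [u], a]. \<exists>v \<in> T' [b, [u], a]. SR B e b y \<or> SR (Neg A) e a v"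
    using valid_St_elim[OF assms(2)] by (simp del: SR.simps) blast
  obtain P where P: "mf [[?\<sigma>]] [?\<sigma>] P"
    "\<And>w. w \<in> D ?\<sigma> \<Longrightarrow> \<exists>p \<in> D ?\<sigma>. P [[w]] = [p] \<and> w \<in> elems ?\<sigma> p"
    using sing_code[of "snd z"] by blast
  let ?T' = "\<lambda>g. T' [g ! 0, P [take 1 (g ! 1)], drop 1 (g ! 1)]"
  have 1: "mf [SX B, ?\<sigma> # ?Y] [?\<sigma>] (\<lambda>g. take 1 (g ! 1))" "mf [SX B, ?\<sigma> # ?Y] ?Y (\<lambda>g. drop 1 (g ! 1))"
    using mf_take[OF mf_nth[of 1 "[SX B, ?\<sigma> # ?Y]" "[?\<sigma>] @ ?Y"]]
      mf_drop[OF mf_nth[of 1 "[SX B, ?\<sigma> # ?Y]" "[?\<sigma>] @ ?Y"]] by simp_all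
  \<comment> \<open>The value \<open>w\<close> heads the argument tuple because the clause for
    \<open>ExistsSt\<close> forms its brackets over \<open>w # Ys\<close>.\<close>
  have "hb ([SX B] @ [?\<sigma> # ?Y]) (SX A) ?T'"
    using hb_comp[OF ST'(2), of "[SX B, ?\<sigma> # ?Y]" "\<lambda>g. [g ! 0, P [take 1 (g ! 1)], drop 1 (g ! 1)]"]
      mfs_Cons[OF mf_nth[of 0 "[SX B, ?\<sigma> # ?Y]" "SX B"] mfs_Cons[OF mf_comp[OF P(1) mfs_Cons[OF 1(1) mfs_Nil]] mfs_Cons[OF 1(2) mfs_Nil]]]
    by simp
  from hb_curry[OF this] obtain F where F: "mf [SX B] ?X F"
    "\<And>g x. g \<in> DDs [SX B] \<Longrightarrow> x \<in> Ds (?\<sigma> # ?Y) \<Longrightarrow> ?T' (g @ [x]) \<subseteq> brs (?\<sigma> # ?Y) (SX A) (F g) x"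
    by blast
  have arg: "mfs [SX C, SX B] [SX C, ?X] (\<lambda>g. [g ! 0, F [g ! 1]])"
    by (intro mfs_intros mf_comp[OF F(1)] mf_nth) auto
  let ?U = "\<lambda>g. \<Union>Y \<in> T [g ! 0, F [g ! 1]]. S' [g ! 1, P [drop (length ?Y) Y], take (length ?Y) Y]"
  have "rdisj C B (\<lambda>g. S [g ! 0, F [g ! 1]]) ?U"
    unfolding rdisj_def
  proof (intro conjI allI impI ballI)
    show "hb [SX C, SX B] (SY C) (\<lambda>g. S [g ! 0, F [g ! 1]])" by (rule hb_comp[OF ST(1) arg])
    have 2: "hb ([SX C, SX B] @ [?Y @ [?\<sigma>]]) (SY B)
        (\<lambda>h. S' [butlast h ! 1, P [drop (length ?Y) (last h)], take (length ?Y) (last h)])"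
      by (rule hb_comp[OF ST'(1)])
        (intro mfs_intros mf_comp[OF P(1)] mf_drop[OF mf_last] mf_take[OF mf_last] mf_weaken mf_nth; simp)
    show "hb [SX C, SX B] (SY B) ?U" by (rule hb_UN'[OF hb_comp[OF ST(2) arg] 2])
    fix e c b assume e: "env e" and c: "c \<in> Ds (SX C)" and b: "b \<in> Ds (SX B)"
    have Fb: "F [b] \<in> Ds ?X" using mf_D[OF F(1), of "[b]"] b by simp
    obtain y Yw where y: "y \<in> S [c, F [b]]" "Yw \<in> T [c, F [b]]" "SR C e c y \<or> SR (ExistsSt z A) e (F [b]) Yw"
      using ST(3)[OF e c Fb] by blast
    have "Yw \<in> Ds (?Y @ [?\<sigma>])" using hb_D[OF ST(2) _ y(2)] c Fb by simp
    then obtain Y w where Y: "Yw = Y @ [w]" "Y \<in> Ds ?Y" "w \<in> D ?\<sigma>"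
      by (auto elim!: Ds_appendE simp: Ds_1)
    have lY: "length Y = ?m" using Ds_length[OF Y(2)] by simp
    obtain p where p: "p \<in> D ?\<sigma>" "P [[w]] = [p]" "w \<in> elems ?\<sigma> p" using P(2) Y by blast
    have U: "v \<in> ?U [c, b]" if "v \<in> S' [b, [p], Y]" for v
      using that y(2) Y(1) p lY by (auto intro!: bexI[of _ Yw])
    obtain v x where v: "v \<in> S' [b, [p], Y]" "x \<in> T' [b, [p], Y]"
      "SR B (e(z := w)) b v \<or> SR (Neg A) (e(z := w)) Y x"
      using ST'(3)[of "e(z := w)" b p Y] e b Y p by auto
    have x: "x \<in> brs (?\<sigma> # ?Y) (SX A) (F [b]) (w # Y)"
      using F(2)[of "[b]" "w # Y"] v(2) b Y p by auto
    have "SR C e c y \<or> SR B e b v"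
    proof (rule ccontr)
      assume "\<not> ?thesis"
      then have "SR (ExistsSt z A) e (F [b]) Yw" "SR (Neg A) (e(z := w)) Y x" using y v assms(3) by auto
      then show False using x Y(1) lY by (auto simp: nth_append)
    qed
    then show "\<exists>y \<in> S [[c, b] ! 0, F [[c, b] ! 1]]. \<exists>v \<in> ?U [c, b]. SR C e c y \<or> SR B e b v"
      using y(1) U[OF v(1)] by auto
  qed
  then show ?thesis by (rule valid_DisjI)
qed

lemma valid_EQ_all: "valid (Iff (ForallSt x A) (Forall x (Imp (St (V x)) A)))"
proof -
  let ?P = "ForallSt x A" and ?Q = "Forall x (Imp (St (V x)) A)"
  have "valid (Imp ?P ?Q)"
    by (rule valid_Forall_intro[OF valid_ForallSt_elim[OF valid_em]]) simp
  moreover have "valid (Disj (Neg ?Q) (subst1 (Imp (St (V x)) A) x (V x)))"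
    by (rule valid_Forall_elim[OF valid_em]) auto
  then have "valid (Disj (Neg ?Q) (Imp (St (V x)) A))" by simp
  then have "valid (Imp ?Q ?P)" by (rule valid_ForallSt_intro) simp
  ultimately show ?thesis by (rule valid_conseq2) auto
qed

lemma valid_EQ_ex: "valid (Iff (ExistsSt x A) (Exists x (Conj (St (V x)) A)))"
proof -
  let ?P = "ExistsSt x A" and ?R = "Conj (St (V x)) A"
  let ?Q = "Exists x ?R" and ?C = "Disj (Neg (St (V x))) (Neg A)"
  have "valid (Disj (Neg ?R) (subst1 ?R x (V x)))" using valid_em by simp
  then have "valid (Disj (Neg ?R) ?Q)" by (rule valid_Exists_intro) auto
  then have "valid (Disj ?Q ?C)" by (rule valid_conseq) auto
  then have 1: "valid (Imp ?P ?Q)" by (rule valid_ExistsSt_elim[OF valid_em]) simp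
  have "valid (Disj ?C ?P)" by (rule valid_ExistsSt_intro; rule valid_taut) auto
  then have "valid (Disj ?P (Neg ?R))" by (rule valid_conseq) auto
  then have "valid (Imp ?Q ?P)" by (rule valid_Exists_elim[OF valid_em]) simp
  with 1 show ?thesis by (rule valid_conseq2) auto
qed

section \<open>Closure axioms of the standardness predicate\<close>

lemma hb_Nil: "hb \<Gamma> [] (\<lambda>g. {[]})"
  by (intro hb_sing) simp

lemma valid_T_eq:
  assumes "ty_of s = ty_of t"
  shows "valid (Imp (Conj (St s) (Eq s t)) (St t))"
proof -
  have "valid (Disj (Neg (Eq s t)) (Disj (Neg (St s)) (St t)))"
  proof (rule valid_St_intro)
    show "hb [SX (Neg (Eq s t)), [ty_of s], SX (St t)] (SY (Neg (Eq s t))) (\<lambda>g. {[]})"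
      using hb_Nil by simp
    have "hb [[], [ty_of s], []] [ty_of s] (\<lambda>g. elemss [ty_of s] (g ! 1))"
      by (intro hb_elemss mf_nth) auto
    then show "hb [SX (Neg (Eq s t)), [ty_of s], SX (St t)] (SY (St t)) (\<lambda>g. elemss [ty_of s] (g ! 1))"
      using assms by simp
  qed auto
  then show ?thesis by (rule valid_conseq) auto
qed

lemma valid_T_closed: "fvt t = {} \<Longrightarrow> wt t \<Longrightarrow> valid (St t)"
proof -
  assume t: "fvt t = {}" "wt t"
  have "hb [[]] [ty_of t] (\<lambda>g. {[cv t]})" using t by (intro hb_sing mf_const) (auto simp: Ds_1)
  then show ?thesis using val_closed[OF t(1)]
    by (auto simp: valid_def realizes_def intro!: exI[of _ "\<lambda>g. {[cv t]}"])
qed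

lemma valid_T_app:
  assumes "wt (s \<cdot> t)"
  shows "valid (Imp (Conj (St s) (St t)) (St (s \<cdot> t)))"
proof -
  obtain \<sigma> \<tau> where ty: "ty_of s = \<sigma> \<rightarrowtail> \<tau>" "ty_of t = \<sigma>" using assms by (auto split: ty.splits)
  \<comment> \<open>The standardness rules expect a side formula; a false one is inserted here and
    removed by the final propositional step.\<close>
  let ?C = "Neg (Eq Zero Zero)" and ?A = "Disj (Neg (St t)) (St (s \<cdot> t))"
  \<comment> \<open>All values of functions from the first code at arguments from the second. The
    zero serves when \<open>t\<close> lies outside the second code and any answer will do.\<close>
  let ?T = "\<lambda>g. {[cv (zero_c \<tau>)]} \<union> (\<Union>f \<in> elemss [\<sigma> \<rightarrowtail> \<tau>] (g ! 1). \<Union>x \<in> elemss [\<sigma>] (g ! 2). {[f ! 0 \<bullet> x ! 0]})"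
  have "valid (Disj ?C (Disj (Neg (St s)) ?A))"
  proof (rule valid_St_intro)
    show "hb [SX ?C, [ty_of s], SX ?A] (SY ?C) (\<lambda>g. {[]})" using hb_Nil by simp
    have app: "mfun [\<sigma> \<rightarrowtail> \<tau>, \<sigma>] \<tau> (\<lambda>x. x ! 0 \<bullet> x ! 1)"
      by (rule mfun_app[of _ \<sigma>]) (rule mfun_nth; simp)+
    have "mf (([[], [\<sigma> \<rightarrowtail> \<tau>], [\<sigma>]] @ [[\<sigma> \<rightarrowtail> \<tau>]]) @ [[\<sigma>]]) ([\<sigma> \<rightarrowtail> \<tau>] @ [\<sigma>]) (\<lambda>h. last (butlast h) @ last h)"
      by (rule mf_append[OF mf_weaken[OF mf_last] mf_last])
    from mf_mfun[OF app this[simplified]]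
    have "mf (([[], [\<sigma> \<rightarrowtail> \<tau>], [\<sigma>]] @ [[\<sigma> \<rightarrowtail> \<tau>]]) @ [[\<sigma>]]) [\<tau>] (\<lambda>h. [last (butlast h) ! 0 \<bullet> last h ! 0])"
      unfolding mf_def
    proof (elim exE conjE, intro exI conjI ballI)
      fix F' g assume *: "\<forall>g \<in> DDs [[], [\<sigma> \<rightarrowtail> \<tau>], [\<sigma>], [\<sigma> \<rightarrowtail> \<tau>], [\<sigma>]].
          [(last (butlast g) @ last g) ! 0 \<bullet> (last (butlast g) @ last g) ! 1] = F' (concat g)"
        and "g \<in> DDs (([[], [\<sigma> \<rightarrowtail> \<tau>], [\<sigma>]] @ [[\<sigma> \<rightarrowtail> \<tau>]]) @ [[\<sigma>]])"
      then have g: "g \<in> DDs [[], [\<sigma> \<rightarrowtail> \<tau>], [\<sigma>], [\<sigma> \<rightarrowtail> \<tau>], [\<sigma>]]" by simp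
      then show "[last (butlast g) ! 0 \<bullet> last g ! 0] = F' (concat g)"
        using bspec[OF * g] by (auto simp: DDs_Cons Ds_1)
    qed simp
    then have "hb [[], [\<sigma> \<rightarrowtail> \<tau>], [\<sigma>]] [\<tau>] ?T"
      by (intro hb_union hb_UN'[of _ "[\<sigma> \<rightarrowtail> \<tau>]" "\<lambda>g. elemss [\<sigma> \<rightarrowtail> \<tau>] (g ! 1)"]
          hb_UN'[of _ "[\<sigma>]" "\<lambda>h. elemss [\<sigma>] (butlast h ! 2)"] hb_elemss mf_weaken mf_nth hb_sing mf_const)
        (auto simp: Ds_1)
    then show "hb [SX ?C, [ty_of s], SX ?A] (SY ?A) ?T" using ty by simp
    fix e c u a assume "val e s \<in> elems (ty_of s) u" "a \<in> Ds (SX ?A)" "c \<in> Ds (SX ?C)"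
    then show "\<exists>y \<in> {[]}. \<exists>v \<in> ?T [c, [u], a]. SR ?C e c y \<or> SR ?A e a v"
      using ty by (cases "val e t \<in> elems \<sigma> (a ! 0)") (auto simp: Ds_1 intro!: exI[of _ "[_]"])
  qed
  moreover have "valid (Eq Zero Zero)" by (simp add: valid_internal)
  ultimately show ?thesis by (rule valid_conseq2) auto
qed

text \<open>The numbers up to a candidate form a finite set in the sense of the model, even if the
  candidate is nonstandard.\<close>

lemma valid_T_le:
  assumes "wt s" "wt t" "ty_of s = TNat" "ty_of t = TNat"
  shows "valid (Imp (Conj (St s) (le t s)) (St t))"
proof -
  let ?C = "Neg (le t s)"
  \<comment> \<open>The identity, read as a sequence of length \<open>w + 1\<close>, lists
    \<open>0, ..., w\<close>.\<close>
  define I where "I = val env0 (lam (nv 0) (V (nv 0)))"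
  have I: "I \<in> D (TNat \<rightarrowtail> TNat)" "\<And>n. n \<in> N \<Longrightarrow> I \<bullet> n = n" by (auto simp: I_def)
  let ?T = "\<lambda>g. \<Union>w \<in> elemss [TNat] (g ! 1). elemss [TNat] [mk TNat (sc (w ! 0)) I]"
  have int: "internal (le t s)" by (simp add: le_def)
  have "valid (Disj ?C (Disj (Neg (St s)) (St t)))"
  proof (rule valid_St_intro)
    show "hb [SX ?C, [ty_of s], SX (St t)] (SY ?C) (\<lambda>g. {[]})" using hb_Nil int by simp
    have "mfun [TNat] TNat (\<lambda>x. mk TNat (sc (x ! 0)) I)"
      using I by (intro mfun_mk mfun_const mfun_unary mfun_nth0) auto
    then have "hb [[], [TNat], []] [TNat] ?T"
      by (intro hb_UN'[of _ "[TNat]" "\<lambda>g. elemss [TNat] (g ! 1)"] hb_elemss mf_mfun[of "[TNat]"]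
          mf_last mf_nth) auto
    then show "hb [SX ?C, [ty_of s], SX (St t)] (SY (St t)) ?T" using int assms by simp
    fix e c u a assume "val e s \<in> elems (ty_of s) u" "c \<in> Ds (SX ?C)" "env e"
    then have N: "val e s \<in> N" "val e t \<in> N" and el: "val e s \<in> elems TNat u" and c: "c = []"
      using assms int by auto
    show "\<exists>y \<in> {[]}. \<exists>v \<in> ?T [c, [u], a]. SR ?C e c y \<or> SR (St t) e a v"
    proof (cases "sat e (le t s)")
      case True
      then have "lt (val e t) (sc (val e s))" using N by (simp add: le_def lt_def)
      then have "val e t \<in> elems TNat (mk TNat (sc (val e s)) I)"
        using N I by (auto simp: elems_mk intro!: exI[of _ "val e t"])
      then have "[val e t] \<in> ?T [c, [u], a]" using el by auto
      moreover have "SR (St t) e a [val e t]" by simp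
      ultimately show ?thesis by blast
    next
      case False
      have "I \<bullet> zr \<in> elems TNat (mk TNat (sc (val e s)) I)"
        using N I by (subst elems_mk) (auto simp: lt_iff intro!: exI[of _ zr])
      then have "[I \<bullet> zr] \<in> ?T [c, [u], a]" using el by auto
      moreover have "SR ?C e c []" using False int c by (simp add: SR_internal)
      ultimately show ?thesis by blast
    qed
  qed
  then show ?thesis by (rule valid_conseq) auto
qed

section \<open>Idealization, choice and transfer\<close>

lemma sat_elem:
  assumes "env e" "wt s" "wt t" "ty_of s = ty_of t"
  shows "sat e (elem s t) \<longleftrightarrow> val e s \<in> elems (ty_of t) (val e t)"
proof -
  let ?i = "fresh (fvt s \<union> fvt t) TNat"
  have i: "?i \<notin> fvt s" "?i \<notin> fvt t" using fresh_notin[of "fvt s \<union> fvt t" TNat] by auto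
  show ?thesis using assms i
    by (auto simp: elem_def Let_def le_def elems_iff lt_def val_upd_idle)
qed

text \<open>The clauses make idealization nearly trivial: on both sides the challenge is one code,
  namely the value of \<open>y'\<close> in the premise and the finite set of tested \<open>y\<close>
  in the conclusion, and the matrices match.\<close>

lemma valid_I:
  assumes A: "internal A" "wff A" and xy: "x \<noteq> y" "y' \<notin> insert x (insert y (fv A))" "snd y' = snd y"
    and C: "valid (Disj C (ForallSt y' (Exists x (ball [y] [V y'] A))))"
  shows "valid (Disj C (Exists x (ForallSt y A)))"
proof -
  let ?P = "ForallSt y' (Exists x (ball [y] [V y'] A))" and ?Q = "Exists x (ForallSt y A)"
  have B: "internal (ball [y] [V y'] A)" using A xy by (simp add: ball_def elem_props)
  have X: "SX ?P = [snd y]" "SX ?Q = [snd y]" "SY ?P = []" "SY ?Q = []" using A B xy by auto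
  obtain S T where ST: "hb [SX C, SX ?P] (SY C) S" "hb [SX C, SX ?P] (SY ?P) T"
    "\<And>e a b. env e \<Longrightarrow> a \<in> Ds (SX C) \<Longrightarrow> b \<in> Ds (SX ?P) \<Longrightarrow>
      \<exists>y \<in> S [a, b]. \<exists>v \<in> T [a, b]. SR C e a y \<or> SR ?P e b v"
    using valid_DisjD[OF C] by blast
  have PQ: "SR ?P e b [] \<Longrightarrow> SR ?Q e b []" if e: "env e" and b: "b \<in> Ds [snd y]" for e b
  proof -
    obtain w where w: "b = [w]" "w \<in> D (snd y)" using b by (auto simp: Ds_1)
    assume "SR ?P e b []"
    then obtain d where d: "d \<in> D (snd x)" "sat (e(y' := w, x := d)) (ball [y] [V y'] A)"
      using w A B by (auto simp: SR_internal)
    have "sat (e(x := d, y := c)) A" if c: "c \<in> elems (snd y) w" for c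
    proof -
      have cD: "c \<in> D (snd y)" using elems_D[OF w(2)] c by blast
      then have "sat (e(y' := w, x := d, y := c)) (elem (V y) (V y'))"
        using xy c d(1) w e by (subst sat_elem) auto
      then have "sat (e(y' := w, x := d, y := c)) A" using d(2) cD by (auto simp: ball_def)
      then show ?thesis using xy by (subst sat_cong[of _ _ "e(y' := w, x := d, y := c)"]) auto
    qed
    then show "SR ?Q e b []" using A w d(1) by (auto simp: SR_internal intro!: bexI[of _ d])
  qed
  have "rdisj C ?Q S T"
    unfolding rdisj_def
  proof (intro conjI allI impI ballI)
    show "hb [SX C, SX ?Q] (SY C) S" "hb [SX C, SX ?Q] (SY ?Q) T" using ST X by simp_all
    fix e c b assume e: "env e" and c: "c \<in> Ds (SX C)" and b: "b \<in> Ds (SX ?Q)"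
    obtain y v where y: "y \<in> S [c, b]" "v \<in> T [c, b]" "SR C e c y \<or> SR ?P e b v"
      using ST(3)[OF e c, of b] b X by auto
    have "v = []" using hb_D[OF ST(2) _ y(2)] c b X by simp
    then show "\<exists>y \<in> S [c, b]. \<exists>v \<in> T [c, b]. SR C e c y \<or> SR ?Q e b v"
      using y PQ[OF e, of b] b X by metis
  qed
  then show ?thesis by (rule valid_DisjI)
qed

text \<open>Currying the candidates for \<open>y\<close> gives the choice functional. The conclusion
  only asks \<open>y\<close> to be an element of \<open>Y[x]\<close>, so a finite set of candidates
  is as good as a value. A challenge \<open>X\<close> tests the arguments in \<open>X[F]\<close>,
  over which candidates for \<open>C\<close> are collected.\<close>

lemma valid_HAC:
  assumes A: "internal A" "wff A" and xy: "x \<noteq> y" "Y \<notin> insert x (insert y (fv A))" "snd Y = snd x \<rightarrowtail> snd y"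
    and C: "valid (Disj C (ForallSt x (ExistsSt y A)))"
  shows "valid (Disj C (ExistsSt Y (ForallSt x (bex [y] [bracket (V Y) [V x]] A))))"
proof -
  let ?\<sigma> = "snd x" and ?\<tau> = "snd y"
  let ?B = "bex [y] [bracket (V Y) [V x]] A"
  let ?P = "ForallSt x (ExistsSt y A)" and ?Q = "ExistsSt Y (ForallSt x ?B)"
  have br: "bracket (V Y) [V x] = bracket_c ?\<sigma> ?\<tau> \<cdot> V Y \<cdot> V x" using xy by (simp add: bracket_def)
  have B: "internal ?B" using A xy by (simp add: bex_def elem_props br)
  have X: "SX ?P = [?\<sigma>]" "SX ?Q = [(?\<sigma> \<rightarrowtail> ?\<tau>) \<rightarrowtail> ?\<sigma>]" "SY ?P = [?\<tau>]" "SY ?Q = [?\<sigma> \<rightarrowtail> ?\<tau>]"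
    using A B xy by auto
  obtain S T where ST: "hb [SX C, [?\<sigma>]] (SY C) S" "hb [SX C, [?\<sigma>]] [?\<tau>] T"
    "\<And>e a b. env e \<Longrightarrow> a \<in> Ds (SX C) \<Longrightarrow> b \<in> Ds [?\<sigma>] \<Longrightarrow>
      \<exists>y \<in> S [a, b]. \<exists>v \<in> T [a, b]. SR C e a y \<or> SR ?P e b v"
    using valid_DisjD[OF C] unfolding X by blast
  have "hb ([SX C] @ [[?\<sigma>]]) [?\<tau>] T" using ST(2) by simp
  from hb_curry[OF this] obtain F where F: "mf [SX C] [?\<sigma> \<rightarrowtail> ?\<tau>] F"
    "\<And>g z. g \<in> DDs [SX C] \<Longrightarrow> z \<in> Ds [?\<sigma>] \<Longrightarrow> T (g @ [z]) \<subseteq> brs [?\<sigma>] [?\<tau>] (F g) z"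
    by auto
  let ?Z = "[(?\<sigma> \<rightarrowtail> ?\<tau>) \<rightarrowtail> ?\<sigma>]"
  let ?S = "\<lambda>g. S [g ! 0, zeros [?\<sigma>]] \<union> (\<Union>z \<in> brs [?\<sigma> \<rightarrowtail> ?\<tau>] [?\<sigma>] (g ! 1) (F [g ! 0]). S [g ! 0, z])"
  have mfF: "mf [SX C, ?Z] [?\<sigma> \<rightarrowtail> ?\<tau>] (\<lambda>g. F [g ! 0])"
    by (rule mf_comp[OF F(1)]) (intro mfs_intros mf_nth; simp)
  have "rdisj C ?Q ?S (\<lambda>g. {F [g ! 0]})"
    unfolding rdisj_def X
  proof (intro conjI allI impI ballI)
    have 1: "hb [SX C, ?Z] [?\<sigma>] (\<lambda>g. brs [?\<sigma> \<rightarrowtail> ?\<tau>] [?\<sigma>] (g ! 1) (F [g ! 0]))"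
      by (intro hb_brs mfF mf_nth) auto
    have 2: "hb ([SX C, ?Z] @ [[?\<sigma>]]) (SY C) (\<lambda>h. S [butlast h ! 0, last h])"
      by (rule hb_comp[OF ST(1)]) (intro mfs_intros mf_last mf_weaken mf_nth; simp)
    have 3: "hb [SX C, ?Z] (SY C) (\<lambda>g. S [g ! 0, zeros [?\<sigma>]])"
      by (rule hb_comp[OF ST(1)]) (intro mfs_intros mf_nth mf_const zeros_Ds; simp)
    show "hb [SX C, ?Z] (SY C) ?S" by (rule hb_union[OF 3 hb_UN'[OF 1 2]])
    show "hb [SX C, ?Z] [?\<sigma> \<rightarrowtail> ?\<tau>] (\<lambda>g. {F [g ! 0]})" by (rule hb_sing[OF mfF])
    fix e c X assume e: "env e" and c: "c \<in> Ds (SX C)" and X: "X \<in> Ds ?Z"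
    have Fc: "F [c] \<in> Ds [?\<sigma> \<rightarrowtail> ?\<tau>]" using mf_D[OF F(1), of "[c]"] c by simp
    then obtain f where f: "F [c] = [f]" "f \<in> D (?\<sigma> \<rightarrowtail> ?\<tau>)" by (auto simp: Ds_1)
    let ?R = "brs [?\<sigma> \<rightarrowtail> ?\<tau>] [?\<sigma>] X (F [c])"
    have R: "z \<in> Ds [?\<sigma>]" if "z \<in> ?R" for z
      using brs_D[OF _ Fc that] X by simp
    show "\<exists>y \<in> ?S [c, X]. \<exists>v \<in> {F [[c, X] ! 0]}. SR C e c y \<or> SR ?Q e X v"
    proof (cases "\<exists>z \<in> ?R. \<exists>y \<in> S [c, z]. SR C e c y")
      case False
      have "SR (ForallSt x ?B) (e(Y := f)) z []" if z: "z \<in> ?R" for z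
      proof -
        obtain a where a: "z = [a]" "a \<in> D ?\<sigma>" using R[OF z] by (auto simp: Ds_1)
        obtain v where v: "v \<in> T [c, z]" "SR ?P e z v"
          using ST(3)[OF e c R[OF z]] False z by blast
        then have "v \<in> brs [?\<sigma>] [?\<tau>] [f] z" using F(2)[of "[c]" z] c R[OF z] f by auto
        then obtain b where b: "v = [b]" "b \<in> elems ?\<tau> (brk ?\<sigma> ?\<tau> f a)"
          using a by (auto simp: brs_def length_Suc_conv)
        have bD: "b \<in> D ?\<tau>" using elems_D[OF brk_D[OF f(2) a(2)]] b by blast
        let ?e = "e(Y := f, x := a, y := b)"
        have e': "env ?e" using e f a bD xy by simp
        have "sat (e(x := a, y := b)) A" using v(2) a b A by (simp add: SR_internal Let_def)
        then have "sat ?e A" using xy by (subst sat_cong[of _ _ "e(x := a, y := b)"]) auto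
        moreover have "sat ?e (elem (V y) (bracket_c ?\<sigma> ?\<tau> \<cdot> V Y \<cdot> V x))"
          using e' xy b by (subst sat_elem) auto
        ultimately have "sat (e(Y := f, x := a)) ?B"
          using bD by (auto simp: bex_def br)
        then show ?thesis using a B by (simp add: SR_internal)
      qed
      then have "SR ?Q e X (F [c])" using f xy B by (simp add: Let_def)
      then show ?thesis using ST(3)[OF e c zeros_Ds] by auto
    qed auto
  qed
  then show ?thesis by (rule valid_DisjI)
qed

text \<open>Each external universal quantifier appends its variable on the right, so a prefix is
  read in reverse.\<close>

lemma SX_ForallSts [simp]: "SX (ForallSts xs A) = SX A @ rev (tys xs)" "SY (ForallSts xs A) = SY A"
  by (induction xs) auto

lemma SR_ForallSts: "internal A \<Longrightarrow> d \<in> Ds (tys xs) \<Longrightarrow>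
    SR (ForallSts xs A) e (rev d) [] \<longleftrightarrow> sat (upds e xs d) A"
proof (induction xs arbitrary: e d)
  case (Cons x xs)
  then obtain a d' where d: "d = a # d'" "d' \<in> Ds (tys xs)" by (auto simp: Ds_Cons)
  then show ?case using Cons Ds_length[OF d(2)] by (simp add: nth_append)
qed (simp add: SR_internal)

lemma upds_cong: "length d = length xs \<Longrightarrow> v \<in> set xs \<Longrightarrow> upds e xs d v = upds e' xs d v"
proof (induction xs arbitrary: e e' d)
  case (Cons x xs)
  then obtain a d' where d: "d = a # d'" by (cases d) auto
  then show ?case using Cons by (cases "v \<in> set xs") auto
qed simp

lemma Ball_Ds_Cons: "(\<forall>d \<in> Ds (\<sigma> # X). P d) \<longleftrightarrow> (\<forall>a \<in> D \<sigma>. \<forall>d \<in> Ds X. P (a # d))"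
  and Bex_Ds_Cons: "(\<exists>d \<in> Ds (\<sigma> # X). P d) \<longleftrightarrow> (\<exists>a \<in> D \<sigma>. \<exists>d \<in> Ds X. P (a # d))"
  by (auto simp: Ds_Cons; blast)+

lemma sat_Foralls_iff: "sat e (Foralls xs A) \<longleftrightarrow> (\<forall>d \<in> Ds (tys xs). sat (upds e xs d) A)"
  by (induction xs arbitrary: e) (simp_all add: Ball_Ds_Cons)

lemma sat_Existss_iff: "sat e (Existss xs A) \<longleftrightarrow> (\<exists>d \<in> Ds (tys xs). sat (upds e xs d) A)"
  by (induction xs arbitrary: e) (simp_all add: Bex_Ds_Cons)

text \<open>All free variables of \<open>A\<close> are among \<open>xs\<close>, so its truth at
  \<open>d\<close> does not depend on the environment. Hence one counterexample serves all
  environments and is a constant realizer of the negated premise.\<close>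

lemma valid_PF_TP:
  assumes "internal A" "fv A \<subseteq> set xs"
  shows "valid (Imp (ForallSts xs A) (Foralls xs A))"
proof -
  have int: "internal (Foralls xs A)" using assms(1) by (induction xs) auto
  show ?thesis
  proof (cases "\<forall>d \<in> Ds (tys xs). sat (upds env0 xs d) A")
    case True
    have "sat (upds e xs d) A" if "d \<in> Ds (tys xs)" for e d
      using True that assms(2) Ds_length[OF that] upds_cong[of d xs _ e env0]
      by (subst sat_cong[of _ _ "upds env0 xs d"]) auto
    then have "valid (Foralls xs A)" using int by (simp add: valid_internal sat_Foralls_iff)
    then show ?thesis by (rule valid_weaken2)
  next
    case False
    then obtain d where d: "d \<in> Ds (tys xs)" "\<not> sat (upds env0 xs d) A" by blast
    have "\<not> sat (upds e xs d) A" for e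
      using d assms(2) Ds_length[OF d(1)] upds_cong[of d xs _ e env0]
      by (subst sat_cong[of _ _ "upds env0 xs d"]) auto
    then have "realizes (Neg (ForallSts xs A)) (\<lambda>g. {rev d})"
      using assms(1) d(1) by (simp add: realizes_def SR_ForallSts)
    moreover have "rev d \<in> Ds (rev (tys xs))" using d(1) by (simp add: Ds_def list_all2_rev)
    then have "hb [[]] (rev (tys xs)) (\<lambda>g. {rev d})" by (intro hb_sing mf_const)
    ultimately have "valid (Neg (ForallSts xs A))"
      using assms(1) by (auto simp: valid_def intro!: exI[of _ "\<lambda>g. {rev d}"])
    then show ?thesis by (rule valid_weaken)
  qed
qed

end

section \<open>External induction\<close>

context epa_model
begin

text \<open>Without product types a pair lives in some finite type, found by induction on both
  components: numbers are paired by Cantor's function, and a functional is paired pointwise, the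
  other component being read off at the zero functional.\<close>

lemma pair_code: "\<exists>\<rho>. \<exists>P \<in> D (\<sigma> \<rightarrowtail> \<tau> \<rightarrowtail> \<rho>). \<exists>F \<in> D (\<rho> \<rightarrowtail> \<sigma>). \<exists>G \<in> D (\<rho> \<rightarrowtail> \<tau>).
    \<forall>a \<in> D \<sigma>. \<forall>b \<in> D \<tau>. F \<bullet> (P \<bullet> a \<bullet> b) = a \<and> G \<bullet> (P \<bullet> a \<bullet> b) = b"
proof (induction \<sigma>)
  case TNat
  show ?case
  proof (induction \<tau>)
    case TNat
    show ?case
      by (rule exI[of _ TNat], rule bexI[of _ "cv pair_c"], rule bexI[of _ "cv fst_c"],
          rule bexI[of _ "cv snd_c"]) auto
  next
    case (TFun \<alpha> \<beta>)
    then obtain \<rho> P F G where P: "P \<in> D (TNat \<rightarrowtail> \<beta> \<rightarrowtail> \<rho>)" and F: "F \<in> D (\<rho> \<rightarrowtail> TNat)"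
      and G: "G \<in> D (\<rho> \<rightarrowtail> \<beta>)"
      and eq: "\<And>a b. a \<in> N \<Longrightarrow> b \<in> D \<beta> \<Longrightarrow> F \<bullet> (P \<bullet> a \<bullet> b) = a \<and> G \<bullet> (P \<bullet> a \<bullet> b) = b"
      by blast
    let ?e = "env0((3, TNat \<rightarrowtail> \<beta> \<rightarrowtail> \<rho>) := P, (4, \<rho> \<rightarrowtail> TNat) := F, (5, \<rho> \<rightarrowtail> \<beta>) := G)"
    have e: "env ?e" using P F G by simp
    let ?P = "lam (0, TNat) (lam (1, \<alpha> \<rightarrowtail> \<beta>) (lam (2, \<alpha>)
      (V (3, TNat \<rightarrowtail> \<beta> \<rightarrowtail> \<rho>) \<cdot> V (0, TNat) \<cdot> (V (1, \<alpha> \<rightarrowtail> \<beta>) \<cdot> V (2, \<alpha>)))))"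
    let ?F = "lam (0, \<alpha> \<rightarrowtail> \<rho>) (V (4, \<rho> \<rightarrowtail> TNat) \<cdot> (V (0, \<alpha> \<rightarrowtail> \<rho>) \<cdot> zero_c \<alpha>))"
    let ?G = "lam (0, \<alpha> \<rightarrowtail> \<rho>) (lam (1, \<alpha>) (V (5, \<rho> \<rightarrowtail> \<beta>) \<cdot> (V (0, \<alpha> \<rightarrowtail> \<rho>) \<cdot> V (1, \<alpha>))))"
    have PD: "val ?e ?P \<in> D (TNat \<rightarrowtail> (\<alpha> \<rightarrowtail> \<beta>) \<rightarrowtail> \<alpha> \<rightarrowtail> \<rho>)" and FD: "val ?e ?F \<in> D ((\<alpha> \<rightarrowtail> \<rho>) \<rightarrowtail> TNat)"
      and GD: "val ?e ?G \<in> D ((\<alpha> \<rightarrowtail> \<rho>) \<rightarrowtail> \<alpha> \<rightarrowtail> \<beta>)"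
      using e by simp_all
    have "val ?e ?F \<bullet> (val ?e ?P \<bullet> a \<bullet> b) = a \<and> val ?e ?G \<bullet> (val ?e ?P \<bullet> a \<bullet> b) = b"
      if a: "a \<in> N" and b: "b \<in> D (\<alpha> \<rightarrowtail> \<beta>)" for a b
    proof
      have Pab: "val ?e ?P \<bullet> a \<bullet> b \<in> D (\<alpha> \<rightarrowtail> \<rho>)" by (rule app_D[OF app_D[OF PD a] b])
      have bx: "b \<bullet> x \<in> D \<beta>" if "x \<in> D \<alpha>" for x using b that by (rule app_D)
      have Px: "val ?e ?P \<bullet> a \<bullet> b \<bullet> x = P \<bullet> a \<bullet> (b \<bullet> x)" if "x \<in> D \<alpha>" for x
        using e a b that by simp
      have "val ?e ?F \<bullet> h = F \<bullet> (h \<bullet> cv (zero_c \<alpha>))" if "h \<in> D (\<alpha> \<rightarrowtail> \<rho>)" for h using e that by simp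
      from this[OF Pab] show "val ?e ?F \<bullet> (val ?e ?P \<bullet> a \<bullet> b) = a"
        using Px eq[OF a bx] by simp
      show "val ?e ?G \<bullet> (val ?e ?P \<bullet> a \<bullet> b) = b"
      proof (rule app_ext[OF app_D[OF GD Pab] b])
        fix x assume x: "x \<in> D \<alpha>"
        have "val ?e ?G \<bullet> h \<bullet> x = G \<bullet> (h \<bullet> x)" if "h \<in> D (\<alpha> \<rightarrowtail> \<rho>)" for h using e that x by simp
        from this[OF Pab] show "val ?e ?G \<bullet> (val ?e ?P \<bullet> a \<bullet> b) \<bullet> x = b \<bullet> x"
          using Px[OF x] eq[OF a bx[OF x]] by simp
      qed
    qed
    then show ?case using PD FD GD by blast
  qed
next
  case (TFun \<alpha> \<beta>)
  then obtain \<rho> P F G where P: "P \<in> D (\<beta> \<rightarrowtail> \<tau> \<rightarrowtail> \<rho>)" and F: "F \<in> D (\<rho> \<rightarrowtail> \<beta>)"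
    and G: "G \<in> D (\<rho> \<rightarrowtail> \<tau>)"
    and eq: "\<And>a b. a \<in> D \<beta> \<Longrightarrow> b \<in> D \<tau> \<Longrightarrow> F \<bullet> (P \<bullet> a \<bullet> b) = a \<and> G \<bullet> (P \<bullet> a \<bullet> b) = b"
    by blast
  let ?e = "env0((3, \<beta> \<rightarrowtail> \<tau> \<rightarrowtail> \<rho>) := P, (4, \<rho> \<rightarrowtail> \<beta>) := F, (5, \<rho> \<rightarrowtail> \<tau>) := G)"
  have e: "env ?e" using P F G by simp
  let ?P = "lam (0, \<alpha> \<rightarrowtail> \<beta>) (lam (1, \<tau>) (lam (2, \<alpha>)
    (V (3, \<beta> \<rightarrowtail> \<tau> \<rightarrowtail> \<rho>) \<cdot> (V (0, \<alpha> \<rightarrowtail> \<beta>) \<cdot> V (2, \<alpha>)) \<cdot> V (1, \<tau>))))"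
  let ?F = "lam (0, \<alpha> \<rightarrowtail> \<rho>) (lam (1, \<alpha>) (V (4, \<rho> \<rightarrowtail> \<beta>) \<cdot> (V (0, \<alpha> \<rightarrowtail> \<rho>) \<cdot> V (1, \<alpha>))))"
  let ?G = "lam (0, \<alpha> \<rightarrowtail> \<rho>) (V (5, \<rho> \<rightarrowtail> \<tau>) \<cdot> (V (0, \<alpha> \<rightarrowtail> \<rho>) \<cdot> zero_c \<alpha>))"
  have PD: "val ?e ?P \<in> D ((\<alpha> \<rightarrowtail> \<beta>) \<rightarrowtail> \<tau> \<rightarrowtail> \<alpha> \<rightarrowtail> \<rho>)" and FD: "val ?e ?F \<in> D ((\<alpha> \<rightarrowtail> \<rho>) \<rightarrowtail> \<alpha> \<rightarrowtail> \<beta>)"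
    and GD: "val ?e ?G \<in> D ((\<alpha> \<rightarrowtail> \<rho>) \<rightarrowtail> \<tau>)"
    using e by simp_all
  have "val ?e ?F \<bullet> (val ?e ?P \<bullet> a \<bullet> b) = a \<and> val ?e ?G \<bullet> (val ?e ?P \<bullet> a \<bullet> b) = b"
    if a: "a \<in> D (\<alpha> \<rightarrowtail> \<beta>)" and b: "b \<in> D \<tau>" for a b
  proof
    have Pab: "val ?e ?P \<bullet> a \<bullet> b \<in> D (\<alpha> \<rightarrowtail> \<rho>)" by (rule app_D[OF app_D[OF PD a] b])
    have ax: "a \<bullet> x \<in> D \<beta>" if "x \<in> D \<alpha>" for x using a that by (rule app_D)
    have Px: "val ?e ?P \<bullet> a \<bullet> b \<bullet> x = P \<bullet> (a \<bullet> x) \<bullet> b" if "x \<in> D \<alpha>" for x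
      using e a b that by simp
    have "val ?e ?G \<bullet> h = G \<bullet> (h \<bullet> cv (zero_c \<alpha>))" if "h \<in> D (\<alpha> \<rightarrowtail> \<rho>)" for h using e that by simp
    from this[OF Pab] show "val ?e ?G \<bullet> (val ?e ?P \<bullet> a \<bullet> b) = b"
      using Px eq[OF ax b] by simp
    show "val ?e ?F \<bullet> (val ?e ?P \<bullet> a \<bullet> b) = a"
    proof (rule app_ext[OF app_D[OF FD Pab] a])
      fix x assume x: "x \<in> D \<alpha>"
      have "val ?e ?F \<bullet> h \<bullet> x = F \<bullet> (h \<bullet> x)" if "h \<in> D (\<alpha> \<rightarrowtail> \<rho>)" for h using e that x by simp
      from this[OF Pab] show "val ?e ?F \<bullet> (val ?e ?P \<bullet> a \<bullet> b) \<bullet> x = a \<bullet> x"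
        using Px[OF x] eq[OF ax[OF x] b] by simp
    qed
  qed
  then show ?case using PD FD GD by blast
qed

text \<open>Iterated pairing; the empty tuple is coded by zero.\<close>

lemma tuple_code: "\<exists>\<zeta> enc dec. mfun Z \<zeta> enc \<and> mfuns [\<zeta>] Z dec \<and> (\<forall>z \<in> Ds Z. dec [enc z] = z)"
proof (induction Z)
  case Nil
  show ?case by (intro exI[of _ TNat] exI[of _ "\<lambda>_. zr"] exI[of _ "\<lambda>_. []"]) (simp add: mfun_const)
next
  case (Cons \<sigma> Z)
  then obtain \<zeta> enc dec where IH: "mfun Z \<zeta> enc" "mfuns [\<zeta>] Z dec" "\<And>z. z \<in> Ds Z \<Longrightarrow> dec [enc z] = z"
    by blast
  obtain \<rho> P F G where P: "P \<in> D (\<sigma> \<rightarrowtail> \<zeta> \<rightarrowtail> \<rho>)" and F: "F \<in> D (\<rho> \<rightarrowtail> \<sigma>)" and G: "G \<in> D (\<rho> \<rightarrowtail> \<zeta>)"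
    and eq: "\<And>a b. a \<in> D \<sigma> \<Longrightarrow> b \<in> D \<zeta> \<Longrightarrow> F \<bullet> (P \<bullet> a \<bullet> b) = a \<and> G \<bullet> (P \<bullet> a \<bullet> b) = b"
    using pair_code[of \<sigma> \<zeta>] by blast
  have "mfuns (\<sigma> # Z) Z (drop 1)"
    using mfuns_slice[of "\<sigma> # Z" "[\<sigma>]" Z "[]"] by (rule mfuns_cong) (auto dest: Ds_length)
  then have "mfun (\<sigma> # Z) \<rho> (\<lambda>z. P \<bullet> (z ! 0) \<bullet> enc (drop 1 z))"
    using P by (intro mfun_app[of _ \<zeta>] mfun_app[of _ \<sigma>] mfun_const mfun_nth mfun_comp[OF IH(1)]) auto
  moreover have G': "mfun [\<rho>] \<zeta> (\<lambda>x. G \<bullet> (x ! 0))" and F': "mfun [\<rho>] \<sigma> (\<lambda>x. F \<bullet> (x ! 0))"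
    using F G by (auto intro!: mfun_app[of _ \<rho>] mfun_const mfun_nth)
  have "mfuns [\<rho>] ([\<sigma>] @ Z) (\<lambda>x. [F \<bullet> (x ! 0)] @ dec [G \<bullet> (x ! 0)])"
    by (intro mfuns_append mfuns_1 F' mfuns_comp[OF IH(2)] G')
  moreover have "[F \<bullet> p] @ dec [G \<bullet> p] = z"
    if "z \<in> Ds (\<sigma> # Z)" "p = P \<bullet> (z ! 0) \<bullet> enc (drop 1 z)" for z p
    using that eq IH(3) mfun_D[OF IH(1)] by (auto simp: Ds_Cons)
  ultimately show ?case
    by (intro exI[of _ \<rho>] exI[of _ "\<lambda>z. P \<bullet> (z ! 0) \<bullet> enc (drop 1 z)"]
        exI[of _ "\<lambda>x. [F \<bullet> (x ! 0)] @ dec [G \<bullet> (x ! 0)]"]) simp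
qed

text \<open>The recursor passes the previous value before the counter, whereas \<open>s\<close>
  takes them in the other order; hence the permutation of arguments before the two
  abstractions.\<close>

lemma mfun_rec:
  assumes b: "mfun X \<zeta> b" and s: "mfun (X @ [TNat, \<zeta>]) \<zeta> s"
  shows "\<exists>r. mfun (X @ [TNat]) \<zeta> r \<and> (\<forall>x \<in> Ds X. r (x @ [zr]) = b x \<and>
    (\<forall>n \<in> N. r (x @ [sc n]) = s (x @ [n, r (x @ [n])])))"
proof -
  have "mfuns ((X @ [\<zeta>]) @ [TNat]) (X @ [TNat] @ [\<zeta>])
      (\<lambda>z. butlast (butlast z) @ [last z] @ [last (butlast z)])"
    by (intro mfuns_append mfuns_1 mfun_last mfun_weaken[OF mfun_last]
        mfuns_comp[OF mfuns_butlast mfuns_butlast])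
  then have "mfun ((X @ [\<zeta>]) @ [TNat]) \<zeta> (\<lambda>z. s (butlast (butlast z) @ [last z, last (butlast z)]))"
    using mfun_comp[OF s] by simp
  from mfun_lam[OF this] obtain s1 where s1: "mfun (X @ [\<zeta>]) (TNat \<rightarrowtail> \<zeta>) s1"
    "\<And>x n. x \<in> Ds (X @ [\<zeta>]) \<Longrightarrow> n \<in> N \<Longrightarrow> s1 x \<bullet> n = s (butlast x @ [n, last x])"
    by (metis butlast_snoc last_snoc)
  obtain s2 where s2: "mfun X (\<zeta> \<rightarrowtail> TNat \<rightarrowtail> \<zeta>) s2"
    "\<And>x a. x \<in> Ds X \<Longrightarrow> a \<in> D \<zeta> \<Longrightarrow> s2 x \<bullet> a = s1 (x @ [a])"
    using mfun_lam[OF s1(1)] by blast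
  let ?r = "\<lambda>z. cst (Rec \<zeta>) \<bullet> b (butlast z) \<bullet> s2 (butlast z) \<bullet> last z"
  have "mfun (X @ [TNat]) \<zeta> ?r"
    by (intro mfun_app[of _ TNat] mfun_app[of _ "\<zeta> \<rightarrowtail> TNat \<rightarrowtail> \<zeta>"] mfun_app[of _ \<zeta> _ "\<lambda>_. cst (Rec \<zeta>)"]
        mfun_const mfun_last mfun_weaken s2 b cst_R)
  moreover have "?r (x @ [zr]) = b x \<and> (\<forall>n \<in> N. ?r (x @ [sc n]) = s (x @ [n, ?r (x @ [n])]))"
    if x: "x \<in> Ds X" for x
    using x mfun_D[OF b x] mfun_D[OF s2(1) x] by (simp add: s2 s1)
  ultimately show ?thesis by blast
qed

text \<open>Simultaneous recursion becomes one recursion on codes of tuples. Decoding inverts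
  encoding on well-typed tuples, so every stage is shown to be well typed.\<close>

lemma mf_rec:
  assumes B: "mf \<Gamma> Z B" and S: "mf (\<Gamma> @ [[TNat], Z]) Z S"
  shows "\<exists>R. mf (\<Gamma> @ [[TNat]]) Z R \<and> (\<forall>g \<in> DDs \<Gamma>. R (g @ [[zr]]) = B g \<and>
    (\<forall>n \<in> N. R (g @ [[sc n]]) = S (g @ [[n], R (g @ [[n]])])))"
proof -
  let ?X = "concat \<Gamma>"
  obtain B' where B': "mfuns ?X Z B'" "\<And>g. g \<in> DDs \<Gamma> \<Longrightarrow> B g = B' (concat g)"
    using B by (auto simp: mf_def)
  obtain S' where S': "mfuns (?X @ TNat # Z) Z S'"
    "\<And>g. g \<in> DDs (\<Gamma> @ [[TNat], Z]) \<Longrightarrow> S g = S' (concat g)"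
    using S by (auto simp: mf_def)
  obtain \<zeta> enc dec where c: "mfun Z \<zeta> enc" "mfuns [\<zeta>] Z dec" "\<And>z. z \<in> Ds Z \<Longrightarrow> dec [enc z] = z"
    using tuple_code[of Z] by blast
  have last: "mfuns (?X @ [TNat, \<zeta>]) [\<zeta>] (\<lambda>z. [last z])"
    using mfuns_1[OF mfun_last[of "?X @ [TNat]" \<zeta>]] by simp
  have "mfuns (?X @ [TNat, \<zeta>]) (?X @ [TNat]) butlast"
    using mfuns_butlast[of "?X @ [TNat]" \<zeta>] by simp
  then have "mfuns (?X @ [TNat, \<zeta>]) ((?X @ [TNat]) @ Z) (\<lambda>z. butlast z @ dec [last z])"
    by (rule mfuns_append) (rule mfuns_comp[OF c(2) last])
  then have "mfun (?X @ [TNat, \<zeta>]) \<zeta> (\<lambda>z. enc (S' (butlast z @ dec [last z])))"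
    by (intro mfun_comp[OF c(1)] mfuns_comp[OF S'(1)]) simp
  from mfun_rec[OF mfun_comp[OF c(1) B'(1)] this]
  obtain r where r: "mfun (?X @ [TNat]) \<zeta> r"
    "\<And>x. x \<in> Ds ?X \<Longrightarrow> r (x @ [zr]) = enc (B' x)"
    "\<And>x n. x \<in> Ds ?X \<Longrightarrow> n \<in> N \<Longrightarrow> r (x @ [sc n]) = enc (S' (x @ n # dec [r (x @ [n])]))"
    by (auto simp: butlast_append)
  let ?R = "\<lambda>g. dec [r (concat g)]"
  have R: "mf (\<Gamma> @ [[TNat]]) Z ?R"
    unfolding mf_def using mfuns_comp[OF c(2) mfuns_1[OF r(1)]] by auto
  have "?R (g @ [[zr]]) = B g \<and> (\<forall>n \<in> N. ?R (g @ [[sc n]]) = S (g @ [[n], ?R (g @ [[n]])]))"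
    if g: "g \<in> DDs \<Gamma>" for g
  proof (intro conjI ballI)
    show "?R (g @ [[zr]]) = B g" using g c(3) mfuns_D[OF B'(1)] by (simp add: r B')
    fix n assume n: "n \<in> N"
    have Rn: "?R (g @ [[n]]) \<in> Ds Z" using mf_D[OF R, of "g @ [[n]]"] g n by simp
    have "S' (concat g @ n # ?R (g @ [[n]])) \<in> Ds Z"
      using g n Rn by (intro mfuns_D[OF S'(1)]) simp
    then show "?R (g @ [[sc n]]) = S (g @ [[n], ?R (g @ [[n]])])"
      using g n c(3) Rn by (simp add: r S')
  qed
  with R show ?thesis by blast
qed

section \<open>Definability of the realizability relation\<close>

lemma dfn_True: "dfn X (\<lambda>x. True)"
  using dfn_eq[OF mfun_const mfun_const, of zr TNat zr X] by simp

text \<open>Here \<open>k\<close> is a number of HOL, the length of a tuple, so this is a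
  conjunction of fixed length rather than a quantifier of the model.\<close>

lemma dfn_ball_less: "(\<And>i. i < k \<Longrightarrow> dfn X (P i)) \<Longrightarrow> dfn X (\<lambda>x. \<forall>i < (k :: nat). P i x)"
proof (induction k)
  case (Suc k)
  then have "dfn X (\<lambda>x. (\<forall>i < k. P i x) \<and> P k x)" by (intro dfn_conj) auto
  then show ?case by (rule dfn_cong) (auto simp: less_Suc_eq)
qed (simp add: dfn_True)

lemma dfn_brs:
  assumes "mfuns X (map (arrs Z) Y) F" "mfuns X Z G" "mfuns X Y H"
  shows "dfn X (\<lambda>x. H x \<in> brs Z Y (F x) (G x))"
proof -
  have "dfn X (\<lambda>x. \<forall>i < length Y. H x ! i \<in> elems (Y ! i) (brks Z (Y ! i) (F x ! i) (G x)))"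
    using mfuns_nth[OF assms(1)] mfuns_nth[OF assms(3)]
    by (intro dfn_ball_less dfn_elems mfun_brks assms(2)) auto
  then show ?thesis
    by (rule dfn_cong) (use assms(3) in \<open>auto simp: brs_def mfuns_def\<close>)
qed

text \<open>A quantifier over a tuple is a block of quantifiers of the model, one per component. In
  the induction a component is moved into the context and handed back to the second argument of
  \<open>Q\<close>.\<close>

lemma dfn_Ball_Ds:
  "dfn (X @ Y) (\<lambda>z. Q (take (length X) z) (drop (length X) z)) \<Longrightarrow> dfn X (\<lambda>x. \<forall>y \<in> Ds Y. Q x y)"
proof (induction Y arbitrary: X Q)
  case Nil
  then show ?case by (auto elim!: dfn_cong dest: Ds_length)
next
  case (Cons \<sigma> Y)
  have "dfn ((X @ [\<sigma>]) @ Y) (\<lambda>z. Q (butlast (take (length (X @ [\<sigma>])) z))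
      (last (take (length (X @ [\<sigma>])) z) # drop (length (X @ [\<sigma>])) z))"
  proof (rule dfn_cong)
    show "dfn ((X @ [\<sigma>]) @ Y) (\<lambda>z. Q (take (length X) z) (drop (length X) z))"
      using Cons.prems by simp
    fix z assume "z \<in> Ds ((X @ [\<sigma>]) @ Y)"
    then obtain x d y where "z = x @ d # y" "x \<in> Ds X"
      by (auto elim!: Ds_appendE simp: Ds_Cons)
    then show "Q (butlast (take (length (X @ [\<sigma>])) z))
      (last (take (length (X @ [\<sigma>])) z) # drop (length (X @ [\<sigma>])) z) =
      Q (take (length X) z) (drop (length X) z)"
      using Ds_length[of x X] by simp
  qed
  then have "dfn (X @ [\<sigma>]) (\<lambda>z. \<forall>y \<in> Ds Y. Q (butlast z) (last z # y))" by (rule Cons.IH)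
  then have "dfn X (\<lambda>x. \<forall>d \<in> D \<sigma>. \<forall>y \<in> Ds Y. Q x (d # y))" by (rule dfn_all')
  then show ?case by (simp add: Ball_Ds_Cons)
qed

lemma dfn_Bex_Ds:
  "dfn (X @ Y) (\<lambda>z. Q (take (length X) z) (drop (length X) z)) \<Longrightarrow> dfn X (\<lambda>x. \<exists>y \<in> Ds Y. Q x y)"
  using dfn_not[OF dfn_Ball_Ds[OF dfn_not, of X Y Q]] by simp

lemma mfuns_drop: "mfuns (X @ Y) Y (drop (length X))"
  using mfuns_slice[of "X @ Y" X Y "[]"] by (rule mfuns_cong) (auto dest: Ds_length)

lemma dfn_Bex_brs:
  assumes "mfuns X (map (arrs Z) Y) F" "mfuns X Z G"
    "dfn (X @ Y) (\<lambda>z. Q (take (length X) z) (drop (length X) z))"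
  shows "dfn X (\<lambda>x. \<exists>y \<in> brs Z Y (F x) (G x). Q x y)"
proof (rule dfn_cong)
  show "dfn X (\<lambda>x. \<exists>y \<in> Ds Y. y \<in> brs Z Y (F x) (G x) \<and> Q x y)"
    by (intro dfn_Bex_Ds dfn_conj dfn_brs mfuns_comp[OF assms(1) mfuns_take]
        mfuns_comp[OF assms(2) mfuns_take] mfuns_drop assms(3))
  show "(\<exists>y \<in> brs Z Y (F x) (G x). Q x y) = (\<exists>y \<in> Ds Y. y \<in> brs Z Y (F x) (G x) \<and> Q x y)"
    if "x \<in> Ds X" for x
    using brs_D[OF mfuns_D[OF assms(1) that] mfuns_D[OF assms(2) that]] by blast
qed

lemma dfn_Ball_brs:
  assumes "mfuns X (map (arrs Z) Y) F" "mfuns X Z G"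
    "dfn (X @ Y) (\<lambda>z. Q (take (length X) z) (drop (length X) z))"
  shows "dfn X (\<lambda>x. \<forall>y \<in> brs Z Y (F x) (G x). Q x y)"
  using dfn_not[OF dfn_Bex_brs[OF assms(1,2) dfn_not[OF assms(3)]]] by simp

lemma mfun_val:
  assumes "wt t" "\<And>v. mfun X (snd v) (\<lambda>z. \<epsilon> z v)"
  shows "mfun X (ty_of t) (\<lambda>z. val (\<epsilon> z) t)"
  using assms(1)
proof (induction t)
  case (V v)
  then show ?case using assms(2)[of v] by simp
next
  case (App s t)
  then obtain \<sigma> \<tau> where "ty_of s = \<sigma> \<rightarrowtail> \<tau>" "ty_of t = \<sigma>" by (auto split: ty.splits)
  then show ?case using App by (auto intro: mfun_app)
qed (auto intro: mfun_const)

lemma mfuns_take': "mfuns X (Y @ Z) F \<Longrightarrow> mfuns X Y (\<lambda>x. take (length Y) (F x))"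
  and mfuns_drop': "mfuns X (Y @ Z) F \<Longrightarrow> mfuns X Z (\<lambda>x. drop (length Y) (F x))"
  using mfuns_comp[OF mfuns_take] mfuns_comp[OF mfuns_drop] by blast+

lemma mfun_upd:
  assumes "\<And>v. mfun X (snd v) (\<lambda>z. \<epsilon> z v)" "mfun X (snd w) h"
  shows "mfun X (snd v) (\<lambda>z. ((\<epsilon> z)(w := h z)) v)"
  using assms by (cases "v = w") auto

text \<open>Internal induction applies to realizability only because it is definable, with
  environment, challenge and answer all varying with the context. Quantifiers over brackets become
  quantifiers over the domains, restricted by the definable membership of
  \<open>dfn_brs\<close>.\<close>

lemma dfn_SR:
  assumes "wff A" "\<And>v. mfun X (snd v) (\<lambda>z. \<epsilon> z v)" "mfuns X (SX A) F" "mfuns X (SY A) G"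
  shows "dfn X (\<lambda>z. SR A (\<epsilon> z) (F z) (G z))"
  using assms
proof (induction A arbitrary: X \<epsilon> F G)
  case (Eq s t)
  then show ?case using mfun_val[of s X \<epsilon>] mfun_val[of t X \<epsilon>]
    by (auto intro: dfn_eq[of X "ty_of t"])
next
  case (St t)
  then show ?case using mfun_val[of t X \<epsilon>] mfuns_nth[OF St(4), of 0]
    by (auto intro: dfn_eq[of X "ty_of t"])
next
  case (Neg A)
  have "dfn X (\<lambda>z. \<forall>y \<in> brs (SX A) (SY A) (F z) (G z). \<not> SR A (\<epsilon> z) (G z) y)"
  proof (rule dfn_Ball_brs)
    show "mfuns X (map (arrs (SX A)) (SY A)) F" "mfuns X (SX A) G" using Neg.prems by simp_all
    then show "dfn (X @ SY A) (\<lambda>z. \<not> SR A (\<epsilon> (take (length X) z)) (G (take (length X) z)) (drop (length X) z))"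
      using Neg.prems by (intro dfn_not Neg.IH mfun_comp[OF Neg.prems(2) mfuns_take]
          mfuns_comp[OF _ mfuns_take] mfuns_drop) auto
  qed
  then show ?case by simp
next
  case (Disj A B)
  have "mfuns X (SX A @ SX B) F" "mfuns X (SY A @ SY B) G" using Disj.prems by simp_all
  then show ?case unfolding SR.simps using Disj.prems
    by (intro dfn_disj Disj.IH mfuns_take' mfuns_drop') auto
next
  case (Conj A B)
  have "mfuns X (SX A @ SX B) F" "mfuns X (SY A @ SY B) G" using Conj.prems by simp_all
  then show ?case unfolding SR.simps using Conj.prems
    by (intro dfn_conj Conj.IH mfuns_take' mfuns_drop') auto
next
  case (Forall v A)
  have F: "mfuns X (SX A) F" and G: "mfuns X (SY A) G" using Forall.prems by simp_all
  \<comment> \<open>\<open>elemss\<close> is written as \<open>brs\<close> without arguments, so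
    that one rule covers every bounded quantifier.\<close>
  have "dfn X (\<lambda>z. \<forall>d \<in> D (snd v). \<exists>y \<in> brs [] (SY A) (G z) []. SR A ((\<epsilon> z)(v := d)) (F z) y)"
  proof (intro dfn_all' dfn_Bex_brs[of "X @ [snd v]" "[]" "SY A" "\<lambda>z. G (butlast z)" "\<lambda>z. []"]
      Forall.IH mfun_upd)
    let ?X = "X @ [snd v]"
    show "mfuns ?X (map (arrs []) (SY A)) (\<lambda>z. G (butlast z))"
      using mfuns_comp[OF G mfuns_butlast] by (simp add: map_idI)
    show "mfuns ?X [] (\<lambda>z. [])" by simp
    show "mfun (?X @ SY A) (snd w) (\<lambda>z. \<epsilon> (butlast (take (length ?X) z)) w)" for w
      by (rule mfun_comp[OF mfun_weaken[OF Forall.prems(2)] mfuns_take])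
    show "mfun (?X @ SY A) (snd v) (\<lambda>z. last (take (length ?X) z))"
      by (rule mfun_comp[OF mfun_last mfuns_take])
    show "mfuns (?X @ SY A) (SX A) (\<lambda>z. F (butlast (take (length ?X) z)))"
      by (rule mfuns_comp[OF mfuns_comp[OF F mfuns_butlast] mfuns_take])
    show "mfuns (?X @ SY A) (SY A) (drop (length ?X))" by (rule mfuns_drop)
  qed (use Forall.prems in simp)
  then show ?case by simp
next
  case (Exists v A)
  let ?Y = "map (arrs (SX A)) (SY A)" and ?X = "X @ [snd v]"
  have F: "mfuns X (map (arrs ?Y) (SX A)) F" and G: "mfuns X ?Y G" using Exists.prems by simp_all
  let ?X' = "?X @ SX A"
  let ?b = "\<lambda>z. butlast (take (length ?X) z)"
  let ?b' = "\<lambda>z. ?b (take (length ?X') z)"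
  have b: "mfuns ?X' X ?b" by (rule mfuns_comp[OF mfuns_butlast mfuns_take])
  then have b': "mfuns (?X' @ SY A) X ?b'" by (rule mfuns_comp[OF _ mfuns_take])
  have "dfn X (\<lambda>z. \<exists>d \<in> D (snd v). \<forall>x \<in> brs ?Y (SX A) (F z) (G z).
      \<exists>y \<in> brs (SX A) (SY A) (G z) x. SR A ((\<epsilon> z)(v := d)) x y)"
  proof (intro dfn_ex' dfn_Ball_brs[of ?X ?Y "SX A" "\<lambda>z. F (butlast z)" "\<lambda>z. G (butlast z)"]
      dfn_Bex_brs[of ?X' "SX A" "SY A" "\<lambda>z. G (?b z)" "\<lambda>z. drop (length ?X) z"]
      Exists.IH mfun_upd)
    show "mfuns ?X (map (arrs ?Y) (SX A)) (\<lambda>z. F (butlast z))" "mfuns ?X ?Y (\<lambda>z. G (butlast z))"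
      by (rule mfuns_comp[OF F mfuns_butlast] mfuns_comp[OF G mfuns_butlast])+
    show "mfuns ?X' ?Y (\<lambda>z. G (?b z))" by (rule mfuns_comp[OF G b])
    show "mfuns ?X' (SX A) (drop (length ?X))" by (rule mfuns_drop)
    show "mfun (?X' @ SY A) (snd w) (\<lambda>z. \<epsilon> (?b' z) w)" for w
      by (rule mfun_comp[OF Exists.prems(2) b'])
    show "mfun (?X' @ SY A) (snd v) (\<lambda>z. last (take (length ?X) (take (length ?X') z)))"
      by (rule mfun_comp[OF mfun_comp[OF mfun_last mfuns_take] mfuns_take])
    show "mfuns (?X' @ SY A) (SX A) (\<lambda>z. drop (length ?X) (take (length ?X') z))"
      by (rule mfuns_comp[OF mfuns_drop mfuns_take])
    show "mfuns (?X' @ SY A) (SY A) (drop (length ?X'))" by (rule mfuns_drop)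
  qed (use Exists.prems in simp)
  then show ?case by simp
next
  case (ForallSt v A)
  have F: "mfuns X (SX A @ [snd v]) F" using ForallSt.prems by simp
  show ?case unfolding SR.simps
  proof (intro ForallSt.IH mfun_upd)
    show "mfun X (snd v) (\<lambda>z. F z ! length (SX A))"
      using mfuns_nth[OF F, of "length (SX A)"] by (simp add: nth_append)
  qed (use ForallSt.prems F in \<open>auto intro: mfuns_take'\<close>)
next
  case (ExistsSt v A)
  let ?Y = "map (arrs (SX A)) (SY A)" and ?m = "length (SY A)"
  have F: "mfuns X (map (arrs (snd v # ?Y)) (SX A)) F" and G: "mfuns X (?Y @ [snd v]) G"
    using ExistsSt.prems by simp_all
  have G1: "mfuns X ?Y (\<lambda>z. take ?m (G z))" using mfuns_take'[OF G] by simp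
  have w: "mfun X (snd v) (\<lambda>z. G z ! ?m)" using mfuns_nth[OF G, of ?m] by (simp add: nth_append)
  have G2: "mfuns X (snd v # ?Y) (\<lambda>z. G z ! ?m # take ?m (G z))"
    using mfuns_append[OF mfuns_1[OF w] G1] by simp
  let ?X' = "X @ SX A"
  have b: "mfuns (?X' @ SY A) X (\<lambda>z. take (length X) (take (length ?X') z))"
    by (rule mfuns_comp[OF mfuns_take mfuns_take])
  have "dfn X (\<lambda>z. \<forall>x \<in> brs (snd v # ?Y) (SX A) (F z) (G z ! ?m # take ?m (G z)).
      \<exists>y \<in> brs (SX A) (SY A) (take ?m (G z)) x. SR A ((\<epsilon> z)(v := G z ! ?m)) x y)"
  proof (intro dfn_Ball_brs[OF F G2]
      dfn_Bex_brs[of ?X' "SX A" "SY A" "\<lambda>z. take ?m (G (take (length X) z))" "\<lambda>z. drop (length X) z"]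
      ExistsSt.IH mfun_upd)
    show "mfuns ?X' ?Y (\<lambda>z. take ?m (G (take (length X) z)))" by (rule mfuns_comp[OF G1 mfuns_take])
    show "mfuns ?X' (SX A) (drop (length X))" by (rule mfuns_drop)
    show "mfun (?X' @ SY A) (snd w) (\<lambda>z. \<epsilon> (take (length X) (take (length ?X') z)) w)" for w
      by (rule mfun_comp[OF ExistsSt.prems(2) b])
    show "mfun (?X' @ SY A) (snd v) (\<lambda>z. G (take (length X) (take (length ?X') z)) ! ?m)"
      by (rule mfun_comp[OF w b])
    show "mfuns (?X' @ SY A) (SX A) (\<lambda>z. drop (length X) (take (length ?X') z))"
      by (rule mfuns_comp[OF mfuns_drop mfuns_take])
    show "mfuns (?X' @ SY A) (SY A) (drop (length ?X'))" by (rule mfuns_drop)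
  qed (use ExistsSt.prems in simp)
  then show ?case by (simp add: Let_def)
qed

text \<open>From realizers of \<open>A(0)\<close> and of the step, realizers \<open>V n\<close> of \<open>A(n)\<close> and
  \<open>E n\<close> of the side formula \<open>C\<close> are computed by recursion; that one of them
  succeeds is proved by internal induction on \<open>n\<close>.\<close>
lemma valid_IA_st:
  assumes zero: "valid (Disj C (subst1 A z Zero))"
    and step: "valid (Disj C (Disj (Neg (St (V z))) (Disj (Neg A) (subst1 A z (Succ \<cdot> V z)))))"
    and z: "z \<notin> fv C" "snd z = TNat" and wff: "wff A" "wff C"
  shows "valid (Disj C (ForallSt z A))"
proof -
  let ?U = "SX A" and ?V = "SY A" and ?E = "SY C" and ?C = "SX C"
  let ?FV = "map (arrs ?U) ?V" and ?FE = "map (arrs ?U) ?E" and ?n = "length (SY A)"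
  have s: "wsubst (V(z := Zero))" "wsubst (V(z := Succ \<cdot> V z))" using z by auto
  obtain S0 T0 where 0: "hb [?C, ?U] ?E S0" "hb [?C, ?U] ?V T0"
    "\<And>e c u. env e \<Longrightarrow> c \<in> Ds ?C \<Longrightarrow> u \<in> Ds ?U \<Longrightarrow>
      \<exists>d \<in> S0 [c, u]. \<exists>v \<in> T0 [c, u]. SR C e c d \<or> SR A (e(z := zr)) u v"
    using valid_DisjD[OF zero] s z by (simp add: SR_subst1) blast
  let ?B = "Disj (Neg A) (subst1 A z (Succ \<cdot> V z))"
  obtain S1 TU where 1: "hb [?C, [TNat], ?FV @ ?U] ?E S1" "hb [?C, [TNat], ?FV @ ?U] (?U @ ?V) TU"
    "\<And>e c p w. env e \<Longrightarrow> c \<in> Ds ?C \<Longrightarrow> p \<in> N \<Longrightarrow> w \<in> Ds (?FV @ ?U) \<Longrightarrow> e z \<in> elems TNat p \<Longrightarrow>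
      \<exists>d \<in> S1 [c, [p], w]. \<exists>uv \<in> TU [c, [p], w]. SR C e c d \<or> SR ?B e w uv"
    using valid_St_elim[OF step] s z by (simp del: SR.simps) blast
  obtain P where P: "mf [[TNat]] [TNat] P"
    "\<And>w. w \<in> N \<Longrightarrow> \<exists>p \<in> N. P [[w]] = [p] \<and> w \<in> elems TNat p"
    using sing_code[of TNat] by blast
  \<comment> \<open>One recursion computes both parts: functionals answering \<open>A(n)\<close>,
    and functionals that propose answers for \<open>C\<close> from a challenge to
    \<open>A(n)\<close>.\<close>
  let ?Z = "?FV @ ?FE"
  \<comment> \<open>The step premise is queried with a code containing \<open>n\<close>, with the
    current functionals as challenge to \<open>Neg A\<close>, and with the new challenge to
    \<open>A(n + 1)\<close>.\<close>
  let ?arg = "\<lambda>g. [g ! 0, P [g ! 1], take ?n (g ! 2) @ g ! 3]"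
  let ?G = "[?C, [TNat], ?Z, ?U]"
  have V: "mf ?G ?FV (\<lambda>g. take ?n (g ! 2))"
    using mf_take[OF mf_nth[of 2 ?G ?Z]] by simp
  have E: "mf ?G ?FE (\<lambda>g. drop ?n (g ! 2))"
    using mf_drop[OF mf_nth[of 2 ?G ?Z]] by simp
  have arg: "mfs ?G [?C, [TNat], ?FV @ ?U] ?arg"
    by (intro mfs_intros mf_append mf_comp[OF P(1)] V mf_nth) auto
  \<comment> \<open>Two sources of candidates for \<open>C\<close>: the step itself, and the
    previous stage at every challenge to \<open>A(n)\<close> that the step produces against the
    current functionals.\<close>
  let ?D = "\<lambda>g. S1 (?arg g) \<union> (\<Union>uv \<in> TU (?arg g). brs ?U ?E (drop ?n (g ! 2)) (take (length ?U) uv))"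
  have W: "hb ([?C, [TNat], ?Z] @ [?U]) ?V (\<lambda>g. drop (length ?U) ` TU (?arg g))"
    using hb_drop[OF hb_comp[OF 1(2) arg]] by simp
  have D: "hb ([?C, [TNat], ?Z] @ [?U]) ?E ?D"
    using hb_union[OF hb_comp[OF 1(1) arg] hb_UN'[OF hb_comp[OF 1(2) arg]
        hb_brs[OF mf_weaken[OF E] mf_take[OF mf_last]]]] by simp
  obtain V1 where V1: "mf [?C, [TNat], ?Z] ?FV V1"
    "\<And>g u. g \<in> DDs [?C, [TNat], ?Z] \<Longrightarrow> u \<in> Ds ?U \<Longrightarrow>
      drop (length ?U) ` TU (?arg (g @ [u])) \<subseteq> brs ?U ?V (V1 g) u"
    using hb_curry[OF W] by blast
  obtain E1 where E1: "mf [?C, [TNat], ?Z] ?FE E1"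
    "\<And>g u. g \<in> DDs [?C, [TNat], ?Z] \<Longrightarrow> u \<in> Ds ?U \<Longrightarrow> ?D (g @ [u]) \<subseteq> brs ?U ?E (E1 g) u"
    using hb_curry[OF D] by blast
  have init: "hb ([?C] @ [?U]) ?V T0" "hb ([?C] @ [?U]) ?E S0" using 0 by simp_all
  obtain V0 where V0: "mf [?C] ?FV V0"
    "\<And>g u. g \<in> DDs [?C] \<Longrightarrow> u \<in> Ds ?U \<Longrightarrow> T0 (g @ [u]) \<subseteq> brs ?U ?V (V0 g) u"
    using hb_curry[OF init(1)] by blast
  obtain E0 where E0: "mf [?C] ?FE E0"
    "\<And>g u. g \<in> DDs [?C] \<Longrightarrow> u \<in> Ds ?U \<Longrightarrow> S0 (g @ [u]) \<subseteq> brs ?U ?E (E0 g) u"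
    using hb_curry[OF init(2)] by blast
  have "mf ([?C] @ [[TNat], ?Z]) ?Z (\<lambda>g. V1 g @ E1 g)"
    using mf_append[OF V1(1) E1(1)] by simp
  from mf_rec[OF mf_append[OF V0(1) E0(1)] this]
  obtain R where R0: "mf ([?C] @ [[TNat]]) ?Z R" and R': "\<forall>g \<in> DDs [?C]. R (g @ [[zr]]) = V0 g @ E0 g \<and>
      (\<forall>n \<in> N. R (g @ [[sc n]]) = V1 (g @ [[n], R (g @ [[n]])]) @ E1 (g @ [[n], R (g @ [[n]])]))"
    by blast
  have R: "mf [?C, [TNat]] ?Z R"
    "\<And>c. c \<in> Ds ?C \<Longrightarrow> R [c, [zr]] = V0 [c] @ E0 [c]"
    "\<And>c n. c \<in> Ds ?C \<Longrightarrow> n \<in> N \<Longrightarrow> R [c, [sc n]] = V1 [c, [n], R [c, [n]]] @ E1 [c, [n], R [c, [n]]]"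
    using R0 R'[rule_format, of "[_]"] by simp_all
  \<comment> \<open>Environment and challenge \<open>c\<close> are fixed parameters, whereas the
    challenge to \<open>A\<close> is quantified inside the induction predicate: the step leads from
    \<open>u'\<close> to another challenge \<open>?u\<close>.\<close>
  have key: "\<forall>u \<in> Ds ?U. (\<exists>v \<in> brs ?U ?V (take ?n (R [c, [k]])) u. SR A (e(z := k)) u v) \<or>
      (\<exists>d \<in> brs ?U ?E (drop ?n (R [c, [k]])) u. SR C e c d)"
    if e: "env e" and c: "c \<in> Ds ?C" and k: "k \<in> N" for e c k
  proof (rule nat_induct[where n = k])
    let ?X = "[TNat] @ ?U"
    let ?k = "\<lambda>w :: 'a list. take (length [TNat]) w ! 0"
    have mk: "mfun ?X TNat ?k" by (rule mfun_comp[OF mfun_nth0 mfuns_take])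
    have mu: "mfuns ?X ?U (drop (length [TNat]))" by (rule mfuns_drop)
    have mR: "mfuns [TNat] ?Z (\<lambda>x. R [c, [x ! 0]])"
    proof -
      have "mf [[TNat]] ?Z (\<lambda>g. R [c, g ! 0])"
        by (rule mf_comp[OF R(1)]) (intro mfs_intros mf_const mf_nth c; simp)
      then obtain F' where F': "mfuns [TNat] ?Z F'" "\<And>g. g \<in> DDs [[TNat]] \<Longrightarrow> R [c, g ! 0] = F' (concat g)"
        by (auto simp: mf_def)
      show ?thesis using F'(1)
      proof (rule mfuns_cong)
        fix x assume "x \<in> Ds [TNat]"
        then obtain k where "x = [k]" "k \<in> N" by (auto simp: Ds_1)
        then show "R [c, [x ! 0]] = F' x" using F'(2)[of "[[k]]"] by simp
      qed
    qed
    have mRw: "mfuns ?X ?Z (\<lambda>w. R [c, [?k w]])" by (rule mfuns_comp[OF mR mfuns_take])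
    have RV: "mfuns ?X ?FV (\<lambda>w. take ?n (R [c, [?k w]]))"
      and RE: "mfuns ?X ?FE (\<lambda>w. drop ?n (R [c, [?k w]]))"
      using mfuns_take'[OF mRw] mfuns_drop'[OF mRw] by simp_all
    have me: "mfun X (snd w) (\<lambda>z. e w)" for X w using e by (intro mfun_const env_snd_D)
    show "dfn [TNat] (\<lambda>x. \<forall>u \<in> Ds ?U. (\<exists>v \<in> brs ?U ?V (take ?n (R [c, [x ! 0]])) u. SR A (e(z := x ! 0)) u v) \<or>
      (\<exists>d \<in> brs ?U ?E (drop ?n (R [c, [x ! 0]])) u. SR C e c d))"
    proof (intro dfn_Ball_Ds dfn_disj dfn_Bex_brs[OF RV mu] dfn_Bex_brs[OF RE mu] dfn_SR wff mfun_upd me)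
      show "mfun (?X @ ?V) (snd z) (\<lambda>w. ?k (take (length ?X) w))"
        using mfun_comp[OF mk mfuns_take] z by simp
      show "mfuns (?X @ ?V) ?U (\<lambda>w. drop (length [TNat]) (take (length ?X) w))"
        by (rule mfuns_comp[OF mu mfuns_take])
      show "mfuns (?X @ ?V) ?V (drop (length ?X))" "mfuns (?X @ ?E) ?E (drop (length ?X))"
        by (rule mfuns_drop)+
      show "mfuns (?X @ ?E) ?C (\<lambda>w. c)" by (rule mfuns_const[OF c])
    qed
  next
    have "length (V0 [c]) = ?n" using Ds_length[OF mf_D[OF V0(1), of "[c]"]] c by simp
    then show "\<forall>u \<in> Ds ?U. (\<exists>v \<in> brs ?U ?V (take ?n (R [c, [zr]])) u. SR A (e(z := zr)) u v) \<or>
      (\<exists>d \<in> brs ?U ?E (drop ?n (R [c, [zr]])) u. SR C e c d)"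
      using 0(3)[OF e c] V0(2)[of "[c]"] E0(2)[of "[c]"] c by (simp add: R) blast
  next
    fix k assume k: "k \<in> N" and IH: "\<forall>u \<in> Ds ?U. (\<exists>v \<in> brs ?U ?V (take ?n (R [c, [k]])) u. SR A (e(z := k)) u v) \<or>
      (\<exists>d \<in> brs ?U ?E (drop ?n (R [c, [k]])) u. SR C e c d)"
    let ?R = "R [c, [k]]"
    let ?g = "[c, [k], ?R]"
    have RD: "?R \<in> Ds ?Z" using mf_D[OF R(1), of "[c, [k]]"] c k by simp
    then have g: "?g \<in> DDs [?C, [TNat], ?Z]" using c k by simp
    have RV: "take ?n ?R \<in> Ds ?FV" using Ds_take[OF RD] by simp
    have l: "length (V1 ?g) = ?n" using Ds_length[OF mf_D[OF V1(1) g]] by simp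
    obtain p where p: "p \<in> N" "P [[k]] = [p]" "k \<in> elems TNat p" using P(2)[OF k] by blast
    have ek: "env (e(z := k))" using e k z by simp
    show "\<forall>u \<in> Ds ?U. (\<exists>v \<in> brs ?U ?V (take ?n (R [c, [sc k]])) u. SR A (e(z := sc k)) u v) \<or>
      (\<exists>d \<in> brs ?U ?E (drop ?n (R [c, [sc k]])) u. SR C e c d)"
    proof
      fix u' assume u': "u' \<in> Ds ?U"
      let ?w = "take ?n ?R @ u'"
      have w: "?w \<in> Ds (?FV @ ?U)" using RV u' by simp
      have lR: "length (take ?n ?R) = ?n" using Ds_length[OF RV] by simp
      obtain d uv where d: "d \<in> S1 [c, [p], ?w]" "uv \<in> TU [c, [p], ?w]"
        "SR C (e(z := k)) c d \<or> SR ?B (e(z := k)) ?w uv"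
        using 1(3)[OF ek c p(1) w] p(3) by auto
      have uvD: "uv \<in> Ds (?U @ ?V)" using hb_D[OF 1(2) _ d(2)] c p w by simp
      let ?u = "take (length ?U) uv" and ?v = "drop (length ?U) uv"
      have uD: "?u \<in> Ds ?U" using Ds_take[OF uvD] .
      have dE: "x \<in> brs ?U ?E (E1 ?g) u'" if "x \<in> ?D (?g @ [u'])" for x
        using E1(2)[OF g u'] that by blast
      have "(\<exists>v \<in> brs ?U ?V (V1 ?g) u'. SR A (e(z := sc k)) u' v) \<or>
        (\<exists>d \<in> brs ?U ?E (E1 ?g) u'. SR C e c d)"
      proof (cases "SR C e c d")
        case True
        have "d \<in> ?D (?g @ [u'])" using d(1) p(2) by simp
        then show ?thesis using True dE by blast
      next
        case False
        then have B: "SR ?B (e(z := k)) ?w uv" using d(3) z(1) by simp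
        show ?thesis
        \<comment> \<open>If the current functionals answer \<open>?u\<close>, then
          \<open>Neg A\<close> fails and the step delivers \<open>A(k + 1)\<close>; otherwise the
          induction hypothesis at \<open>?u\<close> delivers \<open>C\<close>.\<close>
        proof (cases "\<exists>y \<in> brs ?U ?V (take ?n ?R) ?u. SR A (e(z := k)) ?u y")
          case True
          then have "SR (subst1 A z (Succ \<cdot> V z)) (e(z := k)) u' ?v"
            using B lR by auto
          then have "SR A (e(z := sc k)) u' ?v" using z by (simp add: SR_subst1)
          moreover have "?v \<in> brs ?U ?V (V1 ?g) u'" using V1(2)[OF g u'] d(2) p(2) by auto
          ultimately show ?thesis by blast
        next
          case F: False
          then obtain x where x: "x \<in> brs ?U ?E (drop ?n ?R) ?u" "SR C e c x"
            using IH uD by blast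
          have "x \<in> ?D (?g @ [u'])" using x(1) d(2) p(2) by auto
          then show ?thesis using x(2) dE by blast
        qed
      qed
      then show "(\<exists>v \<in> brs ?U ?V (take ?n (R [c, [sc k]])) u'. SR A (e(z := sc k)) u' v) \<or>
        (\<exists>d \<in> brs ?U ?E (drop ?n (R [c, [sc k]])) u'. SR C e c d)"
        using l by (simp add: R(3)[OF c k])
    qed
  qed (rule k)
  let ?H = "[?C, ?U @ [TNat]]" and ?l = "length ?U"
  \<comment> \<open>\<open>key\<close> guarantees a candidate on one side only; the zero tuples fill
    the other side.\<close>
  let ?S = "\<lambda>g. {zeros ?E} \<union> brs ?U ?E (drop ?n (R [g ! 0, drop ?l (g ! 1)])) (take ?l (g ! 1))"
  let ?T = "\<lambda>g. {zeros ?V} \<union> brs ?U ?V (take ?n (R [g ! 0, drop ?l (g ! 1)])) (take ?l (g ! 1))"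
  have RH: "mf ?H ?Z (\<lambda>g. R [g ! 0, drop ?l (g ! 1)])"
    by (rule mf_comp[OF R(1)]) (intro mfs_intros mf_drop mf_nth; simp)
  have uH: "mf ?H ?U (\<lambda>g. take ?l (g ! 1))" by (intro mf_take mf_nth) auto
  have "rdisj C (ForallSt z A) ?S ?T"
    unfolding rdisj_def
  proof (intro conjI allI impI ballI)
    have H: "mf ?H ?FV (\<lambda>g. take ?n (R [g ! 0, drop ?l (g ! 1)]))"
      "mf ?H ?FE (\<lambda>g. drop ?n (R [g ! 0, drop ?l (g ! 1)]))"
      using mf_take[OF RH] mf_drop[OF RH] by simp_all
    have "hb ?H ?E ?S" "hb ?H ?V ?T"
      by (rule hb_union[OF hb_sing[OF mf_const[OF zeros_Ds]] hb_brs[OF H(2) uH]]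
          hb_union[OF hb_sing[OF mf_const[OF zeros_Ds]] hb_brs[OF H(1) uH]])+
    then show "hb [SX C, SX (ForallSt z A)] (SY C) ?S"
      "hb [SX C, SX (ForallSt z A)] (SY (ForallSt z A)) ?T" using z by simp_all
    fix e c x assume e: "env e" and c: "c \<in> Ds ?C" and "x \<in> Ds (SX (ForallSt z A))"
    then obtain u k where x: "x = u @ [k]" "u \<in> Ds ?U" "k \<in> N"
      using z by (auto elim!: Ds_appendE simp: Ds_1)
    have "(\<exists>v \<in> brs ?U ?V (take ?n (R [c, [k]])) u. SR (ForallSt z A) e x v) \<or>
      (\<exists>d \<in> brs ?U ?E (drop ?n (R [c, [k]])) u. SR C e c d)"
      using key[OF e c x(3)] x Ds_length[OF x(2)] by (auto simp: nth_append)
    then show "\<exists>y \<in> ?S [c, x]. \<exists>v \<in> ?T [c, x]. SR C e c y \<or> SR (ForallSt z A) e x v"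
      using x Ds_length[OF x(2)] by (auto simp del: SR.simps)
  qed
  then show ?thesis by (rule valid_DisjI)
qed

end

section \<open>Soundness\<close>

lemma freshes_props:
  "length (freshes X \<sigma>s) = length \<sigma>s" "tys (freshes X \<sigma>s) = \<sigma>s" "distinct (freshes X \<sigma>s)"
  "finite X \<Longrightarrow> set (freshes X \<sigma>s) \<inter> X = {}"
proof -
  show "length (freshes X \<sigma>s) = length \<sigma>s" "tys (freshes X \<sigma>s) = \<sigma>s" "distinct (freshes X \<sigma>s)"
    by (simp_all add: freshes_def distinct_zipI1)
  have "fresh_name X \<le> fst v" if "v \<in> set (freshes X \<sigma>s)" for v
    using that by (auto simp: freshes_def in_set_zip)
  moreover have "fst v < fresh_name X" if "finite X" "v \<in> X" for v
    using that by (auto simp: fresh_name_def less_Suc_eq_le intro!: Max_ge)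
  ultimately show "finite X \<Longrightarrow> set (freshes X \<sigma>s) \<inter> X = {}" by fastforce
qed

section \<open>Well-formedness of the translation\<close>

lemma fv_elem: "fv (elem s t) \<subseteq> fvt s \<union> fvt t"
  by (auto simp: elem_def le_def Let_def)

lemma fv_ball: "length Ts = length ys \<Longrightarrow> fv (ball ys Ts A) \<subseteq> \<Union>(fvt ` set Ts) \<union> (fv A - set ys)"
  and fv_bex: "length Ts = length ys \<Longrightarrow> fv (bex ys Ts A) \<subseteq> \<Union>(fvt ` set Ts) \<union> (fv A - set ys)"
proof -
  have "length ys = length Ts \<Longrightarrow> fv (ball ys Ts A) \<subseteq> \<Union>(fvt ` set Ts) \<union> (fv A - set ys) \<and>
    fv (bex ys Ts A) \<subseteq> \<Union>(fvt ` set Ts) \<union> (fv A - set ys)"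
  proof (induction ys Ts rule: list_induct2)
    case (Cons y ys T Ts)
    then show ?case using fv_elem[of "V y" T] by (auto simp: ball_def bex_def)
  qed (auto simp: ball_def bex_def)
  then show "length Ts = length ys \<Longrightarrow> fv (ball ys Ts A) \<subseteq> \<Union>(fvt ` set Ts) \<union> (fv A - set ys)"
    "length Ts = length ys \<Longrightarrow> fv (bex ys Ts A) \<subseteq> \<Union>(fvt ` set Ts) \<union> (fv A - set ys)" by auto
qed

lemma ball_bex_props:
  assumes "length ys = length Ts" "\<forall>i < length ys. wt (Ts ! i) \<and> ty_of (Ts ! i) = snd (ys ! i)"
    "wff A" "internal A"
  shows "wff (ball ys Ts A) \<and> internal (ball ys Ts A) \<and> wff (bex ys Ts A) \<and> internal (bex ys Ts A)"
  using assms
proof (induction ys Ts rule: list_induct2)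
  case (Cons y ys T Ts)
  have "wt T \<and> ty_of T = snd y" using Cons.prems(1) by auto
  moreover have "\<forall>i < length ys. wt (Ts ! i) \<and> ty_of (Ts ! i) = snd (ys ! i)"
    using Cons.prems(1) by auto
  ultimately show ?case using Cons by (auto simp: ball_def bex_def elem_props)
qed (auto simp: ball_def bex_def)

lemma bracket_props:
  "wt Z \<Longrightarrow> ty_of Z = arrs (tys xs) \<tau> \<Longrightarrow> wt (bracket Z (map V xs)) \<and>
    ty_of (bracket Z (map V xs)) = \<tau> \<and> fvt (bracket Z (map V xs)) = fvt Z \<union> set xs"
  by (induction xs arbitrary: Z) (auto simp: bracket_def)

lemma brackets_props:
  assumes "tys Ys = map (arrs (tys xs)) \<tau>s"
  shows "length (brackets Ys xs) = length \<tau>s"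
    "\<forall>i < length \<tau>s. wt (brackets Ys xs ! i) \<and> ty_of (brackets Ys xs ! i) = \<tau>s ! i \<and>
      fvt (brackets Ys xs ! i) = insert (Ys ! i) (set xs)"
    "\<Union>(fvt ` set (brackets Ys xs)) \<subseteq> set Ys \<union> set xs"
proof -
  have l: "length Ys = length \<tau>s" using assms by (metis length_map)
  then show "length (brackets Ys xs) = length \<tau>s" by (simp add: brackets_def)
  have "snd (Ys ! i) = arrs (tys xs) (\<tau>s ! i)" if "i < length \<tau>s" for i
    using that l assms by (metis nth_map)
  then show all: "\<forall>i < length \<tau>s. wt (brackets Ys xs ! i) \<and> ty_of (brackets Ys xs ! i) = \<tau>s ! i \<and>
      fvt (brackets Ys xs ! i) = insert (Ys ! i) (set xs)"
    using l bracket_props[of "V (Ys ! _)" xs] by (auto simp: brackets_def)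
  show "\<Union>(fvt ` set (brackets Ys xs)) \<subseteq> set Ys \<union> set xs"
  proof (rule UN_least)
    fix T assume "T \<in> set (brackets Ys xs)"
    then obtain i where i: "i < length \<tau>s" "T = brackets Ys xs ! i"
      using l by (auto simp: in_set_conv_nth brackets_def)
    then show "fvt T \<subseteq> set Ys \<union> set xs" using all l nth_mem[of i Ys] by auto
  qed
qed

lemma brackets_Nil: "brackets Ys [] = map V Ys"
  by (simp add: brackets_def bracket_def)

lemma map_arrs_Nil [simp]: "map (arrs []) \<tau>s = \<tau>s"
  by (simp add: map_idI)

lemma ball_brackets_props:
  assumes "tys Ys = map (arrs (tys xs)) (tys ys)" "wff A" "internal A"
  shows "wff (ball ys (brackets Ys xs) A)" "internal (ball ys (brackets Ys xs) A)"
    "wff (bex ys (brackets Ys xs) A)" "internal (bex ys (brackets Ys xs) A)"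
    "fv (ball ys (brackets Ys xs) A) \<subseteq> set Ys \<union> set xs \<union> (fv A - set ys)"
    "fv (bex ys (brackets Ys xs) A) \<subseteq> set Ys \<union> set xs \<union> (fv A - set ys)"
proof -
  note br = brackets_props[OF assms(1)]
  show "wff (ball ys (brackets Ys xs) A)" "internal (ball ys (brackets Ys xs) A)"
    "wff (bex ys (brackets Ys xs) A)" "internal (bex ys (brackets Ys xs) A)"
    using ball_bex_props[of ys "brackets Ys xs" A] br(1,2) assms(2,3) by auto
  have "length (brackets Ys xs) = length ys" using br(1) by simp
  from fv_ball[OF this, of A] fv_bex[OF this, of A] br(3)
  show "fv (ball ys (brackets Ys xs) A) \<subseteq> set Ys \<union> set xs \<union> (fv A - set ys)"
    "fv (bex ys (brackets Ys xs) A) \<subseteq> set Ys \<union> set xs \<union> (fv A - set ys)"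
    by blast+
qed

lemma fv_subst1_V: "fv (subst1 A z (V w)) \<subseteq> insert w (fv A - {z})"
  using fv_subst[of "V(z := V w)" A] by (auto split: if_splits)

text \<open>The invariant behind the freshness conditions: the tuples avoid \<open>X\<close>, and
  the matrix has no further free variables. Both facts allow values of auxiliary variables to be
  discarded later.\<close>

definition Sst_ok :: "var set \<Rightarrow> fm \<Rightarrow> var list \<times> var list \<times> fm \<Rightarrow> bool" where
  "Sst_ok X A = (\<lambda>(xs, ys, \<phi>). distinct (xs @ ys) \<and> set (xs @ ys) \<inter> X = {} \<and> tys xs = SX A \<and>
     tys ys = SY A \<and> fv \<phi> \<subseteq> fv A \<union> set xs \<union> set ys \<and> internal \<phi> \<and> wff \<phi>)"

lemma Sst_ok: "finite X \<Longrightarrow> fv A \<subseteq> X \<Longrightarrow> wff A \<Longrightarrow> Sst_ok X A (Sst X A)"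
proof (induction A arbitrary: X)
  case (Eq s t)
  then show ?case by (simp add: Sst_ok_def)
next
  case (St t)
  then show ?case using fresh_notin[of X "ty_of t"] by (simp add: Sst_ok_def Let_def)
next
  case (Neg A)
  obtain xs ys \<phi> where S: "Sst X A = (xs, ys, \<phi>)" by (cases "Sst X A") auto
  have ok: "Sst_ok X A (xs, ys, \<phi>)" using Neg.IH[of X] Neg.prems S by simp
  define Ys where "Ys = freshes (X \<union> set xs \<union> set ys) (map (arrs (tys xs)) (tys ys))"
  have Ys: "set Ys \<inter> (X \<union> set xs \<union> set ys) = {}" "tys Ys = map (arrs (tys xs)) (tys ys)" "distinct Ys"
    unfolding Ys_def using Neg.prems by (intro freshes_props; auto)+
  have \<phi>: "wff (Neg \<phi>)" "internal (Neg \<phi>)" and fv: "fv \<phi> \<subseteq> fv A \<union> set xs \<union> set ys"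
    using ok by (auto simp: Sst_ok_def)
  note B = ball_brackets_props[OF Ys(2) \<phi>]
  have "fv (ball ys (brackets Ys xs) (Neg \<phi>)) \<subseteq> fv (Neg A) \<union> set Ys \<union> set xs"
    using B(5) fv unfolding fv.simps by blast
  moreover have "Sst X (Neg A) = (Ys, xs, ball ys (brackets Ys xs) (Neg \<phi>))"
    by (simp add: S Let_def Ys_def)
  moreover have "distinct (Ys @ xs)" "set (Ys @ xs) \<inter> X = {}" "tys xs = SY (Neg A)" "tys Ys = SX (Neg A)"
    using ok Ys by (auto simp: Sst_ok_def)
  ultimately show ?case using B(1,2) by (simp add: Sst_ok_def)
next
  case (Disj A B)
  obtain xs ys \<phi> where S: "Sst X A = (xs, ys, \<phi>)" by (cases "Sst X A") auto
  obtain us vs \<psi> where T: "Sst (X \<union> set xs \<union> set ys) B = (us, vs, \<psi>)"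
    by (cases "Sst (X \<union> set xs \<union> set ys) B") auto
  have "Sst_ok X A (xs, ys, \<phi>)" "Sst_ok (X \<union> set xs \<union> set ys) B (us, vs, \<psi>)"
    using Disj.IH(1)[of X] Disj.IH(2)[of "X \<union> set xs \<union> set ys"] Disj.prems S T by auto
  then show ?case by (auto simp: Sst_ok_def S T)
next
  case (Conj A B)
  obtain xs ys \<phi> where S: "Sst X A = (xs, ys, \<phi>)" by (cases "Sst X A") auto
  obtain us vs \<psi> where T: "Sst (X \<union> set xs \<union> set ys) B = (us, vs, \<psi>)"
    by (cases "Sst (X \<union> set xs \<union> set ys) B") auto
  have "Sst_ok X A (xs, ys, \<phi>)" "Sst_ok (X \<union> set xs \<union> set ys) B (us, vs, \<psi>)"
    using Conj.IH(1)[of X] Conj.IH(2)[of "X \<union> set xs \<union> set ys"] Conj.prems S T by auto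
  then show ?case by (auto simp: Sst_ok_def S T)
next
  case (Forall z A)
  let ?X = "insert z X"
  obtain xs ys \<phi> where S: "Sst ?X A = (xs, ys, \<phi>)" by (cases "Sst ?X A") auto
  have ok: "Sst_ok ?X A (xs, ys, \<phi>)" using Forall.IH[of ?X] Forall.prems S by auto
  define Ys where "Ys = freshes (?X \<union> set xs \<union> set ys) (tys ys)"
  have Ys: "set Ys \<inter> (?X \<union> set xs \<union> set ys) = {}" "tys Ys = map (arrs (tys [])) (tys ys)" "distinct Ys"
    unfolding Ys_def using Forall.prems by (auto simp: freshes_props)
  have \<phi>: "wff \<phi>" "internal \<phi>" and fv: "fv \<phi> \<subseteq> fv A \<union> set xs \<union> set ys"
    and z: "z \<notin> set xs"
    using ok by (auto simp: Sst_ok_def)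
  let ?B = "bex ys (brackets Ys []) \<phi>"
  note B = ball_brackets_props[OF Ys(2) \<phi>]
  have "fv (Forall z ?B) \<subseteq> fv (Forall z A) \<union> set xs \<union> set Ys"
    using B(6) fv unfolding fv.simps list.set by blast
  moreover have "Sst X (Forall z A) = (xs, Ys, Forall z ?B)"
    by (simp add: S Let_def Ys_def brackets_Nil)
  moreover have "distinct (xs @ Ys)" "set (xs @ Ys) \<inter> X = {}" "tys xs = SX (Forall z A)"
    "tys Ys = SY (Forall z A)"
    using ok Ys by (auto simp: Sst_ok_def)
  ultimately show ?case using B(3,4) by (simp add: Sst_ok_def)
next
  case (Exists z A)
  let ?X = "insert z X"
  obtain xs ys \<phi> where S: "Sst ?X A = (xs, ys, \<phi>)" by (cases "Sst ?X A") auto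
  have ok: "Sst_ok ?X A (xs, ys, \<phi>)" using Exists.IH[of ?X] Exists.prems S by auto
  define Ys where "Ys = freshes (?X \<union> set xs \<union> set ys) (map (arrs (tys xs)) (tys ys))"
  define Xs where "Xs = freshes (?X \<union> set xs \<union> set ys \<union> set Ys) (map (arrs (tys Ys)) (tys xs))"
  have Ys: "set Ys \<inter> (?X \<union> set xs \<union> set ys) = {}" "tys Ys = map (arrs (tys xs)) (tys ys)" "distinct Ys"
    unfolding Ys_def using Exists.prems by (intro freshes_props; auto)+
  have Xs: "set Xs \<inter> (?X \<union> set xs \<union> set ys \<union> set Ys) = {}" "tys Xs = map (arrs (tys Ys)) (tys xs)"
    "distinct Xs"
    unfolding Xs_def using Exists.prems by (intro freshes_props; auto)+
  have \<phi>: "wff \<phi>" "internal \<phi>" and fv: "fv \<phi> \<subseteq> fv A \<union> set xs \<union> set ys"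
    using ok by (auto simp: Sst_ok_def)
  let ?B = "bex ys (brackets Ys xs) \<phi>"
  let ?C = "ball xs (brackets Xs Ys) ?B"
  note B = ball_brackets_props[OF Ys(2) \<phi>]
  note C = ball_brackets_props[OF Xs(2) B(3,4)]
  have "fv (Exists z ?C) \<subseteq> fv (Exists z A) \<union> set Xs \<union> set Ys"
    using B(6) C(5) fv unfolding fv.simps by blast
  moreover have "Sst X (Exists z A) = (Xs, Ys, Exists z ?C)"
    by (simp add: S Let_def Ys_def Xs_def)
  moreover have "distinct (Xs @ Ys)" "set (Xs @ Ys) \<inter> X = {}"
    using Ys(1,3) Xs(1,3) by auto
  moreover have "tys Ys = SY (Exists z A)" using ok Ys(2) by (simp add: Sst_ok_def)
  moreover have "tys Xs = SX (Exists z A)" unfolding Xs(2) Ys(2) using ok by (simp add: Sst_ok_def)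
  ultimately show ?case using C(1,2) by (simp add: Sst_ok_def)
next
  case (ForallSt z A)
  let ?X = "insert z X"
  obtain xs ys \<phi> where S: "Sst ?X A = (xs, ys, \<phi>)" by (cases "Sst ?X A") auto
  have ok: "Sst_ok ?X A (xs, ys, \<phi>)" using ForallSt.IH[of ?X] ForallSt.prems S by auto
  let ?w = "fresh (?X \<union> set xs \<union> set ys) (snd z)"
  have w: "?w \<notin> ?X \<union> set xs \<union> set ys" using ForallSt.prems by (intro fresh_notin) auto
  have "fv (subst1 \<phi> z (V ?w)) \<subseteq> fv (ForallSt z A) \<union> insert ?w (set xs) \<union> set ys"
    using ok fv_subst1_V[of z ?w \<phi>] by (auto simp: Sst_ok_def)
  then show ?case using ok w by (auto simp: Sst_ok_def S Let_def)
next
  case (ExistsSt z A)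
  let ?X = "insert z X"
  obtain xs ys \<phi> where S: "Sst ?X A = (xs, ys, \<phi>)" by (cases "Sst ?X A") auto
  have ok: "Sst_ok ?X A (xs, ys, \<phi>)" using ExistsSt.IH[of ?X] ExistsSt.prems S by auto
  define w where "w = fresh (?X \<union> set xs \<union> set ys) (snd z)"
  define Ys where "Ys = freshes (insert w ?X \<union> set xs \<union> set ys) (map (arrs (tys xs)) (tys ys))"
  define Xs where "Xs = freshes (insert w ?X \<union> set xs \<union> set ys \<union> set Ys) (map (arrs (tys (w # Ys))) (tys xs))"
  have w: "w \<notin> ?X \<union> set xs \<union> set ys" "snd w = snd z"
    unfolding w_def using ExistsSt.prems fresh_notin[of "?X \<union> set xs \<union> set ys" "snd z"] by simp_all
  have Ys: "set Ys \<inter> (insert w ?X \<union> set xs \<union> set ys) = {}" "tys Ys = map (arrs (tys xs)) (tys ys)"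
    "distinct Ys"
    unfolding Ys_def using ExistsSt.prems by (intro freshes_props; auto)+
  have Xs: "set Xs \<inter> (insert w ?X \<union> set xs \<union> set ys \<union> set Ys) = {}"
    "tys Xs = map (arrs (tys (w # Ys))) (tys xs)" "distinct Xs"
    unfolding Xs_def using ExistsSt.prems by (intro freshes_props; auto)+
  let ?\<phi> = "subst1 \<phi> z (V w)"
  have \<phi>: "wff ?\<phi>" "internal ?\<phi>" and fv: "fv \<phi> \<subseteq> fv A \<union> set xs \<union> set ys"
    using ok w by (auto simp: Sst_ok_def)
  let ?B = "bex ys (brackets Ys xs) ?\<phi>"
  let ?C = "ball xs (brackets Xs (w # Ys)) ?B"
  note B = ball_brackets_props[OF Ys(2) \<phi>]
  note C = ball_brackets_props[OF Xs(2) B(3,4)]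
  have "fv ?C \<subseteq> fv (ExistsSt z A) \<union> set Xs \<union> set (Ys @ [w])"
    using B(6) C(5) fv fv_subst1_V[of z w \<phi>] unfolding fv.simps list.set set_append by blast
  moreover have "Sst X (ExistsSt z A) = (Xs, Ys @ [w], ?C)"
    by (simp add: S Let_def Ys_def Xs_def w_def)
  moreover have "distinct (Xs @ Ys @ [w])" "set (Xs @ Ys @ [w]) \<inter> X = {}"
    using Ys(1,3) Xs(1,3) w(1) by auto
  moreover have "tys (Ys @ [w]) = SY (ExistsSt z A)"
    unfolding map_append list.map Ys(2) w(2) using ok by (simp add: Sst_ok_def)
  moreover have "tys Xs = SX (ExistsSt z A)"
    unfolding Xs(2) list.map Ys(2) w(2) using ok by (simp add: Sst_ok_def)
  ultimately show ?case using C(1,2) by (simp add: Sst_ok_def)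
qed

text \<open>A lookup form of \<open>upds\<close>. For distinct variables it removes the order of
  updates, so that environments built in different ways can be compared by simplification.\<close>

definition lk :: "var list \<Rightarrow> 'a list \<Rightarrow> var \<Rightarrow> 'a" where
  "lk vs d v = the (map_of (zip vs d) v)"

lemma lk_append: "length a = length xs \<Longrightarrow> length b = length us \<Longrightarrow>
    lk (xs @ us) (a @ b) v = (if v \<in> set xs then lk xs a v else lk us b v)"
  by (auto simp: lk_def map_of_append map_add_def split: option.split)
    (metis map_of_zip_is_None option.distinct(1))+

lemma lk_Cons: "lk (x # xs) (a # d) v = (if v = x then a else lk xs d v)"
  by (simp add: lk_def)

lemma upds_lk: "length d = length vs \<Longrightarrow> distinct vs \<Longrightarrow>
    upds e vs d v = (if v \<in> set vs then lk vs d v else e v)"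
proof (induction vs arbitrary: e d)
  case (Cons w vs)
  then obtain a d' where "d = a # d'" by (cases d) auto
  then show ?case using Cons by (auto simp: lk_def)
qed simp

context epa_model
begin

text \<open>The bounding terms contain none of the quantified variables, so each keeps its value
  while earlier variables are assigned.\<close>

lemma sat_ball_bex:
  assumes "length ys = length Ts"
    "\<forall>i < length ys. wt (Ts ! i) \<and> ty_of (Ts ! i) = snd (ys ! i) \<and> fvt (Ts ! i) \<inter> set ys = {}"
    "env e"
  shows "(sat e (ball ys Ts A) \<longleftrightarrow> (\<forall>y \<in> Ds (tys ys).
      (\<forall>i < length ys. y ! i \<in> elems (snd (ys ! i)) (val e (Ts ! i))) \<longrightarrow> sat (upds e ys y) A)) \<and>
    (sat e (bex ys Ts A) \<longleftrightarrow> (\<exists>y \<in> Ds (tys ys).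
      (\<forall>i < length ys. y ! i \<in> elems (snd (ys ! i)) (val e (Ts ! i))) \<and> sat (upds e ys y) A))"
  using assms
proof (induction ys Ts arbitrary: e rule: list_induct2)
  case Nil
  then show ?case by (simp add: ball_def bex_def)
next
  case (Cons v ys T Ts)
  have T: "wt T" "ty_of T = snd v" "v \<notin> fvt T" using Cons.prems(1) by (auto dest: spec[of _ 0])
  have Ts: "\<forall>i < length ys. wt (Ts ! i) \<and> ty_of (Ts ! i) = snd (ys ! i) \<and> fvt (Ts ! i) \<inter> set ys = {}"
    and v: "\<And>i. i < length ys \<Longrightarrow> v \<notin> fvt (Ts ! i)"
    using Cons.prems(1) by (force dest: spec[of _ "Suc _"])+
  have el: "sat (e(v := d)) (elem (V v) T) \<longleftrightarrow> d \<in> elems (snd v) (val e T)" if "d \<in> D (snd v)" for d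
    using that Cons.prems(2) T by (subst sat_elem) (auto simp: val_upd_idle)
  have idle: "(\<forall>i < length ys. y ! i \<in> elems (snd (ys ! i)) (val (e(v := d)) (Ts ! i))) \<longleftrightarrow>
      (\<forall>i < length ys. y ! i \<in> elems (snd (ys ! i)) (val e (Ts ! i)))" for y d
    using v by (simp add: val_upd_idle)
  have IH: "(sat (e(v := d)) (ball ys Ts A) \<longleftrightarrow> (\<forall>y \<in> Ds (tys ys).
      (\<forall>i < length ys. y ! i \<in> elems (snd (ys ! i)) (val e (Ts ! i))) \<longrightarrow> sat (upds (e(v := d)) ys y) A)) \<and>
    (sat (e(v := d)) (bex ys Ts A) \<longleftrightarrow> (\<exists>y \<in> Ds (tys ys).
      (\<forall>i < length ys. y ! i \<in> elems (snd (ys ! i)) (val e (Ts ! i))) \<and> sat (upds (e(v := d)) ys y) A))"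
    if "d \<in> D (snd v)" for d
    using Cons.IH[OF Ts env_upd[OF Cons.prems(2) that]] unfolding idle .
  have all: "(\<forall>i < length (v # ys). (d # y) ! i \<in> elems (snd ((v # ys) ! i)) (val e ((T # Ts) ! i))) \<longleftrightarrow>
      d \<in> elems (snd v) (val e T) \<and> (\<forall>i < length ys. y ! i \<in> elems (snd (ys ! i)) (val e (Ts ! i)))" for d y
    by (auto simp: nth_Cons split: nat.splits)
  have b: "ball (v # ys) (T # Ts) A = Forall v (Imp (elem (V v) T) (ball ys Ts A))"
    "bex (v # ys) (T # Ts) A = Exists v (Conj (elem (V v) T) (bex ys Ts A))"
    by (simp_all add: ball_def bex_def)
  show ?case
    unfolding b list.map Ball_Ds_Cons Bex_Ds_Cons all sat.simps upds.simps
    using el IH by blast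
qed

lemma val_bracket: "val e (bracket Z (map V xs)) = brks (tys xs) \<tau> (val e Z) (map e xs)"
  if "ty_of Z = arrs (tys xs) \<tau>"
  using that
proof (induction xs arbitrary: Z)
  case (Cons x xs)
  then show ?case by (simp add: bracket_def)
qed (simp add: bracket_def)

lemma sat_brackets:
  assumes "tys Ys = map (arrs (tys xs)) (tys ys)" "set ys \<inter> (set Ys \<union> set xs) = {}" "env e"
  shows "sat e (ball ys (brackets Ys xs) A) \<longleftrightarrow>
      (\<forall>y \<in> brs (tys xs) (tys ys) (map e Ys) (map e xs). sat (upds e ys y) A)"
    "sat e (bex ys (brackets Ys xs) A) \<longleftrightarrow>
      (\<exists>y \<in> brs (tys xs) (tys ys) (map e Ys) (map e xs). sat (upds e ys y) A)"
proof -
  note br = brackets_props[OF assms(1)]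
  have l: "length Ys = length ys" using arg_cong[OF assms(1), of length] by simp
  have ty: "snd (Ys ! i) = arrs (tys xs) (snd (ys ! i))" if "i < length ys" for i
    using that l arg_cong[OF assms(1), of "\<lambda>l. l ! i"] by simp
  have 1: "\<forall>i < length ys. wt (brackets Ys xs ! i) \<and> ty_of (brackets Ys xs ! i) = snd (ys ! i) \<and>
      fvt (brackets Ys xs ! i) \<inter> set ys = {}"
    using br(2) assms(2) l nth_mem by fastforce
  have 2: "val e (brackets Ys xs ! i) = brks (tys xs) (snd (ys ! i)) (e (Ys ! i)) (map e xs)"
    if "i < length ys" for i
    using val_bracket[of "V (Ys ! i)" xs "snd (ys ! i)" e] ty that l by (simp add: brackets_def)
  have 3: "y \<in> Ds (tys ys) \<and> (\<forall>i < length ys. y ! i \<in> elems (snd (ys ! i)) (val e (brackets Ys xs ! i)))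
    \<longleftrightarrow> y \<in> brs (tys xs) (tys ys) (map e Ys) (map e xs)" for y
  proof -
    have "map e Ys \<in> Ds (map (arrs (tys xs)) (tys ys))"
    proof (rule DsI)
      fix i assume "i < length (map (arrs (tys xs)) (tys ys))"
      then show "map e Ys ! i \<in> D (map (arrs (tys xs)) (tys ys) ! i)"
        using l ty[of i] env_snd_D[OF assms(3), of "Ys ! i"] by simp
    qed (use l in simp)
    moreover have "map e xs \<in> Ds (tys xs)" using env_snd_D[OF assms(3)] by (intro DsI) auto
    ultimately have "y \<in> brs (tys xs) (tys ys) (map e Ys) (map e xs) \<Longrightarrow> y \<in> Ds (tys ys)"
      by (rule brs_D)
    then show ?thesis using l by (auto simp: brs_def 2 dest: Ds_length)
  qed
  show "sat e (ball ys (brackets Ys xs) A) \<longleftrightarrow>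
      (\<forall>y \<in> brs (tys xs) (tys ys) (map e Ys) (map e xs). sat (upds e ys y) A)"
    "sat e (bex ys (brackets Ys xs) A) \<longleftrightarrow>
      (\<exists>y \<in> brs (tys xs) (tys ys) (map e Ys) (map e xs). sat (upds e ys y) A)"
    using sat_ball_bex[OF _ 1 assms(3), of A] br(1) 3 by (simp_all add: Ball_def Bex_def) blast+
qed

section \<open>Agreement of the translation with realizability\<close>

lemma map_upds_append:
  assumes "distinct (xs @ ys)" "length x = length xs" "length y = length ys"
  shows "map (upds e (xs @ ys) (x @ y)) xs = x" "map (upds e (xs @ ys) (x @ y)) ys = y"
  using map_upds[OF assms(1), of "x @ y" e] assms(2,3) by (simp_all add: append_eq_append_conv)

text \<open>Induction on the formula. In each case the translated matrix is evaluated in an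
  environment that also assigns auxiliary variables; by freshness these are not free in the matrix
  of the subformula, and \<open>sat_cong\<close> discards them.\<close>

lemma Sst_sat:
  assumes "finite X" "fv A \<subseteq> X" "wff A" "Sst X A = (xs, ys, \<phi>)"
    "env e" "x \<in> Ds (SX A)" "y \<in> Ds (SY A)"
  shows "sat (upds e (xs @ ys) (x @ y)) \<phi> \<longleftrightarrow> SR A e x y"
  using assms
proof (induction A arbitrary: X xs ys \<phi> e x y)
  case (Eq s t)
  then show ?case by auto
next
  case (St t)
  obtain c where c: "y = [c]" "x = []" using St.prems by (auto simp: Ds_1)
  have "fresh X (ty_of t) \<notin> fvt t" using fresh_notin[of X] St.prems by auto
  then show ?case using St.prems c by (auto simp: Let_def val_upd_idle)
next
  case (Neg A)
  obtain us vs \<psi> where S: "Sst X A = (us, vs, \<psi>)" by (cases "Sst X A") auto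
  have ok: "Sst_ok X A (us, vs, \<psi>)" using Sst_ok[of X A] Neg.prems S by simp
  define Ys where "Ys = freshes (X \<union> set us \<union> set vs) (map (arrs (tys us)) (tys vs))"
  have Ys: "set Ys \<inter> (X \<union> set us \<union> set vs) = {}" "tys Ys = map (arrs (tys us)) (tys vs)" "distinct Ys"
    unfolding Ys_def using Neg.prems by (intro freshes_props; auto)+
  have eq: "xs = Ys" "ys = us" "\<phi> = ball vs (brackets Ys us) (Neg \<psi>)"
    using Neg.prems(4) by (auto simp: S Let_def Ys_def)
  have ty: "tys us = SX A" "tys vs = SY A" using ok by (auto simp: Sst_ok_def)
  let ?e = "upds e (Ys @ us) (x @ y)"
  have x: "x \<in> Ds (tys Ys)" and y: "y \<in> Ds (tys us)" using Neg.prems Ys(2) ty by simp_all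
  have e: "env ?e" using Neg.prems(5) x y by simp
  have "distinct (Ys @ us)" using Ys(1,3) ok by (auto simp: Sst_ok_def)
  moreover have "length x = length Ys" "length y = length us"
    using Ds_length[OF x] Ds_length[OF y] by simp_all
  ultimately have d: "distinct (Ys @ us)" "length x = length Ys" "length y = length us" .
  have "sat (upds ?e vs v) \<psi> \<longleftrightarrow> SR A e y v" if v: "v \<in> Ds (SY A)" for v
  proof -
    have lv: "length v = length vs" using Ds_length[OF v] by (simp flip: ty)
    have "sat (upds ?e vs v) \<psi> \<longleftrightarrow> sat (upds e (us @ vs) (y @ v)) \<psi>"
    proof (rule sat_cong)
      fix w assume "w \<in> fv \<psi>"
      then show "upds ?e vs v w = upds e (us @ vs) (y @ v) w"
        using ok Ys(1,3) d lv Neg.prems(2)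
        by (auto simp: upds_lk lk_append Sst_ok_def)
    qed
    also have "\<dots> \<longleftrightarrow> SR A e y v"
      using Neg.IH[of X us vs \<psi> e y v] Neg.prems S v by auto
    finally show ?thesis .
  qed
  moreover have "map ?e Ys = x" "map ?e us = y" using map_upds_append[OF d] by auto
  moreover have "v \<in> Ds (SY A)" if "v \<in> brs (SX A) (SY A) x y" for v
    using brs_D[OF _ _ that] Neg.prems by simp
  moreover have "sat ?e \<phi> \<longleftrightarrow> (\<forall>v \<in> brs (tys us) (tys vs) (map ?e Ys) (map ?e us). sat (upds ?e vs v) (Neg \<psi>))"
    unfolding eq by (rule sat_brackets(1)[OF Ys(2) _ e]) (use Ys(1) ok in \<open>auto simp: Sst_ok_def\<close>)
  ultimately show ?case using ty by (simp add: eq)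
next
  case (Disj A B)
  obtain xs1 ys1 \<phi>1 where S: "Sst X A = (xs1, ys1, \<phi>1)" by (cases "Sst X A") auto
  let ?X = "X \<union> set xs1 \<union> set ys1"
  obtain us vs \<psi> where T: "Sst ?X B = (us, vs, \<psi>)" by (cases "Sst ?X B") auto
  have ok: "Sst_ok X A (xs1, ys1, \<phi>1)" "Sst_ok ?X B (us, vs, \<psi>)"
    using Sst_ok[of X A] Sst_ok[of ?X B] Disj.prems S T by auto
  have eq: "xs = xs1 @ us" "ys = ys1 @ vs" "\<phi> = Disj \<phi>1 \<psi>"
    using Disj.prems(4) by (auto simp: S T)
  obtain x1 x2 where x: "x = x1 @ x2" "x1 \<in> Ds (SX A)" "x2 \<in> Ds (SX B)"
    using Disj.prems by (auto elim: Ds_appendE)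
  obtain y1 y2 where y: "y = y1 @ y2" "y1 \<in> Ds (SY A)" "y2 \<in> Ds (SY B)"
    using Disj.prems by (auto elim: Ds_appendE)
  have l: "length x1 = length xs1" "length x2 = length us" "length y1 = length ys1" "length y2 = length vs"
    using ok Ds_length[OF x(2)] Ds_length[OF x(3)] Ds_length[OF y(2)] Ds_length[OF y(3)]
    by (auto simp: Sst_ok_def dest: arg_cong[of "tys _" _ length])
  have dd: "distinct (xs1 @ us @ ys1 @ vs)" using ok by (auto simp: Sst_ok_def)
  let ?e = "upds e (xs @ ys) (x @ y)"
  have "sat ?e \<phi>1 \<longleftrightarrow> sat (upds e (xs1 @ ys1) (x1 @ y1)) \<phi>1"
    by (rule sat_cong) (use ok l dd Disj.prems(2) in \<open>auto simp: eq x y upds_lk lk_append Sst_ok_def\<close>)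
  moreover have "sat ?e \<psi> \<longleftrightarrow> sat (upds e (us @ vs) (x2 @ y2)) \<psi>"
    by (rule sat_cong) (use ok l dd Disj.prems(2) in \<open>auto simp: eq x y upds_lk lk_append Sst_ok_def\<close>)
  moreover have "sat (upds e (xs1 @ ys1) (x1 @ y1)) \<phi>1 \<longleftrightarrow> SR A e x1 y1"
    using Disj.prems S x y by (intro Disj.IH(1)[of X]) auto
  moreover have "sat (upds e (us @ vs) (x2 @ y2)) \<psi> \<longleftrightarrow> SR B e x2 y2"
    using Disj.prems T x y by (intro Disj.IH(2)[of ?X]) auto
  ultimately show ?case using x y Ds_length[OF x(2)] Ds_length[OF y(2)] by (simp add: eq)
next
  case (Conj A B)
  obtain xs1 ys1 \<phi>1 where S: "Sst X A = (xs1, ys1, \<phi>1)" by (cases "Sst X A") auto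
  let ?X = "X \<union> set xs1 \<union> set ys1"
  obtain us vs \<psi> where T: "Sst ?X B = (us, vs, \<psi>)" by (cases "Sst ?X B") auto
  have ok: "Sst_ok X A (xs1, ys1, \<phi>1)" "Sst_ok ?X B (us, vs, \<psi>)"
    using Sst_ok[of X A] Sst_ok[of ?X B] Conj.prems S T by auto
  have eq: "xs = xs1 @ us" "ys = ys1 @ vs" "\<phi> = Conj \<phi>1 \<psi>"
    using Conj.prems(4) by (auto simp: S T)
  obtain x1 x2 where x: "x = x1 @ x2" "x1 \<in> Ds (SX A)" "x2 \<in> Ds (SX B)"
    using Conj.prems by (auto elim: Ds_appendE)
  obtain y1 y2 where y: "y = y1 @ y2" "y1 \<in> Ds (SY A)" "y2 \<in> Ds (SY B)"
    using Conj.prems by (auto elim: Ds_appendE)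
  have l: "length x1 = length xs1" "length x2 = length us" "length y1 = length ys1" "length y2 = length vs"
    using ok Ds_length[OF x(2)] Ds_length[OF x(3)] Ds_length[OF y(2)] Ds_length[OF y(3)]
    by (auto simp: Sst_ok_def dest: arg_cong[of "tys _" _ length])
  have dd: "distinct (xs1 @ us @ ys1 @ vs)" using ok by (auto simp: Sst_ok_def)
  let ?e = "upds e (xs @ ys) (x @ y)"
  have "sat ?e \<phi>1 \<longleftrightarrow> sat (upds e (xs1 @ ys1) (x1 @ y1)) \<phi>1"
    by (rule sat_cong) (use ok l dd Conj.prems(2) in \<open>auto simp: eq x y upds_lk lk_append Sst_ok_def\<close>)
  moreover have "sat ?e \<psi> \<longleftrightarrow> sat (upds e (us @ vs) (x2 @ y2)) \<psi>"
    by (rule sat_cong) (use ok l dd Conj.prems(2) in \<open>auto simp: eq x y upds_lk lk_append Sst_ok_def\<close>)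
  moreover have "sat (upds e (xs1 @ ys1) (x1 @ y1)) \<phi>1 \<longleftrightarrow> SR A e x1 y1"
    using Conj.prems S x y by (intro Conj.IH(1)[of X]) auto
  moreover have "sat (upds e (us @ vs) (x2 @ y2)) \<psi> \<longleftrightarrow> SR B e x2 y2"
    using Conj.prems T x y by (intro Conj.IH(2)[of ?X]) auto
  ultimately show ?case using x y Ds_length[OF x(2)] Ds_length[OF y(2)] by (simp add: eq)
next
  case (Forall z A)
  let ?X = "insert z X"
  obtain us vs \<psi> where S: "Sst ?X A = (us, vs, \<psi>)" by (cases "Sst ?X A") auto
  have fvX: "fv A \<subseteq> ?X" using Forall.prems(2) by auto
  have ok: "Sst_ok ?X A (us, vs, \<psi>)" using Sst_ok[of ?X A] Forall.prems S fvX by simp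
  define Ys where "Ys = freshes (?X \<union> set us \<union> set vs) (tys vs)"
  have Ys: "set Ys \<inter> (?X \<union> set us \<union> set vs) = {}" "tys Ys = tys vs" "distinct Ys"
    unfolding Ys_def using Forall.prems by (intro freshes_props; auto)+
  have eq: "xs = us" "ys = Ys" "\<phi> = Forall z (bex vs (brackets Ys []) \<psi>)"
    using Forall.prems(4) by (auto simp: S Let_def Ys_def brackets_Nil)
  have ty: "tys us = SX A" "tys vs = SY A" using ok by (auto simp: Sst_ok_def)
  let ?e = "upds e (us @ Ys) (x @ y)"
  have x: "x \<in> Ds (tys us)" and y: "y \<in> Ds (tys Ys)" using Forall.prems Ys(2) ty by simp_all
  have e: "env ?e" using Forall.prems(5) x y by simp
  have "distinct (us @ Ys)" using Ys(1,3) ok by (auto simp: Sst_ok_def)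
  moreover have "length x = length us" "length y = length Ys"
    using Ds_length[OF x] Ds_length[OF y] by simp_all
  ultimately have d: "distinct (us @ Ys)" "length x = length us" "length y = length Ys" .
  have "sat (?e(z := a)) (bex vs (brackets Ys []) \<psi>) \<longleftrightarrow> (\<exists>v \<in> elemss (SY A) y. SR A (e(z := a)) x v)"
    if a: "a \<in> D (snd z)" for a
  proof -
    have zY: "z \<notin> set Ys" using Ys by auto
    have "map (?e(z := a)) Ys = y"
      using map_upds_append(2)[OF d, of e] zY by (metis map_fun_upd)
    then have "sat (?e(z := a)) (bex vs (brackets Ys []) \<psi>) \<longleftrightarrow>
        (\<exists>v \<in> elemss (SY A) y. sat (upds (?e(z := a)) vs v) \<psi>)"
      using sat_brackets(2)[of Ys "[]" vs "?e(z := a)" \<psi>] Ys ok e a ty by (auto simp: Sst_ok_def)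
    moreover have "sat (upds (?e(z := a)) vs v) \<psi> \<longleftrightarrow> SR A (e(z := a)) x v" if "v \<in> elemss (SY A) y" for v
    proof -
      have v: "v \<in> Ds (SY A)" using elemss_D[OF _ that] Forall.prems by simp
      have lv: "length v = length vs" using Ds_length[OF v] by (simp flip: ty)
      have "sat (upds (?e(z := a)) vs v) \<psi> \<longleftrightarrow> sat (upds (e(z := a)) (us @ vs) (x @ v)) \<psi>"
      proof (rule sat_cong)
        fix w assume "w \<in> fv \<psi>"
        then show "upds (?e(z := a)) vs v w = upds (e(z := a)) (us @ vs) (x @ v) w"
          using ok Ys(1,3) d lv fvX
          by (auto simp: upds_lk lk_append Sst_ok_def)
      qed
      also have "\<dots> \<longleftrightarrow> SR A (e(z := a)) x v"
        by (rule Forall.IH[OF _ fvX _ S env_upd[OF Forall.prems(5) a] _ v])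
          (use Forall.prems in auto)
      finally show ?thesis .
    qed
    ultimately show ?thesis by auto
  qed
  then show ?case by (simp add: eq)
next
  case (Exists z A)
  let ?X = "insert z X"
  obtain us vs \<psi> where S: "Sst ?X A = (us, vs, \<psi>)" by (cases "Sst ?X A") auto
  have fvX: "fv A \<subseteq> ?X" using Exists.prems(2) by auto
  have ok: "Sst_ok ?X A (us, vs, \<psi>)" using Sst_ok[of ?X A] Exists.prems S fvX by simp
  define Ys where "Ys = freshes (?X \<union> set us \<union> set vs) (map (arrs (tys us)) (tys vs))"
  define Xs where "Xs = freshes (?X \<union> set us \<union> set vs \<union> set Ys) (map (arrs (tys Ys)) (tys us))"
  have Ys: "set Ys \<inter> (?X \<union> set us \<union> set vs) = {}" "tys Ys = map (arrs (tys us)) (tys vs)" "distinct Ys"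
    unfolding Ys_def using Exists.prems by (intro freshes_props; auto)+
  have Xs: "set Xs \<inter> (?X \<union> set us \<union> set vs \<union> set Ys) = {}" "tys Xs = map (arrs (tys Ys)) (tys us)" "distinct Xs"
    unfolding Xs_def using Exists.prems by (intro freshes_props; auto)+
  have eq: "xs = Xs" "ys = Ys" "\<phi> = Exists z (ball us (brackets Xs Ys) (bex vs (brackets Ys us) \<psi>))"
    using Exists.prems(4) by (auto simp: S Let_def Ys_def Xs_def)
  have ty: "tys us = SX A" "tys vs = SY A" using ok by (auto simp: Sst_ok_def)
  let ?e = "upds e (Xs @ Ys) (x @ y)"
  let ?Y = "map (arrs (SX A)) (SY A)"
  have x: "x \<in> Ds (tys Xs)" and y: "y \<in> Ds (tys Ys)" using Exists.prems Ys(2) Xs(2) ty by simp_all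
  have e: "env ?e" using Exists.prems(5) x y by simp
  have "distinct (Xs @ Ys)" using Xs(1,3) Ys(1,3) by auto
  moreover have "length x = length Xs" "length y = length Ys"
    using Ds_length[OF x] Ds_length[OF y] by simp_all
  ultimately have d: "distinct (Xs @ Ys)" "length x = length Xs" "length y = length Ys" .
  have "sat (?e(z := a)) (ball us (brackets Xs Ys) (bex vs (brackets Ys us) \<psi>)) \<longleftrightarrow>
      (\<forall>u \<in> brs ?Y (SX A) x y. \<exists>v \<in> brs (SX A) (SY A) y u. SR A (e(z := a)) u v)"
    if a: "a \<in> D (snd z)" for a
  proof -
    let ?f = "?e(z := a)"
    have f: "env ?f" using e a by simp
    have "z \<notin> set Ys" "z \<notin> set Xs" using Ys Xs by auto
    then have mX: "map ?f Xs = x" and mY: "map ?f Ys = y"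
      using map_upds_append[OF d, of e] by (metis map_fun_upd)+
    have "sat ?f (ball us (brackets Xs Ys) (bex vs (brackets Ys us) \<psi>)) \<longleftrightarrow>
        (\<forall>u \<in> brs ?Y (SX A) x y. sat (upds ?f us u) (bex vs (brackets Ys us) \<psi>))"
      using sat_brackets(1)[of Xs Ys us ?f "bex vs (brackets Ys us) \<psi>"] Ys Xs ok f ty mX mY
      by (auto simp: Sst_ok_def)
    moreover have "sat (upds ?f us u) (bex vs (brackets Ys us) \<psi>) \<longleftrightarrow>
        (\<exists>v \<in> brs (SX A) (SY A) y u. SR A (e(z := a)) u v)" if "u \<in> brs ?Y (SX A) x y" for u
    proof -
      let ?g = "upds ?f us u"
      have u: "u \<in> Ds (SX A)" using brs_D[OF _ _ that] Exists.prems by simp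
      have lu: "length u = length us" using Ds_length[OF u] by (simp flip: ty)
      have g: "env ?g" using f u ty by simp
      have "map ?g us = u" using ok lu by (intro map_upds) (auto simp: Sst_ok_def)
      moreover have "map ?g Ys = map ?f Ys" using Ys(1) by (intro map_cong) auto
      ultimately have "sat ?g (bex vs (brackets Ys us) \<psi>) \<longleftrightarrow>
          (\<exists>v \<in> brs (SX A) (SY A) y u. sat (upds ?g vs v) \<psi>)"
        using sat_brackets(2)[of Ys us vs ?g \<psi>] Ys ok g ty mY by (auto simp: Sst_ok_def)
      moreover have "sat (upds ?g vs v) \<psi> \<longleftrightarrow> SR A (e(z := a)) u v" if "v \<in> brs (SX A) (SY A) y u" for v
      proof -
        have v: "v \<in> Ds (SY A)" using brs_D[OF _ _ that] Exists.prems u by simp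
        have lv: "length v = length vs" using Ds_length[OF v] by (simp flip: ty)
        have "sat (upds ?g vs v) \<psi> \<longleftrightarrow> sat (upds (e(z := a)) (us @ vs) (u @ v)) \<psi>"
        proof (rule sat_cong)
          fix w assume "w \<in> fv \<psi>"
          then show "upds ?g vs v w = upds (e(z := a)) (us @ vs) (u @ v) w"
            using ok Ys(1,3) Xs(1,3) d lu lv fvX
            by (auto simp: upds_lk lk_append Sst_ok_def)
        qed
        also have "\<dots> \<longleftrightarrow> SR A (e(z := a)) u v"
          by (rule Exists.IH[OF _ fvX _ S env_upd[OF Exists.prems(5) a] u v])
            (use Exists.prems in auto)
        finally show ?thesis .
      qed
      ultimately show ?thesis by auto
    qed
    ultimately show ?thesis by auto
  qed
  then show ?case by (simp add: eq)
next
  case (ForallSt z A)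
  let ?X = "insert z X"
  obtain us vs \<psi> where S: "Sst ?X A = (us, vs, \<psi>)" by (cases "Sst ?X A") auto
  have fvX: "fv A \<subseteq> ?X" using ForallSt.prems(2) by auto
  have ok: "Sst_ok ?X A (us, vs, \<psi>)" using Sst_ok[of ?X A] ForallSt.prems S fvX by simp
  define w where "w = fresh (?X \<union> set us \<union> set vs) (snd z)"
  have w: "w \<notin> ?X \<union> set us \<union> set vs" "snd w = snd z"
    unfolding w_def using ForallSt.prems fresh_notin[of "?X \<union> set us \<union> set vs" "snd z"] by simp_all
  have eq: "xs = us @ [w]" "ys = vs" "\<phi> = subst1 \<psi> z (V w)"
    using ForallSt.prems(4) by (auto simp: S Let_def w_def)
  have ty: "tys us = SX A" "tys vs = SY A" using ok by (auto simp: Sst_ok_def)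
  obtain u a where x: "x = u @ [a]" "u \<in> Ds (SX A)" "a \<in> D (snd z)"
    using ForallSt.prems by (auto elim!: Ds_appendE simp: Ds_1)
  have y: "y \<in> Ds (SY A)" using ForallSt.prems by simp
  have l: "length u = length us" "length y = length vs"
    using Ds_length[OF x(2)] Ds_length[OF y] by (simp_all flip: ty)
  let ?e = "upds e (xs @ ys) (x @ y)"
  \<comment> \<open>\<open>w\<close> replaces \<open>z\<close> inside the matrix; assigning its
    value to \<open>z\<close> undoes the renaming.\<close>
  have ew: "?e w = a"
    using ok w l by (auto simp: eq x upds_lk lk_append Sst_ok_def) (simp add: lk_def)
  have "sat ?e \<phi> \<longleftrightarrow> sat (?e(z := a)) \<psi>" unfolding eq(3) using ew by (simp add: sat_subst1)
  also have "\<dots> \<longleftrightarrow> sat (upds (e(z := a)) (us @ vs) (u @ y)) \<psi>"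
  proof (rule sat_cong)
    fix v assume "v \<in> fv \<psi>"
    then show "(?e(z := a)) v = upds (e(z := a)) (us @ vs) (u @ y) v"
      using ok w l fvX by (auto simp: eq x upds_lk lk_append lk_Cons Sst_ok_def)
  qed
  also have "\<dots> \<longleftrightarrow> SR A (e(z := a)) u y"
    by (rule ForallSt.IH[OF _ fvX _ S env_upd[OF ForallSt.prems(5) x(3)] x(2) y])
      (use ForallSt.prems in auto)
  finally show ?case using x Ds_length[OF x(2)] by (simp add: nth_append)
next
  case (ExistsSt z A)
  let ?X = "insert z X"
  obtain us vs \<psi> where S: "Sst ?X A = (us, vs, \<psi>)" by (cases "Sst ?X A") auto
  have fvX: "fv A \<subseteq> ?X" using ExistsSt.prems(2) by auto
  have ok: "Sst_ok ?X A (us, vs, \<psi>)" using Sst_ok[of ?X A] ExistsSt.prems S fvX by simp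
  define w where "w = fresh (?X \<union> set us \<union> set vs) (snd z)"
  define Ys where "Ys = freshes (insert w ?X \<union> set us \<union> set vs) (map (arrs (tys us)) (tys vs))"
  define Xs where "Xs = freshes (insert w ?X \<union> set us \<union> set vs \<union> set Ys) (map (arrs (tys (w # Ys))) (tys us))"
  have w: "w \<notin> ?X \<union> set us \<union> set vs" "snd w = snd z"
    unfolding w_def using ExistsSt.prems fresh_notin[of "?X \<union> set us \<union> set vs" "snd z"] by simp_all
  have Ys: "set Ys \<inter> (insert w ?X \<union> set us \<union> set vs) = {}" "tys Ys = map (arrs (tys us)) (tys vs)" "distinct Ys"
    unfolding Ys_def using ExistsSt.prems by (intro freshes_props; auto)+
  have Xs: "set Xs \<inter> (insert w ?X \<union> set us \<union> set vs \<union> set Ys) = {}"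
    "tys Xs = map (arrs (tys (w # Ys))) (tys us)" "distinct Xs"
    unfolding Xs_def using ExistsSt.prems by (intro freshes_props; auto)+
  let ?B = "bex vs (brackets Ys us) (subst1 \<psi> z (V w))"
  have eq: "xs = Xs" "ys = Ys @ [w]" "\<phi> = ball us (brackets Xs (w # Ys)) ?B"
    using ExistsSt.prems(4) by (auto simp: S Let_def w_def Ys_def Xs_def)
  have ty: "tys us = SX A" "tys vs = SY A" using ok by (auto simp: Sst_ok_def)
  let ?Y = "map (arrs (SX A)) (SY A)"
  obtain y' a where y: "y = y' @ [a]" "y' \<in> Ds ?Y" "a \<in> D (snd z)"
    using ExistsSt.prems by (auto elim!: Ds_appendE simp: Ds_1)
  let ?f = "upds e (Xs @ Ys @ [w]) (x @ y' @ [a])"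
  have x: "x \<in> Ds (tys Xs)" and y': "y' \<in> Ds (tys Ys)" using ExistsSt.prems y Xs(2) Ys(2) ty w by simp_all
  have f: "env ?f" using ExistsSt.prems(5) x y' y(3) w by simp
  have "distinct (Xs @ Ys @ [w])" using Xs(1,3) Ys(1,3) by auto
  moreover have "length x = length Xs" "length (y' @ [a]) = length (Ys @ [w])"
    using Ds_length[OF x] Ds_length[OF y'] by simp_all
  ultimately have d: "distinct (Xs @ Ys @ [w])" "length x = length Xs" "length (y' @ [a]) = length (Ys @ [w])" .
  have mX: "map ?f Xs = x" and "map ?f (Ys @ [w]) = y' @ [a]"
    using map_upds_append[OF d, of e] by auto
  then have mY: "map ?f Ys = y'" and fw: "?f w = a" by auto
  have 1: "sat ?f \<phi> \<longleftrightarrow> (\<forall>u \<in> brs (snd z # ?Y) (SX A) x (a # y'). sat (upds ?f us u) ?B)"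
    unfolding eq using sat_brackets(1)[of Xs "w # Ys" us ?f ?B] Ys Xs ok f ty w mX mY fw
    by (auto simp: Sst_ok_def)
  have 2: "sat (upds ?f us u) ?B \<longleftrightarrow> (\<exists>v \<in> brs (SX A) (SY A) y' u. SR A (e(z := a)) u v)"
    if "u \<in> brs (snd z # ?Y) (SX A) x (a # y')" for u
  proof -
    let ?g = "upds ?f us u"
    have u: "u \<in> Ds (SX A)" using brs_D[OF _ _ that] ExistsSt.prems y by simp
    have lu: "length u = length us" using Ds_length[OF u] by (simp flip: ty)
    have g: "env ?g" using f u ty by simp
    have "map ?g us = u" using ok lu by (intro map_upds) (auto simp: Sst_ok_def)
    moreover have "map ?g Ys = map ?f Ys" using Ys(1) by (intro map_cong) auto
    ultimately have "sat ?g ?B \<longleftrightarrow>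
        (\<exists>v \<in> brs (SX A) (SY A) y' u. sat (upds ?g vs v) (subst1 \<psi> z (V w)))"
      using sat_brackets(2)[of Ys us vs ?g "subst1 \<psi> z (V w)"] Ys ok g ty mY by (auto simp: Sst_ok_def)
    moreover have "sat (upds ?g vs v) (subst1 \<psi> z (V w)) \<longleftrightarrow> SR A (e(z := a)) u v"
      if "v \<in> brs (SX A) (SY A) y' u" for v
    proof -
      have v: "v \<in> Ds (SY A)" using brs_D[OF y(2) u that] .
      have lv: "length v = length vs" using Ds_length[OF v] by (simp flip: ty)
      have "upds ?g vs v w = a" using w fw by simp
      then have "sat (upds ?g vs v) (subst1 \<psi> z (V w)) \<longleftrightarrow> sat ((upds ?g vs v)(z := a)) \<psi>"
        by (simp add: sat_subst1)
      also have "\<dots> \<longleftrightarrow> sat (upds (e(z := a)) (us @ vs) (u @ v)) \<psi>"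
      proof (rule sat_cong)
        fix t assume "t \<in> fv \<psi>"
        then show "((upds ?g vs v)(z := a)) t = upds (e(z := a)) (us @ vs) (u @ v) t"
          using ok Ys(1,3) Xs(1,3) w d lu lv fvX by (auto simp: upds_lk lk_append Sst_ok_def)
      qed
      also have "\<dots> \<longleftrightarrow> SR A (e(z := a)) u v"
        by (rule ExistsSt.IH[OF _ fvX _ S env_upd[OF ExistsSt.prems(5) y(3)] u v])
          (use ExistsSt.prems in auto)
      finally show ?thesis .
    qed
    ultimately show ?thesis by auto
  qed
  show ?case
    using 1 2 y Ds_length[OF y(2)] by (simp add: eq Let_def nth_append)
qed

text \<open>An axiom that is an implication from \<open>P\<close> is obtained from the corresponding
  rule by taking \<open>Neg P\<close> as side formula and starting at excluded middle. The formulas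
  in \<open>\<Delta>\<close> are internal, so for them validity is truth in the model.\<close>

lemma soundness:
  assumes "deriv {B. wff B} (EPA_axioms \<union> st_axioms \<union> I_axioms \<union> HAC_int_axioms \<union> PF_TP_axioms \<union> \<Delta>) A"
    and \<Delta>: "\<And>\<delta>. \<delta> \<in> \<Delta> \<Longrightarrow> internal \<delta> \<and> (\<forall>e. env e \<longrightarrow> sat e \<delta>)"
  shows "valid A"
  using assms(1)
proof induction
  case (ax A)
  then have wff: "wff A" by simp
  consider "A \<in> EPA_axioms" | "A \<in> st_axioms" | "A \<in> I_axioms" | "A \<in> HAC_int_axioms"
    | "A \<in> PF_TP_axioms" | "A \<in> \<Delta>" using ax by blast
  then show ?case
  proof cases
    case 1
    then show ?thesis using EPA_axioms_internal[OF 1] epa[OF 1] wff by (simp add: valid_internal)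
  next
    case 2
    then show ?thesis using wff
    proof cases
      case (EQ_all x A)
      then show ?thesis using valid_EQ_all by simp
    next
      case (EQ_ex x A)
      then show ?thesis using valid_EQ_ex by simp
    next
      case (T_eq s t)
      then show ?thesis using valid_T_eq wff by simp
    next
      case T_closed
      then show ?thesis using valid_T_closed wff by simp
    next
      case (T_app s t)
      then show ?thesis using valid_T_app[of s t] wff by simp
    next
      case (T_le s t)
      moreover have "wt t \<and> ty_of t = TNat" "wt s" using wff T_le by (simp_all add: le_def)
      ultimately show ?thesis using valid_T_le[of s t] by simp
    next
      case (IA_st x B)
      let ?P = "Conj (subst1 B x Zero) (ForallSt x (Imp B (subst1 B x (Succ \<cdot> V x))))"
      have wfP: "wff (Neg ?P)" "wff B" using wff IA_st by auto
      have 1: "valid (Disj (Neg ?P) (subst1 B x Zero))" by (rule valid_taut) auto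
      have "valid (Disj (Neg ?P) (ForallSt x (Imp B (subst1 B x (Succ \<cdot> V x)))))" by (rule valid_taut) auto
      from valid_ForallSt_elim[OF this]
      have 2: "valid (Disj (Neg ?P) (Disj (Neg (St (V x))) (Imp B (subst1 B x (Succ \<cdot> V x)))))" .
      have "x \<notin> fv (Neg ?P)" using fv_subst[of "V(x := Zero)" B] by (auto split: if_splits)
      from valid_IA_st[OF 1 2 this IA_st(2) wfP(2,1)] show ?thesis by (simp only: IA_st(1))
    qed
  next
    case 3
    then show ?thesis using wff
      by cases (auto intro: valid_I[OF _ _ _ _ _ valid_em])
  next
    case 4
    then show ?thesis using wff
      by cases (auto intro: valid_HAC[OF _ _ _ _ _ valid_em])
  next
    case 5
    then show ?thesis by cases (auto intro: valid_PF_TP)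
  next
    case 6
    then show ?thesis using \<Delta> by (simp add: valid_internal)
  qed
next
  case (taut A)
  then show ?case by (intro valid_taut) (simp add: taut_def)
next
  case (forall_elim x A t)
  then show ?case by (intro valid_Forall_elim valid_em)
next
  case (exists_intro x A t)
  then show ?case by (intro valid_Exists_intro[OF valid_em[of "subst1 A x t"]])
next
  case (mp A B)
  show ?case by (rule valid_mp[OF mp.IH])
next
  case (forall_intro A B x)
  then show ?case by (intro valid_Forall_intro) simp_all
next
  case (exists_elim A B x)
  show ?case by (rule valid_Exists_elim[OF valid_em valid_comm[OF exists_elim.IH] exists_elim.hyps(2)])
qed

text \<open>Currying the candidates over the challenge in the empty context leaves a single tuple
  \<open>?t\<close> of the model, independent of environment and challenge; it is the value of
  \<open>ts\<close>.\<close>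

lemma valid_Sst:
  assumes "valid A" "finite X" "fv A \<subseteq> X" "wff A" "Sst X A = (xs, ys, \<phi>)"
    and ts: "set ts \<inter> (X \<union> set xs \<union> set ys) = {}" "distinct ts" "tys ts = map (arrs (tys xs)) (tys ys)"
    and "set as \<subseteq> X" "env e"
  shows "sat e (Existss ts (Foralls as (Foralls xs (bex ys (brackets ts xs) \<phi>))))"
proof -
  have ok: "Sst_ok X A (xs, ys, \<phi>)" using Sst_ok[of X A] assms by simp
  have ty: "tys xs = SX A" "tys ys = SY A" using ok by (auto simp: Sst_ok_def)
  obtain S where S: "hb [SX A] (SY A) S" "realizes A S" using assms(1) by (auto simp: valid_def)
  have "hb ([] @ [SX A]) (SY A) S" using S(1) by simp
  then obtain F where F: "mf [] (map (arrs (SX A)) (SY A)) F"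
    "\<And>g z. g \<in> DDs [] \<Longrightarrow> z \<in> Ds (SX A) \<Longrightarrow> S (g @ [z]) \<subseteq> brs (SX A) (SY A) (F g) z"
    using hb_curry[of "[]" "SX A" "SY A" S] by blast
  let ?t = "F []"
  have t: "?t \<in> Ds (tys ts)" using mf_D[OF F(1), of "[]"] ts ty by simp
  have "sat (upds (upds (upds e ts ?t) as a) xs x) (bex ys (brackets ts xs) \<phi>)"
    if a: "a \<in> Ds (tys as)" and x: "x \<in> Ds (tys xs)" for a x
  proof -
    let ?e = "upds (upds e ts ?t) as a"
    let ?f = "upds ?e xs x"
    have e: "env ?e" using t a assms by simp
    then have f: "env ?f" using x by simp
    have lx: "length x = length xs" "length ?t = length ts" using Ds_length[OF x] Ds_length[OF t] by simp_all
    have mx: "map ?f xs = x" using ok lx by (intro map_upds) (auto simp: Sst_ok_def)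
    \<comment> \<open>The quantifiers over \<open>as\<close> and \<open>xs\<close> must not
      overwrite the values of \<open>ts\<close>.\<close>
    have "v \<notin> set as" "v \<notin> set xs" if "v \<in> set ts" for v using that ts(1) assms(9) by auto
    then have "map ?f ts = map (upds e ts ?t) ts" by (intro map_cong) auto
    then have mt: "map ?f ts = ?t" using map_upds[OF ts(2) lx(2), of e] by simp
    obtain y where y: "y \<in> S [x]" "SR A ?e x y"
      using S(2) e x ty unfolding realizes_def by auto
    have yD: "y \<in> Ds (SY A)" using hb_D[OF S(1) _ y(1)] x ty by simp
    have "sat (upds ?e (xs @ ys) (x @ y)) \<phi>"
      using Sst_sat[OF assms(2-5) e _ yD, of x] x ty y(2) by simp
    then have "sat (upds ?f ys y) \<phi>" using lx by (simp add: upds_append)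
    moreover have "y \<in> brs (tys xs) (tys ys) (map ?f ts) (map ?f xs)"
      using F(2)[of "[]" x] y(1) x ty mx mt by auto
    ultimately show ?thesis
      using sat_brackets(2)[OF ts(3) _ f, of \<phi>] ok ts(1) by (auto simp: Sst_ok_def)
  qed
  then show ?thesis using t by (auto simp: sat_Existss_iff sat_Foralls_iff)
qed

end

lemma wff_internal_quants:
  "wff (Foralls xs A) = wff A" "internal (Foralls xs A) = internal A"
  "wff (Existss xs A) = wff A" "internal (Existss xs A) = internal A"
  by (induction xs) auto

theorem theorem3p3:
  fixes \<Phi> \<phi> :: fm and as xs ys ts :: "var list" and \<Delta>_int :: "fm set"
  assumes "wff \<Phi>" and "distinct as" and "fv \<Phi> \<subseteq> set as"
    and "Sst (set as) \<Phi> = (xs, ys, \<phi>)"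
    and "\<forall>\<delta>\<in>\<Delta>_int. wff \<delta> \<and> internal \<delta>"
    and "EPAst_I_HAC_PFTP_proves \<Delta>_int \<Phi>"
    and "distinct ts" and "set ts \<inter> (set as \<union> set xs \<union> set ys) = {}"
    and "tys ts = map (arrs (tys xs)) (tys ys)"
  shows "EPA_proves \<Delta>_int
           (Existss ts (Foralls as (Foralls xs (bex ys (brackets ts xs) \<phi>))))"
proof (rule ccontr)
  let ?\<psi> = "Existss ts (Foralls as (Foralls xs (bex ys (brackets ts xs) \<phi>)))"
  assume not: "\<not> EPA_proves \<Delta>_int ?\<psi>"
  have "Sst_ok (set as) \<Phi> (xs, ys, \<phi>)" using Sst_ok[of "set as" \<Phi>] assms by simp
  then have "wff \<phi>" "internal \<phi>" by (auto simp: Sst_ok_def)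
  then have \<psi>: "?\<psi> \<in> Lint"
    using ball_brackets_props(3,4)[OF assms(9)] by (simp add: wff_internal_quants)
  interpret internal_logic "EPA_axioms \<union> \<Delta>_int" .
  obtain D :: "ty \<Rightarrow> tm set set" and app cst where M: "tstruct D app cst"
    "\<And>A e. A \<in> EPA_axioms \<union> \<Delta>_int \<Longrightarrow> A \<in> Lint \<Longrightarrow> tstruct.env D e \<Longrightarrow> tstruct.sat D app cst e A"
    "\<exists>e. tstruct.env D e \<and> \<not> tstruct.sat D app cst e ?\<psi>"
    using completeness[OF _ \<psi>] not unfolding EPA_proves_def by blast
  interpret tstruct D app cst by (rule M(1))
  interpret epa_model D app cst by standard (use M(2) in auto)
  \<comment> \<open>The realizer is produced inside the countermodel and may depend on it; this
    already contradicts the failure of \<open>?\<psi>\<close> there.\<close>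
  have "valid \<Phi>"
    by (rule soundness[OF assms(6)[unfolded EPAst_I_HAC_PFTP_proves_def]]) (use M(2) assms(5) in auto)
  then have "sat e ?\<psi>" if "env e" for e
    using that assms by (intro valid_Sst[of \<Phi> "set as"]) auto
  with M(3) show False by blast
qed

end
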